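(* Let $\mathcal R=\{(x^i,z^i): i\in\mathbb N\}\subseteq\mathscr R^{d,m}_{\mathbb F}=\mathbb R^d\times L^2_{\mathbb F}([0,T]\times\Omega,\mathbb R^{d\times m})$ be a nonempty countable set. (i) Suppose that $\mathcal J_T[\mathcal R]$ is dominated in $L^2$. Then $\left(\int_{0-}^t\mathrm{conv}(\mathcal R)\,dB\right)_{t\in[0,T]}$ has a Hausdorff càglàd modification. (ii) Suppose that the following summability condition holds: $$\mathbb E\Big[\sum_{i=1}^\infty|\mathcal J_T(x^i,z^i)|^2\Big]=\sum_{i=1}^\infty\Big(|x^i|^2+\mathbb E\Big[\int_0^T|z^i_s|^2ds\Big]\Big)<+\infty.$$ Then $\left(\int_{0-}^t\mathrm{conv}(\mathcal R)\,dB\right)_{t\in[0,T]}$ has a Hausdorff continuous modification.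
   Context: Setting. $(\Omega,\mathcal F,\mathbb P)$ is a probability space; $T>0$; $B=(B_t)_{t\in[0,T]}$ is an $m$-dimensional Brownian motion; $\mathbb F=(\mathcal F_t)_{t\in[0,T]}$ is the filtration generated by $B$ and satisfies the usual conditions. A map $\Xi$ from $\Omega$ to the nonempty closed subsets of $\mathbb R^d$ is $\mathcal G$-measurable if $\{\omega:\Xi(\omega)\cap C\ne\emptyset\}\in\mathcal G$ for all closed $C\subseteq\mathbb R^d$; such maps (set-valued random variables) are identified up to a.s. equality. $S^2_{\mathcal G}(\Xi)$ is the set of $\mathcal G$-measurable square-integrable random vectors $\xi$ with $\xi\in\Xi$ a.s.; $\Xi$ is square-integrable if this set is nonempty with $\mathcal G=\mathcal F$. A Hausdorff càglàd (resp. continuous) modification of a set-valued process $(M_t)_{t\in[0,T]}$ is a set-valued process $(\tilde M_t)_{t\in[0,T]}$ with $\mathbb P\{M_t=\tilde M_t\}=1$ for each $t$ whose paths are, with probability one, left-continuous with right limits (resp. continuous) in the Hausdorff distance $h(C,D)=\max\{\sup_{x\in C}\inf_{y\in D}|x-y|,\sup_{y\in D}\inf_{x\in C}|x-y|\}$. Integral. $L^2_{\mathbb F}([0,T]\times\Omega,\mathbb R^{d\times m})$ is the set of $\mathbb F$-progressively measurable $\mathbb R^{d\times m}$-valued processes $z$ with $\mathbb E[\int_0^T|z_t|^2dt]<\infty$. For $(x,z)\in\mathscr R^{d,m}_{\mathbb F}$, $\mathcal J_t(x,z)=x+\int_0^tz_s\,dB_s$, and $\mathcal J_t[\mathcal R]=\{\mathcal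 J_t(x,z):(x,z)\in\mathcal R\}$. A set $\mathcal K$ of random vectors is $\mathcal G$-decomposable if $\xi\mathbf 1_A+\zeta\mathbf 1_{A^c}\in\mathcal K$ for all $\xi,\zeta\in\mathcal K$, $A\in\mathcal G$; $\mathrm{dec}_{\mathcal G}(\mathcal K)$ is the smallest $\mathcal G$-decomposable superset of $\mathcal K$. $\mathcal K\subseteq L^2$ is dominated in $L^2$ if there is a square-integrable real random variable $\xi$ with $|\zeta|\le\xi$ a.s. for every $\zeta\in\mathcal K$. $\mathrm{conv}$ denotes the convex hull. For nonempty $\mathcal R\subseteq\mathscr R^{d,m}_{\mathbb F}$, $\int_{0-}^t\mathcal R\,dB$ is the a.s. unique $\mathcal F_t$-measurable square-integrable set-valued random variable with $S^2_{\mathcal F_t}\left(\int_{0-}^t\mathcal R\,dB\right)=\mathrm{cl}_{L^2}\,\mathrm{dec}_{\mathcal F_t}(\mathcal J_t[\mathcal R])$. *)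

theory Defs
  imports "HOL-Probability.Probability"
begin

section \<open>Brownian motion and its filtration\<close>

definition brownian_motion :: "'w measure \<Rightarrow> real \<Rightarrow> (real \<Rightarrow> 'w \<Rightarrow> real ^ 'm) \<Rightarrow> bool" where
  "brownian_motion P T B \<longleftrightarrow>
     (\<forall>t\<in>{0..T}. B t \<in> borel_measurable P) \<and>
     (AE w in P. B 0 w = 0) \<and>
     (AE w in P. continuous_on {0..T} (\<lambda>t. B t w)) \<and>
     (\<forall>s t. 0 \<le> s \<and> s < t \<and> t \<le> T \<longrightarrow>
        (\<forall>k. distributed P lborel (\<lambda>w. B t w $ k - B s w $ k) (normal_density 0 (sqrt (t - s)))) \<and>
        prob_space.indep_vars P (\<lambda>_. borel) (\<lambda>k w. B t w $ k - B s w $ k) UNIV) \<and>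
     (\<forall>n \<tau>. (\<forall>i<n. \<tau> i < \<tau> (Suc i)) \<and> (\<forall>i\<le>n. \<tau> i \<in> {0..T}) \<longrightarrow>
        prob_space.indep_vars P (\<lambda>_. borel) (\<lambda>i w. B (\<tau> (Suc i)) w - B (\<tau> i) w) {..<n::nat})"

text \<open>The natural filtration is augmented by the null sets, as completeness in the usual
  conditions requires. For a filtration indexed by \<open>[0,T]\<close>, right-continuity is a condition
  on \<open>[0,T)\<close> only.\<close>

definition brownian_filtration ::
    "'w measure \<Rightarrow> (real \<Rightarrow> 'w \<Rightarrow> real ^ 'm) \<Rightarrow> real \<Rightarrow> 'w measure" where
  "brownian_filtration P B t =
     sigma (space P) ({B s -` A \<inter> space P | s A. s \<in> {0..t} \<and> A \<in> sets borel} \<union> null_sets P)"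

definition usual_conditions :: "'w measure \<Rightarrow> real \<Rightarrow> (real \<Rightarrow> 'w measure) \<Rightarrow> bool" where
  "usual_conditions P T F \<longleftrightarrow>
     complete_measure P \<and>
     null_sets P \<subseteq> sets (F 0) \<and>
     (\<forall>t\<in>{0..<T}. sets (F t) = (\<Inter>s\<in>{t<..T}. sets (F s)))"


section \<open>Square-integrable integrands and the Ito integral\<close>

text \<open>The norm of type \<^typ>\<open>real ^ 'm ^ 'd\<close> is the Frobenius norm.\<close>

definition L2_prog ::
    "'w measure \<Rightarrow> real \<Rightarrow> (real \<Rightarrow> 'w measure) \<Rightarrow> (real \<Rightarrow> 'w \<Rightarrow> real ^ 'm ^ 'd) set" where
  "L2_prog P T F =
     {z. (\<forall>t\<in>{0..T}. (\<lambda>(s, w). z s w) \<in> borel_measurable (restrict_space borel {0..t} \<Otimes>\<^sub>M F t)) \<and>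
         (\<integral>\<^sup>+w. (\<integral>\<^sup>+s\<in>{0..T}. ennreal ((norm (z s w))\<^sup>2) \<partial>lborel) \<partial>P) < \<infinity>}"

definition simple_integrand ::
    "'w measure \<Rightarrow> real \<Rightarrow> (real \<Rightarrow> 'w measure) \<Rightarrow> nat \<Rightarrow> (nat \<Rightarrow> real)
      \<Rightarrow> (nat \<Rightarrow> 'w \<Rightarrow> real ^ 'm ^ 'd) \<Rightarrow> bool" where
  "simple_integrand P T F n \<tau> \<phi> \<longleftrightarrow>
     (\<forall>i\<le>n. \<tau> i \<in> {0..T}) \<and> (\<forall>i<n. \<tau> i \<le> \<tau> (Suc i)) \<and>
     (\<forall>i<n. \<phi> i \<in> borel_measurable (F (\<tau> i)) \<and> bounded (\<phi> i ` space P))"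

definition simple_process ::
    "nat \<Rightarrow> (nat \<Rightarrow> real) \<Rightarrow> (nat \<Rightarrow> 'w \<Rightarrow> real ^ 'm ^ 'd) \<Rightarrow> real \<Rightarrow> 'w \<Rightarrow> real ^ 'm ^ 'd" where
  "simple_process n \<tau> \<phi> s w = (\<Sum>i<n. indicator {\<tau> i<..\<tau> (Suc i)} s *\<^sub>R \<phi> i w)"

definition simple_integral ::
    "(real \<Rightarrow> 'w \<Rightarrow> real ^ 'm) \<Rightarrow> nat \<Rightarrow> (nat \<Rightarrow> real) \<Rightarrow> (nat \<Rightarrow> 'w \<Rightarrow> real ^ 'm ^ 'd)
      \<Rightarrow> real \<Rightarrow> 'w \<Rightarrow> real ^ 'd" where
  "simple_integral B n \<tau> \<phi> t w =
     (\<Sum>i<n. \<phi> i w *v (B (min (\<tau> (Suc i)) t) w - B (min (\<tau> i) t) w))"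

text \<open>\<open>I\<close> is a version of \<open>\<integral>\<^sub>0\<^sup>t z dB\<close>: the \<open>L\<^sup>2(P)\<close>-limit of the elementary integrals of
  simple processes approximating \<open>z\<close> in \<open>L\<^sup>2([0,T] \<times> \<Omega>)\<close>.\<close>

definition is_ito_integral ::
    "'w measure \<Rightarrow> real \<Rightarrow> (real \<Rightarrow> 'w measure) \<Rightarrow> (real \<Rightarrow> 'w \<Rightarrow> real ^ 'm) \<Rightarrow> real
      \<Rightarrow> (real \<Rightarrow> 'w \<Rightarrow> real ^ 'm ^ 'd) \<Rightarrow> ('w \<Rightarrow> real ^ 'd) \<Rightarrow> bool" where
  "is_ito_integral P T F B t z I \<longleftrightarrow>
     I \<in> borel_measurable (F t) \<and>
     (\<exists>n \<tau> \<phi>. (\<forall>j::nat. simple_integrand P T F (n j) (\<tau> j) (\<phi> j)) \<and>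
        ((\<lambda>j. \<integral>\<^sup>+w. (\<integral>\<^sup>+s\<in>{0..T}.
             ennreal ((norm (z s w - simple_process (n j) (\<tau> j) (\<phi> j) s w))\<^sup>2) \<partial>lborel) \<partial>P)
          \<longlonglongrightarrow> 0) \<and>
        ((\<lambda>j. \<integral>\<^sup>+w. ennreal ((norm (I w - simple_integral B (n j) (\<tau> j) (\<phi> j) t w))\<^sup>2) \<partial>P)
          \<longlonglongrightarrow> 0))"

text \<open>The integral is unique only up to almost sure equality; \<open>SOME\<close> picks one version
  for each \<open>t\<close>, and everything below depends on it only through its almost sure class.\<close>

definition ito_integral ::
    "'w measure \<Rightarrow> real \<Rightarrow> (real \<Rightarrow> 'w measure) \<Rightarrow> (real \<Rightarrow> 'w \<Rightarrow> real ^ 'm) \<Rightarrow> real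
      \<Rightarrow> (real \<Rightarrow> 'w \<Rightarrow> real ^ 'm ^ 'd) \<Rightarrow> 'w \<Rightarrow> real ^ 'd" where
  "ito_integral P T F B t z = (SOME I. is_ito_integral P T F B t z I)"

definition ito_J ::
    "'w measure \<Rightarrow> real \<Rightarrow> (real \<Rightarrow> 'w measure) \<Rightarrow> (real \<Rightarrow> 'w \<Rightarrow> real ^ 'm) \<Rightarrow> real
      \<Rightarrow> (real ^ 'd) \<times> (real \<Rightarrow> 'w \<Rightarrow> real ^ 'm ^ 'd) \<Rightarrow> 'w \<Rightarrow> real ^ 'd" where
  "ito_J P T F B t = (\<lambda>(x, z) w. x + ito_integral P T F B t z w)"

text \<open>The library's \<^const>\<open>hull\<close> for \<^const>\<open>convex\<close> does not apply, since functions are not an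
  instance of \<^class>\<open>real_vector\<close>.\<close>

definition pair_conv ::
    "((real ^ 'd) \<times> (real \<Rightarrow> 'w \<Rightarrow> real ^ 'm ^ 'd)) set
      \<Rightarrow> ((real ^ 'd) \<times> (real \<Rightarrow> 'w \<Rightarrow> real ^ 'm ^ 'd)) set" where
  "pair_conv R =
     {((\<Sum>p\<in>S. c p *\<^sub>R fst p), (\<lambda>s w. \<Sum>p\<in>S. c p *\<^sub>R snd p s w)) | S c.
        finite S \<and> S \<subseteq> R \<and> (\<forall>p\<in>S. 0 \<le> c p) \<and> sum c S = 1}"


section \<open>Families of random vectors\<close>

definition decomposable :: "'w measure \<Rightarrow> ('w \<Rightarrow> 'a) set \<Rightarrow> bool" where
  "decomposable G K \<longleftrightarrow>
     (\<forall>\<xi>\<in>K. \<forall>\<zeta>\<in>K. \<forall>A\<in>sets G. (\<lambda>w. if w \<in> A then \<xi> w else \<zeta> w) \<in> K)"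

definition dec :: "'w measure \<Rightarrow> ('w \<Rightarrow> 'a) set \<Rightarrow> ('w \<Rightarrow> 'a) set" where
  "dec G K = decomposable G hull K"

definition L2_closure :: "'w measure \<Rightarrow> ('w \<Rightarrow> 'a::euclidean_space) set \<Rightarrow> ('w \<Rightarrow> 'a) set" where
  "L2_closure P K =
     {\<xi>. \<xi> \<in> borel_measurable P \<and> integrable P (\<lambda>w. (norm (\<xi> w))\<^sup>2) \<and>
         (\<forall>e>0. \<exists>\<zeta>\<in>K. (\<integral>\<^sup>+w. ennreal ((norm (\<xi> w - \<zeta> w))\<^sup>2) \<partial>P) < e)}"

definition dominated_L2 :: "'w measure \<Rightarrow> ('w \<Rightarrow> 'a::euclidean_space) set \<Rightarrow> bool" where
  "dominated_L2 P K \<longleftrightarrow>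
     (\<exists>\<xi> :: 'w \<Rightarrow> real. \<xi> \<in> borel_measurable P \<and> integrable P (\<lambda>w. (\<xi> w)\<^sup>2) \<and>
        (\<forall>\<zeta>\<in>K. AE w in P. norm (\<zeta> w) \<le> \<xi> w))"


section \<open>Set-valued random variables\<close>

definition set_valued_rv :: "'w measure \<Rightarrow> ('w \<Rightarrow> 'a::euclidean_space set) \<Rightarrow> bool" where
  "set_valued_rv G X \<longleftrightarrow>
     (\<forall>w\<in>space G. X w \<noteq> {} \<and> closed (X w)) \<and>
     (\<forall>C. closed C \<longrightarrow> {w \<in> space G. X w \<inter> C \<noteq> {}} \<in> sets G)"

definition S2 :: "'w measure \<Rightarrow> 'w measure \<Rightarrow> ('w \<Rightarrow> 'a::euclidean_space set) \<Rightarrow> ('w \<Rightarrow> 'a) set" where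
  "S2 P G X =
     {\<xi>. \<xi> \<in> borel_measurable G \<and> integrable P (\<lambda>w. (norm (\<xi> w))\<^sup>2) \<and> (AE w in P. \<xi> w \<in> X w)}"

definition is_sv_integral ::
    "'w measure \<Rightarrow> real \<Rightarrow> (real \<Rightarrow> 'w measure) \<Rightarrow> (real \<Rightarrow> 'w \<Rightarrow> real ^ 'm)
      \<Rightarrow> ((real ^ 'd) \<times> (real \<Rightarrow> 'w \<Rightarrow> real ^ 'm ^ 'd)) set \<Rightarrow> real
      \<Rightarrow> ('w \<Rightarrow> (real ^ 'd) set) \<Rightarrow> bool" where
  "is_sv_integral P T F B R t X \<longleftrightarrow>
     set_valued_rv (F t) X \<and> S2 P P X \<noteq> {} \<and>
     S2 P (F t) X = L2_closure P (dec (F t) (ito_J P T F B t ` R))"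

definition sv_integral ::
    "'w measure \<Rightarrow> real \<Rightarrow> (real \<Rightarrow> 'w measure) \<Rightarrow> (real \<Rightarrow> 'w \<Rightarrow> real ^ 'm)
      \<Rightarrow> ((real ^ 'd) \<times> (real \<Rightarrow> 'w \<Rightarrow> real ^ 'm ^ 'd)) set \<Rightarrow> real \<Rightarrow> 'w \<Rightarrow> (real ^ 'd) set" where
  "sv_integral P T F B R t = (SOME X. is_sv_integral P T F B R t X)"


section \<open>Path regularity in the Hausdorff distance\<close>

definition hausdorff_distance :: "'a::metric_space set \<Rightarrow> 'a set \<Rightarrow> ennreal" where
  "hausdorff_distance C D =
     max (SUP x\<in>C. INF y\<in>D. ennreal (dist x y)) (SUP y\<in>D. INF x\<in>C. ennreal (dist x y))"

definition hausdorff_continuous :: "real \<Rightarrow> (real \<Rightarrow> 'a::metric_space set) \<Rightarrow> bool" where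
  "hausdorff_continuous T m \<longleftrightarrow>
     (\<forall>t\<in>{0..T}. ((\<lambda>s. hausdorff_distance (m s) (m t)) \<longlongrightarrow> 0) (at t within {0..T}))"

text \<open>The right limits are taken in the space of nonempty closed sets.\<close>

definition hausdorff_caglad :: "real \<Rightarrow> (real \<Rightarrow> 'a::metric_space set) \<Rightarrow> bool" where
  "hausdorff_caglad T m \<longleftrightarrow>
     (\<forall>t\<in>{0<..T}. ((\<lambda>s. hausdorff_distance (m s) (m t)) \<longlongrightarrow> 0) (at t within {0..<t})) \<and>
     (\<forall>t\<in>{0..<T}. \<exists>D. D \<noteq> {} \<and> closed D \<and>
        ((\<lambda>s. hausdorff_distance (m s) D) \<longlongrightarrow> 0) (at t within {t<..T}))"

definition has_modification_with ::
    "'w measure \<Rightarrow> real \<Rightarrow> ((real \<Rightarrow> 'a set) \<Rightarrow> bool) \<Rightarrow> (real \<Rightarrow> 'w \<Rightarrow> 'a::euclidean_space set) \<Rightarrow> bool" where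
  "has_modification_with P T reg M \<longleftrightarrow>
     (\<exists>N. (\<forall>t\<in>{0..T}. set_valued_rv P (N t)) \<and>
          (\<forall>t\<in>{0..T}. AE w in P. M t w = N t w) \<and>
          (AE w in P. reg (\<lambda>t. N t w)))"

end

theory Submission
  imports Defs
begin

text \<open>Almost surely the set-valued integral at time \<open>t\<close> is the closed convex hull of the
  countably many points \<open>J\<^sub>t(x\<^sup>i, z\<^sup>i)\<close>: a measurable selection of this hull is
  approximated in \<open>L\<^sup>2\<close> by gluing rational convex combinations of the \<open>J\<^sub>t(x\<^sup>i, z\<^sup>i)\<close>, so
  both sets have the same square-integrable selections.

  Under summability, the maximal inequality and the first Borel--Cantelli lemma show that
  outside finitely many \<open>i\<close> the continuous martingales \<open>J(x\<^sup>i, z\<^sup>i)\<close> move by at most \<open>\<epsilon>\<close>,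
  so the family is equicontinuous and its closed convex hull is Hausdorff continuous.

  Under domination, fix an index \<open>0\<close>. The support function of the hull in a direction \<open>u\<close> is
  \<open>u \<bullet> J(x\<^sup>0, z\<^sup>0)\<close> plus the supremum over \<open>i\<close> of the martingales
  \<open>u \<bullet> (J(x\<^sup>i, z\<^sup>i) - J(x\<^sup>0, z\<^sup>0))\<close>, a nonnegative square-integrable submartingale. Along
  dyadic times it makes finitely many jumps of size \<open>\<epsilon>\<close>, so it has one-sided limits, and at
  each fixed time it is left continuous. Running \<open>u\<close> through a countable dense set, the hulls
  along dyadic times have one-sided Hausdorff limits, and the left limits are the modification.\<close>

section \<open>Independence of the Brownian increments\<close>

text \<open>\<open>SOME\<close> picks the integral at each time separately, so nothing ties together
  the values of \<open>ito_integral\<close> or \<open>sv_integral\<close> at different times: path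
  statements are proved for constructed versions and transferred at each fixed time. A pathwise
  supremum of infinitely many continuous functions is only lower semicontinuous, which is the
  obstacle under domination; one-sided limits must come from a bound on oscillations and left
  continuity from comparing means. The bound is an energy estimate: the value at the last recorded
  jump is held as integrand, and its discrete integral against the increments must have nonnegative
  mean. For a martingale any square-integrable adapted integrand will do; for a submartingale it has
  to be nonnegative, and subtracting the reference member makes the supremum, hence its recorded
  values, nonnegative. The same estimate yields the maximal inequality behind the continuous
  versions of the Ito integral and behind the summable case. Closed convex hulls are controlled by
  support functions, for which closeness in finitely many directions suffices on a fixed
  ball.\<close>

locale brownian_setting = prob_space P + complete_measure P for P :: "'w measure" +
  fixes T :: real and B :: "real \<Rightarrow> 'w \<Rightarrow> real ^ 'm" and F :: "real \<Rightarrow> 'w measure"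
  assumes T_pos: "T > 0"
    and BM: "brownian_motion P T B"
    and F_eq: "F = brownian_filtration P B"
begin

section \<open>The filtration and its null sets\<close>

lemma B_measurable_P: "t \<in> {0..T} \<Longrightarrow> B t \<in> borel_measurable P"
  using BM unfolding brownian_motion_def by blast

lemma filtration_generator_subset: "{B s -` A \<inter> space P | s A. s \<in> {0..t} \<and> A \<in> sets borel} \<union> null_sets P \<subseteq> Pow (space P)"
  by (auto dest: null_setsD2 sets.sets_into_space)

lemma space_F [simp]: "space (F t) = space P"
  unfolding F_eq brownian_filtration_def by (rule space_measure_of[OF filtration_generator_subset])

lemma sets_F: "sets (F t) = sigma_sets (space P)
    ({B s -` A \<inter> space P | s A. s \<in> {0..t} \<and> A \<in> sets borel} \<union> null_sets P)"
  unfolding F_eq brownian_filtration_def by (rule sets_measure_of[OF filtration_generator_subset])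

lemma sets_F_subset: "t \<le> T \<Longrightarrow> sets (F t) \<subseteq> sets P"
  unfolding sets_F by (rule sets.sigma_sets_subset) (auto intro!: measurable_sets B_measurable_P)

lemma F_mono: "s \<le> t \<Longrightarrow> sets (F s) \<subseteq> sets (F t)"
  unfolding sets_F by (rule sigma_sets_mono') fastforce

lemma null_in_F: "N \<in> null_sets P \<Longrightarrow> N \<in> sets (F t)"
  unfolding sets_F by (intro sigma_sets.Basic) auto

lemma measurable_F_mono: "s \<le> t \<Longrightarrow> f \<in> F s \<rightarrow>\<^sub>M M \<Longrightarrow> f \<in> F t \<rightarrow>\<^sub>M M"
  using F_mono[of s t] unfolding measurable_def by auto

lemma measurable_F_P: "t \<le> T \<Longrightarrow> f \<in> F t \<rightarrow>\<^sub>M M \<Longrightarrow> f \<in> P \<rightarrow>\<^sub>M M"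
  using sets_F_subset[of t] unfolding measurable_def by auto

lemma B_measurable_F: "0 \<le> s \<Longrightarrow> s \<le> t \<Longrightarrow> B s \<in> borel_measurable (F t)"
  unfolding measurable_def sets_F by (auto intro!: sigma_sets.Basic)

text \<open>Completeness makes \<open>A' - A\<close> and \<open>A - A'\<close> null although
  \<open>A'\<close> is not assumed measurable, and null sets belong to every
  \<open>F t\<close>.\<close>

lemma sets_F_AE_cong:
  assumes A: "A \<in> sets (F t)" and "t \<le> T" and ae: "AE w in P. w \<in> A \<longleftrightarrow> w \<in> A'" and "A' \<subseteq> space P"
  shows "A' \<in> sets (F t)"
proof -
  have "(AE x in P. x \<notin> A' - A \<and> x \<notin> A - A')"
    using ae by eventually_elim auto
  moreover have "A \<subseteq> space P"
    using sets.sets_into_space[OF A] by simp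
  ultimately have "A' - A \<in> null_sets P" "A - A' \<in> null_sets P"
    using assms unfolding null_sets_iff_AE by auto
  then have "A \<union> (A' - A) - (A - A') \<in> sets (F t)"
    using A null_in_F by blast
  also have "A \<union> (A' - A) - (A - A') = A'"
    by auto
  finally show ?thesis .
qed

lemma measurable_F_AE_cong:
  assumes f: "f \<in> F t \<rightarrow>\<^sub>M M" and "t \<le> T" and ae: "AE w in P. g w = f w"
    and "g \<in> space P \<rightarrow> space M"
  shows "g \<in> F t \<rightarrow>\<^sub>M M"
proof (rule measurableI)
  fix C assume "C \<in> sets M"
  then have "f -` C \<inter> space P \<in> sets (F t)" using measurable_sets[OF f] by simp
  then have "g -` C \<inter> space P \<in> sets (F t)"
    by (rule sets_F_AE_cong[OF _ \<open>t \<le> T\<close>]) (use ae in auto)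
  then show "g -` C \<inter> space (F t) \<in> sets (F t)" by simp
qed (use assms in auto)

section \<open>Independence of an increment from the past\<close>

text \<open>Past values of \<open>B\<close> are sums of consecutive increments over a grid, because
  \<open>B 0\<close> vanishes almost surely. After sorting, the cylinder event is a function of the
  increments up to \<open>a\<close> and the other event concerns the next increment, so independence
  of disjoint blocks applies.\<close>

lemma increment_indep_cylinder:
  fixes S :: "real set"
  assumes ab: "0 \<le> a" "a < b" "b \<le> T" and S: "finite S" "S \<subseteq> {0..a}"
    and A: "\<And>s. A s \<in> sets borel" and C: "C \<in> sets borel"
  shows "prob ({w\<in>space P. \<forall>s\<in>S. B s w \<in> A s} \<inter> ((\<lambda>w. B b w - B a w) -` C \<inter> space P))
    = prob {w\<in>space P. \<forall>s\<in>S. B s w \<in> A s} * prob ((\<lambda>w. B b w - B a w) -` C \<inter> space P)"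
proof -
  \<comment> \<open>\<open>0\<close> is added so that the telescoping sums start where
    \<open>B\<close> vanishes, and \<open>a\<close> so that the step after the last grid point is
    exactly the increment from \<open>a\<close> to \<open>b\<close>.\<close>
  define S' where "S' = insert 0 (insert a S)"
  have S': "finite S'" "S' \<subseteq> {0..a}" "S' \<noteq> {}" using S ab by (auto simp: S'_def)
  define L where "L = sorted_list_of_set S'"
  have L: "sorted_wrt (<) L" "set L = S'" "length L = card S'"
    using S' by (auto simp: L_def)
  define n where "n = length L - 1"
  have lenL: "length L = Suc n"
    using L S' by (cases L) (auto simp: n_def)
  \<comment> \<open>The default \<open>b\<close> beyond index \<open>n\<close> appends the future
    time as grid point \<open>Suc n\<close>.\<close>
  define \<tau> where "\<tau> i = (if i \<le> n then L ! i else b)" for i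
  have \<tau>_S: "\<tau> i \<in> S'" if "i \<le> n" for i
    using that L lenL by (auto simp: \<tau>_def intro: nth_mem)
  have S_\<tau>: "\<exists>i\<le>n. s = \<tau> i" if "s \<in> S'" for s
    using that unfolding L(2)[symmetric] in_set_conv_nth lenL by (auto simp: \<tau>_def)
  have \<tau>_less: "\<tau> i < \<tau> (Suc i)" if "i < Suc n" for i
  proof (cases "i < n")
    case True then show ?thesis using sorted_wrt_nth_less[OF L(1), of i "Suc i"] lenL by (simp add: \<tau>_def)
  next
    case False
    then have "i = n" using that by auto
    then show ?thesis using \<tau>_S[of n] S' ab by (auto simp: \<tau>_def)
  qed
  have \<tau>_mono: "\<tau> i \<le> \<tau> j" if "i \<le> j" "j \<le> n" for i j
    using that
  proof (induction j)
    case (Suc j) then show ?case using \<tau>_less[of j] by (cases "i = Suc j") auto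
  qed auto
  have \<tau>0: "\<tau> 0 = 0" 
  proof -
    obtain i where "i \<le> n" "0 = \<tau> i" using S_\<tau>[of 0] by (auto simp: S'_def)
    then have "\<tau> 0 \<le> 0" using \<tau>_mono[of 0 i] by auto
    moreover have "\<tau> 0 \<ge> 0" using \<tau>_S[of 0] S' by auto
    ultimately show ?thesis by auto
  qed
  have \<tau>n: "\<tau> n = a"
  proof -
    obtain i where "i \<le> n" "a = \<tau> i" using S_\<tau>[of a] by (auto simp: S'_def)
    then have "a \<le> \<tau> n" using \<tau>_mono[of i n] by auto
    moreover have "\<tau> n \<le> a" using \<tau>_S[of n] S' by auto
    ultimately show ?thesis by auto
  qed
  have \<tau>Sn: "\<tau> (Suc n) = b" by (simp add: \<tau>_def)
  have \<tau>T: "\<tau> i \<in> {0..T}" if "i \<le> Suc n" for i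
    using that \<tau>_S[of i] S' ab \<tau>Sn by (cases "i = Suc n") auto
  define X where "X i w = B (\<tau> (Suc i)) w - B (\<tau> i) w" for i w
  have ind: "indep_vars (\<lambda>_. borel) X {..<Suc n}"
  proof -
    have "(\<forall>n \<tau>. (\<forall>i<n. \<tau> i < \<tau> (Suc i)) \<and> (\<forall>i\<le>n. \<tau> i \<in> {0..T}) \<longrightarrow>
        indep_vars (\<lambda>_. borel) (\<lambda>i w. B (\<tau> (Suc i)) w - B (\<tau> i) w) {..<n::nat})"
      using BM unfolding brownian_motion_def by blast
    from this[rule_format, of "Suc n" \<tau>] show ?thesis
      using \<tau>_less \<tau>T unfolding X_def by blast
  qed
  \<comment> \<open>The increments with index below \<open>n\<close> exhaust the past; the block
    \<open>{n}\<close> carries only the increment from \<open>a\<close> to \<open>b\<close>.\<close>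
  have iv: "indep_var (PiM {..<n} (\<lambda>_. borel)) (\<lambda>w. restrict (\<lambda>i. X i w) {..<n})
      (PiM {n} (\<lambda>_. borel)) (\<lambda>w. restrict (\<lambda>i. X i w) {n})"
    by (rule indep_var_restrict[OF ind]) auto
  define J where "J = {j. j \<le> n \<and> \<tau> j \<in> S}"
  have "finite J" by (simp add: J_def)
  define U where "U = {f \<in> space (PiM {..<n} (\<lambda>_. borel :: (real^'m) measure)). \<forall>j\<in>J. (\<Sum>i<j. f i) \<in> A (\<tau> j)}"
  define V where "V = {f \<in> space (PiM {n} (\<lambda>_. borel :: (real^'m) measure)). f n \<in> C}"
  have U: "U \<in> sets (PiM {..<n} (\<lambda>_. borel))"
    unfolding U_def
  proof (rule sets.sets_Collect_finite_All[OF _ \<open>finite J\<close>])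
    fix j assume "j \<in> J"
    then have "(\<lambda>f::nat \<Rightarrow> real^'m. \<Sum>i<j. f i) \<in> borel_measurable (PiM {..<n} (\<lambda>_. borel))"
      by (intro borel_measurable_sum measurable_component_singleton) (auto simp: J_def)
    from measurable_sets[OF this A[of "\<tau> j"]]
    show "{f \<in> space (PiM {..<n} (\<lambda>_. borel)). (\<Sum>i<j. f i) \<in> A (\<tau> j)} \<in> sets (PiM {..<n} (\<lambda>_. borel))"
      by (simp add: vimage_def Int_def conj_commute)
  qed
  have V: "V \<in> sets (PiM {n} (\<lambda>_. borel))"
  proof -
    have "(\<lambda>f::nat \<Rightarrow> real^'m. f n) \<in> borel_measurable (PiM {n} (\<lambda>_. borel))"
      by (intro measurable_component_singleton) auto
    from measurable_sets[OF this C] show ?thesis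
      by (simp add: V_def vimage_def Int_def conj_commute)
  qed
  define E where "E = {w\<in>space P. \<forall>s\<in>S. B s w \<in> A s}"
  define E' where "E' = (\<lambda>w. restrict (\<lambda>i. X i w) {..<n}) -` U \<inter> space P"
  define D where "D = (\<lambda>w. B b w - B a w) -` C \<inter> space P"
  have tele: "(\<Sum>i<j. X i w) = B (\<tau> j) w - B 0 w" for j w
    using sum_lessThan_telescope[of "\<lambda>i. B (\<tau> i) w" j] by (simp add: X_def \<tau>0)
  have D: "(\<lambda>w. restrict (\<lambda>i. X i w) {n}) -` V \<inter> space P = D"
    by (auto simp: D_def V_def X_def \<tau>n \<tau>Sn space_PiM)
  have Dm: "D \<in> sets P"
    unfolding D_def using ab C
    by (intro measurable_sets[OF borel_measurable_diff]) (auto intro!: B_measurable_P)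
  have Em: "E \<in> sets P"
    unfolding E_def
  proof (rule sets.sets_Collect_finite_All[OF _ S(1)])
    fix s assume "s \<in> S"
    then have "s \<in> {0..T}" using S ab by auto
    from measurable_sets[OF B_measurable_P[OF this] A[of s]]
    show "{w \<in> space P. B s w \<in> A s} \<in> sets P"
      by (simp add: vimage_def Int_def conj_commute)
  qed
  have E'm: "E' \<in> sets P"
    unfolding E'_def using indep_var_rv1[OF iv] U by (rule measurable_sets)
  have "AE w in P. B 0 w = 0" using BM unfolding brownian_motion_def by blast
  \<comment> \<open>The two descriptions of the past event agree only up to the null set on which
    \<open>B 0\<close> does not vanish.\<close>
  then have EE': "AE w in P. w \<in> E \<longleftrightarrow> w \<in> E'"
  proof eventually_elim
    case (elim w)
    have r: "(\<Sum>i<j. restrict (\<lambda>i. X i w) {..<n} i) = B (\<tau> j) w" if "j \<in> J" for j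
    proof -
      have "(\<Sum>i<j. restrict (\<lambda>i. X i w) {..<n} i) = (\<Sum>i<j. X i w)"
        using that by (intro sum.cong) (auto simp: J_def)
      then show ?thesis using tele elim by simp
    qed
    have "(\<forall>s\<in>S. B s w \<in> A s) \<longleftrightarrow> (\<forall>j\<in>J. B (\<tau> j) w \<in> A (\<tau> j))"
      using S_\<tau> unfolding J_def S'_def by auto
    then show ?case
      unfolding E_def E'_def U_def using r by (auto simp: space_PiM)
  qed
  have "prob (E \<inter> D) = prob (E' \<inter> D)"
    by (rule finite_measure_eq_AE) (use EE' Em E'm Dm in auto)
  also have "E' \<inter> D = (\<lambda>x. (restrict (\<lambda>i. X i x) {..<n}, restrict (\<lambda>i. X i x) {n})) -` (U \<times> V) \<inter> space P"
    unfolding D[symmetric] E'_def by auto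
  also have "prob \<dots> = prob E' * prob D"
    using indep_varD[OF iv U V] unfolding D E'_def .
  also have "prob E' = prob E"
    by (rule finite_measure_eq_AE) (use EE' Em E'm in auto)
  finally show ?thesis unfolding E_def D_def .
qed

text \<open>Cylinders over finitely many past times form a pi-system, so independence extends to the
  sigma-algebra they generate. The null sets added to \<open>F a\<close> are dealt with afterwards,
  since neither side of the product formula sees them.\<close>

lemma indep_F_increment:
  assumes ab: "0 \<le> a" "a < b" "b \<le> T"
  shows "indep_set (sets (F a)) {(\<lambda>w. B b w - B a w) -` C \<inter> space P | C. C \<in> sets borel}"
proof -
  define G where "G = {{w\<in>space P. \<forall>s\<in>S. B s w \<in> A s} | S A. finite S \<and> S \<subseteq> {0..a} \<and> (\<forall>s. A s \<in> sets borel)}"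
  define D where "D = {(\<lambda>w. B b w - B a w) -` C \<inter> space P | C. C \<in> sets borel}"
  have D_P: "D \<subseteq> events"
    unfolding D_def using ab
    by (auto intro!: measurable_sets[OF borel_measurable_diff] B_measurable_P)
  have G_P: "G \<subseteq> events"
  proof
    fix E assume "E \<in> G"
    then obtain S A where E: "E = {w\<in>space P. \<forall>s\<in>S. B s w \<in> A s}" "finite S" "S \<subseteq> {0..a}" "\<And>s. A s \<in> sets borel"
      unfolding G_def by blast
    show "E \<in> events" unfolding E(1)
    proof (rule sets.sets_Collect_finite_All[OF _ E(2)])
      fix s assume "s \<in> S"
      then have "s \<in> {0..T}" using E ab by auto
      from measurable_sets[OF B_measurable_P[OF this] E(4)[of s]]
      show "{w \<in> space P. B s w \<in> A s} \<in> sets P"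
        by (simp add: vimage_def Int_def conj_commute)
    qed
  qed
  have "indep_set G D"
    unfolding indep_sets2_eq
    using D_P G_P increment_indep_cylinder[OF ab] unfolding G_def D_def by blast
  moreover have "Int_stable G"
  proof (rule Int_stableI)
    fix E1 E2 assume "E1 \<in> G" "E2 \<in> G"
    then obtain S1 A1 S2 A2 where
      E1: "E1 = {w\<in>space P. \<forall>s\<in>S1. B s w \<in> A1 s}" "finite S1" "S1 \<subseteq> {0..a}" "\<And>s. A1 s \<in> sets borel" and
      E2: "E2 = {w\<in>space P. \<forall>s\<in>S2. B s w \<in> A2 s}" "finite S2" "S2 \<subseteq> {0..a}" "\<And>s. A2 s \<in> sets borel"
      unfolding G_def by blast
    define A where "A s = (if s \<in> S1 then A1 s else UNIV) \<inter> (if s \<in> S2 then A2 s else UNIV)" for s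
    have "E1 \<inter> E2 = {w\<in>space P. \<forall>s\<in>S1 \<union> S2. B s w \<in> A s}"
      unfolding E1 E2 A_def by auto
    moreover have "A s \<in> sets borel" for s
      unfolding A_def using E1(4) E2(4) by auto
    ultimately show "E1 \<inter> E2 \<in> G"
      unfolding G_def using E1(2,3) E2(2,3)
      by (intro CollectI exI[of _ "S1 \<union> S2"] exI[of _ A]) auto
  qed
  moreover have "Int_stable D"
  proof (rule Int_stableI)
    fix E1 E2 assume "E1 \<in> D" "E2 \<in> D"
    then obtain C1 C2 where "E1 = (\<lambda>w. B b w - B a w) -` C1 \<inter> space P" "C1 \<in> sets borel"
       "E2 = (\<lambda>w. B b w - B a w) -` C2 \<inter> space P" "C2 \<in> sets borel" unfolding D_def by blast
    then show "E1 \<inter> E2 \<in> D" unfolding D_def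
      by (intro CollectI exI[of _ "C1 \<inter> C2"]) auto
  qed
  ultimately have ind: "indep_set (sigma_sets (space P) G) (sigma_sets (space P) D)"
    by (rule indep_set_sigma_sets)
  \<comment> \<open>Every event of the augmented sigma-algebra agrees almost surely with one
    generated by cylinders; this property is stable under complements and countable unions.\<close>
  have approx: "\<exists>A'\<in>sigma_sets (space P) G. AE w in P. w \<in> A \<longleftrightarrow> w \<in> A'" if "A \<in> sets (F a)" for A
    using that unfolding sets_F
  proof induction
    case (Basic A)
    then show ?case
    proof
      assume "A \<in> {B s -` A \<inter> space P |s A. s \<in> {0..a} \<and> A \<in> sets borel}"
      then obtain s C where "A = B s -` C \<inter> space P" "s \<in> {0..a}" "C \<in> sets borel" by blast
      then have "A \<in> G" unfolding G_def
        by (intro CollectI exI[of _ "{s}"] exI[of _ "\<lambda>_. C"]) auto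
      then show ?thesis by (intro bexI[of _ A]) auto
    next
      assume "A \<in> null_sets P"
      then have "AE w in P. w \<in> A \<longleftrightarrow> w \<in> {}" using AE_not_in by auto
      then show ?thesis by (intro bexI[of _ "{}"]) (auto intro: sigma_sets.Empty)
    qed
  next
    case Empty
    show ?case by (intro bexI[of _ "{}"]) (auto intro: sigma_sets.Empty)
  next
    case (Compl A)
    then obtain A' where "A'\<in>sigma_sets (space P) G" and ae: "AE w in P. w \<in> A \<longleftrightarrow> w \<in> A'" by blast
    show ?case
    proof
      show "space P - A' \<in> sigma_sets (space P) G" by (rule sigma_sets.Compl) fact
      show "AE w in P. (w \<in> space P - A) = (w \<in> space P - A')" using ae by eventually_elim auto
    qed
  next
    case (Union A)
    then obtain A' where A': "\<And>i. A' i \<in> sigma_sets (space P) G" and ae: "\<And>i. AE w in P. w \<in> A i \<longleftrightarrow> w \<in> A' i"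
      by metis
    show ?case
    proof
      show "(\<Union>i::nat. A' i) \<in> sigma_sets (space P) G" by (rule sigma_sets.Union) fact
      have "AE w in P. \<forall>i. w \<in> A i \<longleftrightarrow> w \<in> A' i" unfolding AE_all_countable using ae by blast
      then show "AE w in P. (w \<in> (\<Union>i. A i)) = (w \<in> (\<Union>i::nat. A' i))" by eventually_elim auto
    qed
  qed
  show ?thesis
    unfolding indep_sets2_eq D_def[symmetric]
  proof (intro conjI ballI)
    show "sets (F a) \<subseteq> events" using ab by (intro sets_F_subset) auto
    show "D \<subseteq> events" by fact
    fix A C assume A: "A \<in> sets (F a)" and C: "C \<in> D"
    obtain A' where A': "A'\<in>sigma_sets (space P) G" and ae: "AE w in P. w \<in> A \<longleftrightarrow> w \<in> A'"
      using approx[OF A] by blast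
    have A'P: "A' \<in> events" and "A \<in> events" "C \<in> events"
      using ind A' sets_F_subset[of a] ab A D_P C unfolding indep_sets2_eq by auto
    have "prob (A \<inter> C) = prob (A' \<inter> C)"
      by (rule finite_measure_eq_AE) (use ae \<open>A \<in> events\<close> A'P \<open>C \<in> events\<close> in auto)
    also have "\<dots> = prob A' * prob C"
      using ind A' C unfolding indep_sets2_eq by (auto intro: sigma_sets.Basic)
    also have "prob A' = prob A"
      by (rule finite_measure_eq_AE) (use ae \<open>A \<in> events\<close> A'P in auto)
    finally show "prob (A \<inter> C) = prob A * prob C" .
  qed
qed

text \<open>From events to functions: composing with \<open>g\<close> only coarsens the
  sigma-algebra of the increment, and \<open>Y\<close> generates one contained in
  \<open>F a\<close>.\<close>

lemma indep_var_F_increment: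
  fixes Y :: "'w \<Rightarrow> real" and g :: "real ^ 'm \<Rightarrow> real"
  assumes ab: "0 \<le> a" "a < b" "b \<le> T" and Y: "Y \<in> borel_measurable (F a)" and g: "g \<in> borel_measurable borel"
  shows "indep_var borel Y borel (\<lambda>w. g (B b w - B a w))"
proof -
  let ?D = "{(\<lambda>w. B b w - B a w) -` C \<inter> space P | C. C \<in> sets borel}"
  have "a \<le> T" "0 \<le> b" using ab by auto
  have Yp: "Y \<in> borel_measurable P" using measurable_F_P[OF \<open>a \<le> T\<close> Y] .
  have dp: "(\<lambda>w. B b w - B a w) \<in> borel_measurable P"
    using ab by (intro borel_measurable_diff B_measurable_P) auto
  have gp: "(\<lambda>w. g (B b w - B a w)) \<in> borel_measurable P"
    using measurable_compose[OF dp g] .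
  have ind: "indep_set (sigma_sets (space P) (sets (F a))) (sigma_sets (space P) ?D)"
  proof (rule indep_set_sigma_sets[OF indep_F_increment[OF ab]])
    show "Int_stable (sets (F a))" by (rule sets.Int_stable)
    show "Int_stable ?D"
    proof (rule Int_stableI)
      fix E1 E2 assume "E1 \<in> ?D" "E2 \<in> ?D"
      then obtain C1 C2 where "E1 = (\<lambda>w. B b w - B a w) -` C1 \<inter> space P" "C1 \<in> sets borel"
         "E2 = (\<lambda>w. B b w - B a w) -` C2 \<inter> space P" "C2 \<in> sets borel" by blast
      then show "E1 \<inter> E2 \<in> ?D" 
        by (intro CollectI exI[of _ "C1 \<inter> C2"]) auto
    qed
  qed
  have s1: "sigma_sets (space P) {Y -` A \<inter> space P |A. A \<in> sets borel} \<subseteq> sigma_sets (space P) (sets (F a))"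
    by (rule sigma_sets_mono') (use measurable_sets[OF Y] in auto)
  have s2: "sigma_sets (space P) {(\<lambda>w. g (B b w - B a w)) -` A \<inter> space P |A. A \<in> sets borel}
      \<subseteq> sigma_sets (space P) ?D"
  proof (rule sigma_sets_mono', safe)
    fix A :: "real set" assume "A \<in> sets borel"
    then have "g -` A \<in> sets borel" using measurable_sets[OF g] by auto
    then show "\<exists>C. (\<lambda>w. g (B b w - B a w)) -` A \<inter> space P = (\<lambda>w. B b w - B a w) -` C \<inter> space P \<and> C \<in> sets borel"
      by (intro exI[of _ "g -` A"]) auto
  qed
  show ?thesis
    unfolding indep_var_eq
    using ind s1 s2 Yp gp unfolding indep_sets2_eq by blast
qed

section \<open>Moments of the increments\<close>

text \<open>The components of the increment are independent centred normal variables of variance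
  \<open>b - a\<close>, so the covariance matrix is \<open>b - a\<close> times the identity.\<close>

lemma increment_moments:
  assumes ab: "0 \<le> a" "a < b" "b \<le> T"
  shows "integrable P (\<lambda>w. (B b w - B a w) $ k)"
    and "expectation (\<lambda>w. (B b w - B a w) $ k) = 0"
    and "integrable P (\<lambda>w. (B b w - B a w) $ k * (B b w - B a w) $ l)"
    and "expectation (\<lambda>w. (B b w - B a w) $ k * (B b w - B a w) $ l) = (if k = l then b - a else 0)"
proof -
  have d: "distributed P lborel (\<lambda>w. B b w $ k - B a w $ k) (normal_density 0 (sqrt (b - a)))" for k
    using BM ab unfolding brownian_motion_def by blast
  have iv: "indep_vars (\<lambda>_. borel) (\<lambda>k w. B b w $ k - B a w $ k) UNIV"
    using BM ab unfolding brownian_motion_def by blast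
  have s: "sqrt (b - a) > 0" using ab by auto
  have i1: "integrable P (\<lambda>w. B b w $ k - B a w $ k)" for k
    by (rule distributed_integrable_var[OF d])
       (use integrable_normal_moment[OF s, of 0 1] in auto)
  have e1: "expectation (\<lambda>w. B b w $ k - B a w $ k) = 0" for k
    by (rule normal_distributed_expectation[OF s d])
  have i2: "integrable P (\<lambda>w. (B b w $ k - B a w $ k)^2)" for k
    using distributed_integrable[OF d, of "\<lambda>x. x^2" k] integrable_normal_moment[OF s, of 0 2] by simp
  have e2: "expectation (\<lambda>w. (B b w $ k - B a w $ k)^2) = b - a" for k
    using normal_distributed_variance[OF s d[of k]] e1 s by simp
  have "indep_var borel (\<lambda>w. B b w $ k - B a w $ k) borel (\<lambda>w. B b w $ l - B a w $ l)" if "k \<noteq> l"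
    using indep_vars_sum[of "{l}" k "\<lambda>k w. B b w $ k - B a w $ k"] indep_vars_subset[OF iv, of "{k, l}"] that by auto
  then have "integrable P (\<lambda>w. (B b w $ k - B a w $ k) * (B b w $ l - B a w $ l)) \<and>
     expectation (\<lambda>w. (B b w $ k - B a w $ k) * (B b w $ l - B a w $ l)) = (if k = l then b - a else 0)"
    using i2[of k] e2[of k] i1 e1 indep_var_lebesgue_integral[OF _ i1 i1, of k l] indep_var_integrable[OF _ i1 i1, of k l]
    by (cases "k = l") (auto simp: power2_eq_square)
  then show "integrable P (\<lambda>w. (B b w - B a w) $ k * (B b w - B a w) $ l)"
    and "expectation (\<lambda>w. (B b w - B a w) $ k * (B b w - B a w) $ l) = (if k = l then b - a else 0)" by auto
  show "integrable P (\<lambda>w. (B b w - B a w) $ k)" "expectation (\<lambda>w. (B b w - B a w) $ k) = 0" using i1 e1 by auto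
qed

text \<open>A substitute for the conditional mean and covariance of the increment given
  \<open>F a\<close>: all uses only multiply by an integrable \<open>F a\<close>-measurable weight.
  The degenerate case \<open>a = b\<close> is settled separately because the independence lemmas ask
  for a proper interval.\<close>

lemma increment_mult_F:
  fixes Y :: "'w \<Rightarrow> real"
  assumes ab: "0 \<le> a" "a \<le> b" "b \<le> T" and Y: "Y \<in> borel_measurable (F a)" "integrable P Y"
  shows "integrable P (\<lambda>w. Y w * (B b w - B a w) $ k)"
    and "expectation (\<lambda>w. Y w * (B b w - B a w) $ k) = 0"
    and "integrable P (\<lambda>w. Y w * ((B b w - B a w) $ k * (B b w - B a w) $ l))"
    and "expectation (\<lambda>w. Y w * ((B b w - B a w) $ k * (B b w - B a w) $ l)) = (if k = l then (b - a) * expectation Y else 0)"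
proof -
  have "integrable P (\<lambda>w. Y w * (B b w - B a w) $ k) \<and> expectation (\<lambda>w. Y w * (B b w - B a w) $ k) = 0 \<and>
    integrable P (\<lambda>w. Y w * ((B b w - B a w) $ k * (B b w - B a w) $ l)) \<and>
    expectation (\<lambda>w. Y w * ((B b w - B a w) $ k * (B b w - B a w) $ l)) = (if k = l then (b - a) * expectation Y else 0)"
  proof (cases "a = b")
    case False
    then have ab: "0 \<le> a" "a < b" "b \<le> T" using ab by auto
    note m = increment_moments[OF ab]
    have 1: "indep_var borel Y borel (\<lambda>w. (B b w - B a w) $ k)"
      by (rule indep_var_F_increment[OF ab Y(1)]) simp
    have 2: "indep_var borel Y borel (\<lambda>w. (B b w - B a w) $ k * (B b w - B a w) $ l)"
      by (rule indep_var_F_increment[OF ab Y(1), where g="\<lambda>v. v $ k * v $ l"]) simp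
    show ?thesis
      using indep_var_integrable[OF 1 Y(2) m(1)] indep_var_lebesgue_integral[OF 1 Y(2) m(1)]
        indep_var_integrable[OF 2 Y(2) m(3)] indep_var_lebesgue_integral[OF 2 Y(2) m(3)]
      by (simp only: m) simp
  qed auto
  then show "integrable P (\<lambda>w. Y w * (B b w - B a w) $ k)"
    and "expectation (\<lambda>w. Y w * (B b w - B a w) $ k) = 0"
    and "integrable P (\<lambda>w. Y w * ((B b w - B a w) $ k * (B b w - B a w) $ l))"
    and "expectation (\<lambda>w. Y w * ((B b w - B a w) $ k * (B b w - B a w) $ l)) = (if k = l then (b - a) * expectation Y else 0)" by auto
qed

end

section \<open>Oscillations and the maximal inequality\<close>

definition square_integrable :: "'a measure \<Rightarrow> ('a \<Rightarrow> 'b::euclidean_space) \<Rightarrow> bool" where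
  "square_integrable M f \<longleftrightarrow> f \<in> borel_measurable M \<and> integrable M (\<lambda>x. (norm (f x))\<^sup>2)"

lemma square_integrable_measurable: "square_integrable M f \<Longrightarrow> f \<in> borel_measurable M"
  by (simp add: square_integrable_def)

lemma norm_add_sq_le: "(norm (a + b))\<^sup>2 \<le> 2 * (norm a)\<^sup>2 + 2 * (norm (b::'a::real_inner))\<^sup>2"
proof -
  have "(norm (a + b))\<^sup>2 + (norm (a - b))\<^sup>2 = 2 * (norm a)\<^sup>2 + 2 * (norm b)\<^sup>2"
    by (simp add: power2_norm_eq_inner inner_add_left inner_add_right inner_diff_left inner_diff_right inner_commute)
  then show ?thesis using zero_le_power2[of "norm (a - b)"] by linarith
qed

lemma square_integrable_bound:
  assumes "f \<in> borel_measurable M" "square_integrable M g" "AE x in M. norm (f x) \<le> norm (g x)"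
  shows "square_integrable M f"
proof -
  have "integrable M (\<lambda>x. (norm (f x))\<^sup>2)"
    by (rule Bochner_Integration.integrable_bound[of M "\<lambda>x. (norm (g x))\<^sup>2"])
       (use assms in \<open>auto simp: square_integrable_def power_mono elim!: eventually_mono\<close>)
  then show ?thesis using assms by (simp add: square_integrable_def)
qed

lemma square_integrable_add:
  assumes "square_integrable M f" "square_integrable M g"
  shows "square_integrable M (\<lambda>x. f x + g x)"
proof -
  have m: "f \<in> borel_measurable M" "g \<in> borel_measurable M" using assms by (auto simp: square_integrable_def)
  have "integrable M (\<lambda>x. (norm (f x + g x))\<^sup>2)"
    by (rule Bochner_Integration.integrable_bound[of M "\<lambda>x. 2 * (norm (f x))\<^sup>2 + 2 * (norm (g x))\<^sup>2"])
       (use assms m norm_add_sq_le[of "f x" "g x" for x] in \<open>auto simp: square_integrable_def\<close>)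
  then show ?thesis using m by (simp add: square_integrable_def)
qed

lemma square_integrable_scaleR:
  "square_integrable M f \<Longrightarrow> square_integrable M (\<lambda>x. c *\<^sub>R f x)"
  by (auto simp: square_integrable_def power_mult_distrib)

lemma square_integrable_diff:
  "square_integrable M f \<Longrightarrow> square_integrable M g \<Longrightarrow> square_integrable M (\<lambda>x. f x - g x)"
  using square_integrable_add[of M f "\<lambda>x. (-1) *\<^sub>R g x"] square_integrable_scaleR[of M g "-1"] by simp

lemma square_integrable_sum:
  "finite I \<Longrightarrow> (\<And>i. i \<in> I \<Longrightarrow> square_integrable M (f i)) \<Longrightarrow> square_integrable M (\<lambda>x. \<Sum>i\<in>I. f i x)"
proof (induction I rule: finite_induct)
  case (insert i I)
  then show ?case using square_integrable_add[of M "f i" "\<lambda>x. \<Sum>i\<in>I. f i x"] by simp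
qed (simp add: square_integrable_def)

lemma (in finite_measure) square_integrable_const: "square_integrable M (\<lambda>x. c)"
  by (simp add: square_integrable_def)

lemma square_integrable_inner:
  assumes "square_integrable M f" "square_integrable M g"
  shows "integrable M (\<lambda>x. f x \<bullet> g x)"
proof (rule Bochner_Integration.integrable_bound[of M "\<lambda>x. (norm (f x))\<^sup>2 + (norm (g x))\<^sup>2"])
  show "AE x in M. norm (f x \<bullet> g x) \<le> norm ((norm (f x))\<^sup>2 + (norm (g x))\<^sup>2)"
  proof (rule AE_I2)
    fix x
    have "\<bar>f x \<bullet> g x\<bar> \<le> norm (f x) * norm (g x)" by (rule Cauchy_Schwarz_ineq2)
    also have "\<dots> \<le> (norm (f x))\<^sup>2 + (norm (g x))\<^sup>2"
      using sum_squares_bound[of "norm (f x)" "norm (g x)"] mult_nonneg_nonneg[OF norm_ge_zero[of "f x"] norm_ge_zero[of "g x"]] by linarith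
    finally show "norm (f x \<bullet> g x) \<le> norm ((norm (f x))\<^sup>2 + (norm (g x))\<^sup>2)" by simp
  qed
qed (use assms in \<open>auto simp: square_integrable_def\<close>)

lemma square_integrable_iff_nn_integral:
  "square_integrable M f \<longleftrightarrow> f \<in> borel_measurable M \<and> (\<integral>\<^sup>+x. ennreal ((norm (f x))\<^sup>2) \<partial>M) < \<infinity>"
  unfolding square_integrable_def integrable_iff_bounded by auto

lemma square_integrable_nn_integral:
  "square_integrable M f \<Longrightarrow> (\<integral>\<^sup>+x. ennreal ((norm (f x))\<^sup>2) \<partial>M) = ennreal (\<integral>x. (norm (f x))\<^sup>2 \<partial>M)"
  by (rule nn_integral_eq_integral) (auto simp: square_integrable_def)

section \<open>Counting oscillations along finite grids\<close>

text \<open>The value of the path at the last recorded jump. Held fixed until the next jump, it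
  serves as the integrand of a discrete stochastic integral and takes the place of stopping
  times.\<close>

fun osc_ref :: "real \<Rightarrow> (nat \<Rightarrow> 'a::real_inner) \<Rightarrow> nat \<Rightarrow> 'a" where
  "osc_ref e s 0 = s 0"
| "osc_ref e s (Suc k) = (if e \<le> norm (s (Suc k) - osc_ref e s k) then s (Suc k) else osc_ref e s k)"

fun osc_count :: "real \<Rightarrow> (nat \<Rightarrow> 'a::real_inner) \<Rightarrow> nat \<Rightarrow> nat" where
  "osc_count e s 0 = 0"
| "osc_count e s (Suc k) = osc_count e s k + (if e \<le> norm (s (Suc k) - osc_ref e s k) then 1 else 0)"

text \<open>Along one step with reference \<open>z\<close>, the change of \<open>|s - z|^2\<close>
  is the change of \<open>|s|^2\<close> minus twice the increment of the discrete integral of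
  \<open>z\<close>. At a recorded jump the squared distance, at least \<open>e^2\<close>, is reset
  to \<open>0\<close> while the count rises by one, so the left side gains no more than
  that.\<close>

lemma osc_energy:
  assumes "0 \<le> e"
  shows "e\<^sup>2 * real (osc_count e s n) + (norm (s n - osc_ref e s n))\<^sup>2
    \<le> (norm (s n))\<^sup>2 - (norm (s 0))\<^sup>2 - 2 * (\<Sum>k<n. osc_ref e s k \<bullet> (s (Suc k) - s k))"
proof (induction n)
  case (Suc n)
  let ?z = "osc_ref e s n"
  have id: "(norm (s (Suc n) - ?z))\<^sup>2 - (norm (s n - ?z))\<^sup>2
    = (norm (s (Suc n)))\<^sup>2 - (norm (s n))\<^sup>2 - 2 * (?z \<bullet> (s (Suc n) - s n))"
    by (simp add: power2_norm_eq_inner inner_diff_left inner_diff_right inner_commute)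
  have "e\<^sup>2 * real (osc_count e s (Suc n)) + (norm (s (Suc n) - osc_ref e s (Suc n)))\<^sup>2
     \<le> e\<^sup>2 * real (osc_count e s n) + (norm (s (Suc n) - ?z))\<^sup>2"
    using assms by (auto simp: algebra_simps power_mono)
  then show ?case using Suc id by simp
qed auto

lemma osc_ref_in: "\<exists>j\<le>k. osc_ref e s k = s j"
proof (induction k)
  case (Suc k)
  then show ?case by (metis le_SucI order_refl osc_ref.simps(2))
qed auto

lemma osc_ref_close: "0 < e \<Longrightarrow> norm (s k - osc_ref e s k) < e"
  by (cases k) auto

lemma osc_count_mono: "i \<le> j \<Longrightarrow> osc_count e s i \<le> osc_count e s j"
  by (induction j) (auto simp: le_Suc_eq)

lemma osc_count_eq_imp_ref: "i \<le> j \<Longrightarrow> osc_count e s i = osc_count e s j \<Longrightarrow> osc_ref e s i = osc_ref e s j"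
proof (induction j)
  case (Suc j)
  show ?case
  proof (cases "i = Suc j")
    case False
    then have "i \<le> j" using Suc by auto
    then have "osc_count e s i \<le> osc_count e s j" by (rule osc_count_mono)
    then have "\<not> e \<le> norm (s (Suc j) - osc_ref e s j)" "osc_count e s i = osc_count e s j"
      using Suc(3) by (auto split: if_splits)
    then show ?thesis using Suc \<open>i \<le> j\<close> by auto
  qed auto
qed auto

text \<open>If nothing were recorded between \<open>i\<close> and \<open>j\<close>, both values
  would lie within \<open>e\<close> of one common reference, hence at distance below
  \<open>2 * e\<close>.\<close>

lemma osc_count_jump:
  assumes "0 < e" "i \<le> j" "2 * e \<le> norm (s j - s i)"
  shows "Suc (osc_count e s i) \<le> osc_count e s j"
proof (rule ccontr)
  assume "\<not> ?thesis"
  then have "osc_ref e s i = osc_ref e s j"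
    using osc_count_mono[OF assms(2), of e s] by (intro osc_count_eq_imp_ref assms) auto
  then have "norm (s j - s i) \<le> norm (s j - osc_ref e s j) + norm (s i - osc_ref e s i)"
    using norm_triangle_ineq4[of "s j - osc_ref e s j" "s i - osc_ref e s i"] by simp
  then show False using osc_ref_close[OF assms(1), of s i] osc_ref_close[OF assms(1), of s j] assms by linarith
qed

lemma osc_count_le: "osc_count e s n \<le> n"
  by (induction n) auto

lemma osc_count_pos:
  assumes "k \<le> n" "e \<le> norm (s k - s 0)" "0 < e"
  shows "1 \<le> osc_count e s n"
proof (rule ccontr)
  assume "\<not> ?thesis"
  then have z: "osc_count e s k = osc_count e s 0"
    using osc_count_mono[OF assms(1), of e s] by simp
  then have "osc_ref e s 0 = osc_ref e s k" by (intro osc_count_eq_imp_ref) auto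
  then show False using osc_ref_close[OF assms(3), of s k] assms(2) by simp
qed

section \<open>Jumps along an infinite set of times\<close>

text \<open>Describes jumps along a possibly infinite set \<open>D\<close> of times, where no
  recursion over a grid is available. Only the length and the two end times are kept, which is what
  allows a chain to be prolonged on either side.\<close>

inductive jump_chain :: "real \<Rightarrow> real set \<Rightarrow> (real \<Rightarrow> 'a::real_normed_vector) \<Rightarrow> nat \<Rightarrow> real \<Rightarrow> real \<Rightarrow> bool"
  for e D s where
  base: "a \<in> D \<Longrightarrow> jump_chain e D s 0 a a"
| step: "jump_chain e D s m a b \<Longrightarrow> b < c \<Longrightarrow> c \<in> D \<Longrightarrow> e \<le> norm (s c - s b) \<Longrightarrow> jump_chain e D s (Suc m) a c"

lemma jump_chain_prepend:
  "jump_chain e D s m a b \<Longrightarrow> a' < a \<Longrightarrow> a' \<in> D \<Longrightarrow> e \<le> norm (s a - s a') \<Longrightarrow> jump_chain e D s (Suc m) a' b"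
  by (induction rule: jump_chain.induct) (auto intro: jump_chain.intros)

text \<open>If the oscillation persisted arbitrarily close to \<open>t\<close>, any chain ending at
  \<open>b < t\<close> could be prolonged: of two values at least \<open>2 * e\<close> apart at
  times between \<open>b\<close> and \<open>t\<close>, at least one is \<open>e\<close> away from
  the value at \<open>b\<close>.\<close>

lemma no_chain_left_Cauchy:
  assumes no: "\<And>a b. \<not> jump_chain e D s m a b" 
  shows "\<exists>\<delta>>0. \<forall>q\<in>D \<inter> {t-\<delta><..<t}. \<forall>q'\<in>D \<inter> {t-\<delta><..<t}. norm (s q - s q') < 2 * e"
proof (rule ccontr)
  assume "\<not> ?thesis"
  then have H: "\<exists>q\<in>D \<inter> {t-\<delta><..<t}. \<exists>q'\<in>D \<inter> {t-\<delta><..<t}. 2 * e \<le> norm (s q - s q')" if "\<delta> > 0" for \<delta>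
    using that not_le by blast
  have "\<exists>a b. b < t \<and> jump_chain e D s k a b" for k
  proof (induction k)
    case 0
    then show ?case using H[of 1] jump_chain.base[of _ D e s] by fastforce
  next
    case (Suc k)
    then obtain a b where ab: "b < t" "jump_chain e D s k a b" by auto
    then obtain q q' where q: "q \<in> D" "q' \<in> D" "q \<in> {b<..<t}" "q' \<in> {b<..<t}" "2 * e \<le> norm (s q - s q')"
      using H[of "t - b"] by auto
    have "norm (s q - s q') \<le> norm (s q - s b) + norm (s q' - s b)"
      using norm_triangle_ineq4[of "s q - s b" "s q' - s b"] by simp
    then have "e \<le> norm (s q - s b) \<or> e \<le> norm (s q' - s b)" using q by linarith
    then show ?case using q ab jump_chain.step by fastforce
  qed
  then show False using no by blast
qed

text \<open>The mirror image: chains starting after \<open>t\<close> are prolonged at their front,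
  towards \<open>t\<close>.\<close>

lemma no_chain_right_Cauchy:
  assumes no: "\<And>a b. \<not> jump_chain e D s m a b" 
  shows "\<exists>\<delta>>0. \<forall>q\<in>D \<inter> {t<..<t+\<delta>}. \<forall>q'\<in>D \<inter> {t<..<t+\<delta>}. norm (s q - s q') < 2 * e"
proof (rule ccontr)
  assume "\<not> ?thesis"
  then have H: "\<exists>q\<in>D \<inter> {t<..<t+\<delta>}. \<exists>q'\<in>D \<inter> {t<..<t+\<delta>}. 2 * e \<le> norm (s q - s q')" if "\<delta> > 0" for \<delta>
    using that not_le by blast
  have "\<exists>a b. t < a \<and> jump_chain e D s k a b" for k
  proof (induction k)
    case 0
    then show ?case using H[of 1] jump_chain.base[of _ D e s] by fastforce
  next
    case (Suc k)
    then obtain a b where ab: "t < a" "jump_chain e D s k a b" by auto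
    then obtain q q' where q: "q \<in> D" "q' \<in> D" "q \<in> {t<..<a}" "q' \<in> {t<..<a}" "2 * e \<le> norm (s q - s q')"
      using H[of "a - t"] by auto
    have "norm (s q - s q') \<le> norm (s a - s q) + norm (s a - s q')"
      using norm_triangle_ineq4[of "s a - s q'" "s a - s q"] by simp
    then have "e \<le> norm (s a - s q) \<or> e \<le> norm (s a - s q')" using q by linarith
    then show ?case using q ab jump_chain_prepend by fastforce
  qed
  then show False using no by blast
qed

section \<open>Dyadic times\<close>

definition dyad :: "real \<Rightarrow> nat \<Rightarrow> nat \<Rightarrow> real" where
  "dyad T n k = real k * T / 2 ^ n"

definition dyads :: "real \<Rightarrow> real set" where
  "dyads T = {dyad T n k | n k. k \<le> 2 ^ n}"

lemma dyad_refine: "dyad T (n + m) (k * 2 ^ m) = dyad T n k"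
  by (simp add: dyad_def power_add)

lemma dyad_in: "0 \<le> T \<Longrightarrow> k \<le> 2 ^ n \<Longrightarrow> dyad T n k \<in> {0..T}"
proof -
  assume a: "0 \<le> T" "k \<le> 2 ^ n"
  then have "real k \<le> 2 ^ n" using of_nat_mono by fastforce
  then have "real k * T \<le> 2 ^ n * T" using a by (intro mult_right_mono)
  then show ?thesis using a by (simp add: dyad_def field_simps)
qed

lemma dyads_subset: "0 \<le> T \<Longrightarrow> dyads T \<subseteq> {0..T}"
  using dyad_in by (auto simp: dyads_def)

lemma dyad_0 [simp]: "dyad T n 0 = 0" and dyad_top [simp]: "dyad T n (2 ^ n) = T"
  by (auto simp: dyad_def)

lemma dyad_mono: "0 \<le> T \<Longrightarrow> i \<le> j \<Longrightarrow> dyad T n i \<le> dyad T n j"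
  by (simp add: dyad_def divide_right_mono mult_right_mono)

lemma dyad_less_iff: "0 < T \<Longrightarrow> dyad T n i < dyad T n j \<longleftrightarrow> i < j"
  by (simp add: dyad_def field_simps)

lemma countable_dyads: "countable (dyads T)"
proof -
  have "dyads T \<subseteq> (\<lambda>(n, k). dyad T n k) ` UNIV" by (auto simp: dyads_def)
  then show ?thesis by (rule countable_subset) auto
qed

lemma dyads_eventually:
  assumes "q \<in> dyads T"
  shows "\<exists>n0. \<forall>n\<ge>n0. \<exists>k\<le>2 ^ n. dyad T n k = q"
proof -
  obtain n0 k where k: "q = dyad T n0 k" "k \<le> 2 ^ n0" using assms by (auto simp: dyads_def)
  show ?thesis
  proof (rule exI[of _ n0], intro allI impI)
    fix n assume "n0 \<le> n"
    then obtain m where n: "n = n0 + m" using le_Suc_ex by blast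
    show "\<exists>k\<le>2 ^ n. dyad T n k = q"
      unfolding n k(1) by (rule exI[of _ "k * 2 ^ m"]) (use k in \<open>auto simp: dyad_refine power_add\<close>)
  qed
qed

lemma dyads_dense:
  assumes "0 \<le> a" "a < b" "b \<le> T"
  shows "\<exists>q\<in>dyads T. a < q \<and> q < b"
proof -
  have T: "T > 0" using assms by auto
  have "((b - a) / T) > 0" using assms T by auto
  then obtain n where n: "(1/2::real) ^ n < (b - a) / T"
    using real_arch_pow_inv[of "(b - a) / T" "1/2"] by auto
  \<comment> \<open>The first grid index strictly to the right of \<open>a\<close>; the mesh is
    finer than \<open>b - a\<close>, so this grid point is still below \<open>b\<close>.\<close>
  define k where "k = nat \<lfloor>a * 2 ^ n / T\<rfloor> + 1"
  have "a * 2 ^ n / T \<ge> 0" using assms T by auto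
  then have k: "a * 2 ^ n / T < real k" "real k \<le> a * 2 ^ n / T + 1"
    unfolding k_def by linarith+
  have 1: "a < dyad T n k"
    using k(1) T by (simp add: dyad_def field_simps)
  have "T < (b - a) * 2 ^ n" using n T by (simp add: field_simps power_divide)
  moreover have "real k * T \<le> a * 2 ^ n + T" using k(2) T by (simp add: field_simps)
  ultimately have "real k * T < b * 2 ^ n" by (simp add: algebra_simps)
  then have 2: "dyad T n k < b" by (simp add: dyad_def field_simps)
  have "dyad T n k < dyad T n (2 ^ n)" using 2 assms by simp
  then have "k < 2 ^ n" using dyad_less_iff[OF T] by blast
  then show ?thesis using 1 2 unfolding dyads_def using less_imp_le by blast
qed

text \<open>Dyadic grids are nested, so from some level on all times of a finite chain are grid
  points, and each chain step of size \<open>2 * e\<close> then forces a new recorded jump of size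
  \<open>e\<close>.\<close>

lemma jump_chain_count:
  assumes "0 < e" "0 < T"
  shows "jump_chain (2 * e) (dyads T) s m a b \<Longrightarrow>
     \<exists>n0. \<forall>n\<ge>n0. \<exists>j\<le>2 ^ n. dyad T n j = b \<and> m \<le> osc_count e (\<lambda>k. s (dyad T n k)) j"
proof (induction rule: jump_chain.induct)
  case (base a)
  then show ?case using dyads_eventually by fastforce
next
  case (step m a b c)
  then obtain n0 where n0: "\<And>n. n\<ge>n0 \<Longrightarrow> \<exists>j\<le>2 ^ n. dyad T n j = b \<and> m \<le> osc_count e (\<lambda>k. s (dyad T n k)) j"
    by blast
  obtain n1 where n1: "\<And>n. n\<ge>n1 \<Longrightarrow> \<exists>j\<le>2 ^ n. dyad T n j = c"
    using dyads_eventually[of c T] step by blast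
  show ?case
  proof (rule exI[of _ "max n0 n1"], intro allI impI)
    fix n assume "max n0 n1 \<le> n"
    then obtain i j where ij: "dyad T n i = b" "m \<le> osc_count e (\<lambda>k. s (dyad T n k)) i" "j \<le> 2 ^ n" "dyad T n j = c"
      using n0[of n] n1[of n] by auto
    then have "i < j" using step dyad_less_iff[OF assms(2)] by blast
    then have "Suc (osc_count e (\<lambda>k. s (dyad T n k)) i) \<le> osc_count e (\<lambda>k. s (dyad T n k)) j"
      using ij step by (intro osc_count_jump assms) auto
    then show "\<exists>j\<le>2 ^ n. dyad T n j = c \<and> Suc m \<le> osc_count e (\<lambda>k. s (dyad T n k)) j"
      using ij by (intro exI[of _ j]) auto
  qed
qed

section \<open>Oscillation bounds for martingales and submartingales\<close>

context brownian_setting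
begin

text \<open>For \<open>K = UNIV\<close> these are the square-integrable martingales, for \<open>K = {0..}\<close> the
  nonnegative square-integrable submartingales, both tested against \<open>L\<^sup>2\<close> instead of
  conditional expectations.\<close>

definition cone_martingale :: "'a::euclidean_space set \<Rightarrow> (real \<Rightarrow> 'w \<Rightarrow> 'a) \<Rightarrow> bool" where
  "cone_martingale K X \<longleftrightarrow>
     (\<forall>t\<in>{0..T}. X t \<in> borel_measurable (F t) \<and> square_integrable P (X t) \<and> (\<forall>w\<in>space P. X t w \<in> K)) \<and>
     (\<forall>s t Z. 0 \<le> s \<longrightarrow> s \<le> t \<longrightarrow> t \<le> T \<longrightarrow> Z \<in> borel_measurable (F s) \<longrightarrow> square_integrable P Z \<longrightarrow>
        (\<forall>w\<in>space P. Z w \<in> K) \<longrightarrow> 0 \<le> expectation (\<lambda>w. Z w \<bullet> (X t w - X s w)))"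

lemma cone_martingaleD:
  assumes "cone_martingale K X" "t \<in> {0..T}"
  shows "X t \<in> borel_measurable (F t)" "square_integrable P (X t)" "w \<in> space P \<Longrightarrow> X t w \<in> K"
  using assms unfolding cone_martingale_def by auto

lemma osc_ref_measurable:
  fixes X :: "real \<Rightarrow> 'w \<Rightarrow> 'a::euclidean_space"
  assumes X: "\<And>t. t \<in> {0..T} \<Longrightarrow> X t \<in> borel_measurable (F t)"
    and \<tau>: "\<And>i j. i \<le> j \<Longrightarrow> j \<le> n \<Longrightarrow> \<tau> i \<le> \<tau> j" "\<And>i. i \<le> n \<Longrightarrow> \<tau> i \<in> {0..T}" and "k \<le> n"
  shows "(\<lambda>w. osc_ref e (\<lambda>k. X (\<tau> k) w) k) \<in> borel_measurable (F (\<tau> k))"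
  using \<open>k \<le> n\<close>
proof (induction k)
  case 0 then show ?case using X \<tau> by simp
next
  case (Suc k)
  have 1[measurable]: "(\<lambda>w. osc_ref e (\<lambda>k. X (\<tau> k) w) k) \<in> borel_measurable (F (\<tau> (Suc k)))"
    using measurable_F_mono[OF \<tau>(1)[of k "Suc k"]] Suc by auto
  have 2[measurable]: "X (\<tau> (Suc k)) \<in> borel_measurable (F (\<tau> (Suc k)))"
    using X \<tau> Suc by auto
  show ?case by simp
qed

lemma osc_count_measurable:
  fixes X :: "real \<Rightarrow> 'w \<Rightarrow> 'a::euclidean_space"
  assumes X: "\<And>t. t \<in> {0..T} \<Longrightarrow> X t \<in> borel_measurable (F t)"
    and \<tau>: "\<And>i j. i \<le> j \<Longrightarrow> j \<le> n \<Longrightarrow> \<tau> i \<le> \<tau> j" "\<And>i. i \<le> n \<Longrightarrow> \<tau> i \<in> {0..T}" and "k \<le> n"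
  shows "(\<lambda>w. real (osc_count e (\<lambda>k. X (\<tau> k) w) k)) \<in> borel_measurable P"
  using \<open>k \<le> n\<close>
proof (induction k)
  case (Suc k)
  have 1[measurable]: "(\<lambda>w. osc_ref e (\<lambda>k. X (\<tau> k) w) k) \<in> borel_measurable P"
    by (rule measurable_F_P[OF _ osc_ref_measurable[of X n \<tau>]]) (use X \<tau> Suc in auto)
  have 2[measurable]: "X (\<tau> (Suc k)) \<in> borel_measurable P"
    by (rule measurable_F_P[OF _ X]) (use \<tau>(2)[of "Suc k"] Suc in auto)
  have [measurable]: "(\<lambda>w. real (osc_count e (\<lambda>k. X (\<tau> k) w) k)) \<in> borel_measurable P"
    using Suc by auto
  have "(\<lambda>w. real (osc_count e (\<lambda>k. X (\<tau> k) w) (Suc k))) = (\<lambda>w. real (osc_count e (\<lambda>k. X (\<tau> k) w) k) +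
     (if e \<le> norm (X (\<tau> (Suc k)) w - osc_ref e (\<lambda>k. X (\<tau> k) w) k) then 1 else 0))" by auto
  then show ?case by simp
qed auto

lemma expectation_osc_count:
  fixes X :: "real \<Rightarrow> 'w \<Rightarrow> 'a::euclidean_space"
  assumes X: "cone_martingale K X"
    and \<tau>: "\<And>i j. i \<le> j \<Longrightarrow> j \<le> n \<Longrightarrow> \<tau> i \<le> \<tau> j" "\<And>i. i \<le> n \<Longrightarrow> \<tau> i \<in> {0..T}" and e: "0 < e"
  shows "e\<^sup>2 * expectation (\<lambda>w. real (osc_count e (\<lambda>k. X (\<tau> k) w) n)) \<le> expectation (\<lambda>w. (norm (X (\<tau> n) w))\<^sup>2)"
    and "integrable P (\<lambda>w. real (osc_count e (\<lambda>k. X (\<tau> k) w) n))"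
proof -
  note Xm = cone_martingaleD[OF X]
  define Z where "Z k w = osc_ref e (\<lambda>k. X (\<tau> k) w) k" for k w
  have Zm: "Z k \<in> borel_measurable (F (\<tau> k))" if "k \<le> n" for k
    unfolding Z_def by (rule osc_ref_measurable[of X n \<tau>]) (use Xm \<tau> that in auto)
  have ZmP: "Z k \<in> borel_measurable P" if "k \<le> n" for k
    using measurable_F_P[OF _ Zm[OF that]] \<tau>(2)[OF that] by auto
  \<comment> \<open>The reference is one of finitely many values of \<open>X\<close>, so the sum of
    all their squares dominates its square.\<close>
  have Zs: "square_integrable P (Z k)" if k: "k \<le> n" for k
  proof -
    have "integrable P (\<lambda>w. (norm (Z k w))\<^sup>2)"
    proof (rule Bochner_Integration.integrable_bound[of P "\<lambda>w. \<Sum>j\<le>k. (norm (X (\<tau> j) w))\<^sup>2"])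
      show "integrable P (\<lambda>w. \<Sum>j\<le>k. (norm (X (\<tau> j) w))\<^sup>2)"
        using Xm(2) \<tau> k by (intro Bochner_Integration.integrable_sum) (auto simp: square_integrable_def)
      show "AE w in P. norm ((norm (Z k w))\<^sup>2) \<le> norm (\<Sum>j\<le>k. (norm (X (\<tau> j) w))\<^sup>2)"
      proof (rule AE_I2)
        fix w
        obtain j where j: "j \<le> k" "Z k w = X (\<tau> j) w" using osc_ref_in[of k e "\<lambda>k. X (\<tau> k) w"] unfolding Z_def by auto
        have "(norm (X (\<tau> j) w))\<^sup>2 \<le> (\<Sum>j\<le>k. (norm (X (\<tau> j) w))\<^sup>2)"
          using j by (intro member_le_sum) auto
        then show "norm ((norm (Z k w))\<^sup>2) \<le> norm (\<Sum>j\<le>k. (norm (X (\<tau> j) w))\<^sup>2)" using j by (simp add: sum_nonneg)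
      qed
    qed (use ZmP[OF k] in auto)
    then show ?thesis using ZmP[OF k] by (simp add: square_integrable_def)
  qed
  have ZK: "Z k w \<in> K" if "k \<le> n" "w \<in> space P" for k w
  proof -
    obtain j where j: "j \<le> k" "Z k w = X (\<tau> j) w" using osc_ref_in[of k e "\<lambda>k. X (\<tau> k) w"] unfolding Z_def by auto
    then show ?thesis using Xm(3)[of "\<tau> j" w] \<tau>(2)[of j] that by auto
  qed
  have Zint: "integrable P (\<lambda>w. Z k w \<bullet> (X (\<tau> (Suc k)) w - X (\<tau> k) w))" if "k < n" for k
    using that \<tau> by (intro square_integrable_inner square_integrable_diff Zs Xm(2)) auto
  have Zpos: "0 \<le> expectation (\<lambda>w. Z k w \<bullet> (X (\<tau> (Suc k)) w - X (\<tau> k) w))" if "k < n" for k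
  proof -
    have "0 \<le> \<tau> k" "\<tau> k \<le> \<tau> (Suc k)" "\<tau> (Suc k) \<le> T" using that \<tau>(1)[of k "Suc k"] \<tau>(2)[of k] \<tau>(2)[of "Suc k"] by auto
    moreover have "k \<le> n" using that by simp
    ultimately show ?thesis using X Zm[of k] Zs[of k] ZK[of k] unfolding cone_martingale_def by blast
  qed
  have cm: "(\<lambda>w. real (osc_count e (\<lambda>k. X (\<tau> k) w) n)) \<in> borel_measurable P"
    by (rule osc_count_measurable[of X n \<tau>]) (use Xm \<tau> in auto)
  show ci: "integrable P (\<lambda>w. real (osc_count e (\<lambda>k. X (\<tau> k) w) n))"
    by (rule integrable_const_bound[of _ "real n"]) (use cm osc_count_le[of e _ n] in auto)
  have "expectation (\<lambda>w. e\<^sup>2 * real (osc_count e (\<lambda>k. X (\<tau> k) w) n))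
    \<le> expectation (\<lambda>w. (norm (X (\<tau> n) w))\<^sup>2 - 2 * (\<Sum>k<n. Z k w \<bullet> (X (\<tau> (Suc k)) w - X (\<tau> k) w)))"
  proof (rule integral_mono)
    show "integrable P (\<lambda>w. (norm (X (\<tau> n) w))\<^sup>2 - 2 * (\<Sum>k<n. Z k w \<bullet> (X (\<tau> (Suc k)) w - X (\<tau> k) w)))"
      using Xm(2)[of "\<tau> n"] \<tau>(2)[of n] Zint
      by (intro Bochner_Integration.integrable_diff integrable_mult_right Bochner_Integration.integrable_sum)
         (auto simp: square_integrable_def)
    fix w
    show "e\<^sup>2 * real (osc_count e (\<lambda>k. X (\<tau> k) w) n)
      \<le> (norm (X (\<tau> n) w))\<^sup>2 - 2 * (\<Sum>k<n. Z k w \<bullet> (X (\<tau> (Suc k)) w - X (\<tau> k) w))"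
      using osc_energy[of e "\<lambda>k. X (\<tau> k) w" n] e zero_le_power2[of "norm (X (\<tau> 0) w)"]
        zero_le_power2[of "norm (X (\<tau> n) w - osc_ref e (\<lambda>k. X (\<tau> k) w) n)"]
      unfolding Z_def by linarith
  qed (use ci in auto)
  also have "\<dots> = expectation (\<lambda>w. (norm (X (\<tau> n) w))\<^sup>2) - 2 * (\<Sum>k<n. expectation (\<lambda>w. Z k w \<bullet> (X (\<tau> (Suc k)) w - X (\<tau> k) w)))"
    using Xm(2)[of "\<tau> n"] \<tau>(2)[of n] Zint
    by (subst Bochner_Integration.integral_diff) (auto simp: square_integrable_def)
  also have "\<dots> \<le> expectation (\<lambda>w. (norm (X (\<tau> n) w))\<^sup>2)"
    using sum_nonneg[of "{..<n}" "\<lambda>k. expectation (\<lambda>w. Z k w \<bullet> (X (\<tau> (Suc k)) w - X (\<tau> k) w))"] Zpos by auto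
  finally show "e\<^sup>2 * expectation (\<lambda>w. real (osc_count e (\<lambda>k. X (\<tau> k) w) n)) \<le> expectation (\<lambda>w. (norm (X (\<tau> n) w))\<^sup>2)"
    by simp
qed

lemma expectation_osc_count_dyad:
  fixes X :: "real \<Rightarrow> 'w \<Rightarrow> 'a::euclidean_space"
  assumes X: "cone_martingale K X" and e: "0 < e"
  shows "e\<^sup>2 * expectation (\<lambda>w. real (osc_count e (\<lambda>k. X (dyad T n k) w) (2 ^ n))) \<le> expectation (\<lambda>w. (norm (X T w))\<^sup>2)"
    and "integrable P (\<lambda>w. real (osc_count e (\<lambda>k. X (dyad T n k) w) (2 ^ n)))"
  using expectation_osc_count[OF X _ _ e, of "2 ^ n" "dyad T n"] dyad_mono[of T _ _ n] dyad_in[of T _ n] T_pos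
  by auto

text \<open>The expected counts on dyadic grids are bounded uniformly in the level, so by Fatou's
  lemma their lower limit is finite almost surely. A chain of length \<open>m\<close> is eventually
  counted on every grid and forces this lower limit to be at least \<open>m\<close>.\<close>

lemma AE_no_long_chain:
  fixes X :: "real \<Rightarrow> 'w \<Rightarrow> 'a::euclidean_space"
  assumes X: "cone_martingale K X" and e: "0 < e"
  shows "AE w in P. \<exists>m. \<forall>a b. \<not> jump_chain e (dyads T) (\<lambda>t. X t w) m a b"
proof -
  define C where "C n w = ennreal (real (osc_count (e/2) (\<lambda>k. X (dyad T n k) w) (2 ^ n)))" for n w
  \<comment> \<open>Half the size is counted, because a chain step has to be twice as large as the
    jump it causes to be recorded.\<close>
  have e2: "0 < e / 2" using e by auto
  define L where "L = expectation (\<lambda>w. (norm (X T w))\<^sup>2) / (e/2)\<^sup>2"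
  have Cm[measurable]: "C n \<in> borel_measurable P" for n
    unfolding C_def using expectation_osc_count_dyad(2)[OF X e2, of n] by measurable
  have "(\<integral>\<^sup>+w. liminf (\<lambda>n. C n w) \<partial>P) \<le> liminf (\<lambda>n. \<integral>\<^sup>+w. C n w \<partial>P)"
    by (rule nn_integral_liminf) auto
  also have "\<dots> \<le> ennreal L"
  proof (rule Liminf_le)
    show "\<forall>\<^sub>F n in sequentially. (\<integral>\<^sup>+w. C n w \<partial>P) \<le> ennreal L"
    proof (rule always_eventually, rule allI)
      fix n
      have "(\<integral>\<^sup>+w. C n w \<partial>P) = ennreal (expectation (\<lambda>w. real (osc_count (e/2) (\<lambda>k. X (dyad T n k) w) (2 ^ n))))"
        unfolding C_def by (rule nn_integral_eq_integral[OF expectation_osc_count_dyad(2)[OF X e2]]) auto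
      also have "\<dots> \<le> ennreal L"
        using expectation_osc_count_dyad(1)[OF X e2, of n] e unfolding L_def
        by (intro ennreal_leI) (simp add: field_simps)
      finally show "(\<integral>\<^sup>+w. C n w \<partial>P) \<le> ennreal L" .
    qed
  qed auto
  finally have "(\<integral>\<^sup>+w. liminf (\<lambda>n. C n w) \<partial>P) \<noteq> \<infinity>"
    using ennreal_less_top[of L] by (auto simp: top_unique)
  then have "AE w in P. liminf (\<lambda>n. C n w) \<noteq> \<infinity>"
    by (intro nn_integral_PInf_AE) auto
  then show ?thesis
  proof eventually_elim
    case (elim w)
    show ?case
    proof (rule ccontr)
      assume "\<not> ?thesis"
      then have ch: "\<exists>a b. jump_chain (2 * (e/2)) (dyads T) (\<lambda>t. X t w) m a b" for m by auto
      have "ennreal (real m) \<le> liminf (\<lambda>n. C n w)" for m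
      proof (rule Liminf_bounded)
        obtain a b where "jump_chain (2 * (e/2)) (dyads T) (\<lambda>t. X t w) m a b" using ch by blast
        from jump_chain_count[OF e2 T_pos this] obtain n0 where
          n0: "\<And>n. n\<ge>n0 \<Longrightarrow> \<exists>j\<le>2 ^ n. dyad T n j = b \<and> m \<le> osc_count (e/2) (\<lambda>k. X (dyad T n k) w) j" by blast
        show "\<forall>\<^sub>F n in sequentially. ennreal (real m) \<le> C n w"
        proof (rule eventually_sequentiallyI[of n0])
          fix n assume "n0 \<le> n"
          from n0[OF this] obtain j where j: "j \<le> 2 ^ n" "m \<le> osc_count (e/2) (\<lambda>k. X (dyad T n k) w) j" by blast
          then have "m \<le> osc_count (e/2) (\<lambda>k. X (dyad T n k) w) (2 ^ n)"
            using osc_count_mono[OF j(1)] le_trans by blast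
          then show "ennreal (real m) \<le> C n w" unfolding C_def by (intro ennreal_leI) auto
        qed
      qed
      then have "liminf (\<lambda>n. C n w) = \<infinity>"
        using ennreal_Ex_less_of_nat[of "liminf (\<lambda>n. C n w)"]
        by (metis ennreal_of_nat_eq_real_of_nat infinity_ennreal_def linorder_not_less top.not_eq_extremum)
      then show False using elim by simp
    qed
  qed
qed

text \<open>A Doob type estimate: a path that leaves the ball of radius \<open>e\<close> around its
  starting value has at least one recorded jump, so the indicator of this event is below the count.
  As the grids are nested, the events increase with the level and continuity of the measure gives
  their union.\<close>

lemma dyads_maximal_inequality:
  fixes X :: "real \<Rightarrow> 'w \<Rightarrow> 'a::euclidean_space"
  assumes X: "cone_martingale K X" and e: "0 < e"
  shows "{w \<in> space P. \<exists>q\<in>dyads T. e \<le> norm (X q w - X 0 w)} \<in> sets P"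
    and "e\<^sup>2 * prob {w \<in> space P. \<exists>q\<in>dyads T. e \<le> norm (X q w - X 0 w)} \<le> expectation (\<lambda>w. (norm (X T w))\<^sup>2)"
proof -
  have Xm[measurable]: "X t \<in> borel_measurable P" if "t \<in> {0..T}" for t
    using cone_martingaleD(2)[OF X that] by (simp add: square_integrable_def)
  define A where "A n = {w \<in> space P. \<exists>k\<in>{..2 ^ n}. e \<le> norm (X (dyad T n k) w - X 0 w)}" for n
  have un: "{w \<in> space P. \<exists>q\<in>dyads T. e \<le> norm (X q w - X 0 w)} = (\<Union>n. A n)"
    unfolding A_def dyads_def by auto
  have Am: "A n \<in> sets P" for n
    unfolding A_def
  proof (rule sets.sets_Collect_finite_Ex)
    fix k :: nat assume "k \<in> {..2 ^ n}"
    then have [measurable]: "X (dyad T n k) \<in> borel_measurable P" "X 0 \<in> borel_measurable P"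
      using dyad_in[of T k n] T_pos by (auto intro!: Xm)
    show "{w \<in> space P. e \<le> norm (X (dyad T n k) w - X 0 w)} \<in> sets P" by measurable
  qed auto
  then show "{w \<in> space P. \<exists>q\<in>dyads T. e \<le> norm (X q w - X 0 w)} \<in> sets P"
    unfolding un by auto
  have inc: "incseq A"
  proof (rule incseq_SucI, rule subsetI)
    fix n w assume "w \<in> A n"
    then obtain k where k: "k \<le> 2 ^ n" "e \<le> norm (X (dyad T n k) w - X 0 w)" "w \<in> space P" unfolding A_def by auto
    then have "e \<le> norm (X (dyad T (Suc n) (k * 2)) w - X 0 w)" "k * 2 \<le> 2 ^ Suc n"
      using dyad_refine[of T n 1 k] by auto
    then show "w \<in> A (Suc n)" unfolding A_def using k by blast
  qed
  have "e\<^sup>2 * prob (A n) \<le> expectation (\<lambda>w. (norm (X T w))\<^sup>2)" for n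
  proof -
    have "prob (A n) = expectation (indicator (A n))" using Am[of n] by simp
    also have "\<dots> \<le> expectation (\<lambda>w. real (osc_count e (\<lambda>k. X (dyad T n k) w) (2 ^ n)))"
    proof (rule integral_mono)
      fix w show "indicator (A n) w \<le> real (osc_count e (\<lambda>k. X (dyad T n k) w) (2 ^ n))"
        using osc_count_pos[of _ "2 ^ n" e "\<lambda>k. X (dyad T n k) w"] e unfolding A_def indicator_def by fastforce
    qed (use expectation_osc_count_dyad(2)[OF X e, of n] Am[of n] in \<open>auto intro!: integrable_real_indicator simp: emeasure_eq_measure\<close>)
    finally have "e\<^sup>2 * prob (A n) \<le> e\<^sup>2 * expectation (\<lambda>w. real (osc_count e (\<lambda>k. X (dyad T n k) w) (2 ^ n)))"
      by (intro mult_left_mono) auto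
    then show ?thesis using expectation_osc_count_dyad(1)[OF X e, of n] by linarith
  qed
  moreover have "(\<lambda>n. e\<^sup>2 * prob (A n)) \<longlonglongrightarrow> e\<^sup>2 * prob (\<Union>n. A n)"
    using inc Am by (intro tendsto_mult_left finite_Lim_measure_incseq) auto
  ultimately show "e\<^sup>2 * prob {w \<in> space P. \<exists>q\<in>dyads T. e \<le> norm (X q w - X 0 w)} \<le> expectation (\<lambda>w. (norm (X T w))\<^sup>2)"
    unfolding un by (intro LIMSEQ_le_const2) auto
qed

end

section \<open>Elementary stochastic integrals\<close>

lemma norm_sum_sq: "(norm (\<Sum>k\<in>K. f k))\<^sup>2 = (\<Sum>k\<in>K. \<Sum>l\<in>K. f k \<bullet> f l)" for f :: "'i \<Rightarrow> 'a::real_inner"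
  unfolding power2_norm_eq_inner by (subst inner_sum_left, subst inner_sum_right) (rule refl)

text \<open>Cauchy-Schwarz row by row; since the norm on matrices is the Frobenius norm, the
  constant is \<open>1\<close>.\<close>

lemma norm_matrix_vector_mult_le: "norm (A *v x) \<le> norm A * norm (x :: real ^ 'm)"
proof -
  have "(norm (A *v x))\<^sup>2 = (\<Sum>i\<in>UNIV. (A $ i \<bullet> x)\<^sup>2)"
    unfolding power2_norm_eq_inner by (subst inner_vec_def) (simp add: matrix_vector_mul_component power2_eq_square)
  also have "\<dots> \<le> (\<Sum>i\<in>UNIV. (norm (A $ i))\<^sup>2 * (norm x)\<^sup>2)"
  proof (rule sum_mono)
    fix i
    have "\<bar>A $ i \<bullet> x\<bar> \<le> norm (A $ i) * norm x" by (rule Cauchy_Schwarz_ineq2)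
    then have "\<bar>A $ i \<bullet> x\<bar>\<^sup>2 \<le> (norm (A $ i) * norm x)\<^sup>2" by (intro power_mono) auto
    then show "(A $ i \<bullet> x)\<^sup>2 \<le> (norm (A $ i))\<^sup>2 * (norm x)\<^sup>2" by (simp add: power_mult_distrib)
  qed
  also have "\<dots> = (norm A * norm x)\<^sup>2"
    by (simp add: power_mult_distrib sum_distrib_right[symmetric] power2_norm_eq_inner inner_vec_def)
  finally show ?thesis by (rule power2_le_imp_le) simp
qed

lemma bounded_bilinear_matrix_vector_mult:
  "bounded_bilinear (\<lambda>(A :: real ^ 'm ^ 'd) (x :: real ^ 'm). A *v x)"
proof
  show "\<exists>K. \<forall>(A :: real ^ 'm ^ 'd) x. norm (A *v x) \<le> norm A * norm x * K"
    using norm_matrix_vector_mult_le by (intro exI[of _ 1]) auto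
qed (simp_all add: vec_eq_iff matrix_vector_mul_component inner_add_left inner_add_right)

lemma borel_measurable_matrix_vector_mult [measurable (raw)]:
  fixes A :: "'a \<Rightarrow> real ^ 'm ^ 'd"
  assumes "A \<in> borel_measurable M" "x \<in> borel_measurable M"
  shows "(\<lambda>w. A w *v x w) \<in> borel_measurable M"
  by (rule borel_measurable_continuous_Pair[OF assms])
     (intro bounded_bilinear.continuous_on[OF bounded_bilinear_matrix_vector_mult] continuous_intros)

lemma inner_matrix_vector_mult:
  fixes A :: "real ^ 'm ^ 'd"
  shows "y \<bullet> (A *v x) = (\<Sum>i\<in>UNIV. \<Sum>j\<in>UNIV. (y $ i * A $ i $ j) * x $ j)"
  by (simp add: inner_vec_def matrix_vector_mult_def sum_distrib_left mult.assoc)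

lemma borel_measurable_vec_nth [measurable (raw)]:
  fixes f :: "'a \<Rightarrow> 'b::{second_countable_topology, real_normed_vector} ^ 'n"
  shows "f \<in> borel_measurable M \<Longrightarrow> (\<lambda>x. f x $ i) \<in> borel_measurable M"
  by (rule measurable_compose[where g="\<lambda>v. v $ i"]) (auto intro!: borel_measurable_continuous_onI continuous_intros)

lemma interval_product_integral:
  "has_bochner_integral lborel (\<lambda>s::real. indicator {a<..b} s * indicator {c<..d} s) (max 0 (min b d - max a c))"
proof -
  have "(\<lambda>s::real. indicator {a<..b} s * indicator {c<..d} s :: real) = indicator {max a c<..min b d}"
    by (auto simp: indicator_def fun_eq_iff)
  moreover have "has_bochner_integral lborel (indicator {max a c<..min b d} :: real \<Rightarrow> real) (measure lborel {max a c<..min b d})"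
    by (rule has_bochner_integral_real_indicator, simp)
       (cases "max a c \<le> min b d"; simp del: max.bounded_iff min.bounded_iff)
  moreover have "measure lborel {max a c<..min b d} = max 0 (min b d - max a c)"
    by (cases "max a c \<le> min b d") auto
  ultimately show ?thesis by simp
qed

section \<open>Elementary integrals: orthogonality, isometry and martingale property\<close>

context brownian_setting
begin

text \<open>The intervals may overlap and the index type is arbitrary, in contrast to
  \<open>simple_integrand\<close>. Integrands over unrelated partitions can thus be added without a
  common refinement.\<close>

definition elem_integrand :: "'i set \<Rightarrow> ('i \<Rightarrow> real) \<Rightarrow> ('i \<Rightarrow> real) \<Rightarrow> ('i \<Rightarrow> 'w \<Rightarrow> real ^ 'm ^ 'd) \<Rightarrow> bool" where
  "elem_integrand K a b \<phi> \<longleftrightarrow> finite K \<and>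
     (\<forall>k\<in>K. 0 \<le> a k \<and> a k \<le> b k \<and> b k \<le> T \<and> \<phi> k \<in> borel_measurable (F (a k)) \<and> bounded (\<phi> k ` space P))"

definition elem_process :: "'i set \<Rightarrow> ('i \<Rightarrow> real) \<Rightarrow> ('i \<Rightarrow> real) \<Rightarrow> ('i \<Rightarrow> 'w \<Rightarrow> real ^ 'm ^ 'd) \<Rightarrow> real \<Rightarrow> 'w \<Rightarrow> real ^ 'm ^ 'd" where
  "elem_process K a b \<phi> s w = (\<Sum>k\<in>K. indicator {a k<..b k} s *\<^sub>R \<phi> k w)"

definition elem_integral :: "'i set \<Rightarrow> ('i \<Rightarrow> real) \<Rightarrow> ('i \<Rightarrow> real) \<Rightarrow> ('i \<Rightarrow> 'w \<Rightarrow> real ^ 'm ^ 'd) \<Rightarrow> real \<Rightarrow> 'w \<Rightarrow> real ^ 'd" where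
  "elem_integral K a b \<phi> t w = (\<Sum>k\<in>K. \<phi> k w *v (B (min (b k) t) w - B (min (a k) t) w))"

lemma elem_integrandD:
  assumes "elem_integrand K a b \<phi>" "k \<in> K"
  shows "0 \<le> a k" "a k \<le> b k" "b k \<le> T" "\<phi> k \<in> borel_measurable (F (a k))" "bounded (\<phi> k ` space P)"
  using assms unfolding elem_integrand_def by auto

lemma square_integrable_increment:
  assumes "0 \<le> a" "a \<le> b" "b \<le> T"
  shows "square_integrable P (\<lambda>w. B b w - B a w)"
proof -
  have m: "(\<lambda>w. B b w - B a w) \<in> borel_measurable P"
    using assms by (intro borel_measurable_diff B_measurable_P) auto
  have "integrable P (\<lambda>w. \<Sum>k\<in>UNIV. (B b w - B a w) $ k * (B b w - B a w) $ k)"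
  proof (rule Bochner_Integration.integrable_sum)
    fix k
    have "integrable P (\<lambda>w. 1 * ((B b w - B a w) $ k * (B b w - B a w) $ k))"
      by (rule increment_mult_F(3)[OF assms]) auto
    then show "integrable P (\<lambda>w. (B b w - B a w) $ k * (B b w - B a w) $ k)" by (simp only: mult_1)
  qed
  moreover have "(norm v)\<^sup>2 = (\<Sum>k\<in>UNIV. v $ k * v $ k)" for v :: "real ^ 'm"
    unfolding power2_norm_eq_inner inner_vec_def by simp
  ultimately show ?thesis using m unfolding square_integrable_def by simp
qed

lemma square_integrable_mult_increment:
  fixes \<phi> :: "'w \<Rightarrow> real ^ 'm ^ 'd"
  assumes ab: "0 \<le> a" "a \<le> b" "b \<le> T" and \<phi>: "\<phi> \<in> borel_measurable P" "bounded (\<phi> ` space P)"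
  shows "square_integrable P (\<lambda>w. \<phi> w *v (B b w - B a w))"
proof -
  obtain c where c: "\<And>w. w \<in> space P \<Longrightarrow> norm (\<phi> w) \<le> c" "0 < c" using \<phi>(2) unfolding bounded_pos by auto
  note s = square_integrable_increment[OF ab]
  have [measurable]: "(\<lambda>w. B b w - B a w) \<in> borel_measurable P" "\<phi> \<in> borel_measurable P"
    using s \<phi> by (auto simp: square_integrable_def)
  show ?thesis
  proof (rule square_integrable_bound[OF _ square_integrable_scaleR[OF s, of c]])
    show "AE w in P. norm (\<phi> w *v (B b w - B a w)) \<le> norm (c *\<^sub>R (B b w - B a w))"
    proof (rule AE_I2)
      fix w assume "w \<in> space P"
      have "norm (\<phi> w *v (B b w - B a w)) \<le> norm (\<phi> w) * norm (B b w - B a w)" by (rule norm_matrix_vector_mult_le)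
      also have "\<dots> \<le> c * norm (B b w - B a w)" using c \<open>w \<in> space P\<close> by (intro mult_right_mono) auto
      finally show "norm (\<phi> w *v (B b w - B a w)) \<le> norm (c *\<^sub>R (B b w - B a w))" using c by simp
    qed
  qed measurable
qed

lemma square_integrable_imp_integrable:
  fixes Z :: "'w \<Rightarrow> real ^ 'd"
  assumes "square_integrable P Z" shows "integrable P (\<lambda>w. Z w $ i)"
proof -
  have "integrable P (\<lambda>w. Z w \<bullet> axis i 1)"
    by (rule square_integrable_inner[OF assms square_integrable_const])
  then show ?thesis by (simp add: inner_axis)
qed

text \<open>Expansion in coordinates leaves products of an increment with the weights
  \<open>Z $ i * \<phi> $ i $ j\<close>, which are known at time \<open>a\<close>; boundedness of
  \<open>\<phi>\<close> keeps them integrable.\<close>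

lemma expectation_inner_increment_0:
  fixes \<phi> :: "'w \<Rightarrow> real ^ 'm ^ 'd"
  assumes ab: "0 \<le> a" "a \<le> b" "b \<le> T" and \<phi>: "\<phi> \<in> borel_measurable (F a)" "bounded (\<phi> ` space P)"
    and Z: "Z \<in> borel_measurable (F a)" "square_integrable P Z"
  shows "expectation (\<lambda>w. Z w \<bullet> (\<phi> w *v (B b w - B a w))) = 0"
proof -
  obtain c where c: "\<And>w. w \<in> space P \<Longrightarrow> norm (\<phi> w) \<le> c" "0 < c" using \<phi>(2) unfolding bounded_pos by auto
  have Y: "(\<lambda>w. Z w $ i * \<phi> w $ i $ j) \<in> borel_measurable (F a)" for i j
    using Z \<phi> by measurable
  have "a \<le> T" using ab by simp
  have Yi: "integrable P (\<lambda>w. Z w $ i * \<phi> w $ i $ j)" for i j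
  proof (rule Bochner_Integration.integrable_bound[of P "\<lambda>w. c * Z w $ i"])
    show "integrable P (\<lambda>w. c * Z w $ i)" using square_integrable_imp_integrable[OF Z(2)] by auto
    show "(\<lambda>w. Z w $ i * \<phi> w $ i $ j) \<in> borel_measurable P" using measurable_F_P[OF \<open>a \<le> T\<close> Y] .
    show "AE w in P. norm (Z w $ i * \<phi> w $ i $ j) \<le> norm (c * Z w $ i)"
    proof (rule AE_I2)
      fix w assume "w \<in> space P"
      have "\<bar>\<phi> w $ i $ j\<bar> \<le> norm (\<phi> w $ i)" by (rule component_le_norm_cart)
      also have "\<dots> \<le> norm (\<phi> w)" by (rule Finite_Cartesian_Product.norm_nth_le)
      also have "\<dots> \<le> c" using c \<open>w \<in> space P\<close> by auto
      finally have "\<bar>\<phi> w $ i $ j\<bar> * \<bar>Z w $ i\<bar> \<le> c * \<bar>Z w $ i\<bar>" by (intro mult_right_mono) auto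
      then show "norm (Z w $ i * \<phi> w $ i $ j) \<le> norm (c * Z w $ i)" using c by (simp add: abs_mult mult.commute)
    qed
  qed
  show ?thesis
    unfolding inner_matrix_vector_mult
    using increment_mult_F(1,2)[OF ab Y Yi] by simp
qed

text \<open>In coordinates only the diagonal of the covariance matrix survives, which turns the
  product of the two vectors into the Frobenius inner product of the matrices.\<close>

lemma expectation_inner_increment_same:
  fixes \<phi> \<psi> :: "'w \<Rightarrow> real ^ 'm ^ 'd"
  assumes ab: "0 \<le> a" "a \<le> b" "b \<le> T" and \<phi>: "\<phi> \<in> borel_measurable (F a)" "bounded (\<phi> ` space P)"
    and \<psi>: "\<psi> \<in> borel_measurable (F a)" "bounded (\<psi> ` space P)"
  shows "expectation (\<lambda>w. (\<phi> w *v (B b w - B a w)) \<bullet> (\<psi> w *v (B b w - B a w))) = (b - a) * expectation (\<lambda>w. \<phi> w \<bullet> \<psi> w)"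
proof -
  obtain c where c: "\<And>w. w \<in> space P \<Longrightarrow> norm (\<phi> w) \<le> c" "0 < c" using \<phi>(2) unfolding bounded_pos by auto
  obtain c' where c': "\<And>w. w \<in> space P \<Longrightarrow> norm (\<psi> w) \<le> c'" "0 < c'" using \<psi>(2) unfolding bounded_pos by auto
  have Y: "(\<lambda>w. \<phi> w $ i $ j * \<psi> w $ i $ k) \<in> borel_measurable (F a)" for i j k
    using \<psi> \<phi> by measurable
  have "a \<le> T" using ab by simp
  have Yi: "integrable P (\<lambda>w. \<phi> w $ i $ j * \<psi> w $ i $ k)" for i j k
  proof (rule integrable_const_bound[of _ "c * c'"])
    show "(\<lambda>w. \<phi> w $ i $ j * \<psi> w $ i $ k) \<in> borel_measurable P" using measurable_F_P[OF \<open>a \<le> T\<close> Y] .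
    show "AE w in P. norm (\<phi> w $ i $ j * \<psi> w $ i $ k) \<le> c * c'"
    proof (rule AE_I2)
      fix w assume w: "w \<in> space P"
      have le: "\<bar>M $ i $ j\<bar> \<le> norm M" for M :: "real ^ 'm ^ 'd" and j
        using component_le_norm_cart[of "M $ i" j] Finite_Cartesian_Product.norm_nth_le[of M i] by linarith
      have "\<bar>\<phi> w $ i $ j\<bar> \<le> c" "\<bar>\<psi> w $ i $ k\<bar> \<le> c'" using le[of "\<phi> w"] le[of "\<psi> w"] c(1)[OF w] c'(1)[OF w] order_trans by blast+
      then show "norm (\<phi> w $ i $ j * \<psi> w $ i $ k) \<le> c * c'" using c by (simp add: abs_mult mult_mono)
    qed
  qed
  have e: "(\<phi> w *v v) \<bullet> (\<psi> w *v v) = (\<Sum>i\<in>UNIV. \<Sum>j\<in>UNIV. \<Sum>k\<in>UNIV. (\<phi> w $ i $ j * \<psi> w $ i $ k) * (v $ j * v $ k))" for w v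
    by (simp add: inner_vec_def matrix_vector_mult_def sum_product algebra_simps)
  have "expectation (\<lambda>w. (\<phi> w *v (B b w - B a w)) \<bullet> (\<psi> w *v (B b w - B a w))) =
     (\<Sum>i\<in>UNIV. \<Sum>j\<in>UNIV. \<Sum>k\<in>UNIV. (if j = k then (b - a) * expectation (\<lambda>w. \<phi> w $ i $ j * \<psi> w $ i $ k) else 0))"
    unfolding e using increment_mult_F(3,4)[OF ab Y Yi] by (simp add: Bochner_Integration.integral_sum)
  also have "\<dots> = (b - a) * (\<Sum>i\<in>UNIV. \<Sum>j\<in>UNIV. expectation (\<lambda>w. \<phi> w $ i $ j * \<psi> w $ i $ j))"
    by (simp add: sum_distrib_left)
  also have "(\<Sum>i\<in>UNIV. \<Sum>j\<in>UNIV. expectation (\<lambda>w. \<phi> w $ i $ j * \<psi> w $ i $ j)) = expectation (\<lambda>w. \<phi> w \<bullet> \<psi> w)"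
    using Yi by (simp add: inner_vec_def)
  finally show ?thesis .
qed

lemma F_le_P: "f \<in> borel_measurable (F a) \<Longrightarrow> a \<le> b \<Longrightarrow> b \<le> T \<Longrightarrow> f \<in> borel_measurable P"
  by (rule measurable_F_P[of a]) auto

lemma mult_increment_F:
  fixes \<phi> :: "'w \<Rightarrow> real ^ 'm ^ 'd"
  assumes "0 \<le> a" "a \<le> b" "b \<le> c" "\<phi> \<in> borel_measurable (F a)"
  shows "(\<lambda>w. \<phi> w *v (B b w - B a w)) \<in> borel_measurable (F c)"
proof -
  have [measurable]: "\<phi> \<in> borel_measurable (F c)" "B b \<in> borel_measurable (F c)" "B a \<in> borel_measurable (F c)"
    using assms by (auto intro: measurable_F_mono[of a c] B_measurable_F)
  show ?thesis by measurable
qed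

text \<open>The intervals are cut at \<open>c\<close> and at \<open>min b d\<close>. When one
  interval ends before the other begins, the later increment is orthogonal to everything known at
  its start, so only the common part of the two intervals contributes.\<close>

lemma expectation_inner_increments_le:
  fixes \<phi> \<psi> :: "'w \<Rightarrow> real ^ 'm ^ 'd"
  assumes ab: "0 \<le> a" "a \<le> b" "b \<le> T" and cd: "a \<le> c" "c \<le> d" "d \<le> T"
    and \<phi>: "\<phi> \<in> borel_measurable (F a)" "bounded (\<phi> ` space P)"
    and \<psi>: "\<psi> \<in> borel_measurable (F c)" "bounded (\<psi> ` space P)"
  shows "expectation (\<lambda>w. (\<phi> w *v (B b w - B a w)) \<bullet> (\<psi> w *v (B d w - B c w)))
    = max 0 (min b d - c) * expectation (\<lambda>w. \<phi> w \<bullet> \<psi> w)"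
proof -
  note mP = F_le_P[OF \<phi>(1) ab(2,3)] F_le_P[OF \<psi>(1) cd(2,3)]
  define X where "X u v w = \<phi> w *v (B v w - B u w)" for u v w
  define Y where "Y u v w = \<psi> w *v (B v w - B u w)" for u v w
  have sX: "square_integrable P (X u v)" if "0 \<le> u" "u \<le> v" "v \<le> T" for u v
    unfolding X_def using that mP \<phi> by (intro square_integrable_mult_increment)
  have sY: "square_integrable P (Y u v)" if "0 \<le> u" "u \<le> v" "v \<le> T" for u v
    unfolding Y_def using that mP \<psi> by (intro square_integrable_mult_increment)
  have Xadd: "X u v w + X v v' w = X u v' w" for u v v' w
    unfolding X_def by (simp add: matrix_vector_right_distrib[symmetric])
  have Yadd: "Y u v w + Y v v' w = Y u v' w" for u v v' w
    unfolding Y_def by (simp add: matrix_vector_right_distrib[symmetric])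
  have mX: "X u v \<in> borel_measurable (F r)" if "0 \<le> u" "a \<le> u" "u \<le> v" "v \<le> r" for u v r
    unfolding X_def using that \<phi> ab by (intro mult_increment_F measurable_F_mono[OF _ \<phi>(1)]) auto
  have mY: "Y u v \<in> borel_measurable (F r)" if "0 \<le> u" "c \<le> u" "u \<le> v" "v \<le> r" for u v r
    unfolding Y_def using that \<psi> ab by (intro mult_increment_F measurable_F_mono[OF _ \<psi>(1)]) auto
  have XY0: "expectation (\<lambda>w. X u v w \<bullet> Y u' v' w) = 0" if "a \<le> u" "u \<le> v" "v \<le> u'" "c \<le> u'" "u' \<le> v'" "v' \<le> T" for u v u' v'
    unfolding Y_def using that ab cd
    by (intro expectation_inner_increment_0 sX mX measurable_F_mono[OF _ \<psi>(1)] \<psi>) auto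
  have YX0: "expectation (\<lambda>w. X u v w \<bullet> Y u' v' w) = 0" if "c \<le> u'" "u' \<le> v'" "v' \<le> u" "u \<le> v" "v \<le> T" for u v u' v'
    unfolding X_def inner_commute[of "\<phi> _ *v _"] using that ab cd
    by (intro expectation_inner_increment_0 sY mY measurable_F_mono[OF _ \<phi>(1)] \<phi>) auto
  have "expectation (\<lambda>w. X a b w \<bullet> Y c d w) = max 0 (min b d - c) * expectation (\<lambda>w. \<phi> w \<bullet> \<psi> w)"
  proof (cases "b \<le> c")
    case True
    then show ?thesis using XY0[of a b c d] ab cd by simp
  next
    case False
    define e where "e = min b d"
    have e: "c \<le> e" "e \<le> b" "e \<le> d" "b = e \<or> d = e" using False cd by (auto simp: e_def)
    have i: "integrable P (\<lambda>w. X u v w \<bullet> Y u' v' w)" if "0 \<le> u" "u \<le> v" "v \<le> T" "0 \<le> u'" "u' \<le> v'" "v' \<le> T" for u v u' v'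
      by (rule square_integrable_inner[OF sX sY]) fact+
    have "X a b w \<bullet> Y c d w = X a c w \<bullet> Y c d w + (X c e w \<bullet> Y c e w + (X c e w \<bullet> Y e d w + (X e b w \<bullet> Y c e w + X e b w \<bullet> Y e d w)))" for w
      using Xadd[of a c w b] Xadd[of c e w b] Yadd[of c e w d]
      by (metis inner_add_left inner_add_right add.assoc)
    then have "expectation (\<lambda>w. X a b w \<bullet> Y c d w) = expectation (\<lambda>w. X a c w \<bullet> Y c d w) + (expectation (\<lambda>w. X c e w \<bullet> Y c e w)
      + (expectation (\<lambda>w. X c e w \<bullet> Y e d w) + (expectation (\<lambda>w. X e b w \<bullet> Y c e w) + expectation (\<lambda>w. X e b w \<bullet> Y e d w))))"
      using i e ab cd by simp
    also have "expectation (\<lambda>w. X a c w \<bullet> Y c d w) = 0" using ab cd e by (intro XY0) auto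
    also have "expectation (\<lambda>w. X c e w \<bullet> Y e d w) = 0" using ab cd e by (intro XY0) auto
    also have "expectation (\<lambda>w. X e b w \<bullet> Y c e w) = 0" using ab cd e by (intro YX0) auto
    \<comment> \<open>One of the two pieces beyond \<open>e\<close> is degenerate, because
      \<open>e\<close> equals \<open>b\<close> or \<open>d\<close>.\<close>
    also have "expectation (\<lambda>w. X e b w \<bullet> Y e d w) = 0"
      using e(4) by (auto simp: X_def Y_def)
    also have "expectation (\<lambda>w. X c e w \<bullet> Y c e w) = (e - c) * expectation (\<lambda>w. \<phi> w \<bullet> \<psi> w)"
      unfolding X_def Y_def using ab cd e
      by (intro expectation_inner_increment_same measurable_F_mono[OF _ \<phi>(1)] \<phi> \<psi>) auto
    finally show ?thesis using e(1) by (simp add: e_def)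
  qed
  then show ?thesis unfolding X_def Y_def .
qed

lemma expectation_inner_increments:
  fixes \<phi> \<psi> :: "'w \<Rightarrow> real ^ 'm ^ 'd"
  assumes ab: "0 \<le> a" "a \<le> b" "b \<le> T" and cd: "0 \<le> c" "c \<le> d" "d \<le> T"
    and \<phi>: "\<phi> \<in> borel_measurable (F a)" "bounded (\<phi> ` space P)"
    and \<psi>: "\<psi> \<in> borel_measurable (F c)" "bounded (\<psi> ` space P)"
  shows "expectation (\<lambda>w. (\<phi> w *v (B b w - B a w)) \<bullet> (\<psi> w *v (B d w - B c w)))
    = max 0 (min b d - max a c) * expectation (\<lambda>w. \<phi> w \<bullet> \<psi> w)"
proof (cases "a \<le> c")
  case True
  then show ?thesis using expectation_inner_increments_le[OF ab True cd(2,3) \<phi> \<psi>] by (simp add: max_absorb2)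
next
  case False
  then have ca: "c \<le> a" by simp
  show ?thesis using expectation_inner_increments_le[OF cd ca ab(2,3) \<psi> \<phi>] ca
    by (simp add: max_absorb1 inner_commute min.commute)
qed

lemma elem_measurable_P:
  assumes "elem_integrand K a b \<phi>" "k \<in> K"
  shows "\<phi> k \<in> borel_measurable P"
  using elem_integrandD[OF assms] by (intro F_le_P[of "\<phi> k" "a k" "b k"]) auto

text \<open>Stopping at \<open>t\<close> and at \<open>s\<close> leaves the increment over the part
  of the interval between \<open>s\<close> and \<open>t\<close>. If that part is proper, its left
  end is \<open>max (a k) s\<close>, so the coefficient and everything known at \<open>s\<close>
  precede it.\<close>

lemma elem_increment_cases:
  assumes "elem_integrand K a b \<phi>" "k \<in> K" "0 \<le> s" "s \<le> t" "t \<le> T"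
  shows "(\<forall>w. (B (min (b k) t) w - B (min (a k) t) w) - (B (min (b k) s) w - B (min (a k) s) w) = 0) \<or>
    (\<exists>a' b'. a k \<le> a' \<and> s \<le> a' \<and> a' \<le> b' \<and> b' \<le> t \<and>
      (\<forall>w. (B (min (b k) t) w - B (min (a k) t) w) - (B (min (b k) s) w - B (min (a k) s) w) = B b' w - B a' w))"
proof -
  note e = elem_integrandD[OF assms(1,2)]
  consider "t \<le> a k" | "b k \<le> s" | "a k < t" "s < b k" by linarith
  then show ?thesis
  proof cases
    case 1 then have "min (b k) t = t" "min (a k) t = t" "min (b k) s = s" "min (a k) s = s" using e assms by auto
    then show ?thesis by simp
  next
    case 2 then have "min (b k) t = b k" "min (a k) t = a k" "min (b k) s = b k" "min (a k) s = a k" using e assms by auto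
    then show ?thesis by simp
  next
    case 3
    show ?thesis
    proof (rule disjI2, rule exI[of _ "max (a k) s"], rule exI[of _ "min (b k) t"], intro conjI allI)
      have 1: "min (a k) t = a k" "min (b k) s = s" using 3 by auto
      fix w
      show "B (min (b k) t) w - B (min (a k) t) w - (B (min (b k) s) w - B (min (a k) s) w) =
         B (min (b k) t) w - B (max (a k) s) w"
        unfolding 1 by (cases "a k \<le> s") (simp_all add: min_absorb1 min_absorb2 max_absorb1 max_absorb2)
    qed (use 3 e assms in auto)
  qed
qed

lemma elem_integral_0 [simp]: "elem_integrand K a b \<phi> \<Longrightarrow> elem_integral K a b \<phi> 0 w = 0"
proof -
  assume E: "elem_integrand K a b \<phi>"
  have "min (b k) 0 = 0" "min (a k) 0 = 0" if "k \<in> K" for k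
    using elem_integrandD(1,2)[OF E that] by auto
  then show ?thesis unfolding elem_integral_def by simp
qed

lemma elem_integral_diff:
  "elem_integral K a b \<phi> t w - elem_integral K a b \<phi> s w =
    (\<Sum>k\<in>K. \<phi> k w *v ((B (min (b k) t) w - B (min (a k) t) w) - (B (min (b k) s) w - B (min (a k) s) w)))"
  unfolding elem_integral_def sum_subtractf[symmetric] matrix_vector_mult_diff_distrib[symmetric] ..

lemma elem_integral_measurable_F:
  assumes E: "elem_integrand K a b \<phi>" and t: "t \<in> {0..T}"
  shows "elem_integral K a b \<phi> t \<in> borel_measurable (F t)"
proof -
  have "(\<lambda>w. \<phi> k w *v (B (min (b k) t) w - B (min (a k) t) w)) \<in> borel_measurable (F t)" if k: "k \<in> K" for k
  proof (cases "a k \<le> t")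
    case True
    have [measurable]: "\<phi> k \<in> borel_measurable (F t)" "B (min (b k) t) \<in> borel_measurable (F t)"
       "B (min (a k) t) \<in> borel_measurable (F t)"
      using True elem_integrandD[OF E k] t by (auto intro: measurable_F_mono[of "a k" t] B_measurable_F)
    show ?thesis by measurable
  next
    case False
    then have "min (b k) t = t" "min (a k) t = t" using elem_integrandD[OF E k] by auto
    then show ?thesis by simp
  qed
  then have "(\<lambda>w. elem_integral K a b \<phi> t w) \<in> borel_measurable (F t)"
    unfolding elem_integral_def by (rule borel_measurable_sum)
  then show ?thesis by simp
qed

lemma elem_integral_square_integrable:
  assumes E: "elem_integrand K a b \<phi>" and t: "t \<in> {0..T}"
  shows "square_integrable P (elem_integral K a b \<phi> t)"
proof -
  have "square_integrable P (\<lambda>w. elem_integral K a b \<phi> t w)"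
    unfolding elem_integral_def
    using elem_integrandD[OF E] elem_measurable_P[OF E] t E
    by (intro square_integrable_sum square_integrable_mult_increment)
       (auto simp: elem_integrand_def intro: min.coboundedI1 min.coboundedI2)
  then show ?thesis by simp
qed

text \<open>Between \<open>s\<close> and \<open>t\<close> every summand is zero or an increment
  starting at or after both \<open>s\<close> and \<open>a k\<close>, and is therefore orthogonal to
  any \<open>Z\<close> known at \<open>s\<close>.\<close>

lemma elem_integral_cone_martingale:
  fixes \<phi> :: "'i \<Rightarrow> 'w \<Rightarrow> real ^ 'm ^ 'd"
  assumes E: "elem_integrand K a b \<phi>"
  shows "cone_martingale UNIV (elem_integral K a b \<phi>)"
  unfolding cone_martingale_def
proof (intro conjI ballI allI impI)
  fix s t :: real and Z :: "'w \<Rightarrow> real ^ 'd"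
  assume st: "0 \<le> s" "s \<le> t" "t \<le> T" and Z: "Z \<in> borel_measurable (F s)" "square_integrable P Z"
  define D where "D k w = (B (min (b k) t) w - B (min (a k) t) w) - (B (min (b k) s) w - B (min (a k) s) w)" for k w
  have fin: "finite K" using E by (simp add: elem_integrand_def)
  have *: "integrable P (\<lambda>w. Z w \<bullet> (\<phi> k w *v D k w)) \<and> expectation (\<lambda>w. Z w \<bullet> (\<phi> k w *v D k w)) = 0" if k: "k \<in> K" for k
    using elem_increment_cases[OF E k st]
  proof (elim disjE exE conjE)
    fix a' b' assume ab: "a k \<le> a'" "s \<le> a'" "a' \<le> b'" "b' \<le> t"
      and w: "\<forall>w. (B (min (b k) t) w - B (min (a k) t) w) - (B (min (b k) s) w - B (min (a k) s) w) = B b' w - B a' w"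
    then have D: "D k = (\<lambda>w. B b' w - B a' w)" by (auto simp: D_def)
    have a': "0 \<le> a'" "a' \<le> b'" "b' \<le> T" using ab st by auto
    note e = elem_integrandD[OF E k]
    show ?thesis
      unfolding D using ab a' st e
      by (intro conjI square_integrable_inner Z square_integrable_mult_increment elem_measurable_P[OF E k]
          expectation_inner_increment_0 measurable_F_mono[OF ab(1) e(4)] measurable_F_mono[OF ab(2) Z(1)])
  qed (auto simp: D_def)
  have "Z w \<bullet> (elem_integral K a b \<phi> t w - elem_integral K a b \<phi> s w) = (\<Sum>k\<in>K. Z w \<bullet> (\<phi> k w *v D k w))" for w
    unfolding elem_integral_diff D_def by (simp add: inner_sum_right)
  then have "expectation (\<lambda>w. Z w \<bullet> (elem_integral K a b \<phi> t w - elem_integral K a b \<phi> s w)) = 0"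
    using * by simp
  then show "0 \<le> expectation (\<lambda>w. Z w \<bullet> (elem_integral K a b \<phi> t w - elem_integral K a b \<phi> s w))" by simp
qed (use elem_integral_measurable_F[OF E] elem_integral_square_integrable[OF E] in auto)

text \<open>Both sides are the mean of one quadratic form: the products
  \<open>\<phi> k \<bullet> \<phi> l\<close> weighted by the lengths of the overlaps of the
  intervals. On the left these weights come from the covariance of the increments, on the right from
  integrating products of indicators.\<close>

lemma elem_isometry:
  fixes \<phi> :: "'i \<Rightarrow> 'w \<Rightarrow> real ^ 'm ^ 'd"
  assumes E: "elem_integrand K a b \<phi>"
  shows "(\<integral>\<^sup>+w. ennreal ((norm (elem_integral K a b \<phi> T w))\<^sup>2) \<partial>P) =
    (\<integral>\<^sup>+w. (\<integral>\<^sup>+s\<in>{0..T}. ennreal ((norm (elem_process K a b \<phi> s w))\<^sup>2) \<partial>lborel) \<partial>P)"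
proof -
  have fin: "finite K" using E by (simp add: elem_integrand_def)
  note e = elem_integrandD[OF E] and mP = elem_measurable_P[OF E]
  define len where "len k l = max 0 (min (b k) (b l) - max (a k) (a l))" for k l
  define G where "G w = (\<Sum>k\<in>K. \<Sum>l\<in>K. len k l * (\<phi> k w \<bullet> \<phi> l w))" for w
  have sq\<phi>: "square_integrable P (\<phi> k)" if k: "k \<in> K" for k
  proof -
    obtain c where c: "\<And>w. w \<in> space P \<Longrightarrow> norm (\<phi> k w) \<le> c" "0 < c" using e(5)[OF k] unfolding bounded_pos by auto
    show ?thesis
      by (rule square_integrable_bound[OF mP[OF k] square_integrable_const[of c]]) (use c in force)
  qed
  have iG: "integrable P G"
    unfolding G_def
    by (intro Bochner_Integration.integrable_sum integrable_mult_right square_integrable_inner sq\<phi>)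
  have EG: "expectation G = (\<Sum>k\<in>K. \<Sum>l\<in>K. len k l * expectation (\<lambda>w. \<phi> k w \<bullet> \<phi> l w))"
    unfolding G_def using sq\<phi>
    by (simp add: Bochner_Integration.integral_sum square_integrable_inner)
  define X where "X k w = \<phi> k w *v (B (b k) w - B (a k) w)" for k w
  have sX: "square_integrable P (X k)" if "k \<in> K" for k
    unfolding X_def using e that mP by (intro square_integrable_mult_increment) auto
  have IT: "elem_integral K a b \<phi> T w = (\<Sum>k\<in>K. X k w)" for w
    unfolding elem_integral_def X_def using order_trans[OF e(2) e(3)] e(3)
    by (intro sum.cong refl) (simp add: min_absorb1)
  have "expectation (\<lambda>w. (norm (elem_integral K a b \<phi> T w))\<^sup>2) = expectation (\<lambda>w. \<Sum>k\<in>K. \<Sum>l\<in>K. X k w \<bullet> X l w)"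
    unfolding IT norm_sum_sq ..
  also have "\<dots> = (\<Sum>k\<in>K. \<Sum>l\<in>K. expectation (\<lambda>w. X k w \<bullet> X l w))"
    using sX by (simp add: square_integrable_inner)
  also have "\<dots> = expectation G"
    unfolding EG X_def len_def using e by (intro sum.cong refl expectation_inner_increments) auto
  finally have L: "(\<integral>\<^sup>+w. ennreal ((norm (elem_integral K a b \<phi> T w))\<^sup>2) \<partial>P) = ennreal (expectation G)"
    using square_integrable_nn_integral[OF elem_integral_square_integrable[OF E, of T]] T_pos by simp
  have inner: "(\<integral>\<^sup>+s\<in>{0..T}. ennreal ((norm (elem_process K a b \<phi> s w))\<^sup>2) \<partial>lborel) = ennreal (G w) \<and> 0 \<le> G w" for w
  proof -
    have bi: "has_bochner_integral lborel (\<lambda>s. (norm (elem_process K a b \<phi> s w))\<^sup>2) (G w)"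
    proof -
      have "(\<lambda>s. (norm (elem_process K a b \<phi> s w))\<^sup>2) =
        (\<lambda>s. \<Sum>k\<in>K. \<Sum>l\<in>K. (indicator {a k<..b k} s * indicator {a l<..b l} s) * (\<phi> k w \<bullet> \<phi> l w))"
        unfolding elem_process_def norm_sum_sq by (simp add: ac_simps)
      then show ?thesis
        unfolding G_def len_def
        by (simp only:) (intro has_bochner_integral_sum has_bochner_integral_mult_left interval_product_integral)
    qed
    \<comment> \<open>All intervals lie in \<open>{0..T}\<close>, so the time integral may be taken
      over the whole line, where the overlap formula is available.\<close>
    have z: "elem_process K a b \<phi> s w = 0" if "s \<notin> {0..T}" for s
      unfolding elem_process_def using that e by (intro sum.neutral) (force simp: indicator_def)
    have "(\<integral>\<^sup>+s\<in>{0..T}. ennreal ((norm (elem_process K a b \<phi> s w))\<^sup>2) \<partial>lborel) =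
      (\<integral>\<^sup>+s. ennreal ((norm (elem_process K a b \<phi> s w))\<^sup>2) \<partial>lborel)"
      using z by (intro nn_integral_cong) (auto simp: indicator_def)
    also have "\<dots> = ennreal (\<integral>s. (norm (elem_process K a b \<phi> s w))\<^sup>2 \<partial>lborel)"
      by (rule nn_integral_eq_integral) (use bi in \<open>auto simp: has_bochner_integral_iff\<close>)
    moreover have G: "(\<integral>s. (norm (elem_process K a b \<phi> s w))\<^sup>2 \<partial>lborel) = G w"
      using bi by (simp add: has_bochner_integral_iff)
    moreover have "0 \<le> G w"
      unfolding G[symmetric] by (rule Bochner_Integration.integral_nonneg) simp
    ultimately show ?thesis by simp
  qed
  have "(\<integral>\<^sup>+w. ennreal (G w) \<partial>P) = ennreal (expectation G)"
    by (rule nn_integral_eq_integral[OF iG]) (use inner in auto)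
  then show ?thesis unfolding L using inner by simp
qed

lemma elem_integral_continuous:
  assumes E: "elem_integrand K a b \<phi>"
  shows "AE w in P. continuous_on {0..T} (\<lambda>t. elem_integral K a b \<phi> t w)"
proof -
  have "AE w in P. continuous_on {0..T} (\<lambda>t. B t w)" using BM unfolding brownian_motion_def by blast
  then show ?thesis
  proof eventually_elim
    case (elim w)
    have c: "continuous_on {0..T} (\<lambda>t. B (min u t) w)" if "0 \<le> u" for u
      by (rule continuous_on_compose2[OF elim, of _ "\<lambda>t. min u t"]) (use that in \<open>auto intro!: continuous_intros\<close>)
    show ?case
      unfolding elem_integral_def
      by (intro continuous_on_sum bounded_bilinear.continuous_on[OF bounded_bilinear_matrix_vector_mult]
          continuous_on_const continuous_on_diff c)
         (use elem_integrandD[OF E] in \<open>force+\<close>)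
  qed
qed

text \<open>Testing with \<open>Z = X s\<close> makes the cross term nonnegative when the squared
  norm of \<open>X t\<close> is expanded around \<open>X s\<close>.\<close>

lemma cone_martingale_norm_mono:
  assumes X: "cone_martingale K X" and st: "0 \<le> s" "s \<le> t" "t \<le> T"
  shows "expectation (\<lambda>w. (norm (X s w))\<^sup>2) \<le> expectation (\<lambda>w. (norm (X t w))\<^sup>2)"
proof -
  have s: "X s \<in> borel_measurable (F s)" "square_integrable P (X s)" "\<forall>w\<in>space P. X s w \<in> K" and t: "square_integrable P (X t)"
    using cone_martingaleD[OF X, of s] cone_martingaleD[OF X, of t] st by auto
  have "0 \<le> expectation (\<lambda>w. X s w \<bullet> (X t w - X s w))"
    using X s st unfolding cone_martingale_def by blast
  moreover have "expectation (\<lambda>w. (norm (X s w))\<^sup>2 + 2 * (X s w \<bullet> (X t w - X s w))) \<le> expectation (\<lambda>w. (norm (X t w))\<^sup>2)"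
  proof (rule integral_mono)
    fix w
    have "(norm (X t w))\<^sup>2 = (norm (X s w))\<^sup>2 + 2 * (X s w \<bullet> (X t w - X s w)) + (norm (X t w - X s w))\<^sup>2"
      by (simp add: power2_norm_eq_inner inner_diff_left inner_diff_right inner_commute)
    then show "(norm (X s w))\<^sup>2 + 2 * (X s w \<bullet> (X t w - X s w)) \<le> (norm (X t w))\<^sup>2" by simp
  qed (use s t square_integrable_inner[OF s(2) square_integrable_diff[OF t s(2)]] in \<open>auto simp: square_integrable_def\<close>)
  moreover have "expectation (\<lambda>w. (norm (X s w))\<^sup>2 + 2 * (X s w \<bullet> (X t w - X s w))) =
    expectation (\<lambda>w. (norm (X s w))\<^sup>2) + 2 * expectation (\<lambda>w. X s w \<bullet> (X t w - X s w))"
    using s square_integrable_inner[OF s(2) square_integrable_diff[OF t s(2)]]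
    by (subst Bochner_Integration.integral_add) (auto simp: square_integrable_def)
  ultimately show ?thesis by linarith
qed

end

section \<open>Simple processes are dense\<close>

text \<open>The mean over the previous mesh interval makes a progressive process adapted; as
  averaging contracts \<open>L\<^sup>1\<close>, convergence need only be checked on indicators of intervals.\<close>

definition prev_mean :: "real \<Rightarrow> nat \<Rightarrow> (real \<Rightarrow> 'b::euclidean_space) \<Rightarrow> 'b" where
  "prev_mean h k f = (1 / h) *\<^sub>R (\<integral>u. indicator {(real k - 1) * h<..real k * h} u *\<^sub>R f u \<partial>lborel)"

definition mesh_mean :: "real \<Rightarrow> nat \<Rightarrow> (real \<Rightarrow> 'b::euclidean_space) \<Rightarrow> real \<Rightarrow> 'b" where
  "mesh_mean T n f s = (\<Sum>k<n. indicator {real k * (T / n)<..real (Suc k) * (T / n)} s *\<^sub>R prev_mean (T / n) k f)"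

lemma mesh_interval_ex:
  fixes h :: real
  assumes "0 < h" "0 < s" "s \<le> real n * h"
  shows "\<exists>k<n. s \<in> {real k * h<..real (Suc k) * h}"
proof -
  \<comment> \<open>The cells are open on the left and closed on the right, hence the ceiling minus
    one.\<close>
  define k where "k = nat (\<lceil>s / h\<rceil> - 1)"
  have "0 < s / h" using assms by simp
  then have "1 \<le> \<lceil>s / h\<rceil>" by linarith
  then have k: "real k = of_int \<lceil>s / h\<rceil> - 1" by (simp add: k_def)
  then have 1: "real k < s / h" "s / h \<le> real k + 1" by linarith+
  then have 2: "real k * h < s" "s \<le> (real k + 1) * h" using assms by (simp_all add: field_simps)
  have "real k * h < real n * h" using 2 assms by linarith
  then have "k < n" using assms by simp
  then show ?thesis using 2 by (intro exI[of _ k]) (auto simp: algebra_simps)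
qed

lemma mesh_interval_unique:
  fixes h :: real
  assumes "0 < h" "s \<in> {real k * h<..real (Suc k) * h}" "s \<in> {real j * h<..real (Suc j) * h}"
  shows "k = j"
proof -
  have "real k * h < real (Suc j) * h" "real j * h < real (Suc k) * h"
    using assms(2,3) by (meson greaterThanAtMost_iff less_le_trans)+
  then have "real k < real (Suc j)" "real j < real (Suc k)"
    using assms(1) mult_less_cancel_right_pos[of h "real k" "real (Suc j)"] mult_less_cancel_right_pos[of h "real j" "real (Suc k)"]
    by blast+
  then show ?thesis by linarith
qed

lemma sum_mesh_indicator:
  assumes "0 < h" "k < n" "s \<in> {real k * h<..real (Suc k) * h}"
  shows "(\<Sum>j<n. indicator {real j * h<..real (Suc j) * h} s *\<^sub>R c j) = (c k :: 'b::real_vector)"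
proof -
  have "(\<Sum>j<n. indicator {real j * h<..real (Suc j) * h} s *\<^sub>R c j) = (\<Sum>j<n. if j = k then c j else 0)"
  proof (intro sum.cong refl)
    fix j
    show "indicator {real j * h<..real (Suc j) * h} s *\<^sub>R c j = (if j = k then c j else 0)"
    proof (cases "j = k")
      case True then show ?thesis using assms(3) by (simp only: indicator_simps) simp
    next
      case False
      then have "s \<notin> {real j * h<..real (Suc j) * h}" using mesh_interval_unique[OF assms(1,3), of j] by blast
      then show ?thesis using False by (simp only: indicator_simps) simp
    qed
  qed
  then show ?thesis using assms(2) by simp
qed

lemma mesh_mean_eq:
  assumes "0 < T" "0 < n" "k < n" "s \<in> {real k * (T / n)<..real (Suc k) * (T / n)}"
  shows "mesh_mean T n f s = prev_mean (T / n) k f"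
  unfolding mesh_mean_def by (rule sum_mesh_indicator) (use assms in auto)

lemma integrable_indicator_scaleR:
  fixes f :: "real \<Rightarrow> 'b::euclidean_space"
  shows "integrable lborel f \<Longrightarrow> A \<in> sets borel \<Longrightarrow> integrable lborel (\<lambda>u. indicator A u *\<^sub>R f u)"
  using integrable_mult_indicator[of A lborel f] by simp

lemma norm_prev_mean_le:
  assumes "0 < h" "integrable lborel f"
  shows "h * norm (prev_mean h k f) \<le> (\<integral>u. indicator {(real k - 1) * h<..real k * h} u * norm (f u) \<partial>lborel)"
proof -
  have "h * norm (prev_mean h k f) = norm (\<integral>u. indicator {(real k - 1) * h<..real k * h} u *\<^sub>R f u \<partial>lborel)"
    using assms by (simp add: prev_mean_def)
  also have "\<dots> \<le> (\<integral>u. norm (indicator {(real k - 1) * h<..real k * h} u *\<^sub>R f u) \<partial>lborel)"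
    by (rule integral_norm_bound)
  finally show ?thesis by (simp add: indicator_def)
qed

text \<open>A cell contributes its length times the norm of the mean over the preceding cell, which
  is at most the integral of the norm over that preceding cell. The preceding cells are disjoint, so
  the total stays below the full integral.\<close>

lemma mesh_mean_L1:
  assumes T: "0 < T" "0 < n" and f: "integrable lborel (f :: real \<Rightarrow> 'b::euclidean_space)"
  shows "integrable lborel (mesh_mean T n f)"
    and "(\<integral>s. norm (mesh_mean T n f s) \<partial>lborel) \<le> (\<integral>s. norm (f s) \<partial>lborel)"
proof -
  define h where "h = T / n"
  have h: "0 < h" using T by (simp add: h_def)
  have hb: "has_bochner_integral lborel (indicator {real k * h<..real (Suc k) * h} :: real \<Rightarrow> real) h" for k
  proof -
    have "real k * h \<le> real (Suc k) * h" using h by (simp add: algebra_simps)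
    then have "emeasure lborel {real k * h<..real (Suc k) * h} = ennreal h" by (simp add: algebra_simps)
    then show ?thesis using h has_bochner_integral_real_indicator[of "{real k * h<..real (Suc k) * h}" lborel]
      by (simp add: measure_def)
  qed
  have ii: "integrable lborel (\<lambda>s. indicator {real k * h<..real (Suc k) * h} s *\<^sub>R c)" for k and c :: 'b
    using hb[of k] by (intro integrable_scaleR_left) (auto simp: has_bochner_integral_iff)
  show "integrable lborel (mesh_mean T n f)"
    unfolding mesh_mean_def[abs_def] h_def[symmetric] by (intro Bochner_Integration.integrable_sum ii)
  have ir: "integrable lborel (\<lambda>s. indicator {real k * h<..real (Suc k) * h} s * c)" for k and c :: real
    using hb[of k] by (intro integrable_mult_left) (auto simp: has_bochner_integral_iff)
  have iN: "integrable lborel (\<lambda>u. indicator A u * norm (f u))" if "A \<in> sets borel" for A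
    using integrable_mult_indicator[of A lborel "\<lambda>u. norm (f u)"] f that by simp
  have "(\<integral>s. norm (mesh_mean T n f s) \<partial>lborel)
    \<le> (\<integral>s. (\<Sum>k<n. indicator {real k * h<..real (Suc k) * h} s * norm (prev_mean h k f)) \<partial>lborel)"
  proof (rule integral_mono)
    show "integrable lborel (\<lambda>s. norm (mesh_mean T n f s))"
      unfolding mesh_mean_def[abs_def] h_def[symmetric] by (intro integrable_norm Bochner_Integration.integrable_sum ii)
    show "integrable lborel (\<lambda>s. \<Sum>k<n. indicator {real k * h<..real (Suc k) * h} s * norm (prev_mean h k f))"
      by (intro Bochner_Integration.integrable_sum ir)
    fix s show "norm (mesh_mean T n f s) \<le> (\<Sum>k<n. indicator {real k * h<..real (Suc k) * h} s * norm (prev_mean h k f))"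
      unfolding mesh_mean_def h_def[symmetric] by (rule order_trans[OF norm_sum]) (auto intro!: sum_mono)
  qed
  also have "\<dots> = (\<Sum>k<n. h * norm (prev_mean h k f))"
    using hb by (subst Bochner_Integration.integral_sum) (auto intro!: ir sum.cong simp: has_bochner_integral_iff)
  also have "\<dots> \<le> (\<Sum>k<n. \<integral>u. indicator {(real k - 1) * h<..real k * h} u * norm (f u) \<partial>lborel)"
    by (intro sum_mono norm_prev_mean_le h f)
  also have "\<dots> = (\<integral>u. (\<Sum>k<n. indicator {(real k - 1) * h<..real k * h} u * norm (f u)) \<partial>lborel)"
    by (intro Bochner_Integration.integral_sum[symmetric] iN) auto
  also have "\<dots> \<le> (\<integral>u. norm (f u) \<partial>lborel)"
  proof (rule integral_mono)
    show "integrable lborel (\<lambda>u. \<Sum>k<n. indicator {(real k - 1) * h<..real k * h} u * norm (f u))"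
      by (intro Bochner_Integration.integrable_sum iN) auto
    fix u
    have "(\<Sum>k<n. indicator {(real k - 1) * h<..real k * h} u) \<le> (1::real)"
    proof (cases "\<exists>k<n. u \<in> {(real k - 1) * h<..real k * h}")
      case True
      then obtain k where k: "k < n" "u \<in> {(real k - 1) * h<..real k * h}" by blast
      \<comment> \<open>Shifting by \<open>h\<close> carries preceding cells to mesh cells, for
        which uniqueness is known.\<close>
      then have k': "u + h \<in> {real k * h<..real (Suc k) * h}" by (auto simp: algebra_simps)
      have "j = k" if "u \<in> {(real j - 1) * h<..real j * h}" for j
      proof -
        have "u + h \<in> {real j * h<..real (Suc j) * h}" using that by (auto simp: algebra_simps)
        then show ?thesis using mesh_interval_unique[OF h _ k'] by blast
      qed
      then have "indicator {(real j - 1) * h<..real j * h} u = (if j = k then 1 else 0::real)" for j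
      proof (cases "j = k")
        case True then show ?thesis using k(2) by (simp only: indicator_simps) simp
      next
        case False
        then have "u \<notin> {(real j - 1) * h<..real j * h}" using \<open>\<And>j. u \<in> {(real j - 1) * h<..real j * h} \<Longrightarrow> j = k\<close>[of j] by blast
        then show ?thesis using False by (simp only: indicator_simps) simp
      qed
      then have "(\<Sum>j<n. indicator {(real j - 1) * h<..real j * h} u) = (\<Sum>j<n. if j = k then 1 else 0::real)"
        by simp
      then show ?thesis using k by simp
    next
      case False
      then have "(\<Sum>k<n. indicator {(real k - 1) * h<..real k * h} u) = (0::real)"
      proof (intro sum.neutral ballI)
        fix k assume "k \<in> {..<n}"
        then have "u \<notin> {(real k - 1) * h<..real k * h}" using False by blast
        then show "indicator {(real k - 1) * h<..real k * h} u = (0::real)"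
          by (simp add: indicator_def del: greaterThanAtMost_iff)
      qed
      then show ?thesis by (simp only: zero_le_one)
    qed
    then show "(\<Sum>k<n. indicator {(real k - 1) * h<..real k * h} u * norm (f u)) \<le> norm (f u)"
      unfolding sum_distrib_right[symmetric] by (simp add: mult_left_le_one_le sum_nonneg)
  qed (use f in auto)
  finally show "(\<integral>s. norm (mesh_mean T n f s) \<partial>lborel) \<le> (\<integral>s. norm (f s) \<partial>lborel)" .
qed

section \<open>Convergence of the mesh means in L^1\<close>

definition mean_err :: "real \<Rightarrow> nat \<Rightarrow> (real \<Rightarrow> 'b::euclidean_space) \<Rightarrow> real" where
  "mean_err T n f = (\<integral>s. indicator {0<..T} s * norm (mesh_mean T n f s - f s) \<partial>lborel)"

lemma prev_mean_add:
  "integrable lborel f \<Longrightarrow> integrable lborel g \<Longrightarrow> prev_mean h k (\<lambda>x. f x + g x) = prev_mean h k f + prev_mean h k g"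
  unfolding prev_mean_def
  by (simp add: scaleR_add_right integrable_indicator_scaleR Bochner_Integration.integral_add)

lemma prev_mean_scaleR: "prev_mean h k (\<lambda>x. c *\<^sub>R f x) = c *\<^sub>R prev_mean h k f"
  unfolding prev_mean_def scaleR_left_commute[of _ c] integral_scaleR_right by simp

lemma prev_mean_scaleR_left: 
  "integrable lborel f \<Longrightarrow> prev_mean h k (\<lambda>x. f x *\<^sub>R (c::'b::euclidean_space)) = prev_mean h k f *\<^sub>R c" for f :: "real \<Rightarrow> real"
proof -
  assume f: "integrable lborel f"
  have "(\<integral>u. indicator {(real k - 1) * h<..real k * h} u *\<^sub>R (f u *\<^sub>R c) \<partial>lborel) =
     (\<integral>u. (indicator {(real k - 1) * h<..real k * h} u *\<^sub>R f u) *\<^sub>R c \<partial>lborel)" by simp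
  also have "\<dots> = (\<integral>u. indicator {(real k - 1) * h<..real k * h} u *\<^sub>R f u \<partial>lborel) *\<^sub>R c"
    by (rule integral_scaleR_left) (rule integrable_indicator_scaleR[OF f], simp)
  finally show ?thesis unfolding prev_mean_def by simp
qed

lemma mesh_mean_add:
  "integrable lborel f \<Longrightarrow> integrable lborel g \<Longrightarrow> mesh_mean T n (\<lambda>x. f x + g x) s = mesh_mean T n f s + mesh_mean T n g s"
  unfolding mesh_mean_def by (simp add: prev_mean_add scaleR_add_right sum.distrib)

lemma mesh_mean_scaleR: "mesh_mean T n (\<lambda>x. c *\<^sub>R f x) s = c *\<^sub>R mesh_mean T n f s"
  unfolding mesh_mean_def prev_mean_scaleR scaleR_sum_right scaleR_left_commute[of _ c] ..

lemma mesh_mean_scaleR_left: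
  "integrable lborel f \<Longrightarrow> mesh_mean T n (\<lambda>x. f x *\<^sub>R (c::'b::euclidean_space)) s = mesh_mean T n f s *\<^sub>R c" for f :: "real \<Rightarrow> real"
proof -
  assume f: "integrable lborel f"
  show ?thesis
    unfolding mesh_mean_def scaleR_sum_left prev_mean_scaleR_left[OF f] by (simp only: scaleR_scaleR real_scaleR_def)
qed

lemma mean_err_integrable:
  assumes T: "0 < T" "0 < n" and f: "integrable lborel f"
  shows "integrable lborel (\<lambda>s. indicator {0<..T} s * norm (mesh_mean T n f s - f s))"
  using integrable_mult_indicator[of "{0<..T}" lborel "\<lambda>s. norm (mesh_mean T n f s - f s)"] mesh_mean_L1(1)[OF T f] f
  by simp

lemma mean_err_nonneg: "0 \<le> mean_err T n f"
  unfolding mean_err_def by (rule Bochner_Integration.integral_nonneg) simp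

lemma mean_err_add:
  assumes T: "0 < T" "0 < n" and f: "integrable lborel f" "integrable lborel g"
  shows "mean_err T n (\<lambda>x. f x + g x) \<le> mean_err T n f + mean_err T n g"
proof -
  have "mean_err T n (\<lambda>x. f x + g x) \<le> (\<integral>s. indicator {0<..T} s * norm (mesh_mean T n f s - f s) + indicator {0<..T} s * norm (mesh_mean T n g s - g s) \<partial>lborel)"
    unfolding mean_err_def
  proof (rule integral_mono)
    fix s
    show "indicator {0<..T} s * norm (mesh_mean T n (\<lambda>x. f x + g x) s - (f s + g s))
      \<le> indicator {0<..T} s * norm (mesh_mean T n f s - f s) + indicator {0<..T} s * norm (mesh_mean T n g s - g s)"
      using norm_triangle_ineq[of "mesh_mean T n f s - f s" "mesh_mean T n g s - g s"]
      by (simp add: mesh_mean_add[OF f] indicator_def algebra_simps)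
  qed (intro Bochner_Integration.integrable_add mean_err_integrable[OF T] f)+
  also have "\<dots> = mean_err T n f + mean_err T n g"
    unfolding mean_err_def by (intro Bochner_Integration.integral_add mean_err_integrable T f)
  finally show ?thesis .
qed

lemma mean_err_scaleR: "mean_err T n (\<lambda>x. c *\<^sub>R f x) = \<bar>c\<bar> * mean_err T n f"
  unfolding mean_err_def by (simp add: mesh_mean_scaleR scaleR_diff_right[symmetric] mult.left_commute)

lemma mean_err_scaleR_left:
  "integrable lborel f \<Longrightarrow> mean_err T n (\<lambda>x. f x *\<^sub>R (c::'b::euclidean_space)) = norm c * mean_err T n f" for f :: "real \<Rightarrow> real"
proof -
  assume f: "integrable lborel f"
  have "indicator {0<..T} s * norm (mesh_mean T n (\<lambda>x. f x *\<^sub>R c) s - f s *\<^sub>R c) =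
      norm c * (indicator {0<..T} s * norm (mesh_mean T n f s - f s))" for s
    unfolding mesh_mean_scaleR_left[OF f] scaleR_diff_left[symmetric] by simp
  then show ?thesis unfolding mean_err_def by (simp only: integral_mult_right_zero)
qed

lemma mean_err_diff:
  assumes T: "0 < T" "0 < n" and f: "integrable lborel f" "integrable lborel g"
  shows "mean_err T n (\<lambda>x. f x - g x) \<le> mean_err T n f + mean_err T n g"
  using mean_err_add[OF T f(1), of "\<lambda>x. (-1) *\<^sub>R g x"] mean_err_scaleR[of T n "-1" g] f(2) by simp

text \<open>Contraction in L^1 together with the triangle inequality. The bound does not depend on
  \<open>n\<close>, which is what lets convergence extend from a dense class.\<close>

lemma mean_err_le:
  assumes T: "0 < T" "0 < n" and f: "integrable lborel f"
  shows "mean_err T n f \<le> 2 * (\<integral>s. norm (f s) \<partial>lborel)"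
proof -
  have "mean_err T n f \<le> (\<integral>s. norm (mesh_mean T n f s) + norm (f s) \<partial>lborel)"
    unfolding mean_err_def
  proof (rule integral_mono)
    fix s show "indicator {0<..T} s * norm (mesh_mean T n f s - f s) \<le> norm (mesh_mean T n f s) + norm (f s)"
      using norm_triangle_ineq4[of "mesh_mean T n f s" "f s"] by (simp add: indicator_def)
  qed (use mean_err_integrable[OF T f] mesh_mean_L1(1)[OF T f] f in auto)
  also have "\<dots> = (\<integral>s. norm (mesh_mean T n f s) \<partial>lborel) + (\<integral>s. norm (f s) \<partial>lborel)"
    using mesh_mean_L1(1)[OF T f] f by simp
  finally show ?thesis using mesh_mean_L1(2)[OF T f] by linarith
qed

text \<open>Functions with vanishing error form a closed class, by the uniform bound
  \<open>mean_err_le\<close>; its factor \<open>2\<close> is why the approximation is taken within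
  \<open>r/4\<close>.\<close>

lemma mean_err_L1_limit:
  fixes f :: "real \<Rightarrow> 'b::euclidean_space"
  assumes T: "0 < T" and f: "integrable lborel f" and s: "\<And>i. integrable lborel (s i)"
    and c: "\<And>i. (\<lambda>n. mean_err T n (s i)) \<longlonglongrightarrow> 0" and L: "(\<lambda>i. \<integral>x. norm (f x - s i x) \<partial>lborel) \<longlonglongrightarrow> 0"
  shows "(\<lambda>n. mean_err T n f) \<longlonglongrightarrow> 0"
proof (rule LIMSEQ_I)
  fix r :: real assume r: "0 < r"
  from LIMSEQ_D[OF L, of "r/4"] r obtain i where i: "(\<integral>x. norm (f x - s i x) \<partial>lborel) < r/4" by auto
  from LIMSEQ_D[OF c[of i], of "r/2"] r obtain N where "\<forall>n\<ge>N. norm (mean_err T n (s i) - 0) < r/2" by auto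
  then have N: "mean_err T n (s i) < r/2" if "n \<ge> N" for n using that mean_err_nonneg[of T n "s i"] by auto
  show "\<exists>no. \<forall>n\<ge>no. norm (mean_err T n f - 0) < r"
  proof (rule exI[of _ "max N 1"], intro allI impI)
    fix n assume n: "max N 1 \<le> n"
    then have n0: "0 < n" by auto
    have "mean_err T n f = mean_err T n (\<lambda>x. s i x + (f x - s i x))" by simp
    also have "\<dots> \<le> mean_err T n (s i) + mean_err T n (\<lambda>x. f x - s i x)"
      by (rule mean_err_add[OF T n0]) (use s f in auto)
    also have "mean_err T n (\<lambda>x. f x - s i x) \<le> 2 * (\<integral>x. norm (f x - s i x) \<partial>lborel)"
      by (rule mean_err_le[OF T n0]) (use s f in auto)
    finally show "norm (mean_err T n f - 0) < r" using i N[of n] n mean_err_nonneg[of T n f] by simp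
  qed
qed

text \<open>The mean over the preceding cell differs from the indicator only if \<open>s\<close>
  lies within two cell lengths to the right of an end point \<open>a\<close> or \<open>b\<close>,
  and there by at most \<open>1\<close>. Two exceptional intervals of length \<open>2 * h\<close>
  give the constant \<open>4\<close>.\<close>

lemma mean_err_interval:
  fixes a b :: real
  assumes T: "0 < T"
  shows "(\<lambda>n. mean_err T n (indicator {a<..b} :: real \<Rightarrow> real)) \<longlonglongrightarrow> 0"
proof (rule tendsto_sandwich[where f="\<lambda>_. 0" and h="\<lambda>n::nat. 4 * (T / real n)"])
  show "(\<lambda>n. 4 * (T / real n)) \<longlonglongrightarrow> 0"
    using tendsto_mult_right_zero[OF lim_const_over_n[of T], of 4] .
  show "\<forall>\<^sub>F n in sequentially. mean_err T n (indicator {a<..b} :: real \<Rightarrow> real) \<le> 4 * (T / real n)"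
  proof (rule eventually_sequentiallyI[of 1])
    fix n :: nat assume "1 \<le> n"
    then have n: "0 < n" by simp
    define h where "h = T / n"
    have h: "0 < h" using T n by (simp add: h_def)
    have int: "integrable lborel (indicator {a<..b} :: real \<Rightarrow> real)"
      by (rule integrable_real_indicator, simp) (cases "a \<le> b"; simp)
    let ?R = "\<lambda>s. indicator {a..a + 2 * h} s + indicator {b..b + 2 * h} s :: real"
    have "indicator {0<..T} s * norm (mesh_mean T n (indicator {a<..b}) s - (indicator {a<..b} s :: real)) \<le> ?R s" for s
    proof (cases "s \<in> {0<..T}")
      case True
      then obtain k where k: "k < n" "s \<in> {real k * h<..real (Suc k) * h}"
        using mesh_interval_ex[OF h, of s n] n by (auto simp: h_def)
      have m: "mesh_mean T n (indicator {a<..b}) s = prev_mean h k (indicator {a<..b} :: real \<Rightarrow> real)"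
        using mesh_mean_eq[OF T n k(1)] k(2) unfolding h_def by blast
      have bi: "has_bochner_integral lborel (\<lambda>u. indicator {(real k - 1) * h<..real k * h} u *\<^sub>R (indicator {a<..b} u :: real))
          (max 0 (min (real k * h) b - max ((real k - 1) * h) a))"
        using interval_product_integral[of "(real k - 1) * h" "real k * h" a b] by simp
      have pm: "prev_mean h k (indicator {a<..b} :: real \<Rightarrow> real) = max 0 (min (real k * h) b - max ((real k - 1) * h) a) / h"
        unfolding prev_mean_def using bi by (simp add: has_bochner_integral_iff)
      define l where "l = max 0 (min (real k * h) b - max ((real k - 1) * h) a)"
      have kh: "(real k - 1) * h = real k * h - h" "real (Suc k) * h = real k * h + h" by (simp_all add: algebra_simps)
      have l: "0 \<le> l" "l \<le> h" unfolding l_def kh using h by auto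
      show ?thesis
      proof (cases "s \<in> {a..a + 2 * h} \<union> {b..b + 2 * h}")
        case True
        have "\<bar>l / h - (indicator {a<..b} s :: real)\<bar> \<le> 1" using l h by (auto simp: indicator_def field_simps)
        also have "1 \<le> ?R s" using True by (auto simp: indicator_def)
        finally show ?thesis unfolding m pm l_def[symmetric] using \<open>s \<in> {0<..T}\<close>
          by (simp only: indicator_simps real_norm_def mult_1)
      next
        case False
        then have F: "s < a \<or> a + 2 * h < s" "s < b \<or> b + 2 * h < s" by auto
        have sk: "real k * h < s" "s \<le> real k * h + h" using k(2) unfolding kh by auto
        have "l / h = indicator {a<..b} s"
        proof (cases "s \<in> {a<..b}")
          case True
          then have "a + 2 * h < s" using F by auto
          then have "max ((real k - 1) * h) a = real k * h - h" unfolding kh using sk by auto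
          moreover have "min (real k * h) b = real k * h" using sk True by auto
          ultimately have "l = h" unfolding l_def using h by auto
          then show ?thesis using True h by simp
        next
          case no: False
          have "min (real k * h) b - max ((real k - 1) * h) a \<le> 0"
          proof (cases "s < a")
            case True
            moreover have "min (real k * h) b \<le> real k * h" "a \<le> max ((real k - 1) * h) a" by auto
            ultimately show ?thesis using sk by linarith
          next
            case False
            then have "b + 2 * h < s" using F no h by auto
            then show ?thesis unfolding kh using sk(2) h by linarith
          qed
          then have "l = 0" unfolding l_def by auto
          then show ?thesis using no by simp
        qed
        then show ?thesis unfolding m pm l_def[symmetric] by simp
      qed
    next
      case False
      then have z: "indicator {0<..T} s = (0::real)" by (simp add: indicator_def)
      show ?thesis unfolding z by simp
    qed
    then have "mean_err T n (indicator {a<..b} :: real \<Rightarrow> real) \<le> (\<integral>s. ?R s \<partial>lborel)"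
      unfolding mean_err_def
      by (intro integral_mono mean_err_integrable[OF T n int]) (use h in \<open>auto intro!: Bochner_Integration.integrable_add integrable_real_indicator\<close>)
    also have "\<dots> = 4 * h"
      using h by (subst Bochner_Integration.integral_add) (auto intro!: integrable_real_indicator)
    finally show "mean_err T n (indicator {a<..b} :: real \<Rightarrow> real) \<le> 4 * (T / real n)" unfolding h_def .
  qed
qed (auto simp: mean_err_nonneg)

text \<open>The window reaches down to \<open>-T\<close> because the mean used on the first cell is
  taken over an interval to the left of \<open>0\<close>.\<close>

lemma mean_err_cong:
  assumes "0 < T" "\<And>s. s \<in> {-T..T} \<Longrightarrow> f s = g s"
  shows "mean_err T n f = mean_err T n g"
proof (cases "n = 0")
  case True
  then show ?thesis using assms unfolding mean_err_def mesh_mean_def 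
    by (intro Bochner_Integration.integral_cong refl) (auto simp: indicator_def)
next
  case False
  define h where "h = T / n"
  have h: "0 < h" "real n * h = T" using False assms by (auto simp: h_def)
  have hT: "h \<le> T" using False assms by (auto simp: h_def field_simps)
  have pm: "prev_mean h k f = prev_mean h k g" if "k < n" for k
  proof -
    have "u \<in> {-T..T}" if "u \<in> {(real k - 1) * h<..real k * h}" for u
    proof -
      have "real k * h \<le> real n * h" using \<open>k < n\<close> h by (intro mult_right_mono) auto
      moreover have "real k * h \<ge> 0" using h by simp
      ultimately show ?thesis using that h(2) hT unfolding atLeastAtMost_iff greaterThanAtMost_iff left_diff_distrib by linarith
    qed
    then show ?thesis unfolding prev_mean_def
      by (intro arg_cong[of _ _ "\<lambda>x. (1/h) *\<^sub>R x"] Bochner_Integration.integral_cong refl)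
         (auto simp: indicator_def assms(2))
  qed
  show ?thesis unfolding mean_err_def mesh_mean_def h_def[symmetric]
    using pm assms by (intro Bochner_Integration.integral_cong refl) (auto simp: indicator_def)
qed

text \<open>A pi-lambda argument from half-open intervals: complements are handled by subtraction
  inside the window, disjoint unions by finite sums and an L^1 limit. Intersecting with the window
  keeps the indicators integrable.\<close>

lemma mean_err_indicator:
  assumes T: "0 < T" and A: "A \<in> sets borel"
  shows "(\<lambda>n. mean_err T n (indicator (A \<inter> {-T..T}) :: real \<Rightarrow> real)) \<longlonglongrightarrow> 0"
proof -
  let ?G = "range (\<lambda>(a, b). {a<..b::real})"
  have int: "integrable lborel (indicator (A \<inter> {-T..T}) :: real \<Rightarrow> real)" if "A \<in> sets borel" for A
  proof (rule integrable_real_indicator)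
    show "A \<inter> {-T..T} \<in> sets lborel" using that by simp
    have "emeasure lborel (A \<inter> {-T..T}) \<le> emeasure lborel {-T..T}" by (rule emeasure_mono) auto
    also have "\<dots> < \<infinity>" using T by simp
    finally show "emeasure lborel (A \<inter> {-T..T}) < \<infinity>" .
  qed
  have AG: "A \<in> sigma_sets UNIV ?G" using A unfolding borel_sigma_sets_Ioc by (simp add: sets_measure_of)
  have "Int_stable ?G"
  proof (rule Int_stableI)
    fix X Y assume "X \<in> ?G" "Y \<in> ?G"
    then obtain a b c d where "X = {a<..b}" "Y = {c<..d}" by auto
    then have "X \<inter> Y = (\<lambda>(a, b). {a<..b}) (max a c, min b d)" by simp
    then show "X \<inter> Y \<in> ?G" by (simp only: rangeI)
  qed
  from this subset_UNIV[of ?G, folded Pow_UNIV] AG show ?thesis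
  proof (induction rule: sigma_sets_induct_disjoint)
    case (basic A)
    then obtain a b where A: "A = {a<..b}" by auto
    have "mean_err T n (indicator (A \<inter> {-T..T}) :: real \<Rightarrow> real) = mean_err T n (indicator {a<..b} :: real \<Rightarrow> real)" for n
      by (rule mean_err_cong[OF T]) (auto simp: A indicator_def)
    then show ?case using mean_err_interval[OF T, of a b] by simp
  next
    case empty
    have "{} \<inter> {-T..T} = {0<..0::real}" by auto
    then show ?case using mean_err_interval[OF T, of 0 0] by (simp only:)
  next
    case (compl A)
    then have A: "A \<in> sets borel" unfolding borel_sigma_sets_Ioc by (simp add: sets_measure_of)
    have U: "(\<lambda>n. mean_err T n (indicator (UNIV \<inter> {-T..T}) :: real \<Rightarrow> real)) \<longlonglongrightarrow> 0"
    proof -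
      \<comment> \<open>Inside the window the whole line looks like the interval
        \<open>{-T-1<..T}\<close>, to which the interval case applies.\<close>
      have "mean_err T n (indicator (UNIV \<inter> {-T..T}) :: real \<Rightarrow> real) = mean_err T n (indicator {-T-1<..T} :: real \<Rightarrow> real)" for n
        by (rule mean_err_cong[OF T]) (auto simp: indicator_def)
      then show ?thesis using mean_err_interval[OF T, of "-T-1" T] by simp
    qed
    have eq: "(indicator ((UNIV - A) \<inter> {-T..T}) :: real \<Rightarrow> real) = (\<lambda>x. indicator (UNIV \<inter> {-T..T}) x - indicator (A \<inter> {-T..T}) x)"
      by (auto simp: indicator_def)
    show ?case
    proof (rule tendsto_sandwich[OF _ _ tendsto_const tendsto_add_zero[OF U compl(2)]])
      show "\<forall>\<^sub>F n in sequentially. mean_err T n (indicator ((UNIV - A) \<inter> {-T..T}) :: real \<Rightarrow> real)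
         \<le> mean_err T n (indicator (UNIV \<inter> {-T..T}) :: real \<Rightarrow> real) + mean_err T n (indicator (A \<inter> {-T..T}) :: real \<Rightarrow> real)"
        unfolding eq by (rule eventually_sequentiallyI[of 1]) (intro mean_err_diff T int A, auto)
    qed (auto simp: mean_err_nonneg)
  next
    case (union A)
    then have A: "A i \<in> sets borel" for i unfolding borel_sigma_sets_Ioc by (auto simp: sets_measure_of)
    then have UA: "(\<Union>i. A i) \<in> sets borel" by auto
    define s where "s N x = (\<Sum>i<N. indicator (A i \<inter> {-T..T}) x :: real)" for N x
    have s_eq: "s N x = indicator ((\<Union>i<N. A i) \<inter> {-T..T}) x" for N x
      unfolding s_def using union(1)
      by (subst indicator_UN_disjoint[symmetric, of "{..<N}"])
         (auto simp: disjoint_family_on_def indicator_def)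
    have si: "integrable lborel (s N)" for N
      unfolding s_def[abs_def] by (intro Bochner_Integration.integrable_sum int A)
    have sc: "(\<lambda>n. mean_err T n (s N)) \<longlonglongrightarrow> 0" for N
    proof (induction N)
      case 0
      have "mean_err T n (s 0) = mean_err T n (indicator {0<..0} :: real \<Rightarrow> real)" for n
        by (rule mean_err_cong[OF T]) (auto simp: s_def)
      then show ?case using mean_err_interval[OF T, of 0 0] by (simp only:)
    next
      case (Suc N)
      have eq: "s (Suc N) = (\<lambda>x. s N x + indicator (A N \<inter> {-T..T}) x)" by (auto simp: s_def)
      show ?case
      proof (rule tendsto_sandwich[OF _ _ tendsto_const tendsto_add_zero[OF Suc union(3)[of N]]])
        show "\<forall>\<^sub>F n in sequentially. mean_err T n (s (Suc N)) \<le> mean_err T n (s N) + mean_err T n (indicator (A N \<inter> {-T..T}) :: real \<Rightarrow> real)"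
          unfolding eq by (rule eventually_sequentiallyI[of 1]) (intro mean_err_add T si int A, auto)
      qed (auto simp: mean_err_nonneg)
    qed
    have "(\<lambda>N. \<integral>x. norm (indicator ((\<Union>i. A i) \<inter> {-T..T}) x - s N x) \<partial>lborel) \<longlonglongrightarrow> (\<integral>x. 0 \<partial>(lborel :: real measure))"
    proof (rule integral_dominated_convergence[where w="indicator ((\<Union>i. A i) \<inter> {-T..T}) :: real \<Rightarrow> real"])
      show "AE x in lborel. (\<lambda>N. norm (indicator ((\<Union>i. A i) \<inter> {-T..T}) x - s N x)) \<longlonglongrightarrow> 0"
      proof (rule AE_I2)
        fix x
        have "\<forall>\<^sub>F N in sequentially. norm (indicator ((\<Union>i. A i) \<inter> {-T..T}) x - s N x) = 0"
        proof (cases "x \<in> (\<Union>i. A i)")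
          case True
          then obtain i where "x \<in> A i" by auto
          then show ?thesis unfolding s_eq by (intro eventually_sequentiallyI[of "Suc i"]) (auto simp: indicator_def)
        next
          case False then show ?thesis unfolding s_eq by (auto simp: indicator_def)
        qed
        then show "(\<lambda>N. norm (indicator ((\<Union>i. A i) \<inter> {-T..T}) x - s N x)) \<longlonglongrightarrow> 0"
          by (rule tendsto_eventually)
      qed
      show "AE x in lborel. norm (norm (indicator ((\<Union>i. A i) \<inter> {-T..T}) x - s N x)) \<le> indicator ((\<Union>i. A i) \<inter> {-T..T}) x" for N
        unfolding s_eq by (auto simp: indicator_def)
    qed (use int[OF UA] si in auto)
    then have L: "(\<lambda>N. \<integral>x. norm (indicator ((\<Union>i. A i) \<inter> {-T..T}) x - s N x) \<partial>lborel) \<longlonglongrightarrow> 0" by simp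
    show ?case by (rule mean_err_L1_limit[OF T int[OF UA] si sc L])
  qed
qed

text \<open>Induction over integrable functions: multiples of indicators reduce to sets inside the
  window, and the limit step uses closedness in L^1.\<close>

lemma mean_err_tendsto_0:
  fixes f :: "real \<Rightarrow> 'b::euclidean_space"
  assumes T: "0 < T" and f: "integrable lborel f"
  shows "(\<lambda>n. mean_err T n f) \<longlonglongrightarrow> 0"
  using f
proof induction
  case (base A c)
  have int: "integrable lborel (indicator (A \<inter> {-T..T}) :: real \<Rightarrow> real)"
  proof (rule integrable_real_indicator)
    show "A \<inter> {-T..T} \<in> sets lborel" using base by simp
    have "emeasure lborel (A \<inter> {-T..T}) \<le> emeasure lborel A" by (rule emeasure_mono) (use base in auto)
    also have "\<dots> < \<infinity>" using base by simp
    finally show "emeasure lborel (A \<inter> {-T..T}) < \<infinity>" .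
  qed
  have "mean_err T n (\<lambda>x. indicator A x *\<^sub>R c) = mean_err T n (\<lambda>x. indicator (A \<inter> {-T..T}) x *\<^sub>R c)" for n
    by (rule mean_err_cong[OF T]) (auto simp: indicator_def)
  then have "mean_err T n (\<lambda>x. indicator A x *\<^sub>R c) = norm c * mean_err T n (indicator (A \<inter> {-T..T}) :: real \<Rightarrow> real)" for n
    using mean_err_scaleR_left[OF int] by simp
  then show ?case using tendsto_mult_right_zero[OF mean_err_indicator[OF T, of A], of "norm c"] base by simp
next
  case (add f g)
  show ?case
  proof (rule tendsto_sandwich[OF _ _ tendsto_const tendsto_add_zero[OF add(3) add(4)]])
    show "\<forall>\<^sub>F n in sequentially. mean_err T n (\<lambda>x. f x + g x) \<le> mean_err T n f + mean_err T n g"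
      by (rule eventually_sequentiallyI[of 1]) (intro mean_err_add T add, auto)
  qed (auto simp: mean_err_nonneg)
next
  case (lim f s)
  \<comment> \<open>The approximants satisfy \<open>norm (s i x) \<le> 2 * norm (f x)\<close>, which
    makes \<open>3 * norm (f x)\<close> a dominating function.\<close>
  have "(\<lambda>i. \<integral>x. norm (f x - s i x) \<partial>lborel) \<longlonglongrightarrow> (\<integral>x. 0 \<partial>(lborel :: real measure))"
  proof (rule integral_dominated_convergence[where w="\<lambda>x. 3 * norm (f x)" and f="\<lambda>_. 0" and s="\<lambda>i x. norm (f x - s i x)"])
    show "AE x in lborel. (\<lambda>i. norm (f x - s i x)) \<longlonglongrightarrow> 0"
    proof (rule AE_I2)
      fix x assume "x \<in> space (lborel :: real measure)"
      from tendsto_norm[OF tendsto_diff[OF tendsto_const lim(2)[OF this]], of "f x"]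
      show "(\<lambda>i. norm (f x - s i x)) \<longlonglongrightarrow> 0" by simp
    qed
    show "AE x in lborel. norm (norm (f x - s i x)) \<le> 3 * norm (f x)" for i
    proof (rule AE_I2)
      fix x show "norm (norm (f x - s i x)) \<le> 3 * norm (f x)"
        using lim(3)[of x i] norm_triangle_ineq4[of "f x" "s i x"] by auto
    qed
  qed (use lim(1,4) in auto)
  then show ?case by (intro mean_err_L1_limit[OF T lim(4,1,5)]) simp
qed

section \<open>Norm and measurability of integrands\<close>

context brownian_setting
begin

definition proc_norm2 :: "(real \<Rightarrow> 'w \<Rightarrow> real ^ 'm ^ 'd) \<Rightarrow> ennreal" where
  "proc_norm2 z = (\<integral>\<^sup>+w. (\<integral>\<^sup>+s\<in>{0..T}. ennreal ((norm (z s w))\<^sup>2) \<partial>lborel) \<partial>P)"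

text \<open>The pair is ordered as \<open>(w, s)\<close>, opposite to \<open>L2_prog\<close>, so
  that the time integral is the inner one in Tonelli's theorem, as in \<open>proc_norm2\<close>. The
  indicator restricts attention to the time horizon.\<close>

definition jointly_measurable :: "(real \<Rightarrow> 'w \<Rightarrow> real ^ 'm ^ 'd) \<Rightarrow> bool" where
  "jointly_measurable z \<longleftrightarrow> (\<lambda>(w, s). indicator {0..T} s *\<^sub>R z s w) \<in> borel_measurable (P \<Otimes>\<^sub>M lborel)"

lemma jointly_measurable_norm2:
  assumes "jointly_measurable z"
  shows "(\<lambda>x. ennreal ((norm (z (snd x) (fst x)))\<^sup>2) * indicator {0..T} (snd x)) \<in> borel_measurable (P \<Otimes>\<^sub>M lborel)"
proof -
  have m: "(\<lambda>x. ennreal ((norm (case x of (w, s) \<Rightarrow> indicator {0..T} s *\<^sub>R z s w))\<^sup>2)) \<in> borel_measurable (P \<Otimes>\<^sub>M lborel)"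
    using assms[unfolded jointly_measurable_def] by measurable
  have eq: "(\<lambda>x. ennreal ((norm (case x of (w, s) \<Rightarrow> indicator {0..T} s *\<^sub>R z s w))\<^sup>2)) =
    (\<lambda>x. ennreal ((norm (z (snd x) (fst x)))\<^sup>2) * indicator {0..T} (snd x))"
    by (auto simp: fun_eq_iff indicator_def)
  show ?thesis using m unfolding eq .
qed

lemma proc_norm2_eq:
  assumes "jointly_measurable z"
  shows "proc_norm2 z = (\<integral>\<^sup>+x. ennreal ((norm (z (snd x) (fst x)))\<^sup>2) * indicator {0..T} (snd x) \<partial>(P \<Otimes>\<^sub>M lborel))"
  using lborel.nn_integral_fst[OF jointly_measurable_norm2[OF assms]] by (simp add: proc_norm2_def)

lemma proc_norm2_inner_measurable:
  assumes "jointly_measurable z"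
  shows "(\<lambda>w. \<integral>\<^sup>+s\<in>{0..T}. ennreal ((norm (z s w))\<^sup>2) \<partial>lborel) \<in> borel_measurable P"
  using lborel.borel_measurable_nn_integral_fst[OF jointly_measurable_norm2[OF assms]] by simp

lemma jointly_measurable_add:
  "jointly_measurable y \<Longrightarrow> jointly_measurable z \<Longrightarrow> jointly_measurable (\<lambda>s w. y s w + z s w)"
  unfolding jointly_measurable_def
  using borel_measurable_add[of "\<lambda>(w, s). indicator {0..T} s *\<^sub>R y s w" "P \<Otimes>\<^sub>M lborel" "\<lambda>(w, s). indicator {0..T} s *\<^sub>R z s w"]
  by (simp add: case_prod_beta' scaleR_add_right)

lemma jointly_measurable_scaleR:
  "jointly_measurable z \<Longrightarrow> jointly_measurable (\<lambda>s w. c *\<^sub>R z s w)"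
  unfolding jointly_measurable_def
  using borel_measurable_scaleR[of "\<lambda>_. c" "P \<Otimes>\<^sub>M lborel" "\<lambda>(w, s). indicator {0..T} s *\<^sub>R z s w"]
  by (simp add: case_prod_beta' scaleR_left_commute[of c] del: scaleR_scaleR)

lemma jointly_measurable_diff:
  "jointly_measurable y \<Longrightarrow> jointly_measurable z \<Longrightarrow> jointly_measurable (\<lambda>s w. y s w - z s w)"
  using jointly_measurable_add[of y "\<lambda>s w. (-1) *\<^sub>R z s w"] jointly_measurable_scaleR[of z "-1"] by simp

lemma proc_norm2_add_le:
  assumes y: "jointly_measurable y" and z: "jointly_measurable z"
  shows "proc_norm2 (\<lambda>s w. y s w + z s w) \<le> 2 * proc_norm2 y + 2 * proc_norm2 z"
proof -
  note m = jointly_measurable_norm2[OF y] jointly_measurable_norm2[OF z]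
  let ?N = "\<lambda>z x. ennreal ((norm (z (snd x) (fst x)))\<^sup>2) * indicator {0..T} (snd x)"
  have "proc_norm2 (\<lambda>s w. y s w + z s w) \<le> (\<integral>\<^sup>+x. 2 * ?N y x + 2 * ?N z x \<partial>(P \<Otimes>\<^sub>M lborel))"
    unfolding proc_norm2_eq[OF jointly_measurable_add[OF y z]]
  proof (rule nn_integral_mono)
    fix x
    have "ennreal ((norm (y (snd x) (fst x) + z (snd x) (fst x)))\<^sup>2)
       \<le> ennreal (2 * (norm (y (snd x) (fst x)))\<^sup>2 + 2 * (norm (z (snd x) (fst x)))\<^sup>2)"
      by (intro ennreal_leI norm_add_sq_le)
    also have "\<dots> = 2 * ennreal ((norm (y (snd x) (fst x)))\<^sup>2) + 2 * ennreal ((norm (z (snd x) (fst x)))\<^sup>2)"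
      by (simp add: ennreal_mult)
    finally show "?N (\<lambda>s w. y s w + z s w) x \<le> 2 * ?N y x + 2 * ?N z x"
      by (cases "snd x \<in> {0..T}") auto
  qed
  also have "\<dots> = 2 * proc_norm2 y + 2 * proc_norm2 z"
    unfolding proc_norm2_eq[OF y] proc_norm2_eq[OF z] using m
    by (subst nn_integral_add) (auto simp: nn_integral_cmult)
  finally show ?thesis .
qed

lemma proc_norm2_scaleR: "proc_norm2 (\<lambda>s w. c *\<^sub>R z s w) \<le> ennreal (c\<^sup>2) * proc_norm2 z" if "jointly_measurable z"
proof -
  have "proc_norm2 (\<lambda>s w. c *\<^sub>R z s w) = (\<integral>\<^sup>+x. ennreal (c\<^sup>2) * (ennreal ((norm (z (snd x) (fst x)))\<^sup>2) * indicator {0..T} (snd x)) \<partial>(P \<Otimes>\<^sub>M lborel))"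
    unfolding proc_norm2_eq[OF jointly_measurable_scaleR[OF that]]
    by (simp add: power_mult_distrib ennreal_mult mult.assoc)
  also have "\<dots> = ennreal (c\<^sup>2) * proc_norm2 z"
    unfolding proc_norm2_eq[OF that] by (rule nn_integral_cmult[OF jointly_measurable_norm2[OF that]])
  finally show ?thesis by simp
qed

lemma proc_norm2_commute: "proc_norm2 (\<lambda>s w. y s w - z s w) = proc_norm2 (\<lambda>s w. z s w - y s w)"
  by (simp add: proc_norm2_def norm_minus_commute)

lemma proc_norm2_triangle:
  assumes "jointly_measurable x" "jointly_measurable y" "jointly_measurable z"
  shows "proc_norm2 (\<lambda>s w. x s w - z s w) \<le> 2 * proc_norm2 (\<lambda>s w. x s w - y s w) + 2 * proc_norm2 (\<lambda>s w. y s w - z s w)"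
  using proc_norm2_add_le[OF jointly_measurable_diff[OF assms(1,2)] jointly_measurable_diff[OF assms(2,3)]] by simp

text \<open>Progressive measurability lives on the space restricted to \<open>{0..t}\<close>;
  clamping time into \<open>{0..t}\<close> and multiplying by an indicator moves it to the whole
  line.\<close>

lemma L2_prog_measurable:
  assumes z: "z \<in> L2_prog P T F" and t: "t \<in> {0..T}"
  shows "(\<lambda>(w, s). indicator {0..t} s *\<^sub>R z s w) \<in> borel_measurable (F t \<Otimes>\<^sub>M borel)"
proof -
  have zm: "(\<lambda>(s, w). z s w) \<in> borel_measurable (restrict_space borel {0..t} \<Otimes>\<^sub>M F t)"
    using z t unfolding L2_prog_def by blast
  have r: "(\<lambda>(w, s). (max 0 (min s t), w)) \<in> F t \<Otimes>\<^sub>M borel \<rightarrow>\<^sub>M restrict_space borel {0..t} \<Otimes>\<^sub>M F t"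
    unfolding case_prod_beta'
    by (intro measurable_Pair measurable_restrict_space2) (use t in auto)
  have "(\<lambda>x. indicator {0..t} (snd x) *\<^sub>R ((\<lambda>(s, w). z s w) ((\<lambda>(w, s). (max 0 (min s t), w)) x))) \<in> borel_measurable (F t \<Otimes>\<^sub>M borel)"
    by (intro borel_measurable_scaleR measurable_compose[OF r zm] borel_measurable_indicator' ) auto
  also have "(\<lambda>x. indicator {0..t} (snd x) *\<^sub>R ((\<lambda>(s, w). z s w) ((\<lambda>(w, s). (max 0 (min s t), w)) x))) =
     (\<lambda>(w, s). indicator {0..t} s *\<^sub>R z s w)"
    by (auto simp: fun_eq_iff indicator_def)
  finally show ?thesis .
qed

lemma pair_F_P: "t \<le> T \<Longrightarrow> f \<in> borel_measurable (F t \<Otimes>\<^sub>M borel) \<Longrightarrow> f \<in> borel_measurable (P \<Otimes>\<^sub>M lborel)"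
proof -
  assume t: "t \<le> T" and f: "f \<in> borel_measurable (F t \<Otimes>\<^sub>M borel)"
  have "(\<lambda>x. (fst x, snd x)) \<in> P \<Otimes>\<^sub>M lborel \<rightarrow>\<^sub>M F t \<Otimes>\<^sub>M borel"
  proof (rule measurable_Pair)
    show "fst \<in> P \<Otimes>\<^sub>M lborel \<rightarrow>\<^sub>M F t"
    proof (rule measurable_compose[OF measurable_fst])
      show "(\<lambda>x. x) \<in> P \<rightarrow>\<^sub>M F t" by (rule measurable_F_P[OF t]) auto
    qed
  qed auto
  from measurable_compose[OF this f] show ?thesis by simp
qed

lemma L2_prog_jointly_measurable: "z \<in> L2_prog P T F \<Longrightarrow> jointly_measurable z"
  unfolding jointly_measurable_def using L2_prog_measurable[of z T] T_pos by (intro pair_F_P[of T]) auto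

lemma L2_prog_norm2: "z \<in> L2_prog P T F \<Longrightarrow> proc_norm2 z < \<infinity>"
  unfolding L2_prog_def proc_norm2_def by simp

lemma elem_process_jointly_measurable:
  assumes "elem_integrand K a b \<phi>"
  shows "jointly_measurable (elem_process K a b \<phi>)"
proof -
  have "(\<lambda>x. indicator {0..T} (snd x) *\<^sub>R (\<Sum>k\<in>K. indicator {a k<..b k} (snd x) *\<^sub>R \<phi> k (fst x))) \<in> borel_measurable (P \<Otimes>\<^sub>M lborel)"
    by (intro borel_measurable_scaleR borel_measurable_sum measurable_compose[OF measurable_fst elem_measurable_P[OF assms]]
        measurable_compose[OF measurable_snd borel_measurable_indicator]) auto
  then show ?thesis unfolding jointly_measurable_def elem_process_def by (simp add: case_prod_beta')
qed

lemma simple_integrand_elem: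
  assumes "simple_integrand P T F n \<tau> \<phi>"
  shows "elem_integrand {..<n} \<tau> (\<lambda>k. \<tau> (Suc k)) \<phi>"
    and "simple_process n \<tau> \<phi> = elem_process {..<n} \<tau> (\<lambda>k. \<tau> (Suc k)) \<phi>"
    and "simple_integral B n \<tau> \<phi> = elem_integral {..<n} \<tau> (\<lambda>k. \<tau> (Suc k)) \<phi>"
  using assms unfolding simple_integrand_def elem_integrand_def simple_process_def simple_integral_def
    elem_process_def elem_integral_def fun_eq_iff by auto

section \<open>Approximation of progressive integrands\<close>

definition truncate :: "real \<Rightarrow> (real \<Rightarrow> 'w \<Rightarrow> real ^ 'm ^ 'd) \<Rightarrow> real \<Rightarrow> 'w \<Rightarrow> real ^ 'm ^ 'd" where
  "truncate c z s w = (if norm (z s w) \<le> c then z s w else 0)"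

lemma truncate_measurable:
  assumes "(\<lambda>(w, s). indicator {0..t} s *\<^sub>R z s w) \<in> borel_measurable M"
  shows "(\<lambda>(w, s). indicator {0..t} s *\<^sub>R truncate c z s w) \<in> borel_measurable M"
proof -
  have "(\<lambda>x. if norm ((\<lambda>(w, s). indicator {0..t} s *\<^sub>R z s w) x) \<le> c then (\<lambda>(w, s). indicator {0..t} s *\<^sub>R z s w) x else 0) \<in> borel_measurable M"
    using assms by measurable
  also have "(\<lambda>x. if norm ((\<lambda>(w, s). indicator {0..t} s *\<^sub>R z s w) x) \<le> c then (\<lambda>(w, s). indicator {0..t} s *\<^sub>R z s w) x else 0)
    = (\<lambda>(w, s). indicator {0..t} s *\<^sub>R truncate c z s w)"
    by (auto simp: fun_eq_iff truncate_def indicator_def)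
  finally show ?thesis .
qed

lemma truncate_tendsto:
  assumes z: "jointly_measurable z" "proc_norm2 z < \<infinity>"
  shows "(\<lambda>n. proc_norm2 (\<lambda>s w. z s w - truncate (real n) z s w)) \<longlonglongrightarrow> 0"
proof -
  have jt: "jointly_measurable (truncate (real n) z)" for n
    using truncate_measurable[OF z(1)[unfolded jointly_measurable_def]] unfolding jointly_measurable_def .
  let ?N = "\<lambda>z x. ennreal ((norm (z (snd x) (fst x)))\<^sup>2) * indicator {0..T} (snd x)"
  have "(\<lambda>n. \<integral>\<^sup>+x. ?N (\<lambda>s w. z s w - truncate (real n) z s w) x \<partial>(P \<Otimes>\<^sub>M lborel)) \<longlonglongrightarrow> (\<integral>\<^sup>+x. 0 \<partial>(P \<Otimes>\<^sub>M (lborel :: real measure)))"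
  proof (rule nn_integral_dominated_convergence[where w="?N z"])
    show "?N (\<lambda>s w. z s w - truncate (real n) z s w) \<in> borel_measurable (P \<Otimes>\<^sub>M lborel)" for n
      by (rule jointly_measurable_norm2[OF jointly_measurable_diff[OF z(1) jt]])
    show "?N z \<in> borel_measurable (P \<Otimes>\<^sub>M lborel)" by (rule jointly_measurable_norm2[OF z(1)])
    show "(\<integral>\<^sup>+x. ?N z x \<partial>(P \<Otimes>\<^sub>M lborel)) < \<infinity>" using z(2) unfolding proc_norm2_eq[OF z(1)] .
    show "AE x in P \<Otimes>\<^sub>M lborel. ?N (\<lambda>s w. z s w - truncate (real n) z s w) x \<le> ?N z x" for n
      by (rule AE_I2) (auto simp: truncate_def intro!: mult_right_mono)
    show "AE x in P \<Otimes>\<^sub>M lborel. (\<lambda>n. ?N (\<lambda>s w. z s w - truncate (real n) z s w) x) \<longlonglongrightarrow> 0"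
    proof (rule AE_I2)
      fix x
      obtain n0 :: nat where "norm (z (snd x) (fst x)) \<le> real n0" using real_arch_simple by blast
      then have "\<forall>\<^sub>F n in sequentially. ?N (\<lambda>s w. z s w - truncate (real n) z s w) x = 0"
        by (intro eventually_sequentiallyI[of n0]) (auto simp: truncate_def)
      then show "(\<lambda>n. ?N (\<lambda>s w. z s w - truncate (real n) z s w) x) \<longlonglongrightarrow> 0" by (rule tendsto_eventually)
    qed
  qed auto
  then show ?thesis unfolding proc_norm2_eq[OF jointly_measurable_diff[OF z(1) jt]] by simp
qed

text \<open>The mean over the cell before a mesh time uses the process only up to that time, so
  progressive measurability makes it known then. For each \<open>w\<close> the mesh means converge
  in L^1 of time; as both functions are bounded by \<open>c\<close>, this controls the squared
  error, and dominated convergence gives the mean over \<open>w\<close>.\<close>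

lemma bounded_simple_approx:
  fixes z :: "real \<Rightarrow> 'w \<Rightarrow> real ^ 'm ^ 'd"
  assumes zm: "\<And>t. t \<in> {0..T} \<Longrightarrow> (\<lambda>(w, s). indicator {0..t} s *\<^sub>R z s w) \<in> borel_measurable (F t \<Otimes>\<^sub>M borel)"
    and c: "\<And>s w. norm (z s w) \<le> c"
  shows "\<exists>\<phi>. (\<forall>n. simple_integrand P T F (Suc n) (\<lambda>k. real k * (T / Suc n)) (\<phi> n)) \<and>
    (\<lambda>n. proc_norm2 (\<lambda>s w. z s w - simple_process (Suc n) (\<lambda>k. real k * (T / Suc n)) (\<phi> n) s w)) \<longlonglongrightarrow> 0"
proof -
  have c0: "0 \<le> c" using c[of 0 undefined] norm_ge_zero order_trans by blast
  \<comment> \<open>Cutting at \<open>0\<close> makes the function vanish on the stretch to the left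
    of \<open>0\<close> over which the first cell averages.\<close>
  define f where "f w u = indicator {0<..T} u *\<^sub>R z u w" for w u
  define \<phi> where "\<phi> n k w = prev_mean (T / Suc n) k (f w)" for n k w
  have fb: "norm (f w u) \<le> c" for w u using c[of u w] c0 by (auto simp: f_def indicator_def)
  have fint: "integrable lborel (f w)" if w: "w \<in> space P" for w
  proof -
    have "(\<lambda>u. indicator {0..T} u *\<^sub>R z u w) \<in> borel_measurable borel"
      using measurable_compose[OF measurable_Pair1'[of w "F T" borel] zm[of T]] w T_pos by simp
    then have "(\<lambda>u. indicator {0<..T} u *\<^sub>R (indicator {0..T} u *\<^sub>R z u w)) \<in> borel_measurable borel" by measurable
    moreover have "(\<lambda>u. indicator {0<..T} u *\<^sub>R (indicator {0..T} u *\<^sub>R z u w)) = f w"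
      by (auto simp: f_def indicator_def fun_eq_iff)
    ultimately have fm: "f w \<in> borel_measurable borel" by simp
    have "integrable lborel (\<lambda>u. indicator {0<..T} u *\<^sub>R f w u)"
      by (rule integrableI_bounded_set_indicator[where B=c]) (use fm fb T_pos in auto)
    moreover have "(\<lambda>u. indicator {0<..T} u *\<^sub>R f w u) = f w" by (auto simp: f_def indicator_def)
    ultimately show ?thesis by simp
  qed
  have fL1: "(\<integral>u. norm (f w u) \<partial>lborel) \<le> c * T" if "w \<in> space P" for w
  proof -
    have "(\<integral>u. norm (f w u) \<partial>lborel) \<le> (\<integral>u. c * indicator {0<..T} u \<partial>lborel)"
    proof (rule integral_mono)
      show "integrable lborel (\<lambda>u. c * indicator {0<..T} u)" by (intro integrable_mult_right integrable_real_indicator) (use T_pos in auto)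
      fix u show "norm (f w u) \<le> c * indicator {0<..T} u" using c[of u w] by (auto simp: f_def indicator_def)
    qed (use fint[OF that] in auto)
    also have "\<dots> = c * T" using T_pos by simp
    finally show ?thesis .
  qed
  have tau: "real k * (T / Suc n) \<in> {0..T}" if "k \<le> Suc n" for k n
  proof -
    have "real k * T \<le> real (Suc n) * T" using that T_pos by (intro mult_right_mono) auto
    then show ?thesis using T_pos by (simp add: field_simps)
  qed
  have h: "0 < T / Suc n" for n using T_pos by simp
  have pmb: "norm (prev_mean (T / Suc n) k (f w)) \<le> c" if w: "w \<in> space P" for n k w
  proof -
    define h' where "h' = T / Suc n"
    have h': "0 < h'" using h unfolding h'_def .
    have le: "(real k - 1) * h' \<le> real k * h'" using h' by (simp add: algebra_simps)
    have "h' * norm (prev_mean h' k (f w)) \<le> (\<integral>u. indicator {(real k - 1) * h'<..real k * h'} u * norm (f w u) \<partial>lborel)"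
      by (rule norm_prev_mean_le[OF h' fint[OF w]])
    also have "\<dots> \<le> (\<integral>u. c * indicator {(real k - 1) * h'<..real k * h'} u \<partial>lborel)"
    proof (rule integral_mono)
      show "integrable lborel (\<lambda>u. c * indicator {(real k - 1) * h'<..real k * h'} u)"
        by (intro integrable_mult_right integrable_real_indicator) (use le in auto)
      show "integrable lborel (\<lambda>u. indicator {(real k - 1) * h'<..real k * h'} u * norm (f w u))"
        using integrable_mult_indicator[of "{(real k - 1) * h'<..real k * h'}" lborel "\<lambda>u. norm (f w u)"] fint[OF w] by simp
      fix u show "indicator {(real k - 1) * h'<..real k * h'} u * norm (f w u) \<le> c * indicator {(real k - 1) * h'<..real k * h'} u"
        unfolding mult.commute[of c] using fb by (intro mult_left_mono) auto
    qed
    also have "\<dots> = c * h'"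
    proof -
      have "real k * h' - (real k - 1) * h' = h'" by (simp add: algebra_simps)
      then show ?thesis using le by (simp del: left_diff_distrib_numeral)
    qed
    finally have "norm (prev_mean h' k (f w)) \<le> c" using h' by (simp add: mult.commute)
    then show ?thesis unfolding h'_def .
  qed
  have \<phi>m: "\<phi> n k \<in> borel_measurable (F (real k * (T / Suc n)))" if k: "k \<le> Suc n" for n k
  proof -
    define t where "t = real k * (T / Suc n)"
    have t: "t \<in> {0..T}" using tau[OF k] unfolding t_def .
    define a where "a = (real k - 1) * (T / Suc n)"
    \<comment> \<open>The cut-off at \<open>t\<close> makes the integrand jointly measurable with
      respect to \<open>F t\<close>, so that integrating out time leaves an
      \<open>F t\<close>-measurable mean.\<close>
    have "(\<lambda>x. indicator ({a<..t} \<inter> {0<..}) (snd x) *\<^sub>R ((\<lambda>(w, s). indicator {0..t} s *\<^sub>R z s w) x)) \<in> borel_measurable (F t \<Otimes>\<^sub>M lborel)"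
    proof (intro borel_measurable_scaleR measurable_compose[OF measurable_snd borel_measurable_indicator])
      show "(\<lambda>(w, s). indicator {0..t} s *\<^sub>R z s w) \<in> borel_measurable (F t \<Otimes>\<^sub>M lborel)"
        using zm[OF t] by (simp cong: measurable_cong_sets sets_pair_measure_cong)
    qed auto
    also have "(\<lambda>x. indicator ({a<..t} \<inter> {0<..}) (snd x) *\<^sub>R ((\<lambda>(w, s). indicator {0..t} s *\<^sub>R z s w) x)) =
       (\<lambda>(w, u). indicator {a<..t} u *\<^sub>R f w u)"
      using t by (auto simp: f_def indicator_def fun_eq_iff)
    finally have "(\<lambda>w. \<integral>u. indicator {a<..t} u *\<^sub>R f w u \<partial>lborel) \<in> borel_measurable (F t)"
      by (rule lborel.borel_measurable_lebesgue_integral)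
    then have "(\<lambda>w. (1 / (T / Suc n)) *\<^sub>R (\<integral>u. indicator {a<..t} u *\<^sub>R f w u \<partial>lborel)) \<in> borel_measurable (F t)" by measurable
    then show ?thesis unfolding \<phi>_def[abs_def] prev_mean_def t_def a_def .
  qed
  have simp: "simple_integrand P T F (Suc n) (\<lambda>k. real k * (T / Suc n)) (\<phi> n)" for n
    unfolding simple_integrand_def
  proof (intro conjI allI impI)
    fix i assume i: "i < Suc n"
    show "\<phi> n i \<in> borel_measurable (F (real i * (T / Suc n)))" using \<phi>m[of i n] i by simp
    show "bounded (\<phi> n i ` space P)" unfolding bounded_iff using pmb by (auto simp: \<phi>_def)
    show "real i * (T / Suc n) \<le> real (Suc i) * (T / Suc n)" using h[of n] by (intro mult_right_mono) auto
  qed (use tau in auto)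
  have sp: "simple_process (Suc n) (\<lambda>k. real k * (T / Suc n)) (\<phi> n) s w = mesh_mean T (Suc n) (f w) s" for n s w
    unfolding simple_process_def mesh_mean_def \<phi>_def ..
  have jz: "jointly_measurable z"
    unfolding jointly_measurable_def using zm[of T] T_pos by (intro pair_F_P[of T]) auto
  define G where "G n w = (\<integral>\<^sup>+s\<in>{0..T}. ennreal ((norm (z s w - simple_process (Suc n) (\<lambda>k. real k * (T / Suc n)) (\<phi> n) s w))\<^sup>2) \<partial>lborel)" for n w
  have Gm: "G n \<in> borel_measurable P" for n
    unfolding G_def[abs_def] using simple_integrand_elem[OF simp[of n]]
    by (intro proc_norm2_inner_measurable jointly_measurable_diff jz) (simp add: elem_process_jointly_measurable)
  have Gle: "G n w \<le> ennreal (2 * c * mean_err T (Suc n) (f w))" if w: "w \<in> space P" for n w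
  proof -
    have "G n w \<le> (\<integral>\<^sup>+s. ennreal (2 * c * (indicator {0<..T} s * norm (mesh_mean T (Suc n) (f w) s - f w s))) \<partial>lborel)"
      unfolding G_def
    proof (rule nn_integral_mono_AE)
      \<comment> \<open>The cells are open on the left and miss the point \<open>0\<close>, which
        has measure zero.\<close>
      have "AE s in lborel. s \<noteq> (0::real)" by (rule AE_lborel_singleton)
      then show "AE s in lborel. ennreal ((norm (z s w - simple_process (Suc n) (\<lambda>k. real k * (T / Suc n)) (\<phi> n) s w))\<^sup>2) * indicator {0..T} s
        \<le> ennreal (2 * c * (indicator {0<..T} s * norm (mesh_mean T (Suc n) (f w) s - f w s)))"
      proof eventually_elim
        case (elim s)
        show ?case
        proof (cases "s \<in> {0<..T}")
          case True
          have "s \<le> real (Suc n) * (T / Suc n)" using True by simp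
          then obtain k where k: "k < Suc n" "s \<in> {real k * (T / Suc n)<..real (Suc k) * (T / Suc n)}"
            using mesh_interval_ex[OF h[of n], of s "Suc n"] True by auto
          have "mesh_mean T (Suc n) (f w) s = prev_mean (T / Suc n) k (f w)" using mesh_mean_eq[OF T_pos _ k] by simp
          then have mb: "norm (mesh_mean T (Suc n) (f w) s) \<le> c" using pmb[OF w] by simp
          define D where "D = norm (mesh_mean T (Suc n) (f w) s - f w s)"
          have zD: "norm (z s w - simple_process (Suc n) (\<lambda>k. real k * (T / Suc n)) (\<phi> n) s w) = D"
            unfolding D_def sp using True by (simp add: f_def norm_minus_commute)
          have "D \<le> 2 * c" unfolding D_def using norm_triangle_ineq4[of "mesh_mean T (Suc n) (f w) s" "f w s"] mb fb[of w s] by linarith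
          \<comment> \<open>Boundedness by \<open>2 * c\<close> trades one factor of the square for
            a constant, so an L^1 bound becomes a bound on squares.\<close>
          then have "D\<^sup>2 \<le> 2 * c * D" unfolding power2_eq_square by (intro mult_right_mono) (auto simp: D_def)
          then show ?thesis unfolding zD D_def[symmetric] using True by (simp add: ennreal_leI)
        next
          case False
          then show ?thesis using elim by (auto simp: indicator_def)
        qed
      qed
    qed
    also have "\<dots> = ennreal (\<integral>s. 2 * c * (indicator {0<..T} s * norm (mesh_mean T (Suc n) (f w) s - f w s)) \<partial>lborel)"
      by (rule nn_integral_eq_integral)
         (use mean_err_integrable[OF T_pos _ fint[OF w], of "Suc n"] c0 in \<open>auto intro!: integrable_mult_right\<close>)
    also have "\<dots> = ennreal (2 * c * mean_err T (Suc n) (f w))" unfolding mean_err_def by (simp only: integral_mult_right_zero)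
    finally show ?thesis .
  qed
  have "(\<lambda>n. \<integral>\<^sup>+w. G n w \<partial>P) \<longlonglongrightarrow> (\<integral>\<^sup>+w. 0 \<partial>P)"
  proof (rule nn_integral_dominated_convergence[where w="\<lambda>_. ennreal (2 * c * (2 * (c * T)))"])
    show "AE w in P. G n w \<le> ennreal (2 * c * (2 * (c * T)))" for n
    proof (rule AE_I2)
      fix w assume w: "w \<in> space P"
      have "mean_err T (Suc n) (f w) \<le> 2 * (c * T)" using mean_err_le[OF T_pos _ fint[OF w], of "Suc n"] fL1[OF w] by simp
      then have "2 * c * mean_err T (Suc n) (f w) \<le> 2 * c * (2 * (c * T))" using c0 by (intro mult_left_mono) auto
      then show "G n w \<le> ennreal (2 * c * (2 * (c * T)))" using Gle[OF w, of n] order_trans ennreal_leI by blast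
    qed
    show "AE w in P. (\<lambda>n. G n w) \<longlonglongrightarrow> 0"
    proof (rule AE_I2)
      fix w assume w: "w \<in> space P"
      have "(\<lambda>n. ennreal (2 * c * mean_err T (Suc n) (f w))) \<longlonglongrightarrow> ennreal (2 * c * 0)"
        by (intro tendsto_ennrealI tendsto_mult_left LIMSEQ_Suc mean_err_tendsto_0 T_pos fint w)
      then have L: "(\<lambda>n. ennreal (2 * c * mean_err T (Suc n) (f w))) \<longlonglongrightarrow> 0" by simp
      show "(\<lambda>n. G n w) \<longlonglongrightarrow> 0"
        by (rule tendsto_sandwich[OF _ _ tendsto_const L]) (use Gle[OF w] in auto)
    qed
  qed (use Gm in \<open>auto simp: emeasure_space_1\<close>)
  then have "(\<lambda>n. proc_norm2 (\<lambda>s w. z s w - simple_process (Suc n) (\<lambda>k. real k * (T / Suc n)) (\<phi> n) s w)) \<longlonglongrightarrow> 0"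
    unfolding proc_norm2_def G_def[symmetric] by simp
  then show ?thesis using simp by blast
qed

theorem simple_process_dense:
  fixes z :: "real \<Rightarrow> 'w \<Rightarrow> real ^ 'm ^ 'd"
  assumes z: "z \<in> L2_prog P T F" and e: "0 < e"
  shows "\<exists>n \<tau> \<phi>. simple_integrand P T F n \<tau> \<phi> \<and> proc_norm2 (\<lambda>s w. z s w - simple_process n \<tau> \<phi> s w) < e"
proof -
  have jz: "jointly_measurable z" by (rule L2_prog_jointly_measurable[OF z])
  \<comment> \<open>The triangle inequality for squared norms costs a factor \<open>2\<close> on
    each of two errors below \<open>e'\<close>, hence four times \<open>e'\<close> in total. An
    infinite \<open>e\<close> is treated apart because it is not the image of a real.\<close>
  obtain e' where e': "0 < e'" "4 * e' \<le> e"
  proof (cases "e = \<infinity>")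
    case False
    then obtain r where r: "e = ennreal r" "0 < r" using e by (cases e) auto
    show ?thesis by (rule that[of "ennreal (r / 4)"]) (use r in \<open>auto simp: ennreal_mult[symmetric] simp del: ennreal_numeral simp flip: ennreal_numeral\<close>)
  qed (use that[of 1] in auto)
  have "\<forall>\<^sub>F n in sequentially. proc_norm2 (\<lambda>s w. z s w - truncate (real n) z s w) < e'"
    using order_tendstoD(2)[OF truncate_tendsto[OF jz L2_prog_norm2[OF z]] e'(1)] .
  then obtain c :: nat where c: "proc_norm2 (\<lambda>s w. z s w - truncate (real c) z s w) < e'" by (auto simp: eventually_sequentially)
  let ?y = "truncate (real c) z"
  have "\<exists>\<phi>. (\<forall>n. simple_integrand P T F (Suc n) (\<lambda>k. real k * (T / Suc n)) (\<phi> n)) \<and>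
    (\<lambda>n. proc_norm2 (\<lambda>s w. ?y s w - simple_process (Suc n) (\<lambda>k. real k * (T / Suc n)) (\<phi> n) s w)) \<longlonglongrightarrow> 0"
    by (rule bounded_simple_approx[of _ "real c"]) (auto simp: truncate_measurable L2_prog_measurable[OF z], simp add: truncate_def)
  then obtain \<phi> where \<phi>: "\<And>n. simple_integrand P T F (Suc n) (\<lambda>k. real k * (T / Suc n)) (\<phi> n)"
    and L: "(\<lambda>n. proc_norm2 (\<lambda>s w. ?y s w - simple_process (Suc n) (\<lambda>k. real k * (T / Suc n)) (\<phi> n) s w)) \<longlonglongrightarrow> 0" by blast
  obtain n where n: "proc_norm2 (\<lambda>s w. ?y s w - simple_process (Suc n) (\<lambda>k. real k * (T / Suc n)) (\<phi> n) s w) < e'"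
    using order_tendstoD(2)[OF L e'(1)] by (auto simp: eventually_sequentially)
  let ?s = "simple_process (Suc n) (\<lambda>k. real k * (T / Suc n)) (\<phi> n)"
  have js: "jointly_measurable ?s" using simple_integrand_elem[OF \<phi>[of n]] by (simp add: elem_process_jointly_measurable)
  have jy: "jointly_measurable ?y"
    using truncate_measurable[OF jz[unfolded jointly_measurable_def]] unfolding jointly_measurable_def .
  have "proc_norm2 (\<lambda>s w. z s w - ?s s w) \<le> 2 * proc_norm2 (\<lambda>s w. z s w - ?y s w) + 2 * proc_norm2 (\<lambda>s w. ?y s w - ?s s w)"
    by (rule proc_norm2_triangle[OF jz jy js])
  also have "\<dots> < 2 * e' + 2 * e'"
    using c n by (intro add_strict_mono ennreal_mult_strict_left_mono) auto
  also have "\<dots> = 4 * e'" by (simp add: distrib_right[symmetric])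
  also have "\<dots> \<le> e" by (rule e'(2))
  finally show ?thesis using \<phi> by blast
qed

end

section \<open>Continuous versions of the Ito integral\<close>

text \<open>The series of squared errors has finite mean, so it converges almost surely and its
  terms tend to \<open>0\<close>.\<close>

lemma AE_tendsto_of_summable_L2:
  fixes f :: "nat \<Rightarrow> 'a \<Rightarrow> 'b::euclidean_space"
  assumes [measurable]: "\<And>n. f n \<in> borel_measurable M" "g \<in> borel_measurable M"
    and s: "(\<Sum>n. \<integral>\<^sup>+x. ennreal ((norm (g x - f n x))\<^sup>2) \<partial>M) < \<infinity>"
  shows "AE x in M. (\<lambda>n. f n x) \<longlonglongrightarrow> g x"
proof -
  have "(\<integral>\<^sup>+x. (\<Sum>n. ennreal ((norm (g x - f n x))\<^sup>2)) \<partial>M) \<noteq> \<infinity>"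
    using s by (subst nn_integral_suminf) auto
  then have "AE x in M. (\<Sum>n. ennreal ((norm (g x - f n x))\<^sup>2)) \<noteq> \<infinity>"
    by (rule nn_integral_PInf_AE[rotated]) measurable
  then show ?thesis
  proof eventually_elim
    case (elim x)
    then have "summable (\<lambda>n. (norm (g x - f n x))\<^sup>2)" by (intro summable_suminf_not_top) auto
    then have "(\<lambda>n. (norm (g x - f n x))\<^sup>2) \<longlonglongrightarrow> 0" by (rule summable_LIMSEQ_zero)
    then have "(\<lambda>n. sqrt ((norm (g x - f n x))\<^sup>2)) \<longlonglongrightarrow> sqrt 0" by (rule tendsto_real_sqrt)
    then have "(\<lambda>n. norm (f n x - g x)) \<longlonglongrightarrow> 0" by (simp add: norm_minus_commute)
    then show ?case by (simp add: tendsto_norm_zero_iff LIM_zero_iff)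
  qed
qed

lemma tendsto_integral_inner:
  assumes Z: "square_integrable M Z" and X: "\<And>n. square_integrable M (X n)" "square_integrable M Y"
    and L: "(\<lambda>n. \<integral>x. (norm (Y x - X n x))\<^sup>2 \<partial>M) \<longlonglongrightarrow> 0"
  shows "(\<lambda>n. \<integral>x. Z x \<bullet> X n x \<partial>M) \<longlonglongrightarrow> (\<integral>x. Z x \<bullet> Y x \<partial>M)"
proof (rule LIMSEQ_I)
  fix r :: real assume r: "0 < r"
  define \<alpha> where "\<alpha> = (\<integral>x. (norm (Z x))\<^sup>2 \<partial>M)"
  have \<alpha>: "0 \<le> \<alpha>" by (simp add: \<alpha>_def)
  \<comment> \<open>The weight in Young's inequality \<open>a * b \<le> (\<delta> / 2) * a^2 + (1 /
    (2 * \<delta>)) * b^2\<close>, small enough that \<open>\<delta> * \<alpha> < r\<close>; the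
    second term is then made small by taking \<open>n\<close> large.\<close>
  define \<delta> where "\<delta> = r / (\<alpha> + 1)"
  have \<delta>: "0 < \<delta>" "\<delta> * \<alpha> < r" using r \<alpha> by (auto simp: \<delta>_def field_simps)
  from LIMSEQ_D[OF L, of "r * \<delta>"] r \<delta> obtain N
    where "\<forall>n\<ge>N. norm ((\<integral>x. (norm (Y x - X n x))\<^sup>2 \<partial>M) - 0) < r * \<delta>" by auto
  then have N: "(\<integral>x. (norm (Y x - X n x))\<^sup>2 \<partial>M) < r * \<delta>" if "n \<ge> N" for n using that by auto
  show "\<exists>no. \<forall>n\<ge>no. norm ((\<integral>x. Z x \<bullet> X n x \<partial>M) - (\<integral>x. Z x \<bullet> Y x \<partial>M)) < r"
  proof (rule exI[of _ N], intro allI impI)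
    fix n assume n: "N \<le> n"
    note D = square_integrable_diff[OF X(2) X(1)[of n]]
    have "(\<integral>x. Z x \<bullet> X n x \<partial>M) - (\<integral>x. Z x \<bullet> Y x \<partial>M) = - (\<integral>x. Z x \<bullet> (Y x - X n x) \<partial>M)"
      using square_integrable_inner[OF Z X(2)] square_integrable_inner[OF Z X(1)] by (simp add: inner_diff_right)
    then have "norm ((\<integral>x. Z x \<bullet> X n x \<partial>M) - (\<integral>x. Z x \<bullet> Y x \<partial>M)) \<le> (\<integral>x. norm (Z x \<bullet> (Y x - X n x)) \<partial>M)"
      using integral_norm_bound[of M "\<lambda>x. Z x \<bullet> (Y x - X n x)"] by simp
    also have "\<dots> \<le> (\<integral>x. (\<delta> / 2) * (norm (Z x))\<^sup>2 + (1 / (2 * \<delta>)) * (norm (Y x - X n x))\<^sup>2 \<partial>M)"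
    proof (rule integral_mono)
      show "integrable M (\<lambda>x. norm (Z x \<bullet> (Y x - X n x)))" by (intro integrable_norm square_integrable_inner Z D)
      show "integrable M (\<lambda>x. (\<delta> / 2) * (norm (Z x))\<^sup>2 + (1 / (2 * \<delta>)) * (norm (Y x - X n x))\<^sup>2)"
        using Z D by (auto simp: square_integrable_def)
      fix x
      define a b where "a = norm (Z x)" and "b = norm (Y x - X n x)"
      have "\<bar>Z x \<bullet> (Y x - X n x)\<bar> \<le> a * b" unfolding a_def b_def by (rule Cauchy_Schwarz_ineq2)
      also have "a * b \<le> (\<delta> / 2) * a\<^sup>2 + (1 / (2 * \<delta>)) * b\<^sup>2"
      proof -
        have "0 \<le> (\<delta> * a - b)\<^sup>2" by simp
        then have "2 * \<delta> * (a * b) \<le> \<delta> * \<delta> * a\<^sup>2 + b\<^sup>2" by (simp add: power2_eq_square algebra_simps)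
        moreover have "2 * \<delta> * ((\<delta> / 2) * a\<^sup>2 + (1 / (2 * \<delta>)) * b\<^sup>2) = \<delta> * \<delta> * a\<^sup>2 + b\<^sup>2"
          using \<delta> by (simp add: distrib_left)
        ultimately have "2 * \<delta> * (a * b) \<le> 2 * \<delta> * ((\<delta> / 2) * a\<^sup>2 + (1 / (2 * \<delta>)) * b\<^sup>2)"
          by simp
        then show ?thesis using \<delta> by simp
      qed
      finally show "norm (Z x \<bullet> (Y x - X n x)) \<le> (\<delta> / 2) * (norm (Z x))\<^sup>2 + (1 / (2 * \<delta>)) * (norm (Y x - X n x))\<^sup>2"
        unfolding a_def b_def by simp
    qed
    also have "\<dots> = (\<delta> / 2) * \<alpha> + (1 / (2 * \<delta>)) * (\<integral>x. (norm (Y x - X n x))\<^sup>2 \<partial>M)"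
      using Z D by (simp add: square_integrable_def \<alpha>_def)
    also have "\<dots> < r / 2 + r / 2"
    proof (rule add_strict_mono)
      show "1 / (2 * \<delta>) * (\<integral>x. (norm (Y x - X n x))\<^sup>2 \<partial>M) < r / 2" using N[OF n] \<delta> by (simp add: field_simps)
    qed (use \<delta> in simp)
    finally show "norm ((\<integral>x. Z x \<bullet> X n x \<partial>M) - (\<integral>x. Z x \<bullet> Y x \<partial>M)) < r" by simp
  qed
qed

text \<open>\<open>|X|^2\<close> equals \<open>|Y - X|^2 + 2 (Y \<bullet> X) - |Y|^2\<close>, so
  convergence of the mixed term against the fixed \<open>Y\<close> is enough.\<close>

lemma tendsto_integral_norm2:
  assumes X: "\<And>n. square_integrable M (X n)" "square_integrable M Y"
    and L: "(\<lambda>n. \<integral>x. (norm (Y x - X n x))\<^sup>2 \<partial>M) \<longlonglongrightarrow> 0"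
  shows "(\<lambda>n. \<integral>x. (norm (X n x))\<^sup>2 \<partial>M) \<longlonglongrightarrow> (\<integral>x. (norm (Y x))\<^sup>2 \<partial>M)"
proof -
  have "(\<integral>x. (norm (X n x))\<^sup>2 \<partial>M) = (\<integral>x. (norm (Y x - X n x))\<^sup>2 \<partial>M) + 2 * (\<integral>x. Y x \<bullet> X n x \<partial>M) - (\<integral>x. (norm (Y x))\<^sup>2 \<partial>M)" for n
  proof -
    have "(norm (X n x))\<^sup>2 = (norm (Y x - X n x))\<^sup>2 + 2 * (Y x \<bullet> X n x) - (norm (Y x))\<^sup>2" for x
      by (simp add: power2_norm_eq_inner inner_diff_left inner_diff_right inner_commute)
    then show ?thesis using square_integrable_diff[OF X(2) X(1)[of n]] square_integrable_inner[OF X(2) X(1)[of n]] X(2)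
      by (simp add: square_integrable_def)
  qed
  moreover have "(\<lambda>n. (\<integral>x. (norm (Y x - X n x))\<^sup>2 \<partial>M) + 2 * (\<integral>x. Y x \<bullet> X n x \<partial>M) - (\<integral>x. (norm (Y x))\<^sup>2 \<partial>M))
     \<longlonglongrightarrow> 0 + 2 * (\<integral>x. Y x \<bullet> Y x \<partial>M) - (\<integral>x. (norm (Y x))\<^sup>2 \<partial>M)"
    by (intro tendsto_intros L tendsto_integral_inner X)
  ultimately show ?thesis by (simp add: power2_norm_eq_inner)
qed

lemma tendsto_real_of_nn_integral:
  assumes "\<And>n. square_integrable M (D n)" "(\<lambda>n. \<integral>\<^sup>+x. ennreal ((norm (D n x))\<^sup>2) \<partial>M) \<longlonglongrightarrow> 0"
  shows "(\<lambda>n. \<integral>x. (norm (D n x))\<^sup>2 \<partial>M) \<longlonglongrightarrow> 0"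
proof -
  have "(\<lambda>n. ennreal (\<integral>x. (norm (D n x))\<^sup>2 \<partial>M)) \<longlonglongrightarrow> ennreal 0"
    using assms(2) unfolding square_integrable_nn_integral[OF assms(1)] by simp
  then show ?thesis by (subst (asm) tendsto_ennreal_iff) auto
qed

lemma closure_dyads:
  assumes "0 < T" shows "{0..T} \<subseteq> closure (dyads T)"
proof
  fix t assume t: "t \<in> {0..T}"
  show "t \<in> closure (dyads T)"
    unfolding closure_approachable
  proof (intro allI impI)
    fix e :: real assume e: "0 < e"
    define a b where "a = max 0 (t - e)" and "b = min T (t + e)"
    have "0 \<le> a" "a < b" "b \<le> T" using t e assms by (auto simp: a_def b_def)
    then obtain q where "q \<in> dyads T" "a < q" "q < b" using dyads_dense by blast
    then show "\<exists>y\<in>dyads T. dist y t < e" by (intro bexI[of _ q]) (auto simp: a_def b_def dist_real_def)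
  qed
qed

lemma dyads_bound_extend:
  fixes f :: "real \<Rightarrow> 'a::real_normed_vector"
  assumes T: "0 < T" and f: "continuous_on {0..T} f" and b: "\<And>q. q \<in> dyads T \<Longrightarrow> norm (f q) \<le> c" and t: "t \<in> {0..T}"
  shows "norm (f t) \<le> c"
proof -
  have cl: "closure (dyads T) = {0..T}"
    using closure_dyads[OF T] closure_minimal[OF dyads_subset[of T] closed_atLeastAtMost] T by auto
  have "f ` closure (dyads T) \<subseteq> cball 0 c"
    by (rule image_closure_subset) (use f cl b in auto)
  moreover have "f t \<in> f ` closure (dyads T)" using t cl by blast
  ultimately have "f t \<in> cball 0 c" by blast
  then show ?thesis by simp
qed

section \<open>Linearity and uniqueness of the Ito integral\<close>

context brownian_setting
begin

lemma elem_add_scaleR: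
  fixes \<phi>1 :: "'i \<Rightarrow> 'w \<Rightarrow> real ^ 'm ^ 'd" and \<phi>2 :: "'j \<Rightarrow> 'w \<Rightarrow> real ^ 'm ^ 'd" and c :: real
  assumes E1: "elem_integrand K1 a1 b1 \<phi>1" and E2: "elem_integrand K2 a2 b2 \<phi>2"
  defines "K \<equiv> K1 <+> K2" and "a \<equiv> case_sum a1 a2" and "b \<equiv> case_sum b1 b2"
    and "\<phi> \<equiv> case_sum \<phi>1 (\<lambda>k w. c *\<^sub>R \<phi>2 k w)"
  shows "elem_integrand K a b \<phi>"
    and "elem_process K a b \<phi> s w = elem_process K1 a1 b1 \<phi>1 s w + c *\<^sub>R elem_process K2 a2 b2 \<phi>2 s w"
    and "elem_integral K a b \<phi> t w = elem_integral K1 a1 b1 \<phi>1 t w + c *\<^sub>R elem_integral K2 a2 b2 \<phi>2 t w"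
proof -
  have fin: "finite K1" "finite K2" using E1 E2 by (auto simp: elem_integrand_def)
  have bd: "bounded ((\<lambda>w. c *\<^sub>R \<phi>2 k w) ` space P)" if "k \<in> K2" for k
    using bounded_scaling[OF elem_integrandD(5)[OF E2 that], of c] by (simp add: image_image)
  show "elem_integrand K a b \<phi>"
    unfolding elem_integrand_def K_def a_def b_def \<phi>_def
    using fin bd elem_integrandD[OF E1] elem_integrandD[OF E2] by (auto elim!: PlusE)
  show "elem_process K a b \<phi> s w = elem_process K1 a1 b1 \<phi>1 s w + c *\<^sub>R elem_process K2 a2 b2 \<phi>2 s w"
    unfolding elem_process_def K_def a_def b_def \<phi>_def
    by (simp only: sum.Plus[OF fin] o_def sum.case scaleR_sum_right scaleR_left_commute[of c])
  show "elem_integral K a b \<phi> t w = elem_integral K1 a1 b1 \<phi>1 t w + c *\<^sub>R elem_integral K2 a2 b2 \<phi>2 t w"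
    unfolding elem_integral_def K_def a_def b_def \<phi>_def
    by (simp only: sum.Plus[OF fin] o_def sum.case scaleR_sum_right scaleR_matrix_vector_assoc)
qed

text \<open>The second moment at \<open>t\<close> is at most that at \<open>T\<close>, where the
  isometry is available.\<close>

lemma elem_integral_norm2_le:
  fixes \<phi> :: "'i \<Rightarrow> 'w \<Rightarrow> real ^ 'm ^ 'd"
  assumes E: "elem_integrand K a b \<phi>" and t: "t \<in> {0..T}"
  shows "(\<integral>\<^sup>+w. ennreal ((norm (elem_integral K a b \<phi> t w))\<^sup>2) \<partial>P) \<le> proc_norm2 (elem_process K a b \<phi>)"
proof -
  have "expectation (\<lambda>w. (norm (elem_integral K a b \<phi> t w))\<^sup>2) \<le> expectation (\<lambda>w. (norm (elem_integral K a b \<phi> T w))\<^sup>2)"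
    by (rule cone_martingale_norm_mono[OF elem_integral_cone_martingale[OF E]]) (use t in auto)
  moreover have "T \<in> {0..T}" using T_pos by simp
  note square_integrable_nn_integral[OF elem_integral_square_integrable[OF E this]]
    square_integrable_nn_integral[OF elem_integral_square_integrable[OF E t]]
  ultimately show ?thesis
    unfolding proc_norm2_def elem_isometry[OF E, symmetric] by (simp only: ennreal_leI)
qed

text \<open>The isometry for differences: two elementary integrands on unrelated partitions form
  a single one indexed by the disjoint sum.\<close>

lemma elem_integral_diff_norm2_le:
  fixes \<phi>1 :: "'i \<Rightarrow> 'w \<Rightarrow> real ^ 'm ^ 'd" and \<phi>2 :: "'j \<Rightarrow> 'w \<Rightarrow> real ^ 'm ^ 'd"
  assumes E1: "elem_integrand K1 a1 b1 \<phi>1" and E2: "elem_integrand K2 a2 b2 \<phi>2" and t: "t \<in> {0..T}"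
  shows "(\<integral>\<^sup>+w. ennreal ((norm (elem_integral K1 a1 b1 \<phi>1 t w - elem_integral K2 a2 b2 \<phi>2 t w))\<^sup>2) \<partial>P)
    \<le> proc_norm2 (\<lambda>s w. elem_process K1 a1 b1 \<phi>1 s w - elem_process K2 a2 b2 \<phi>2 s w)"
proof -
  note c = elem_add_scaleR[OF E1 E2, where c="-1"]
  have eq: "elem_process (K1 <+> K2) (case_sum a1 a2) (case_sum b1 b2) (case_sum \<phi>1 (\<lambda>k w. (-1) *\<^sub>R \<phi>2 k w)) =
     (\<lambda>s w. elem_process K1 a1 b1 \<phi>1 s w + (-1) *\<^sub>R elem_process K2 a2 b2 \<phi>2 s w)"
    by (intro ext) (rule c(2))
  show ?thesis using elem_integral_norm2_le[OF c(1) t, unfolded eq c(3)] by simp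
qed

lemma is_ito_integralD:
  assumes "is_ito_integral P T F B t z I" "t \<in> {0..T}"
  obtains n \<tau> \<phi> where "\<And>j::nat. simple_integrand P T F (n j) (\<tau> j) (\<phi> j)"
    "(\<lambda>j. proc_norm2 (\<lambda>s w. z s w - simple_process (n j) (\<tau> j) (\<phi> j) s w)) \<longlonglongrightarrow> 0"
    "(\<lambda>j. \<integral>\<^sup>+w. ennreal ((norm (I w - simple_integral B (n j) (\<tau> j) (\<phi> j) t w))\<^sup>2) \<partial>P) \<longlonglongrightarrow> 0"
  using assms unfolding is_ito_integral_def proc_norm2_def by blast

lemma is_ito_measurable:
  assumes "is_ito_integral P T F B t z I" "t \<in> {0..T}"
  shows "I \<in> borel_measurable (F t)" "I \<in> borel_measurable P"
proof -
  show "I \<in> borel_measurable (F t)" using assms unfolding is_ito_integral_def by blast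
  then show "I \<in> borel_measurable P" using assms measurable_F_P[of t] by auto
qed

lemma nn_norm2_add_le:
  fixes f g :: "'w \<Rightarrow> 'a::euclidean_space"
  assumes [measurable]: "f \<in> borel_measurable M" "g \<in> borel_measurable M"
  shows "(\<integral>\<^sup>+w. ennreal ((norm (f w + g w))\<^sup>2) \<partial>M) \<le> 2 * (\<integral>\<^sup>+w. ennreal ((norm (f w))\<^sup>2) \<partial>M) + 2 * (\<integral>\<^sup>+w. ennreal ((norm (g w))\<^sup>2) \<partial>M)"
proof -
  have "(\<integral>\<^sup>+w. ennreal ((norm (f w + g w))\<^sup>2) \<partial>M) \<le> (\<integral>\<^sup>+w. 2 * ennreal ((norm (f w))\<^sup>2) + 2 * ennreal ((norm (g w))\<^sup>2) \<partial>M)"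
  proof (rule nn_integral_mono)
    fix w
    have "ennreal ((norm (f w + g w))\<^sup>2) \<le> ennreal (2 * (norm (f w))\<^sup>2 + 2 * (norm (g w))\<^sup>2)"
      by (intro ennreal_leI norm_add_sq_le)
    then show "ennreal ((norm (f w + g w))\<^sup>2) \<le> 2 * ennreal ((norm (f w))\<^sup>2) + 2 * ennreal ((norm (g w))\<^sup>2)"
      by (simp add: ennreal_mult)
  qed
  also have "\<dots> = 2 * (\<integral>\<^sup>+w. ennreal ((norm (f w))\<^sup>2) \<partial>M) + 2 * (\<integral>\<^sup>+w. ennreal ((norm (g w))\<^sup>2) \<partial>M)"
    by (subst nn_integral_add) (auto simp: nn_integral_cmult)
  finally show ?thesis .
qed

lemma nn_norm2_scaleR:
  fixes f :: "'w \<Rightarrow> 'a::euclidean_space"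
  assumes [measurable]: "f \<in> borel_measurable M"
  shows "(\<integral>\<^sup>+w. ennreal ((norm (c *\<^sub>R f w))\<^sup>2) \<partial>M) = ennreal (c\<^sup>2) * (\<integral>\<^sup>+w. ennreal ((norm (f w))\<^sup>2) \<partial>M)"
  by (simp add: power_mult_distrib ennreal_mult nn_integral_cmult)

lemma tendsto_0_le_ennreal:
  fixes f g :: "nat \<Rightarrow> ennreal"
  assumes "g \<longlonglongrightarrow> 0" "\<And>n. f n \<le> g n" shows "f \<longlonglongrightarrow> 0"
  by (rule tendsto_sandwich[OF _ _ tendsto_const assms(1)]) (use assms(2) in auto)

lemma tendsto_2_0:
  fixes f g :: "nat \<Rightarrow> ennreal"
  assumes "f \<longlonglongrightarrow> 0" "g \<longlonglongrightarrow> 0" shows "(\<lambda>n. 2 * f n + 2 * g n) \<longlonglongrightarrow> 0"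
proof -
  have "(\<lambda>n. 2 * f n + 2 * g n) \<longlonglongrightarrow> 2 * 0 + 2 * 0"
    by (intro tendsto_add ennreal_tendsto_cmult assms) auto
  then show ?thesis by simp
qed

text \<open>The three integrals come with approximations over unrelated partitions. The isometry
  bounds the distance between the third elementary integral and the combination of the other two by
  the distance of the processes, which tends to \<open>0\<close>. All errors together bound a
  quantity that does not depend on \<open>j\<close>, so it vanishes.\<close>

lemma ito_integral_add_scaleR_AE:
  fixes z1 z2 :: "real \<Rightarrow> 'w \<Rightarrow> real ^ 'm ^ 'd"
  assumes t: "t \<in> {0..T}" and j: "jointly_measurable z1" "jointly_measurable z2"
    and I1: "is_ito_integral P T F B t z1 I1" and I2: "is_ito_integral P T F B t z2 I2"
    and I3: "is_ito_integral P T F B t (\<lambda>s w. z1 s w + c *\<^sub>R z2 s w) I3"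
  shows "AE w in P. I3 w = I1 w + c *\<^sub>R I2 w"
proof -
  obtain n1 \<tau>1 \<phi>1 where
    s1: "\<And>j. simple_integrand P T F (n1 j) (\<tau>1 j) (\<phi>1 j)"
    and p1: "(\<lambda>j. proc_norm2 (\<lambda>s w. z1 s w - simple_process (n1 j) (\<tau>1 j) (\<phi>1 j) s w)) \<longlonglongrightarrow> 0"
    and q1: "(\<lambda>j. \<integral>\<^sup>+w. ennreal ((norm (I1 w - simple_integral B (n1 j) (\<tau>1 j) (\<phi>1 j) t w))\<^sup>2) \<partial>P) \<longlonglongrightarrow> 0"
    by (rule is_ito_integralD[OF I1 t], rule that; assumption)
  obtain n2 \<tau>2 \<phi>2 where
    s2: "\<And>j. simple_integrand P T F (n2 j) (\<tau>2 j) (\<phi>2 j)"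
    and p2: "(\<lambda>j. proc_norm2 (\<lambda>s w. z2 s w - simple_process (n2 j) (\<tau>2 j) (\<phi>2 j) s w)) \<longlonglongrightarrow> 0"
    and q2: "(\<lambda>j. \<integral>\<^sup>+w. ennreal ((norm (I2 w - simple_integral B (n2 j) (\<tau>2 j) (\<phi>2 j) t w))\<^sup>2) \<partial>P) \<longlonglongrightarrow> 0"
    by (rule is_ito_integralD[OF I2 t], rule that; assumption)
  obtain n3 \<tau>3 \<phi>3 where
    s3: "\<And>j. simple_integrand P T F (n3 j) (\<tau>3 j) (\<phi>3 j)"
    and p3: "(\<lambda>j. proc_norm2 (\<lambda>s w. (z1 s w + c *\<^sub>R z2 s w) - simple_process (n3 j) (\<tau>3 j) (\<phi>3 j) s w)) \<longlonglongrightarrow> 0"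
    and q3: "(\<lambda>j. \<integral>\<^sup>+w. ennreal ((norm (I3 w - simple_integral B (n3 j) (\<tau>3 j) (\<phi>3 j) t w))\<^sup>2) \<partial>P) \<longlonglongrightarrow> 0"
    by (rule is_ito_integralD[OF I3 t], rule that; assumption)
  define S1 where "S1 j = simple_process (n1 j) (\<tau>1 j) (\<phi>1 j)" for j
  define S2 where "S2 j = simple_process (n2 j) (\<tau>2 j) (\<phi>2 j)" for j
  define S3 where "S3 j = simple_process (n3 j) (\<tau>3 j) (\<phi>3 j)" for j
  define X1 where "X1 j = simple_integral B (n1 j) (\<tau>1 j) (\<phi>1 j) t" for j
  define X2 where "X2 j = simple_integral B (n2 j) (\<tau>2 j) (\<phi>2 j) t" for j
  define X3 where "X3 j = simple_integral B (n3 j) (\<tau>3 j) (\<phi>3 j) t" for j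
  note e1 = simple_integrand_elem[OF s1] and e2 = simple_integrand_elem[OF s2] and e3 = simple_integrand_elem[OF s3]
  have jS: "jointly_measurable (S1 j)" "jointly_measurable (S2 j)" "jointly_measurable (S3 j)" for j
    unfolding S1_def S2_def S3_def e1(2) e2(2) e3(2)
    by (intro elem_process_jointly_measurable e1 e2 e3)+
  have mX[measurable]: "X1 j \<in> borel_measurable P" "X2 j \<in> borel_measurable P" "X3 j \<in> borel_measurable P" for j
    unfolding X1_def X2_def X3_def e1(3) e2(3) e3(3)
    by (intro square_integrable_measurable elem_integral_square_integrable e1 e2 e3 t)+
  note mI[measurable] = is_ito_measurable(2)[OF I1 t] is_ito_measurable(2)[OF I2 t] is_ito_measurable(2)[OF I3 t]
  have le: "(\<integral>\<^sup>+w. ennreal ((norm (X3 j w - (X1 j w + c *\<^sub>R X2 j w)))\<^sup>2) \<partial>P) \<le> proc_norm2 (\<lambda>s w. S3 j s w - (S1 j s w + c *\<^sub>R S2 j s w))" for j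
    using elem_integral_diff_norm2_le[OF e3(1)[of j] elem_add_scaleR(1)[OF e1(1)[of j] e2(1)[of j], of c] t]
    unfolding elem_add_scaleR[OF e1(1)[of j] e2(1)[of j]] X1_def X2_def X3_def S1_def S2_def S3_def e1(2,3) e2(2,3) e3(2,3) .
  let ?z3 = "\<lambda>s w. z1 s w + c *\<^sub>R z2 s w"
  have j3: "jointly_measurable ?z3" by (intro jointly_measurable_add jointly_measurable_scaleR j)
  have L: "(\<lambda>j. proc_norm2 (\<lambda>s w. S3 j s w - (S1 j s w + c *\<^sub>R S2 j s w))) \<longlonglongrightarrow> 0"
  proof (rule tendsto_0_le_ennreal)
    have "(\<lambda>j. ennreal (c\<^sup>2) * proc_norm2 (\<lambda>s w. z2 s w - S2 j s w)) \<longlonglongrightarrow> ennreal (c\<^sup>2) * 0"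
      unfolding S2_def by (intro ennreal_tendsto_cmult p2) auto
    then show "(\<lambda>j. 2 * proc_norm2 (\<lambda>s w. ?z3 s w - S3 j s w) + 2 * (2 * proc_norm2 (\<lambda>s w. z1 s w - S1 j s w)
       + 2 * (ennreal (c\<^sup>2) * proc_norm2 (\<lambda>s w. z2 s w - S2 j s w)))) \<longlonglongrightarrow> 0"
      unfolding S1_def S3_def by (intro tendsto_2_0 p1 p3) simp
    fix j
    have "proc_norm2 (\<lambda>s w. S3 j s w - (S1 j s w + c *\<^sub>R S2 j s w)) \<le> 2 * proc_norm2 (\<lambda>s w. S3 j s w - ?z3 s w) +
       2 * proc_norm2 (\<lambda>s w. ?z3 s w - (S1 j s w + c *\<^sub>R S2 j s w))"
      by (rule proc_norm2_triangle) (intro jS j3 jointly_measurable_add jointly_measurable_scaleR)+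
    also have "proc_norm2 (\<lambda>s w. S3 j s w - ?z3 s w) = proc_norm2 (\<lambda>s w. ?z3 s w - S3 j s w)" by (rule proc_norm2_commute)
    also have "(\<lambda>s w. ?z3 s w - (S1 j s w + c *\<^sub>R S2 j s w)) = (\<lambda>s w. (z1 s w - S1 j s w) + c *\<^sub>R (z2 s w - S2 j s w))"
      by (simp add: fun_eq_iff algebra_simps)
    also have "proc_norm2 \<dots> \<le> 2 * proc_norm2 (\<lambda>s w. z1 s w - S1 j s w) + 2 * proc_norm2 (\<lambda>s w. c *\<^sub>R (z2 s w - S2 j s w))"
      by (intro proc_norm2_add_le jointly_measurable_scaleR jointly_measurable_diff j jS)
    also have "proc_norm2 (\<lambda>s w. c *\<^sub>R (z2 s w - S2 j s w)) \<le> ennreal (c\<^sup>2) * proc_norm2 (\<lambda>s w. z2 s w - S2 j s w)"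
      by (intro proc_norm2_scaleR jointly_measurable_diff j jS)
    finally show "proc_norm2 (\<lambda>s w. S3 j s w - (S1 j s w + c *\<^sub>R S2 j s w)) \<le> 2 * proc_norm2 (\<lambda>s w. ?z3 s w - S3 j s w) + 2 * (2 * proc_norm2 (\<lambda>s w. z1 s w - S1 j s w)
       + 2 * (ennreal (c\<^sup>2) * proc_norm2 (\<lambda>s w. z2 s w - S2 j s w)))"
      by (simp add: add_left_mono mult_left_mono)
  qed
  have W: "(\<lambda>j. \<integral>\<^sup>+w. ennreal ((norm (X3 j w - (X1 j w + c *\<^sub>R X2 j w)))\<^sup>2) \<partial>P) \<longlonglongrightarrow> 0"
    by (rule tendsto_0_le_ennreal[OF L le])
  let ?D = "\<integral>\<^sup>+w. ennreal ((norm (I3 w - (I1 w + c *\<^sub>R I2 w)))\<^sup>2) \<partial>P"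
  have "(\<lambda>j. ?D) \<longlonglongrightarrow> 0"
  proof (rule tendsto_0_le_ennreal)
    have "(\<lambda>j. ennreal (c\<^sup>2) * (\<integral>\<^sup>+w. ennreal ((norm (I2 w - X2 j w))\<^sup>2) \<partial>P)) \<longlonglongrightarrow> ennreal (c\<^sup>2) * 0"
      unfolding X2_def by (intro ennreal_tendsto_cmult q2) auto
    then show "(\<lambda>j. 2 * (\<integral>\<^sup>+w. ennreal ((norm (X3 j w - (X1 j w + c *\<^sub>R X2 j w)))\<^sup>2) \<partial>P) +
       2 * (2 * (\<integral>\<^sup>+w. ennreal ((norm (I3 w - X3 j w))\<^sup>2) \<partial>P) + 2 * (2 * (\<integral>\<^sup>+w. ennreal ((norm (I1 w - X1 j w))\<^sup>2) \<partial>P)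
         + 2 * (ennreal (c\<^sup>2) * (\<integral>\<^sup>+w. ennreal ((norm (I2 w - X2 j w))\<^sup>2) \<partial>P))))) \<longlonglongrightarrow> 0"
      unfolding X1_def[symmetric] X3_def[symmetric]
      using q1 q3 W unfolding X1_def[symmetric] X3_def[symmetric] by (intro tendsto_2_0) simp_all
    fix j
    let ?A = "\<lambda>w. X3 j w - (X1 j w + c *\<^sub>R X2 j w)" and ?B = "\<lambda>w. I3 w - X3 j w"
      and ?C = "\<lambda>w. I1 w - X1 j w" and ?E = "\<lambda>w. I2 w - X2 j w"
    let ?N = "\<lambda>f. (\<integral>\<^sup>+w. ennreal ((norm (f w))\<^sup>2) \<partial>P)"
    \<comment> \<open>The difference is split into the discrepancy between the elementary integrals
      and the three approximation errors.\<close>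
    have "?D = ?N (\<lambda>w. ?A w + (?B w + (- 1) *\<^sub>R (?C w + c *\<^sub>R ?E w)))"
      by (intro nn_integral_cong) (simp add: algebra_simps)
    also have "\<dots> \<le> 2 * ?N ?A + 2 * ?N (\<lambda>w. ?B w + (- 1) *\<^sub>R (?C w + c *\<^sub>R ?E w))"
      by (rule nn_norm2_add_le) measurable
    also have "?N (\<lambda>w. ?B w + (- 1) *\<^sub>R (?C w + c *\<^sub>R ?E w)) \<le> 2 * ?N ?B + 2 * ?N (\<lambda>w. (- 1) *\<^sub>R (?C w + c *\<^sub>R ?E w))"
      by (rule nn_norm2_add_le) measurable
    also have "?N (\<lambda>w. (- 1) *\<^sub>R (?C w + c *\<^sub>R ?E w)) = ?N (\<lambda>w. ?C w + c *\<^sub>R ?E w)"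
      by simp (intro nn_integral_cong, metis norm_minus_cancel minus_add_distrib uminus_add_conv_diff minus_diff_eq)
    also have "?N (\<lambda>w. ?C w + c *\<^sub>R ?E w) \<le> 2 * ?N ?C + 2 * ?N (\<lambda>w. c *\<^sub>R ?E w)"
      by (rule nn_norm2_add_le) measurable
    also have "?N (\<lambda>w. c *\<^sub>R ?E w) = ennreal (c\<^sup>2) * ?N ?E"
      by (rule nn_norm2_scaleR) measurable
    finally show "?D \<le> 2 * ?N ?A + 2 * (2 * ?N ?B + 2 * (2 * ?N ?C + 2 * (ennreal (c\<^sup>2) * ?N ?E)))"
      by (simp add: add_left_mono mult_left_mono)
  qed
  then have "?D = 0" by (simp add: LIMSEQ_const_iff)
  then have "AE w in P. ennreal ((norm (I3 w - (I1 w + c *\<^sub>R I2 w)))\<^sup>2) = 0"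
    by (subst (asm) nn_integral_0_iff_AE) auto
  then show ?thesis by eventually_elim simp
qed

text \<open>The case \<open>c = 0\<close>: uniqueness is linearity applied to two versions of the
  integral of one process.\<close>

lemma ito_integral_unique_AE:
  assumes t: "t \<in> {0..T}" and j: "jointly_measurable z"
    and I: "is_ito_integral P T F B t z I" "is_ito_integral P T F B t z I'"
  shows "AE w in P. I' w = I w"
  using ito_integral_add_scaleR_AE[OF t j j I(1) I(1), of 0 I'] I(2) by simp

end

lemma square_integrable_of_close:
  fixes f g :: "'a \<Rightarrow> 'b::euclidean_space"
  assumes f: "f \<in> borel_measurable M" and g: "square_integrable M g"
    and d: "(\<integral>\<^sup>+x. ennreal ((norm (f x - g x))\<^sup>2) \<partial>M) < \<infinity>"
  shows "square_integrable M f"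
proof -
  have "square_integrable M (\<lambda>x. f x - g x)"
    unfolding square_integrable_iff_nn_integral using d f g by (auto simp: square_integrable_def)
  from square_integrable_add[OF this g] show ?thesis by simp
qed

section \<open>Construction of the continuous version\<close>

context brownian_setting
begin

text \<open>For the full space both \<open>Z\<close> and its negative are admissible test functions,
  so the inequality in the definition becomes an equality.\<close>

lemma cone_martingale_UNIV_eq_0:
  assumes X: "cone_martingale UNIV X" and st: "0 \<le> s" "s \<le> t" "t \<le> T"
    and Z: "Z \<in> borel_measurable (F s)" "square_integrable P Z"
  shows "expectation (\<lambda>w. Z w \<bullet> (X t w - X s w)) = 0"
proof -
  have "0 \<le> expectation (\<lambda>w. Z w \<bullet> (X t w - X s w))"
    using X st Z unfolding cone_martingale_def by blast
  moreover have "(\<lambda>w. - Z w) \<in> borel_measurable (F s)" "square_integrable P (\<lambda>w. - Z w)"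
    using Z by (auto simp: square_integrable_def)
  then have "0 \<le> expectation (\<lambda>w. (- Z w) \<bullet> (X t w - X s w))"
    using X st unfolding cone_martingale_def by blast
  ultimately show ?thesis by simp
qed

text \<open>Along a fast approximating sequence the maximal inequality and the first
  Borel--Cantelli lemma make the paths of the elementary integrals converge uniformly.\<close>

theorem ito_continuous_version:
  fixes z :: "real \<Rightarrow> 'w \<Rightarrow> real ^ 'm ^ 'd"
  assumes z: "z \<in> L2_prog P T F"
  obtains Y where "\<And>t. t \<in> {0..T} \<Longrightarrow> is_ito_integral P T F B t z (Y t)"
    and "AE w in P. continuous_on {0..T} (\<lambda>t. Y t w)"
    and "cone_martingale UNIV Y"
    and "(\<integral>\<^sup>+w. ennreal ((norm (Y T w))\<^sup>2) \<partial>P) = proc_norm2 z"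
    and "AE w in P. Y 0 w = 0"
proof -
  have jz: "jointly_measurable z" by (rule L2_prog_jointly_measurable[OF z])
  \<comment> \<open>The rate \<open>1/16\<close> is chosen for the maximal inequality at level
    \<open>(1/2)^j\<close>: dividing by the squared level \<open>(1/4)^j\<close> still leaves
    probabilities of order \<open>(1/4)^j\<close>, which are summable.\<close>
  have "\<exists>n \<tau> \<phi>. simple_integrand P T F n \<tau> \<phi> \<and> proc_norm2 (\<lambda>s w. z s w - simple_process n \<tau> \<phi> s w) < ennreal ((1/16) ^ j)" for j :: nat
    by (rule simple_process_dense[OF z]) simp
  then obtain n \<tau> \<phi> where s: "\<And>j::nat. simple_integrand P T F (n j) (\<tau> j) (\<phi> j)"
    and p: "\<And>j. proc_norm2 (\<lambda>s w. z s w - simple_process (n j) (\<tau> j) (\<phi> j) s w) < ennreal ((1/16) ^ j)"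
  proof -
    assume ex: "\<And>j. \<exists>n \<tau> \<phi>. simple_integrand P T F n \<tau> \<phi> \<and> proc_norm2 (\<lambda>s w. z s w - simple_process n \<tau> \<phi> s w) < ennreal ((1/16) ^ j)"
    have "\<exists>x. \<forall>j. simple_integrand P T F (fst (x j)) (fst (snd (x j))) (snd (snd (x j))) \<and>
       proc_norm2 (\<lambda>s w. z s w - simple_process (fst (x j)) (fst (snd (x j))) (snd (snd (x j))) s w) < ennreal ((1/16) ^ j)"
    proof (rule choice, rule allI)
      fix j :: nat
      obtain n \<tau> \<phi> where "simple_integrand P T F n \<tau> \<phi>" "proc_norm2 (\<lambda>s w. z s w - simple_process n \<tau> \<phi> s w) < ennreal ((1/16) ^ j)"
        using ex by blast
      then show "\<exists>x. simple_integrand P T F (fst x) (fst (snd x)) (snd (snd x)) \<and>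
       proc_norm2 (\<lambda>s w. z s w - simple_process (fst x) (fst (snd x)) (snd (snd x)) s w) < ennreal ((1/16) ^ j)"
        by (intro exI[of _ "(n, \<tau>, \<phi>)"]) simp
    qed
    then obtain x where x: "\<And>j. simple_integrand P T F (fst (x j)) (fst (snd (x j))) (snd (snd (x j)))"
       "\<And>j. proc_norm2 (\<lambda>s w. z s w - simple_process (fst (x j)) (fst (snd (x j))) (snd (snd (x j))) s w) < ennreal ((1/16) ^ j)" by blast
    show thesis by (rule that[OF x])
  qed
  note e = simple_integrand_elem[OF s]
  define S where "S j = simple_process (n j) (\<tau> j) (\<phi> j)" for j
  define X where "X j = simple_integral B (n j) (\<tau> j) (\<phi> j)" for j
  have jS: "jointly_measurable (S j)" for j
    unfolding S_def e(2) by (rule elem_process_jointly_measurable[OF e(1)])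
  have XF: "X j t \<in> borel_measurable (F t)" if "t \<in> {0..T}" for j t
    unfolding X_def e(3) by (rule elem_integral_measurable_F[OF e(1) that])
  have Xs: "square_integrable P (X j t)" if "t \<in> {0..T}" for j t
    unfolding X_def e(3) by (rule elem_integral_square_integrable[OF e(1) that])
  have XP: "X j t \<in> borel_measurable P" if "t \<in> {0..T}" for j t using Xs[OF that] by (rule square_integrable_measurable)
  have Xm: "cone_martingale UNIV (X j)" for j
    unfolding X_def e(3) by (rule elem_integral_cone_martingale[OF e(1)])
  have Xc: "AE w in P. continuous_on {0..T} (\<lambda>t. X j t w)" for j
    unfolding X_def e(3) by (rule elem_integral_continuous[OF e(1)])
  have SS: "proc_norm2 (\<lambda>s w. S k s w - S j s w) \<le> ennreal (2 * (1/16) ^ k + 2 * (1/16) ^ j)" for j k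
  proof -
    have "proc_norm2 (\<lambda>s w. S k s w - S j s w) \<le> 2 * proc_norm2 (\<lambda>s w. S k s w - z s w) + 2 * proc_norm2 (\<lambda>s w. z s w - S j s w)"
      by (rule proc_norm2_triangle[OF jS jz jS])
    also have "\<dots> \<le> 2 * ennreal ((1/16) ^ k) + 2 * ennreal ((1/16) ^ j)"
      unfolding proc_norm2_commute[of "S k" z] unfolding S_def
      by (intro add_mono mult_left_mono less_imp_le[OF p]) auto
    also have "\<dots> = ennreal (2 * (1/16) ^ k + 2 * (1/16) ^ j)" by (simp add: ennreal_mult)
    finally show ?thesis .
  qed
  have XX: "(\<integral>\<^sup>+w. ennreal ((norm (X k t w - X j t w))\<^sup>2) \<partial>P) \<le> ennreal (2 * (1/16) ^ k + 2 * (1/16) ^ j)" if "t \<in> {0..T}" for j k t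
    using elem_integral_diff_norm2_le[OF e(1)[of k] e(1)[of j] that] SS[of k j]
    unfolding X_def S_def e(2,3) by (rule order_trans)
  define A where "A j = {w \<in> space P. \<exists>q\<in>dyads T. (1/2) ^ j \<le> norm ((X (Suc j) q w - X j q w) - (X (Suc j) 0 w - X j 0 w))}" for j
  have D: "cone_martingale UNIV (\<lambda>t w. X (Suc j) t w - X j t w)" for j
  proof -
    note c = elem_add_scaleR[OF e(1)[of "Suc j"] e(1)[of j], where c="-1"]
    have "elem_integral ({..<n (Suc j)} <+> {..<n j}) (case_sum (\<tau> (Suc j)) (\<tau> j)) (case_sum (\<lambda>k. \<tau> (Suc j) (Suc k)) (\<lambda>k. \<tau> j (Suc k)))
        (case_sum (\<phi> (Suc j)) (\<lambda>k w. (-1) *\<^sub>R \<phi> j k w)) = (\<lambda>t w. X (Suc j) t w + (-1) *\<^sub>R X j t w)"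
      unfolding X_def e(3) by (intro ext) (rule c(3))
    with elem_integral_cone_martingale[OF c(1)] show ?thesis by simp
  qed
  have A: "A j \<in> sets P" for j
    unfolding A_def by (rule dyads_maximal_inequality(1)[OF D]) simp
  have T0: "T \<in> {0..T}" "0 \<in> {0..T}" using T_pos by auto
  have pA: "prob (A j) \<le> 4 * (1/4) ^ j" for j
  proof -
    have "((1/2) ^ j)\<^sup>2 * prob (A j) \<le> expectation (\<lambda>w. (norm (X (Suc j) T w - X j T w))\<^sup>2)"
      unfolding A_def by (rule dyads_maximal_inequality(2)[OF D]) simp
    also have "\<dots> \<le> 4 * (1/16) ^ j"
    proof -
      have "ennreal (expectation (\<lambda>w. (norm (X (Suc j) T w - X j T w))\<^sup>2)) \<le> ennreal (2 * (1/16) ^ Suc j + 2 * (1/16) ^ j)"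
        using XX[OF T0(1), of "Suc j" j] square_integrable_nn_integral[OF square_integrable_diff[OF Xs[OF T0(1), of "Suc j"] Xs[OF T0(1), of j]]]
        by simp
      then have "expectation (\<lambda>w. (norm (X (Suc j) T w - X j T w))\<^sup>2) \<le> 2 * (1/16) ^ Suc j + 2 * (1/16) ^ j"
        by (subst (asm) ennreal_le_iff) auto
      also have "\<dots> \<le> 4 * (1/16) ^ j" by simp
      finally show ?thesis .
    qed
    finally have "(1/4) ^ j * prob (A j) \<le> (1/4) ^ j * (4 * (1/4) ^ j)"
      by (simp add: power2_eq_square power_mult_distrib[symmetric] mult.left_commute)
    then show ?thesis by (subst (asm) mult_le_cancel_left_pos) auto
  qed
  have "summable (\<lambda>j. prob (A j))"
    by (rule summable_comparison_test'[where g="\<lambda>j. 4 * (1/4) ^ j" and N=0])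
       (use pA in \<open>auto intro!: summable_mult summable_geometric\<close>)
  then have BC: "AE w in P. eventually (\<lambda>j. w \<in> space P - A j) sequentially"
    by (intro borel_cantelli_AE1 A) (auto simp: emeasure_eq_measure)
  have X0: "X j 0 w = 0" for j w unfolding X_def e(3) using e(1) by simp
  \<comment> \<open>A pointwise \<open>lim\<close> on the whole space inherits
    \<open>F t\<close>-measurability directly; where the sequence diverges its value is
    arbitrary.\<close>
  define Y where "Y t w = lim (\<lambda>j. X j t w)" for t w
  have unif: "AE w in P. uniform_limit {0..T} (\<lambda>j t. X j t w) (\<lambda>t. Y t w) sequentially \<and> (\<forall>j. continuous_on {0..T} (\<lambda>t. X j t w))"
  proof -
    have "AE w in P. \<forall>j. continuous_on {0..T} (\<lambda>t. X j t w)" using Xc by (simp add: AE_all_countable)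
    with BC show ?thesis
    proof eventually_elim
      case (elim w)
      then obtain N where N: "\<And>j. N \<le> j \<Longrightarrow> w \<in> space P - A j" by (auto simp: eventually_sequentially)
      have b: "norm (X (Suc j) t w - X j t w) \<le> (1/2) ^ j" if j: "N \<le> j" and t: "t \<in> {0..T}" for j t
      proof (rule dyads_bound_extend[OF T_pos _ _ t])
        show "continuous_on {0..T} (\<lambda>t. X (Suc j) t w - X j t w)"
          using elim(2) by (intro continuous_on_diff) auto
        fix q assume "q \<in> dyads T"
        then show "norm (X (Suc j) q w - X j q w) \<le> (1/2) ^ j"
          using N[OF j] by (auto simp: A_def X0 not_le less_imp_le)
      qed
      \<comment> \<open>From index \<open>N\<close> on the differences are below a geometric
        sequence uniformly in time, so the telescoping series converges uniformly.\<close>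
      have "uniform_limit {0..T} (\<lambda>n t. \<Sum>i<n. X (Suc i) t w - X i t w) (\<lambda>t. \<Sum>i. X (Suc i) t w - X i t w) sequentially"
      proof (rule Weierstrass_m_test_ev)
        show "\<forall>\<^sub>F n in sequentially. \<forall>t\<in>{0..T}. norm (X (Suc n) t w - X n t w) \<le> (1/2) ^ n"
          using b by (intro eventually_sequentiallyI[of N]) auto
      qed (auto intro!: summable_geometric)
      moreover have "(\<Sum>i<n. X (Suc i) t w - X i t w) = X n t w - X 0 t w" for n t
        using sum_lessThan_telescope[of "\<lambda>i. X i t w" n] .
      ultimately have U: "uniform_limit {0..T} (\<lambda>n t. X n t w - X 0 t w) (\<lambda>t. \<Sum>i. X (Suc i) t w - X i t w) sequentially" by simp
      have U2: "uniform_limit {0..T} (\<lambda>n t. X n t w) (\<lambda>t. (\<Sum>i. X (Suc i) t w - X i t w) + X 0 t w) sequentially"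
        using uniform_limit_add[OF U uniform_limit_const[of "\<lambda>t. X 0 t w" "{0..T}" sequentially]] by simp
      have "Y t w = (\<Sum>i. X (Suc i) t w - X i t w) + X 0 t w" if "t \<in> {0..T}" for t
        unfolding Y_def using tendsto_uniform_limitI[OF U2 that] by (rule limI)
      then have "uniform_limit {0..T} (\<lambda>n t. X n t w) (\<lambda>t. Y t w) sequentially"
        using U2 uniform_limit_cong'[of "{0..T}" "\<lambda>n t. X n t w" "\<lambda>n t. X n t w" "\<lambda>t. Y t w" "\<lambda>t. (\<Sum>i. X (Suc i) t w - X i t w) + X 0 t w" sequentially] by simp
      with elim show ?case by blast
    qed
  qed
  have cont: "AE w in P. continuous_on {0..T} (\<lambda>t. Y t w)"
    using unif
  proof eventually_elim
    case (elim w)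
    then show ?case by (intro uniform_limit_theorem[where f="\<lambda>n t. X n t w" and F=sequentially]) auto
  qed
  have YF: "Y t \<in> borel_measurable (F t)" if "t \<in> {0..T}" for t
    unfolding Y_def[abs_def] using XF[OF that] by (rule borel_measurable_lim_metric)
  have YP[measurable]: "Y t \<in> borel_measurable P" if "t \<in> {0..T}" for t
    using YF[OF that] that by (intro measurable_F_P[of t]) auto
  \<comment> \<open>Fatou's lemma passes the Cauchy bound from \<open>X k\<close> to the limit and
    keeps the rate in \<open>j\<close>.\<close>
  have YX: "(\<integral>\<^sup>+w. ennreal ((norm (Y t w - X j t w))\<^sup>2) \<partial>P) \<le> ennreal (4 * (1/16) ^ j)" if t: "t \<in> {0..T}" for t j
  proof -
    have "AE w in P. (\<lambda>k. X k t w) \<longlonglongrightarrow> Y t w"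
      using unif by eventually_elim (use t in \<open>auto intro: tendsto_uniform_limitI\<close>)
    then have "AE w in P. ennreal ((norm (Y t w - X j t w))\<^sup>2) = liminf (\<lambda>k. ennreal ((norm (X k t w - X j t w))\<^sup>2))"
    proof eventually_elim
      case (elim w)
      have "(\<lambda>k. ennreal ((norm (X k t w - X j t w))\<^sup>2)) \<longlonglongrightarrow> ennreal ((norm (Y t w - X j t w))\<^sup>2)"
        by (intro tendsto_ennrealI tendsto_intros elim)
      from lim_imp_Liminf[OF _ this] show ?case by simp
    qed
    then have "(\<integral>\<^sup>+w. ennreal ((norm (Y t w - X j t w))\<^sup>2) \<partial>P) = (\<integral>\<^sup>+w. liminf (\<lambda>k. ennreal ((norm (X k t w - X j t w))\<^sup>2)) \<partial>P)"
      by (rule nn_integral_cong_AE)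
    also have "\<dots> \<le> liminf (\<lambda>k. \<integral>\<^sup>+w. ennreal ((norm (X k t w - X j t w))\<^sup>2) \<partial>P)"
      using XP[OF t] by (intro nn_integral_liminf) measurable
    also have "\<dots> \<le> ennreal (4 * (1/16) ^ j)"
    proof (rule Liminf_le)
      show "\<forall>\<^sub>F k in sequentially. (\<integral>\<^sup>+w. ennreal ((norm (X k t w - X j t w))\<^sup>2) \<partial>P) \<le> ennreal (4 * (1/16) ^ j)"
      proof (rule eventually_sequentiallyI[of j])
        fix k assume "j \<le> k"
        then have "(1/16::real) ^ k \<le> (1/16) ^ j" by (intro power_decreasing) auto
        then have "ennreal (2 * (1/16) ^ k + 2 * (1/16) ^ j) \<le> ennreal (4 * (1/16) ^ j)" by (intro ennreal_leI) linarith
        then show "(\<integral>\<^sup>+w. ennreal ((norm (X k t w - X j t w))\<^sup>2) \<partial>P) \<le> ennreal (4 * (1/16) ^ j)"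
          using XX[OF t, of k j] by (rule order_trans[rotated])
      qed
    qed simp
    finally show ?thesis .
  qed
  have g0: "(\<lambda>j. ennreal (c * (1/16) ^ j)) \<longlonglongrightarrow> 0" for c :: real
  proof -
    have "(\<lambda>j. c * (1/16) ^ j) \<longlonglongrightarrow> c * 0" by (intro tendsto_mult_left LIMSEQ_power_zero) auto
    then have "(\<lambda>j. ennreal (c * (1/16) ^ j)) \<longlonglongrightarrow> ennreal (c * 0)" by (rule tendsto_ennrealI)
    then show ?thesis by simp
  qed
  have YX0: "(\<lambda>j. \<integral>\<^sup>+w. ennreal ((norm (Y t w - X j t w))\<^sup>2) \<partial>P) \<longlonglongrightarrow> 0" if "t \<in> {0..T}" for t
    by (rule tendsto_0_le_ennreal[OF g0 YX[OF that]])
  have pS: "(\<lambda>j. proc_norm2 (\<lambda>s w. z s w - S j s w)) \<longlonglongrightarrow> 0"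
    by (rule tendsto_0_le_ennreal[OF g0[of 1]]) (use p in \<open>auto simp: S_def less_imp_le\<close>)
  have ito: "is_ito_integral P T F B t z (Y t)" if t: "t \<in> {0..T}" for t
    unfolding is_ito_integral_def
    using YF[OF t] s pS[unfolded S_def proc_norm2_def] YX0[OF t, unfolded X_def] by blast
  have Ys: "square_integrable P (Y t)" if t: "t \<in> {0..T}" for t
    by (rule square_integrable_of_close[OF YP[OF t] Xs[OF t, of 0]])
       (use YX[OF t, of 0] in \<open>auto intro: le_less_trans\<close>)
  have rL: "(\<lambda>j. expectation (\<lambda>w. (norm (Y t w - X j t w))\<^sup>2)) \<longlonglongrightarrow> 0" if t: "t \<in> {0..T}" for t
    by (intro tendsto_real_of_nn_integral square_integrable_diff Ys Xs t YX0)
  have mart: "cone_martingale UNIV Y"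
    unfolding cone_martingale_def
  proof (intro conjI ballI allI impI)
    fix r t :: real and Z :: "'w \<Rightarrow> real ^ 'd"
    assume rt: "0 \<le> r" "r \<le> t" "t \<le> T" and Z: "Z \<in> borel_measurable (F r)" "square_integrable P Z"
    then have r: "r \<in> {0..T}" and t: "t \<in> {0..T}" by auto
    have "(\<lambda>j. expectation (\<lambda>w. Z w \<bullet> X j t w) - expectation (\<lambda>w. Z w \<bullet> X j r w)) \<longlonglongrightarrow>
      expectation (\<lambda>w. Z w \<bullet> Y t w) - expectation (\<lambda>w. Z w \<bullet> Y r w)"
      by (intro tendsto_diff tendsto_integral_inner Z Ys Xs rL r t)
    moreover have "expectation (\<lambda>w. Z w \<bullet> X j t w) - expectation (\<lambda>w. Z w \<bullet> X j r w) = 0" for j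
      using cone_martingale_UNIV_eq_0[OF Xm rt Z, of j] square_integrable_inner[OF Z(2) Xs[OF t]] square_integrable_inner[OF Z(2) Xs[OF r]]
      by (simp add: inner_diff_right)
    ultimately have "expectation (\<lambda>w. Z w \<bullet> Y t w) - expectation (\<lambda>w. Z w \<bullet> Y r w) = 0" by (simp add: LIMSEQ_const_iff)
    then show "0 \<le> expectation (\<lambda>w. Z w \<bullet> (Y t w - Y r w))"
      using square_integrable_inner[OF Z(2) Ys[OF t]] square_integrable_inner[OF Z(2) Ys[OF r]]
      by (simp add: inner_diff_right)
  qed (use YF Ys in auto)
  \<comment> \<open>Both norms pass to the limit, one on the probability space and one on its
    product with time; the isometry for elementary integrands makes the two sequences equal.\<close>
  have iso: "(\<integral>\<^sup>+w. ennreal ((norm (Y T w))\<^sup>2) \<partial>P) = proc_norm2 z"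
  proof -
    have 1: "(\<lambda>j. expectation (\<lambda>w. (norm (X j T w))\<^sup>2)) \<longlonglongrightarrow> expectation (\<lambda>w. (norm (Y T w))\<^sup>2)"
      by (intro tendsto_integral_norm2 Ys Xs rL T0)
    define M where "M = P \<Otimes>\<^sub>M (lborel :: real measure)"
    define emb where "emb y = (\<lambda>(w, s). indicator {0..T} s *\<^sub>R y s w)" for y :: "real \<Rightarrow> 'w \<Rightarrow> real ^ 'm ^ 'd"
    have nn: "(\<integral>\<^sup>+x. ennreal ((norm (emb y x))\<^sup>2) \<partial>M) = proc_norm2 y" if "jointly_measurable y" for y
      unfolding proc_norm2_eq[OF that] M_def by (intro nn_integral_cong) (auto simp: emb_def indicator_def)
    have m: "emb y \<in> borel_measurable M" if "jointly_measurable y" for y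
      using that unfolding jointly_measurable_def emb_def M_def .
    have isoX: "(\<integral>\<^sup>+w. ennreal ((norm (X j T w))\<^sup>2) \<partial>P) = proc_norm2 (S j)" for j
      using elem_isometry[OF e(1)[of j]] unfolding X_def S_def e(2,3) proc_norm2_def .
    have sS: "square_integrable M (emb (S j))" for j
      unfolding square_integrable_iff_nn_integral nn[OF jS] isoX[symmetric] square_integrable_nn_integral[OF Xs[OF T0(1)]]
      using m[OF jS] by simp
    have sz: "square_integrable M (emb z)"
      unfolding square_integrable_iff_nn_integral nn[OF jz] using m[OF jz] L2_prog_norm2[OF z] by simp
    have emb_diff: "emb z x - emb (S j) x = emb (\<lambda>s w. z s w - S j s w) x" for x j
      by (cases x) (simp add: emb_def scaleR_diff_right)
    have "(\<lambda>j. \<integral>x. (norm (emb z x - emb (S j) x))\<^sup>2 \<partial>M) \<longlonglongrightarrow> 0"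
    proof (rule tendsto_real_of_nn_integral)
      show "(\<lambda>j. \<integral>\<^sup>+x. ennreal ((norm (emb z x - emb (S j) x))\<^sup>2) \<partial>M) \<longlonglongrightarrow> 0"
        unfolding emb_diff nn[OF jointly_measurable_diff[OF jz jS]] by (rule pS)
    qed (intro square_integrable_diff sz sS)
    then have 2: "(\<lambda>j. \<integral>x. (norm (emb (S j) x))\<^sup>2 \<partial>M) \<longlonglongrightarrow> (\<integral>x. (norm (emb z x))\<^sup>2 \<partial>M)"
      by (intro tendsto_integral_norm2 sS sz)
    have "(\<integral>x. (norm (emb (S j) x))\<^sup>2 \<partial>M) = expectation (\<lambda>w. (norm (X j T w))\<^sup>2)" for j
    proof -
      have "ennreal (\<integral>x. (norm (emb (S j) x))\<^sup>2 \<partial>M) = ennreal (expectation (\<lambda>w. (norm (X j T w))\<^sup>2))"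
        unfolding square_integrable_nn_integral[OF sS, symmetric] square_integrable_nn_integral[OF Xs[OF T0(1)], symmetric]
          nn[OF jS] isoX ..
      then show ?thesis by (subst (asm) ennreal_inj) auto
    qed
    with 1 2 have "(\<integral>x. (norm (emb z x))\<^sup>2 \<partial>M) = expectation (\<lambda>w. (norm (Y T w))\<^sup>2)" using LIMSEQ_unique by fastforce
    then show ?thesis
      unfolding square_integrable_nn_integral[OF Ys[OF T0(1)]] nn[OF jz, symmetric] square_integrable_nn_integral[OF sz] by simp
  qed
  have "AE w in P. Y 0 w = 0"
  proof -
    have "(\<integral>\<^sup>+w. ennreal ((norm (Y 0 w))\<^sup>2) \<partial>P) = 0"
      using YX0[OF T0(2)] by (simp add: X0 LIMSEQ_const_iff)
    then have "AE w in P. ennreal ((norm (Y 0 w))\<^sup>2) = 0"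
      using YP[OF T0(2)] by (subst (asm) nn_integral_0_iff_AE) auto
    then show ?thesis by eventually_elim simp
  qed
  then show ?thesis using that ito cont mart iso by blast
qed

lemma is_ito_integral_ito_integral:
  assumes "z \<in> L2_prog P T F" "t \<in> {0..T}"
  shows "is_ito_integral P T F B t z (ito_integral P T F B t z)"
  unfolding ito_integral_def
proof -
  have "\<exists>I. is_ito_integral P T F B t z I"
    by (rule ito_continuous_version[OF assms(1)], rule exI, drule meta_spec, erule meta_mp, rule assms(2))
  then show "is_ito_integral P T F B t z (SOME I. is_ito_integral P T F B t z I)" by (rule someI_ex)
qed

text \<open>The integral chosen by \<open>SOME\<close> agrees with the continuous version at each
  time, up to a null set that depends on the time; path arguments are therefore carried out for
  \<open>Y\<close>.\<close>

theorem ito_version: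
  fixes z :: "real \<Rightarrow> 'w \<Rightarrow> real ^ 'm ^ 'd"
  assumes z: "z \<in> L2_prog P T F"
  shows "\<exists>Y. (\<forall>t\<in>{0..T}. AE w in P. ito_integral P T F B t z w = Y t w) \<and>
    (AE w in P. continuous_on {0..T} (\<lambda>t. Y t w)) \<and> cone_martingale UNIV Y \<and>
    (\<integral>\<^sup>+w. ennreal ((norm (Y T w))\<^sup>2) \<partial>P) = proc_norm2 z \<and> (AE w in P. Y 0 w = 0)"
proof -
  obtain Y where Y: "\<And>t. t \<in> {0..T} \<Longrightarrow> is_ito_integral P T F B t z (Y t)"
    "AE w in P. continuous_on {0..T} (\<lambda>t. Y t w)" "cone_martingale UNIV Y"
    "(\<integral>\<^sup>+w. ennreal ((norm (Y T w))\<^sup>2) \<partial>P) = proc_norm2 z" "AE w in P. Y 0 w = 0"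
    by (rule ito_continuous_version[OF z], rule that; assumption)
  have "AE w in P. ito_integral P T F B t z w = Y t w" if "t \<in> {0..T}" for t
    by (rule ito_integral_unique_AE[OF that L2_prog_jointly_measurable[OF z] Y(1)[OF that] is_ito_integral_ito_integral[OF z that]])
  with Y show ?thesis by blast
qed

lemma ito_integral_measurable:
  "z \<in> L2_prog P T F \<Longrightarrow> t \<in> {0..T} \<Longrightarrow> ito_integral P T F B t z \<in> borel_measurable (F t)"
  by (rule is_ito_measurable(1)[OF is_ito_integral_ito_integral])

lemma ito_integral_square_integrable:
  assumes "z \<in> L2_prog P T F" "t \<in> {0..T}"
  shows "square_integrable P (ito_integral P T F B t z)"
proof -
  obtain Y where Y: "AE w in P. ito_integral P T F B t z w = Y t w" "cone_martingale UNIV Y"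
    using ito_version[OF assms(1)] assms(2) by blast
  show ?thesis
    by (rule square_integrable_bound[OF is_ito_measurable(2)[OF is_ito_integral_ito_integral[OF assms] assms(2)] cone_martingaleD(2)[OF Y(2) assms(2)]])
       (use Y(1) in eventually_elim, simp)
qed

end

section \<open>Measurable selections and decomposable hulls\<close>

text \<open>Sublevel sets of the distance are hitting events of closed balls, because the distance
  to a nonempty closed set is attained in finite dimension.\<close>

lemma measurable_infdist_set_valued:
  assumes X: "set_valued_rv G X"
  shows "(\<lambda>w. infdist a (X w)) \<in> borel_measurable G"
  unfolding borel_measurable_iff_le
proof
  fix r
  have "{w \<in> space G. infdist a (X w) \<le> r} = {w \<in> space G. X w \<inter> cball a r \<noteq> {}}"
  proof (intro Collect_cong conj_cong refl)
    fix w assume "w \<in> space G"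
    then have c: "X w \<noteq> {}" "closed (X w)" using X unfolding set_valued_rv_def by auto
    show "infdist a (X w) \<le> r \<longleftrightarrow> X w \<inter> cball a r \<noteq> {}"
    proof
      assume "infdist a (X w) \<le> r"
      moreover obtain y where "y \<in> X w" "infdist a (X w) = dist a y" using infdist_attains_inf[OF c(2,1)] by blast
      ultimately show "X w \<inter> cball a r \<noteq> {}" by auto
    next
      assume "X w \<inter> cball a r \<noteq> {}"
      then obtain y where "y \<in> X w" "dist a y \<le> r" by auto
      then show "infdist a (X w) \<le> r" using infdist_le[of y "X w" a] by linarith
    qed
  qed
  then show "{w \<in> space G. infdist a (X w) \<le> r} \<in> sets G" using X unfolding set_valued_rv_def by auto
qed

lemma dense_sequence: "\<exists>q :: nat \<Rightarrow> 'a::euclidean_space. \<forall>x e. 0 < e \<longrightarrow> (\<exists>k. dist (q k) x < e)"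
proof -
  obtain D :: "'a set" where D: "countable D" "\<And>X. open X \<Longrightarrow> X \<noteq> {} \<Longrightarrow> \<exists>d\<in>D. d \<in> X"
    by (rule countable_dense_setE) blast
  have ne: "D \<noteq> {}" using D(2)[of UNIV] by auto
  have "\<exists>k. dist (from_nat_into D k) x < e" if "0 < e" for x e
  proof -
    have "\<exists>d\<in>D. d \<in> ball x e" using D(2)[of "ball x e"] that by auto
    then obtain d where "d \<in> D" "dist d x < e" by (auto simp: dist_commute)
    then show ?thesis using from_nat_into_surj[OF D(1)] by metis
  qed
  then show ?thesis by blast
qed

text \<open>Kuratowski--Ryll-Nardzewski: successive approximation by the first points of a dense
  sequence that are close both to the set and to the previous approximation.\<close>

theorem measurable_selection:
  fixes X :: "'w \<Rightarrow> 'a::euclidean_space set"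
  assumes X: "set_valued_rv G X"
  shows "\<exists>\<xi>. \<xi> \<in> borel_measurable G \<and> (\<forall>w\<in>space G. \<xi> w \<in> X w)"
proof -
  obtain q :: "nat \<Rightarrow> 'a" where q: "\<And>x e. 0 < e \<Longrightarrow> \<exists>k. dist (q k) x < e" using dense_sequence by blast
  have Xc: "X w \<noteq> {}" "closed (X w)" if "w \<in> space G" for w using X that unfolding set_valued_rv_def by auto
  define k0 where "k0 w = (LEAST k. infdist (q k) (X w) < 1)" for w
  \<comment> \<open>\<open>LEAST\<close> makes the choice measurable. A point at distance below
    \<open>(1/2)^n\<close> from the set has a dense point within \<open>(1/2)^Suc n\<close> of its
    nearest point in the set, hence within \<open>2 * (1/2)^n\<close> of the given point; these step
    lengths are summable.\<close>
  define ks where "ks n y w = (LEAST k. infdist (q k) (X w) < (1/2) ^ Suc n \<and> dist (q k) y < 2 * (1/2) ^ n)" for n :: nat and y w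
  define f where "f = rec_nat (\<lambda>w. q (k0 w)) (\<lambda>n g w. q (ks n (g w) w))"
  have f0: "f 0 w = q (k0 w)" and fS: "f (Suc n) w = q (ks n (f n w) w)" for n w by (simp_all add: f_def)
  have [measurable]: "(\<lambda>w. infdist a (X w)) \<in> borel_measurable G" for a by (rule measurable_infdist_set_valued[OF X])
  have [measurable]: "q \<in> measurable (count_space UNIV) borel" by simp
  have fm: "f n \<in> borel_measurable G" for n
  proof (induction n)
    case 0
    have "k0 \<in> measurable G (count_space UNIV)" unfolding k0_def[abs_def] by measurable
    then have "(\<lambda>w. q (k0 w)) \<in> borel_measurable G" by measurable
    then show ?case unfolding f0[abs_def, symmetric] by simp
  next
    case (Suc n)
    note [measurable] = Suc
    have "(\<lambda>w. ks n (f n w) w) \<in> measurable G (count_space UNIV)" unfolding ks_def by measurable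
    then have "(\<lambda>w. q (ks n (f n w) w)) \<in> borel_measurable G" by measurable
    then show ?case unfolding fS[abs_def, symmetric] by simp
  qed
  have ex: "\<exists>k. infdist (q k) (X w) < (1/2) ^ Suc n \<and> dist (q k) y < 2 * (1/2) ^ n"
    if w: "w \<in> space G" and y: "infdist y (X w) < (1/2) ^ n" for n y w
  proof -
    obtain x where x: "x \<in> X w" "infdist y (X w) = dist y x" using infdist_attains_inf[OF Xc(2,1)] w by blast
    obtain k where k: "dist (q k) x < (1/2) ^ Suc n" using q[of "(1/2) ^ Suc n" x] by auto
    have "infdist (q k) (X w) < (1/2) ^ Suc n" using infdist_le[OF x(1), of "q k"] k by linarith
    moreover have "dist (q k) y \<le> dist (q k) x + dist y x" by (rule dist_triangle2)
    then have "dist (q k) y < 2 * (1/2) ^ n"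
      using k x(2) y zero_less_power[of "1/2::real" n] power_Suc[of "1/2::real" n] by linarith
    ultimately show ?thesis by blast
  qed
  have id: "infdist (f n w) (X w) < (1/2) ^ n" if w: "w \<in> space G" for n w
  proof (induction n)
    case 0
    obtain x where x: "x \<in> X w" using Xc w by blast
    obtain k where k: "dist (q k) x < 1" using q[of 1 x] by auto
    have "infdist (q k) (X w) < 1" using infdist_le[OF x(1), of "q k"] k by linarith
    then have "infdist (q (k0 w)) (X w) < 1" unfolding k0_def by (rule LeastI)
    then show ?case by (simp add: f0)
  next
    case (Suc n)
    from LeastI_ex[OF ex[OF w Suc]] show ?case unfolding fS ks_def by blast
  qed
  have step: "dist (f (Suc n) w) (f n w) < 2 * (1/2) ^ n" if w: "w \<in> space G" for n w
    using LeastI_ex[OF ex[OF w id[OF w, of n]]] unfolding fS ks_def by blast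
  have conv: "(\<lambda>n. f n w) \<longlonglongrightarrow> lim (\<lambda>n. f n w)" if w: "w \<in> space G" for w
  proof -
    have "summable (\<lambda>n. f (Suc n) w - f n w)"
    proof (rule summable_comparison_test'[where g="\<lambda>n. 2 * (1/2) ^ n" and N=0])
      show "summable (\<lambda>n. 2 * (1 / 2) ^ n :: real)" by (intro summable_mult summable_geometric) simp
      show "norm (f (Suc n) w - f n w) \<le> 2 * (1/2) ^ n" for n using step[OF w, of n] by (simp add: dist_norm)
    qed
    then have "(\<lambda>n. \<Sum>i<n. f (Suc i) w - f i w) \<longlonglongrightarrow> (\<Sum>i. f (Suc i) w - f i w)" by (rule summable_LIMSEQ)
    then have "(\<lambda>n. f n w - f 0 w) \<longlonglongrightarrow> (\<Sum>i. f (Suc i) w - f i w)"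
      using sum_lessThan_telescope[of "\<lambda>i. f i w"] by simp
    from tendsto_add[OF this tendsto_const[of "f 0 w"]] have "convergent (\<lambda>n. f n w)" unfolding convergent_def by auto
    then show ?thesis by (simp add: convergent_LIMSEQ_iff)
  qed
  have "lim (\<lambda>n. f n w) \<in> X w" if w: "w \<in> space G" for w
  proof -
    have "(\<lambda>n. infdist (f n w) (X w)) \<longlonglongrightarrow> infdist (lim (\<lambda>n. f n w)) (X w)" by (intro tendsto_infdist conv w)
    moreover have "(\<lambda>n. infdist (f n w) (X w)) \<longlonglongrightarrow> 0"
    proof (rule tendsto_sandwich[OF _ _ tendsto_const])
      show "(\<lambda>n. (1/2) ^ n :: real) \<longlonglongrightarrow> 0" by (intro LIMSEQ_power_zero) simp
    qed (use id[OF w] in \<open>auto simp: infdist_nonneg less_imp_le\<close>)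
    ultimately have "infdist (lim (\<lambda>n. f n w)) (X w) = 0" by (rule LIMSEQ_unique)
    then show ?thesis using in_closed_iff_infdist_zero[OF Xc(2)[OF w] Xc(1)[OF w]] by simp
  qed
  moreover have "(\<lambda>w. lim (\<lambda>n. f n w)) \<in> borel_measurable G" by (rule borel_measurable_lim_metric[OF fm])
  ultimately show ?thesis by blast
qed

text \<open>If \<open>X w\<close> is not contained in \<open>Y w\<close>, some ball from a countable
  family meets \<open>X w\<close> and misses \<open>Y w\<close>. On the event \<open>A k n\<close>
  where this happens, a selection of \<open>X\<close> inside the ball replaces
  \<open>\<xi>0\<close>; the result is a square-integrable selection of \<open>X\<close>, hence of
  \<open>Y\<close>, which forces \<open>A k n\<close> to be null.\<close>

lemma S2_subset_imp_AE_subset: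
  fixes X Y :: "'w \<Rightarrow> 'a::euclidean_space set"
  assumes fin: "finite_measure P" and G: "sets G \<subseteq> sets P" "space G = space P"
    and X: "set_valued_rv G X" and Y: "set_valued_rv G Y"
    and S: "S2 P G X \<subseteq> S2 P G Y" "S2 P G X \<noteq> {}"
  shows "AE w in P. X w \<subseteq> Y w"
proof -
  interpret finite_measure P by (rule fin)
  have GP: "f \<in> borel_measurable G \<Longrightarrow> f \<in> borel_measurable P" for f :: "'w \<Rightarrow> 'a"
    using G unfolding measurable_def by auto
  obtain q :: "nat \<Rightarrow> 'a" where q: "\<And>x e. 0 < e \<Longrightarrow> \<exists>k. dist (q k) x < e" using dense_sequence by blast
  obtain \<xi>0 where \<xi>0: "\<xi>0 \<in> S2 P G X" using S(2) by blast
  define A where "A k n = {w \<in> space P. X w \<inter> cball (q k) (1 / real (Suc n)) \<noteq> {}} \<inter> {w \<in> space P. Y w \<inter> cball (q k) (1 / real (Suc n)) = {}}" for k n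
  have AG: "A k n \<in> sets G" for k n
  proof -
    have 1: "{w \<in> space P. X w \<inter> cball (q k) (1 / real (Suc n)) \<noteq> {}} \<in> sets G"
      using X G(2) unfolding set_valued_rv_def by auto
    have "{w \<in> space P. Y w \<inter> cball (q k) (1 / real (Suc n)) \<noteq> {}} \<in> sets G"
      using Y G(2) unfolding set_valued_rv_def by auto
    from sets.compl_sets[OF this] have "{w \<in> space P. Y w \<inter> cball (q k) (1 / real (Suc n)) = {}} \<in> sets G"
      using G(2) by (simp add: set_diff_eq conj_commute[of "_ \<in> _"] cong: conj_cong)
    with 1 show ?thesis unfolding A_def by auto
  qed
  have "AE w in P. w \<notin> A k n" for k n
  proof -
    let ?C = "cball (q k) (1 / real (Suc n))"
    \<comment> \<open>The value \<open>{0}\<close> off \<open>A k n\<close> only keeps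
      \<open>X'\<close> nonempty and closed; it is discarded when the selection is glued with
      \<open>\<xi>0\<close>.\<close>
    define X' where "X' w = (if w \<in> A k n then X w \<inter> ?C else {0})" for w
    have "set_valued_rv G X'"
      unfolding set_valued_rv_def
    proof (intro conjI ballI allI impI)
      fix w assume "w \<in> space G"
      then show "X' w \<noteq> {}" "closed (X' w)"
        using X unfolding set_valued_rv_def X'_def by (auto simp: A_def intro: closed_Int)
    next
      fix D :: "'a set" assume D: "closed D"
      have "{w \<in> space G. X' w \<inter> D \<noteq> {}} = (A k n \<inter> {w \<in> space G. X w \<inter> (?C \<inter> D) \<noteq> {}}) \<union> (if 0 \<in> D then space G - A k n else {})"
        using G(2) by (auto simp: X'_def A_def split: if_splits)
      moreover have "{w \<in> space G. X w \<inter> (?C \<inter> D) \<noteq> {}} \<in> sets G"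
        using X closed_Int[OF closed_cball D] unfolding set_valued_rv_def by blast
      ultimately show "{w \<in> space G. X' w \<inter> D \<noteq> {}} \<in> sets G" using AG[of k n] by auto
    qed
    from measurable_selection[OF this] obtain \<xi>' where \<xi>': "\<xi>' \<in> borel_measurable G" "\<And>w. w \<in> space P \<Longrightarrow> \<xi>' w \<in> X' w"
      using G(2) by auto
    define \<xi> where "\<xi> w = (if w \<in> A k n then \<xi>' w else \<xi>0 w)" for w
    have \<xi>0G: "\<xi>0 \<in> borel_measurable G" using \<xi>0 unfolding S2_def by auto
    have \<xi>G: "\<xi> \<in> borel_measurable G"
      unfolding \<xi>_def[abs_def] by (rule measurable_If_set[OF \<xi>'(1) \<xi>0G]) (use AG[of k n] sets.sets_into_space in auto)
    have b: "norm (\<xi> w) \<le> norm (q k) + 1" if "w \<in> A k n" for w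
    proof -
      have "w \<in> space P" using that by (auto simp: A_def)
      then have "\<xi>' w \<in> ?C" using \<xi>'(2)[of w] that by (auto simp: X'_def)
      then have "dist (q k) (\<xi>' w) \<le> 1 / real (Suc n)" by simp
      also have "\<dots> \<le> 1" by simp
      finally have "dist (q k) (\<xi>' w) \<le> 1" .
      then show ?thesis using that norm_triangle_ineq2[of "\<xi>' w" "q k"] by (simp add: \<xi>_def dist_norm norm_minus_commute)
    qed
    have "integrable P (\<lambda>w. (norm (\<xi> w))\<^sup>2)"
    proof (rule Bochner_Integration.integrable_bound[of P "\<lambda>w. (norm (q k) + 1)\<^sup>2 + (norm (\<xi>0 w))\<^sup>2"])
      show "integrable P (\<lambda>w. (norm (q k) + 1)\<^sup>2 + (norm (\<xi>0 w))\<^sup>2)" using \<xi>0 unfolding S2_def by auto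
      show "(\<lambda>w. (norm (\<xi> w))\<^sup>2) \<in> borel_measurable P" using GP[OF \<xi>G] by measurable
      show "AE w in P. norm ((norm (\<xi> w))\<^sup>2) \<le> norm ((norm (q k) + 1)\<^sup>2 + (norm (\<xi>0 w))\<^sup>2)"
      proof (rule AE_I2)
        fix w
        show "norm ((norm (\<xi> w))\<^sup>2) \<le> norm ((norm (q k) + 1)\<^sup>2 + (norm (\<xi>0 w))\<^sup>2)"
        proof (cases "w \<in> A k n")
          case True
          have "(norm (\<xi> w))\<^sup>2 \<le> (norm (q k) + 1)\<^sup>2" using b[OF True] by (intro power_mono) auto
          also have "\<dots> \<le> (norm (q k) + 1)\<^sup>2 + (norm (\<xi>0 w))\<^sup>2" by simp
          finally show ?thesis by simp
        qed (simp add: \<xi>_def)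
      qed
    qed
    moreover have "AE w in P. \<xi> w \<in> X w"
    proof -
      have "AE w in P. \<xi>0 w \<in> X w" using \<xi>0 unfolding S2_def by auto
      then show ?thesis
      proof (rule AE_mp, intro AE_I2 impI)
        fix w assume "w \<in> space P" "\<xi>0 w \<in> X w"
        then show "\<xi> w \<in> X w" using \<xi>'(2)[of w] by (auto simp: \<xi>_def X'_def)
      qed
    qed
    ultimately have "\<xi> \<in> S2 P G X" unfolding S2_def using \<xi>G by simp
    then have "\<xi> \<in> S2 P G Y" using S(1) by blast
    then have "AE w in P. \<xi> w \<in> Y w" by (simp add: S2_def)
    then show ?thesis
    proof (rule AE_mp, intro AE_I2 impI notI)
      fix w assume w: "w \<in> space P" "\<xi> w \<in> Y w" "w \<in> A k n"
      then have "\<xi> w \<in> ?C" using \<xi>'(2)[of w] by (auto simp: \<xi>_def X'_def)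
      then show False using w unfolding A_def by blast
    qed
  qed
  then have "AE w in P. \<forall>k n. w \<notin> A k n" by (simp add: AE_all_countable)
  with AE_space[of P] show ?thesis
  proof eventually_elim
    case (elim w)
    then have w: "w \<in> space P" and nA: "\<forall>k n. w \<notin> A k n" by auto
    show ?case
    proof (rule subsetI, rule ccontr)
    fix x assume x: "x \<in> X w" "x \<notin> Y w"
    have c: "closed (Y w)" using Y w G(2) unfolding set_valued_rv_def by auto
    then have "open (- Y w)" by auto
    then obtain e where e: "0 < e" "ball x e \<subseteq> - Y w" using x openE[of "- Y w" x] by auto
    \<comment> \<open>A closed ball of radius below \<open>e/2\<close> that contains
      \<open>x\<close> lies in \<open>ball x e\<close> and therefore misses
      \<open>Y w\<close>.\<close>
    obtain n where n: "1 / real (Suc n) < e / 2" using nat_approx_posE[of "e/2"] e by auto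
    obtain k where k: "dist (q k) x < 1 / real (Suc n)" using q[of "1 / real (Suc n)" x] by auto
    have "x \<in> X w \<inter> cball (q k) (1 / real (Suc n))" using x k by auto
    moreover have "Y w \<inter> cball (q k) (1 / real (Suc n)) = {}"
    proof (rule equals0I)
      fix y assume y: "y \<in> Y w \<inter> cball (q k) (1 / real (Suc n))"
      have "dist x y \<le> dist (q k) x + dist (q k) y" by (rule dist_triangle3)
      then have "y \<in> ball x e" using y k n by auto
      then show False using y e by auto
    qed
    ultimately have "w \<in> A k n" unfolding A_def using w by blast
    then show False using nA by blast
    qed
  qed
qed

text \<open>For compact \<open>C\<close> the closure meets \<open>C\<close> exactly if members of
  the sequence come arbitrarily close to \<open>C\<close>, which is a countable condition. A closed
  \<open>C\<close> is exhausted by its compact intersections with balls.\<close>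

lemma set_valued_rv_closure_range:
  fixes \<eta> :: "nat \<Rightarrow> 'w \<Rightarrow> 'a::euclidean_space"
  assumes m[measurable]: "\<And>k. \<eta> k \<in> borel_measurable G"
  shows "set_valued_rv G (\<lambda>w. closure (range (\<lambda>k. \<eta> k w)))"
  unfolding set_valued_rv_def
proof (intro conjI ballI allI impI)
  fix C :: "'a set" assume C: "closed C"
  have compact: "{w \<in> space G. closure (range (\<lambda>k. \<eta> k w)) \<inter> C \<noteq> {}} \<in> sets G" if C: "compact C" for C :: "'a set"
  proof (cases "C = {}")
    case False
    have eq: "{w \<in> space G. closure (range (\<lambda>k. \<eta> k w)) \<inter> C \<noteq> {}} = {w \<in> space G. \<forall>n. \<exists>k. infdist (\<eta> k w) C < 1 / real (Suc n)}"
    proof (intro Collect_cong conj_cong refl iffI allI)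
      fix w n assume "closure (range (\<lambda>k. \<eta> k w)) \<inter> C \<noteq> {}"
      then obtain c where c: "c \<in> closure (range (\<lambda>k. \<eta> k w))" "c \<in> C" by blast
      then obtain k where "dist (\<eta> k w) c < 1 / real (Suc n)"
        unfolding closure_approachable by (metis (no_types, lifting) imageE of_nat_0_less_iff zero_less_Suc zero_less_divide_1_iff)
      then have "infdist (\<eta> k w) C < 1 / real (Suc n)" using infdist_le[OF c(2), of "\<eta> k w"] by linarith
      then show "\<exists>k. infdist (\<eta> k w) C < 1 / real (Suc n)" by blast
    next
      fix w assume "\<forall>n. \<exists>k. infdist (\<eta> k w) C < 1 / real (Suc n)"
      then obtain k where k: "\<And>n. infdist (\<eta> (k n) w) C < 1 / real (Suc n)" by metis
      have "\<exists>c\<in>C. infdist (\<eta> (k n) w) C = dist (\<eta> (k n) w) c" for n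
        using infdist_attains_inf[OF compact_imp_closed[OF C] False, of "\<eta> (k n) w"] by blast
      then obtain c where c: "\<And>n. c n \<in> C" "\<And>n. infdist (\<eta> (k n) w) C = dist (\<eta> (k n) w) (c n)" by metis
      obtain l r where l: "l \<in> C" "strict_mono r" "(c \<circ> r) \<longlonglongrightarrow> l"
        using C[unfolded compact_def] c(1) by blast
      have "(\<lambda>n. dist (\<eta> (k n) w) (c n)) \<longlonglongrightarrow> 0"
      proof (rule tendsto_sandwich[OF _ _ tendsto_const LIMSEQ_inverse_real_of_nat])
        show "\<forall>\<^sub>F n in sequentially. dist (\<eta> (k n) w) (c n) \<le> inverse (real (Suc n))"
          using k c(2) by (intro always_eventually) (auto simp: less_imp_le inverse_eq_divide)
      qed auto
      from LIMSEQ_subseq_LIMSEQ[OF this l(2)] have d: "(\<lambda>n. dist (\<eta> (k (r n)) w) (c (r n))) \<longlonglongrightarrow> 0" by (simp add: o_def)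
      have "(\<lambda>n. \<eta> (k (r n)) w) \<longlonglongrightarrow> l"
        by (rule Lim_transform[OF l(3)]) (use d in \<open>simp add: o_def dist_norm tendsto_norm_zero_iff\<close>)
      then have "l \<in> closure (range (\<lambda>k. \<eta> k w))"
        unfolding closure_sequential by (intro exI[of _ "\<lambda>n. \<eta> (k (r n)) w"]) auto
      then show "closure (range (\<lambda>k. \<eta> k w)) \<inter> C \<noteq> {}" using l(1) by blast
    qed
    have [measurable]: "(\<lambda>w. infdist (\<eta> k w) C) \<in> borel_measurable G" for k
      by (rule measurable_compose[OF m])
         (intro borel_measurable_continuous_onI continuous_intros)
    have "{w \<in> space G. \<forall>n. \<exists>k. infdist (\<eta> k w) C < 1 / real (Suc n)} \<in> sets G" by measurable
    with eq show ?thesis by simp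
  qed simp
  have eq: "{w \<in> space G. closure (range (\<lambda>k. \<eta> k w)) \<inter> C \<noteq> {}} = (\<Union>N::nat. {w \<in> space G. closure (range (\<lambda>k. \<eta> k w)) \<inter> (C \<inter> cball 0 (real N)) \<noteq> {}})"
  proof (rule set_eqI, rule iffI)
    fix w assume "w \<in> {w \<in> space G. closure (range (\<lambda>k. \<eta> k w)) \<inter> C \<noteq> {}}"
    then obtain c where c: "w \<in> space G" "c \<in> closure (range (\<lambda>k. \<eta> k w))" "c \<in> C" by blast
    obtain N :: nat where "norm c \<le> real N" using real_arch_simple by blast
    then have "c \<in> closure (range (\<lambda>k. \<eta> k w)) \<inter> (C \<inter> cball 0 (real N))" using c by simp
    then have "w \<in> {w \<in> space G. closure (range (\<lambda>k. \<eta> k w)) \<inter> (C \<inter> cball 0 (real N)) \<noteq> {}}" using c(1) by blast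
    then show "w \<in> (\<Union>N::nat. {w \<in> space G. closure (range (\<lambda>k. \<eta> k w)) \<inter> (C \<inter> cball 0 (real N)) \<noteq> {}})" by (rule UN_I[OF UNIV_I])
  next
    fix w assume "w \<in> (\<Union>N::nat. {w \<in> space G. closure (range (\<lambda>k. \<eta> k w)) \<inter> (C \<inter> cball 0 (real N)) \<noteq> {}})"
    then show "w \<in> {w \<in> space G. closure (range (\<lambda>k. \<eta> k w)) \<inter> C \<noteq> {}}" by blast
  qed
  have "{w \<in> space G. closure (range (\<lambda>k. \<eta> k w)) \<inter> (C \<inter> cball 0 (real N)) \<noteq> {}} \<in> sets G" for N
    by (rule compact) (intro closed_Int_compact C compact_cball)
  then show "{w \<in> space G. closure (range (\<lambda>k. \<eta> k w)) \<inter> C \<noteq> {}} \<in> sets G"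
    unfolding eq by (intro sets.countable_UN) blast
next
  fix w show "closure (range (\<lambda>k. \<eta> k w)) \<noteq> {}" by simp
qed (rule closed_closure)

section \<open>Rational convex combinations\<close>

text \<open>Averages over lists with repetitions stand for convex combinations with rational
  weights; lists over a countable set are countable, so these combinations can be
  enumerated.\<close>

definition list_mean :: "'a::real_vector list \<Rightarrow> 'a" where
  "list_mean l = (1 / real (length l)) *\<^sub>R sum_list l"

definition list_means :: "'a::real_vector set \<Rightarrow> 'a set" where
  "list_means A = {list_mean l | l. l \<noteq> [] \<and> set l \<subseteq> A}"

lemma sum_list_concat_replicate: "sum_list (concat (replicate n l)) = real n *\<^sub>R sum_list (l :: 'a::real_vector list)"
  by (induction n) (auto simp: algebra_simps)

lemma length_concat_replicate: "length (concat (replicate n l)) = n * length l"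
  by (induction n) auto

lemma list_means_rational:
  assumes x: "x \<in> list_means A" and y: "y \<in> list_means A" and k: "k \<le> n" "0 < n"
  shows "(real k / real n) *\<^sub>R x + (1 - real k / real n) *\<^sub>R y \<in> list_means A"
proof -
  obtain l m where l: "x = list_mean l" "l \<noteq> []" "set l \<subseteq> A" and m: "y = list_mean m" "m \<noteq> []" "set m \<subseteq> A"
    using x y unfolding list_means_def by blast
  \<comment> \<open>Repetition brings both lists to the common denominator
    \<open>n * (length l * length m)\<close>, of which the entries of \<open>l\<close> occupy the
    fraction \<open>k / n\<close>.\<close>
  define r where "r = concat (replicate (k * length m) l) @ concat (replicate ((n - k) * length l) m)"
  have len: "length r = n * (length l * length m)"
  proof -
    have "length r = k * (length l * length m) + (n - k) * (length l * length m)"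
      unfolding r_def by (simp only: length_append length_concat_replicate mult_ac)
    then show ?thesis using k(1) by (simp only: add_mult_distrib[symmetric] le_add_diff_inverse)
  qed
  have pos: "0 < real n" "0 < real (length l)" "0 < real (length m)" using l m k by auto
  have "list_mean r = (1 / real (length r)) *\<^sub>R ((real k * real (length m)) *\<^sub>R sum_list l + ((real n - real k) * real (length l)) *\<^sub>R sum_list m)"
    unfolding list_mean_def by (simp add: r_def sum_list_concat_replicate of_nat_diff k)
  also have "\<dots> = (real k / real n) *\<^sub>R x + (1 - real k / real n) *\<^sub>R y"
    unfolding len l(1) m(1) list_mean_def scaleR_add_right scaleR_scaleR using pos
    by (intro arg_cong2[where f="(+)"] arg_cong2[where f="scaleR"] refl) (simp_all add: field_simps)
  finally have "list_mean r = (real k / real n) *\<^sub>R x + (1 - real k / real n) *\<^sub>R y" .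
  moreover have "r \<noteq> []" using len pos by (metis length_0_conv mult_eq_0_iff of_nat_0 order_less_irrefl)
  moreover have "set r \<subseteq> A" unfolding r_def using l m by auto
  ultimately show ?thesis unfolding list_means_def by (intro CollectI exI[of _ r]) auto
qed

text \<open>Rational combinations stay inside \<open>list_means\<close>, and rounding
  \<open>u * real (Suc n)\<close> down gives rational weights tending to a real weight
  \<open>u\<close>. Limits of the two end points are taken last.\<close>

lemma convex_closure_list_means:
  fixes A :: "'a::real_normed_vector set"
  shows "convex (closure (list_means A))"
proof -
  have 1: "u *\<^sub>R x + (1 - u) *\<^sub>R y \<in> closure (list_means A)"
    if x: "x \<in> list_means A" and y: "y \<in> list_means A" and u: "0 \<le> u" "u \<le> 1" for x y u
  proof -
    define k where "k n = nat \<lfloor>u * real (Suc n)\<rfloor>" for n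
    have k1: "real (k n) \<le> u * real (Suc n)" "u * real (Suc n) < real (k n) + 1" for n
    proof -
      have "0 \<le> u * real (Suc n)" using u by auto
      then show "real (k n) \<le> u * real (Suc n)" "u * real (Suc n) < real (k n) + 1" unfolding k_def by linarith+
    qed
    have kn: "k n \<le> Suc n" for n
    proof -
      have "u * real (Suc n) \<le> real (Suc n)" using u by (intro mult_left_le_one_le) auto
      then show ?thesis using k1(1)[of n] by linarith
    qed
    have lim: "(\<lambda>n. real (k n) / real (Suc n)) \<longlonglongrightarrow> u"
    proof (rule tendsto_sandwich)
      show "(\<lambda>n. u - inverse (real (Suc n))) \<longlonglongrightarrow> u" using tendsto_diff[OF tendsto_const[of u] LIMSEQ_inverse_real_of_nat] by simp
      show "(\<lambda>n. u) \<longlonglongrightarrow> u" by simp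
      show "\<forall>\<^sub>F n in sequentially. u - inverse (real (Suc n)) \<le> real (k n) / real (Suc n)"
      proof (intro always_eventually allI)
        fix n
        have "u \<le> (real (k n) + 1) / real (Suc n)" using less_imp_le[OF k1(2)[of n]] by (simp add: pos_le_divide_eq)
        then show "u - inverse (real (Suc n)) \<le> real (k n) / real (Suc n)" by (simp add: add_divide_distrib inverse_eq_divide)
      qed
      show "\<forall>\<^sub>F n in sequentially. real (k n) / real (Suc n) \<le> u"
      proof (intro always_eventually allI)
        fix n show "real (k n) / real (Suc n) \<le> u" using k1(1)[of n] by (simp add: field_simps)
      qed
    qed
    have "(\<lambda>n. (real (k n) / real (Suc n)) *\<^sub>R x + (1 - real (k n) / real (Suc n)) *\<^sub>R y) \<longlonglongrightarrow> u *\<^sub>R x + (1 - u) *\<^sub>R y"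
      by (intro tendsto_intros lim)
    moreover have "(real (k n) / real (Suc n)) *\<^sub>R x + (1 - real (k n) / real (Suc n)) *\<^sub>R y \<in> list_means A" for n
      by (rule list_means_rational[OF x y kn]) simp
    ultimately show ?thesis
      unfolding closure_sequential
      by (intro exI[of _ "\<lambda>n. (real (k n) / real (Suc n)) *\<^sub>R x + (1 - real (k n) / real (Suc n)) *\<^sub>R y"]) blast
  qed
  show ?thesis
  proof (rule convexI)
    fix x y and u v :: real
    assume xy: "x \<in> closure (list_means A)" "y \<in> closure (list_means A)" and uv: "0 \<le> u" "0 \<le> v" "u + v = 1"
    obtain a b where ab: "\<And>n. a n \<in> list_means A" "a \<longlonglongrightarrow> x" "\<And>n. b n \<in> list_means A" "b \<longlonglongrightarrow> y"
      using xy unfolding closure_sequential by blast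
    have v: "v = 1 - u" using uv by simp
    have L: "(\<lambda>n. u *\<^sub>R a n + v *\<^sub>R b n) \<longlonglongrightarrow> u *\<^sub>R x + v *\<^sub>R y" by (intro tendsto_intros ab)
    show "u *\<^sub>R x + v *\<^sub>R y \<in> closure (list_means A)"
      by (rule Lim_in_closed_set[OF closed_closure _ _ L]) (use 1 ab uv in \<open>auto simp: v\<close>)
  qed
qed

lemma closure_convex_hull_eq:
  fixes A :: "'a::real_normed_vector set"
  shows "closure (convex hull A) = closure (list_means A)"
proof
  have "A \<subseteq> list_means A"
  proof
    fix x assume "x \<in> A" then show "x \<in> list_means A"
      unfolding list_means_def by (intro CollectI exI[of _ "[x]"]) (auto simp: list_mean_def)
  qed
  then have "A \<subseteq> closure (list_means A)" using closure_subset by blast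
  then have "convex hull A \<subseteq> closure (list_means A)" by (rule hull_minimal[where S=convex]) (rule convex_closure_list_means)
  then show "closure (convex hull A) \<subseteq> closure (list_means A)" by (rule closure_minimal) simp
  have "list_means A \<subseteq> convex hull A"
  proof
    fix x assume "x \<in> list_means A"
    then obtain l where l: "x = list_mean l" "l \<noteq> []" "set l \<subseteq> A" unfolding list_means_def by blast
    have "(\<Sum>i<length l. (1 / real (length l)) *\<^sub>R l ! i) \<in> convex hull A"
      by (rule convex_sum) (use l in \<open>auto intro!: hull_inc simp: subset_iff\<close>)
    then show "x \<in> convex hull A"
      unfolding l(1) list_mean_def by (simp add: sum_list_sum_nth scaleR_sum_right lessThan_atLeast0)
  qed
  then show "closure (list_means A) \<subseteq> closure (convex hull A)" by (rule closure_mono)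
qed

text \<open>Grouping equal entries turns a sum over a list into a weighted finite sum, the form in
  which \<open>pair_conv\<close> and the linearity of the integral are stated.\<close>

lemma sum_list_map_scaleR_count:
  "sum_list (map f l) = (\<Sum>p\<in>set l. real (count_list l p) *\<^sub>R (f p :: 'b::real_vector))"
proof (induction l)
  case (Cons a l)
  have "(\<Sum>p\<in>set (a # l). real (count_list (a # l) p) *\<^sub>R f p) =
    (\<Sum>p\<in>set (a # l). (if p = a then f p else 0) + real (count_list l p) *\<^sub>R f p)"
    by (intro sum.cong refl) (auto simp: algebra_simps)
  also have "\<dots> = f a + (\<Sum>p\<in>set (a # l). real (count_list l p) *\<^sub>R f p)"
    by (subst sum.distrib) (simp add: sum.delta)
  also have "(\<Sum>p\<in>set (a # l). real (count_list l p) *\<^sub>R f p) = (\<Sum>p\<in>set l. real (count_list l p) *\<^sub>R f p)"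
    by (rule sum.mono_neutral_right) (auto simp: count_notin)
  finally show ?case using Cons by simp
qed simp

section \<open>Decomposable hulls and the set-valued integral\<close>

lemma decomposable_dec: "decomposable G (dec G K)"
  unfolding dec_def hull_def decomposable_def by blast

lemma dec_superset: "K \<subseteq> dec G K"
  unfolding dec_def by (rule hull_subset)

lemma dec_minimal: "K \<subseteq> L \<Longrightarrow> decomposable G L \<Longrightarrow> dec G K \<subseteq> L"
  unfolding dec_def by (rule hull_minimal)

context brownian_setting
begin

lemma L2_prog_iff:
  "z \<in> L2_prog P T F \<longleftrightarrow>
    (\<forall>t\<in>{0..T}. (\<lambda>(s, w). z s w) \<in> borel_measurable (restrict_space borel {0..t} \<Otimes>\<^sub>M F t)) \<and> proc_norm2 z < \<infinity>"
  by (simp add: L2_prog_def proc_norm2_def)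

lemma L2_prog_add_scaleR:
  fixes y z :: "real \<Rightarrow> 'w \<Rightarrow> real ^ 'm ^ 'd"
  assumes y: "y \<in> L2_prog P T F" and z: "z \<in> L2_prog P T F"
  shows "(\<lambda>s w. y s w + c *\<^sub>R z s w) \<in> L2_prog P T F"
  unfolding L2_prog_iff
proof (intro conjI ballI)
  fix t assume t: "t \<in> {0..T}"
  have "(\<lambda>x. (\<lambda>(s, w). y s w) x + c *\<^sub>R (\<lambda>(s, w). z s w) x) \<in> borel_measurable (restrict_space borel {0..t} \<Otimes>\<^sub>M F t)"
    using y z t unfolding L2_prog_iff by (intro borel_measurable_add borel_measurable_scaleR borel_measurable_const) blast+
  then show "(\<lambda>(s, w). y s w + c *\<^sub>R z s w) \<in> borel_measurable (restrict_space borel {0..t} \<Otimes>\<^sub>M F t)"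
    by (simp add: case_prod_beta')
next
  note j = L2_prog_jointly_measurable[OF y] L2_prog_jointly_measurable[OF z]
  have "proc_norm2 (\<lambda>s w. y s w + c *\<^sub>R z s w) \<le> 2 * proc_norm2 y + 2 * proc_norm2 (\<lambda>s w. c *\<^sub>R z s w)"
    by (intro proc_norm2_add_le jointly_measurable_scaleR j)
  also have "\<dots> \<le> 2 * proc_norm2 y + 2 * (ennreal (c\<^sup>2) * proc_norm2 z)"
    by (intro add_left_mono mult_left_mono proc_norm2_scaleR j) auto
  also have "\<dots> < \<infinity>"
    using L2_prog_norm2[OF y] L2_prog_norm2[OF z] by (simp add: ennreal_mult_less_top)
  finally show "proc_norm2 (\<lambda>s w. y s w + c *\<^sub>R z s w) < \<infinity>" .
qed

lemma L2_prog_zero: "((\<lambda>s w. 0) :: real \<Rightarrow> 'w \<Rightarrow> real ^ 'm ^ 'd) \<in> L2_prog P T F"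
  unfolding L2_prog_iff by (simp add: proc_norm2_def)

text \<open>Induction from linearity for two integrands. Membership in \<open>L2_prog\<close> is
  carried along because it guarantees that the choice made by \<open>ito_integral\<close> is an
  integral.\<close>

lemma ito_integral_sum_AE:
  fixes z :: "'i \<Rightarrow> real \<Rightarrow> 'w \<Rightarrow> real ^ 'm ^ 'd"
  assumes t: "t \<in> {0..T}" and S: "finite S" "\<And>p. p \<in> S \<Longrightarrow> z p \<in> L2_prog P T F"
  shows "(\<lambda>s w. \<Sum>p\<in>S. c p *\<^sub>R z p s w) \<in> L2_prog P T F \<and>
    (AE w in P. ito_integral P T F B t (\<lambda>s w. \<Sum>p\<in>S. c p *\<^sub>R z p s w) w = (\<Sum>p\<in>S. c p *\<^sub>R ito_integral P T F B t (z p) w))"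
  using S
proof (induction S rule: finite_induct)
  case empty
  let ?z = "(\<lambda>s w. 0) :: real \<Rightarrow> 'w \<Rightarrow> real ^ 'm ^ 'd"
  have i: "is_ito_integral P T F B t ?z (ito_integral P T F B t ?z)" by (rule is_ito_integral_ito_integral[OF L2_prog_zero t])
  have j: "jointly_measurable ?z" by (rule L2_prog_jointly_measurable[OF L2_prog_zero])
  \<comment> \<open>The zero integrand equals itself plus \<open>-1\<close> times itself, so
    linearity forces its integral to vanish.\<close>
  have "AE w in P. ito_integral P T F B t ?z w = ito_integral P T F B t ?z w + (- 1) *\<^sub>R ito_integral P T F B t ?z w"
    by (rule ito_integral_add_scaleR_AE[OF t j j i i]) (use i in simp)
  then have "AE w in P. ito_integral P T F B t ?z w = 0" by eventually_elim simp
  then show ?case using L2_prog_zero by simp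
next
  case (insert q S)
  let ?y = "\<lambda>s w. \<Sum>p\<in>S. c p *\<^sub>R z p s w"
  have y: "?y \<in> L2_prog P T F" and IH: "AE w in P. ito_integral P T F B t ?y w = (\<Sum>p\<in>S. c p *\<^sub>R ito_integral P T F B t (z p) w)"
    using insert by auto
  have zq: "z q \<in> L2_prog P T F" using insert by auto
  have eq: "(\<lambda>s w. \<Sum>p\<in>insert q S. c p *\<^sub>R z p s w) = (\<lambda>s w. ?y s w + c q *\<^sub>R z q s w)"
    using insert by (simp add: add.commute)
  have m: "(\<lambda>s w. ?y s w + c q *\<^sub>R z q s w) \<in> L2_prog P T F" by (rule L2_prog_add_scaleR[OF y zq])
  have "AE w in P. ito_integral P T F B t (\<lambda>s w. ?y s w + c q *\<^sub>R z q s w) w = ito_integral P T F B t ?y w + c q *\<^sub>R ito_integral P T F B t (z q) w"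
    by (rule ito_integral_add_scaleR_AE[OF t L2_prog_jointly_measurable[OF y] L2_prog_jointly_measurable[OF zq]
        is_ito_integral_ito_integral[OF y t] is_ito_integral_ito_integral[OF zq t] is_ito_integral_ito_integral[OF m t]])
  then have "AE w in P. ito_integral P T F B t (\<lambda>s w. ?y s w + c q *\<^sub>R z q s w) w = (\<Sum>p\<in>insert q S. c p *\<^sub>R ito_integral P T F B t (z p) w)"
    using IH by eventually_elim (use insert in \<open>simp add: add.commute\<close>)
  then show ?case unfolding eq using m by blast
qed

lemma ito_J_eq: "ito_J P T F B t p w = fst p + ito_integral P T F B t (snd p) w"
  by (simp add: ito_J_def case_prod_beta)

lemma ito_J_sum_AE:
  fixes S :: "((real ^ 'd) \<times> (real \<Rightarrow> 'w \<Rightarrow> real ^ 'm ^ 'd)) set" and c :: "_ \<Rightarrow> real"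
  assumes t: "t \<in> {0..T}" and S: "finite S" "S \<subseteq> UNIV \<times> L2_prog P T F"
  defines "q \<equiv> ((\<Sum>p\<in>S. c p *\<^sub>R fst p), (\<lambda>s w. \<Sum>p\<in>S. c p *\<^sub>R snd p s w))"
  shows "snd q \<in> L2_prog P T F"
    and "AE w in P. ito_J P T F B t q w = (\<Sum>p\<in>S. c p *\<^sub>R ito_J P T F B t p w)"
proof -
  have *: "snd p \<in> L2_prog P T F" if "p \<in> S" for p using S(2) that by auto
  show "snd q \<in> L2_prog P T F" using ito_integral_sum_AE[OF t S(1) *] by (simp add: q_def)
  have "AE w in P. ito_integral P T F B t (snd q) w = (\<Sum>p\<in>S. c p *\<^sub>R ito_integral P T F B t (snd p) w)"
    using ito_integral_sum_AE[OF t S(1) *] by (simp add: q_def)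
  then show "AE w in P. ito_J P T F B t q w = (\<Sum>p\<in>S. c p *\<^sub>R ito_J P T F B t p w)"
    by eventually_elim (simp add: ito_J_eq q_def scaleR_add_right sum.distrib)
qed

lemma ito_J_measurable_F:
  "t \<in> {0..T} \<Longrightarrow> snd p \<in> L2_prog P T F \<Longrightarrow> ito_J P T F B t p \<in> borel_measurable (F t)"
  unfolding ito_J_eq[abs_def] by (rule borel_measurable_add[OF borel_measurable_const ito_integral_measurable])

lemma ito_J_square_integrable:
  "t \<in> {0..T} \<Longrightarrow> snd p \<in> L2_prog P T F \<Longrightarrow> square_integrable P (ito_J P T F B t p)"
  unfolding ito_J_eq[abs_def] by (rule square_integrable_add[OF square_integrable_const ito_integral_square_integrable])

lemma S2_iff: "t \<in> {0..T} \<Longrightarrow>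
  \<xi> \<in> S2 P (F t) X \<longleftrightarrow> \<xi> \<in> borel_measurable (F t) \<and> square_integrable P \<xi> \<and> (AE w in P. \<xi> w \<in> X w)"
proof -
  assume "t \<in> {0..T}"
  then have "\<xi> \<in> borel_measurable (F t) \<Longrightarrow> \<xi> \<in> borel_measurable P" by (intro measurable_F_P[of t]) auto
  then show ?thesis unfolding S2_def square_integrable_def by blast
qed

text \<open>The selections form a decomposable set, so they contain the hull. For the closure, an
  approximating sequence with squared errors below \<open>(1/2)^n\<close> converges almost surely;
  closed values retain the limit, and its \<open>F t\<close>-measurability survives because null
  sets belong to \<open>F t\<close>.\<close>

lemma L2_closure_dec_subset_S2:
  fixes X :: "'w \<Rightarrow> 'a::euclidean_space set"
  assumes t: "t \<in> {0..T}" and X: "\<And>w. w \<in> space P \<Longrightarrow> closed (X w)" and K: "K \<subseteq> S2 P (F t) X"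
  shows "L2_closure P (dec (F t) K) \<subseteq> S2 P (F t) X"
proof
  have tT: "t \<le> T" using t by simp
  have "decomposable (F t) (S2 P (F t) X)"
    unfolding decomposable_def
  proof (intro ballI)
    fix \<xi> \<zeta> A assume \<xi>S: "\<xi> \<in> S2 P (F t) X" and \<zeta>S: "\<zeta> \<in> S2 P (F t) X" and A: "A \<in> sets (F t)"
    have \<xi>: "\<xi> \<in> borel_measurable (F t)" "integrable P (\<lambda>w. (norm (\<xi> w))\<^sup>2)" "AE w in P. \<xi> w \<in> X w"
      using \<xi>S unfolding S2_def by auto
    have \<zeta>: "\<zeta> \<in> borel_measurable (F t)" "integrable P (\<lambda>w. (norm (\<zeta> w))\<^sup>2)" "AE w in P. \<zeta> w \<in> X w"
      using \<zeta>S unfolding S2_def by auto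
    have m: "(\<lambda>w. if w \<in> A then \<xi> w else \<zeta> w) \<in> borel_measurable (F t)"
      by (rule measurable_If_set[OF \<xi>(1) \<zeta>(1)]) (use A sets.sets_into_space[OF A] in \<open>auto simp: Int_absorb2\<close>)
    have "square_integrable P (\<lambda>w. if w \<in> A then \<xi> w else \<zeta> w)"
      unfolding square_integrable_def
    proof
      show "(\<lambda>w. if w \<in> A then \<xi> w else \<zeta> w) \<in> borel_measurable P" by (rule measurable_F_P[OF tT m])
      then show "integrable P (\<lambda>w. (norm (if w \<in> A then \<xi> w else \<zeta> w))\<^sup>2)"
        by (intro Bochner_Integration.integrable_bound[OF Bochner_Integration.integrable_add[OF \<xi>(2) \<zeta>(2)]]) auto
    qed
    moreover have "AE w in P. (if w \<in> A then \<xi> w else \<zeta> w) \<in> X w"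
      using \<xi>(3) \<zeta>(3) by eventually_elim auto
    ultimately show "(\<lambda>w. if w \<in> A then \<xi> w else \<zeta> w) \<in> S2 P (F t) X" using m S2_iff[OF t] by blast
  qed
  from dec_minimal[OF K this] have D: "dec (F t) K \<subseteq> S2 P (F t) X" .
  fix \<xi> assume \<xi>: "\<xi> \<in> L2_closure P (dec (F t) K)"
  have "\<exists>\<zeta>. \<forall>n::nat. \<zeta> n \<in> dec (F t) K \<and> (\<integral>\<^sup>+w. ennreal ((norm (\<xi> w - \<zeta> n w))\<^sup>2) \<partial>P) < ennreal ((1/2) ^ n)"
  proof (rule choice, rule allI)
    fix n :: nat
    have "0 < ennreal ((1/2) ^ n)" by simp
    then show "\<exists>\<zeta>. \<zeta> \<in> dec (F t) K \<and> (\<integral>\<^sup>+w. ennreal ((norm (\<xi> w - \<zeta> w))\<^sup>2) \<partial>P) < ennreal ((1/2) ^ n)"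
      using \<xi> unfolding L2_closure_def by blast
  qed
  then obtain \<zeta> where \<zeta>: "\<And>n. \<zeta> n \<in> dec (F t) K" "\<And>n::nat. (\<integral>\<^sup>+w. ennreal ((norm (\<xi> w - \<zeta> n w))\<^sup>2) \<partial>P) < ennreal ((1/2) ^ n)"
    by blast
  have \<zeta>S: "\<zeta> n \<in> S2 P (F t) X" for n using \<zeta>(1) D by blast
  have \<zeta>F: "\<zeta> n \<in> borel_measurable (F t)" for n using \<zeta>S S2_iff[OF t] by blast
  have \<xi>s: "square_integrable P \<xi>" using \<xi> unfolding L2_closure_def square_integrable_def by auto
  have "(\<Sum>n. \<integral>\<^sup>+w. ennreal ((norm (\<xi> w - \<zeta> n w))\<^sup>2) \<partial>P) \<le> (\<Sum>n. ennreal ((1/2) ^ n))"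
    using \<zeta>(2) by (intro suminf_le summableI) (auto simp: less_imp_le)
  also have "\<dots> = ennreal (\<Sum>n. (1/2) ^ n)" by (rule suminf_ennreal2) (auto intro: summable_geometric)
  also have "\<dots> < \<infinity>" by simp
  finally have lim: "AE w in P. (\<lambda>n. \<zeta> n w) \<longlonglongrightarrow> \<xi> w"
    using \<xi>s measurable_F_P[OF tT \<zeta>F]
    by (intro AE_tendsto_of_summable_L2) (auto simp: square_integrable_def)
  have "\<xi> \<in> borel_measurable (F t)"
  proof (rule measurable_F_AE_cong[OF borel_measurable_lim_metric[of \<zeta>, OF \<zeta>F] tT])
    show "AE w in P. \<xi> w = lim (\<lambda>n. \<zeta> n w)" using lim by eventually_elim (simp add: limI)
  qed auto
  moreover have "AE w in P. \<xi> w \<in> X w"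
  proof -
    have "AE w in P. \<forall>n. \<zeta> n w \<in> X w" unfolding AE_all_countable using \<zeta>S S2_iff[OF t] by blast
    with lim AE_space show ?thesis
    proof eventually_elim
      case (elim w)
      then show ?case by (intro Lim_in_closed_set[OF X _ _ elim(1)]) auto
    qed
  qed
  ultimately show "\<xi> \<in> S2 P (F t) X" using \<xi>s S2_iff[OF t] by blast
qed

text \<open>A selection is approximated by gluing the dense sequence along the sets on which one
  of its members is \<open>\<delta>\<close>-close.\<close>

lemma S2_subset_L2_closure_dec:
  fixes X :: "'w \<Rightarrow> 'a::euclidean_space set" and \<eta> :: "nat \<Rightarrow> 'w \<Rightarrow> 'a"
  assumes t: "t \<in> {0..T}" and \<eta>: "\<And>k. \<eta> k \<in> borel_measurable (F t)" "\<And>k. square_integrable P (\<eta> k)" "\<And>k. \<eta> k \<in> K"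
    and X: "AE w in P. X w \<subseteq> closure (range (\<lambda>k. \<eta> k w))"
  shows "S2 P (F t) X \<subseteq> L2_closure P (dec (F t) K)"
proof
  fix \<xi> assume "\<xi> \<in> S2 P (F t) X"
  then have \<xi>: "\<xi> \<in> borel_measurable (F t)" "square_integrable P \<xi>" "AE w in P. \<xi> w \<in> X w" using S2_iff[OF t] by auto
  note [measurable] = square_integrable_measurable[OF \<xi>(2)] square_integrable_measurable[OF \<eta>(2)]
  have "\<exists>\<zeta>\<in>dec (F t) K. (\<integral>\<^sup>+w. ennreal ((norm (\<xi> w - \<zeta> w))\<^sup>2) \<partial>P) < e" if e: "0 < e" for e
  proof -
    obtain r where r: "0 < r" "ennreal r < e"
    proof (cases e)
      case (real a)
      then have "0 < a" using e by auto
      then show ?thesis using real that[of "a / 2"] by (simp add: ennreal_less_iff)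
    next
      case top
      then show ?thesis using that[of 1] by simp
    qed
    define \<delta> where "\<delta> = sqrt r"
    have \<delta>: "0 < \<delta>" "\<delta>\<^sup>2 = r" using r by (auto simp: \<delta>_def)
    define A where "A k = {w \<in> space (F t). dist (\<xi> w) (\<eta> k w) < \<delta>}" for k
    have AF: "A k \<in> sets (F t)" for k unfolding A_def using \<xi>(1) \<eta>(1)[of k] by measurable
    have AP[measurable]: "A k \<in> sets P" for k using AF sets_F_subset[of t] t by auto
    \<comment> \<open>Finite gluing, so that every stage stays in the decomposable hull. A later
      close member overrides an earlier one, and \<open>\<eta> 0\<close> remains where none is
      close.\<close>
    define H where "H = rec_nat (\<eta> 0) (\<lambda>n h w. if w \<in> A n then \<eta> n w else h w)"
    have H0: "H 0 = \<eta> 0" unfolding H_def by simp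
    have HS: "H (Suc n) = (\<lambda>w. if w \<in> A n then \<eta> n w else H n w)" for n unfolding H_def by simp
    have Hd: "H n \<in> dec (F t) K" for n
    proof (induction n)
      case 0 show ?case using \<eta>(3)[of 0] dec_superset[of K "F t"] by (auto simp: H0)
    next
      case (Suc n)
      have "\<eta> n \<in> dec (F t) K" using \<eta>(3)[of n] dec_superset[of K "F t"] by auto
      with Suc AF[of n] decomposable_dec[of "F t" K] show ?case unfolding HS decomposable_def by blast
    qed
    have Hw: "dist (\<xi> w) (H n w) < \<delta> \<or> (H n w = \<eta> 0 w \<and> w \<notin> (\<Union>k<n. A k))" for n w
    proof (induction n)
      case (Suc n) then show ?case by (auto simp: HS A_def less_Suc_eq)
    qed (simp add: H0)
    \<comment> \<open>By density, the points without a close member among the first \<open>n\<close>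
      decrease to a null set, and the square-integrable error on them tends to
      \<open>0\<close>.\<close>
    have "(\<lambda>n. \<integral>\<^sup>+w. ennreal ((norm (\<xi> w - \<eta> 0 w))\<^sup>2) * indicator (space P - (\<Union>k<n. A k)) w \<partial>P) \<longlonglongrightarrow> (\<integral>\<^sup>+w. 0 \<partial>P)"
    proof (rule nn_integral_dominated_convergence[where w="\<lambda>w. ennreal ((norm (\<xi> w - \<eta> 0 w))\<^sup>2)"])
      show "(\<integral>\<^sup>+w. ennreal ((norm (\<xi> w - \<eta> 0 w))\<^sup>2) \<partial>P) < \<infinity>"
        using square_integrable_diff[OF \<xi>(2) \<eta>(2)[of 0]] unfolding square_integrable_iff_nn_integral by blast
      show "AE w in P. ennreal ((norm (\<xi> w - \<eta> 0 w))\<^sup>2) * indicator (space P - (\<Union>k<n. A k)) w \<le> ennreal ((norm (\<xi> w - \<eta> 0 w))\<^sup>2)" for n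
        by (rule AE_I2) (auto simp: indicator_def)
      show "AE w in P. (\<lambda>n. ennreal ((norm (\<xi> w - \<eta> 0 w))\<^sup>2) * indicator (space P - (\<Union>k<n. A k)) w) \<longlonglongrightarrow> 0"
        using X \<xi>(3) AE_space
      proof eventually_elim
        case (elim w)
        then have "\<xi> w \<in> closure (range (\<lambda>k. \<eta> k w))" by auto
        then obtain k where "dist (\<eta> k w) (\<xi> w) < \<delta>" using \<delta>(1) unfolding closure_approachable by auto
        then have "w \<in> A k" using elim unfolding A_def by (simp add: dist_commute)
        then have "\<forall>\<^sub>F n in sequentially. ennreal ((norm (\<xi> w - \<eta> 0 w))\<^sup>2) * indicator (space P - (\<Union>k<n. A k)) w = 0"
          by (intro eventually_sequentiallyI[of "Suc k"]) (auto simp: indicator_def)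
        then show ?case by (rule tendsto_eventually)
      qed
    qed measurable
    then have "(\<lambda>n. \<integral>\<^sup>+w. ennreal ((norm (\<xi> w - \<eta> 0 w))\<^sup>2) * indicator (space P - (\<Union>k<n. A k)) w \<partial>P) \<longlonglongrightarrow> 0" by simp
    moreover have "0 < e - ennreal r" using r by (simp add: diff_gr0_ennreal)
    ultimately have "\<forall>\<^sub>F n in sequentially. (\<integral>\<^sup>+w. ennreal ((norm (\<xi> w - \<eta> 0 w))\<^sup>2) * indicator (space P - (\<Union>k<n. A k)) w \<partial>P) < e - ennreal r"
      by (rule order_tendstoD(2))
    then obtain n where n: "(\<integral>\<^sup>+w. ennreal ((norm (\<xi> w - \<eta> 0 w))\<^sup>2) * indicator (space P - (\<Union>k<n. A k)) w \<partial>P) < e - ennreal r"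
      by (auto simp: eventually_sequentially)
    have "(\<integral>\<^sup>+w. ennreal ((norm (\<xi> w - H n w))\<^sup>2) \<partial>P) \<le> (\<integral>\<^sup>+w. ennreal r + ennreal ((norm (\<xi> w - \<eta> 0 w))\<^sup>2) * indicator (space P - (\<Union>k<n. A k)) w \<partial>P)"
    proof (rule nn_integral_mono)
      fix w assume w: "w \<in> space P"
      show "ennreal ((norm (\<xi> w - H n w))\<^sup>2) \<le> ennreal r + ennreal ((norm (\<xi> w - \<eta> 0 w))\<^sup>2) * indicator (space P - (\<Union>k<n. A k)) w"
        using Hw[of w n]
      proof
        assume "dist (\<xi> w) (H n w) < \<delta>"
        then have "(norm (\<xi> w - H n w))\<^sup>2 \<le> \<delta>\<^sup>2" by (intro power_mono) (auto simp: dist_norm)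
        then have "ennreal ((norm (\<xi> w - H n w))\<^sup>2) \<le> ennreal r" unfolding \<delta>(2) by (rule ennreal_leI)
        then show ?thesis by (rule order_trans) simp
      next
        assume "H n w = \<eta> 0 w \<and> w \<notin> (\<Union>k<n. A k)"
        then show ?thesis using w by (simp add: indicator_def)
      qed
    qed
    also have "\<dots> = ennreal r + (\<integral>\<^sup>+w. ennreal ((norm (\<xi> w - \<eta> 0 w))\<^sup>2) * indicator (space P - (\<Union>k<n. A k)) w \<partial>P)"
      by (subst nn_integral_add) (auto simp: emeasure_space_1)
    also have "\<dots> < ennreal r + (e - ennreal r)"
      using n by (simp add: ennreal_add_left_cancel_less)
    also have "\<dots> = e" using r by (simp add: less_imp_le)
    finally show ?thesis using Hd by blast
  qed
  then show "\<xi> \<in> L2_closure P (dec (F t) K)"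
    using \<xi>(2) unfolding L2_closure_def square_integrable_def by blast
qed

text \<open>Two inclusions between the selections and the closed decomposable hull. The means
  \<open>m k\<close> enumerate the rational convex combinations pointwise, which gives
  measurability; each equals almost surely the integral of the combined pair \<open>q k\<close> in
  \<open>pair_conv R\<close>, which gives the sequence to glue.\<close>

lemma is_sv_integral_closure_convex_hull:
  fixes R :: "((real ^ 'd) \<times> (real \<Rightarrow> 'w \<Rightarrow> real ^ 'm ^ 'd)) set"
  assumes t: "t \<in> {0..T}" and R: "countable R" "R \<noteq> {}" "R \<subseteq> UNIV \<times> L2_prog P T F"
  shows "is_sv_integral P T F B (pair_conv R) t (\<lambda>w. closure (convex hull ((\<lambda>p. ito_J P T F B t p w) ` R)))"
proof -
  have tT: "t \<le> T" using t by simp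
  define J where "J p w = ito_J P T F B t p w" for p :: "(real ^ 'd) \<times> (real \<Rightarrow> 'w \<Rightarrow> real ^ 'm ^ 'd)" and w
  define X where "X w = closure (convex hull ((\<lambda>p. J p w) ` R))" for w
  have Rz: "snd p \<in> L2_prog P T F" if "p \<in> R" for p using R(3) that by auto
  have JF: "J p \<in> borel_measurable (F t)" if "snd p \<in> L2_prog P T F" for p
    unfolding J_def[abs_def] using ito_J_measurable_F[OF t that] .
  have Js: "square_integrable P (J p)" if "snd p \<in> L2_prog P T F" for p
    unfolding J_def[abs_def] using ito_J_square_integrable[OF t that] .
  define LL where "LL = {l. l \<noteq> [] \<and> set l \<subseteq> R}"
  have cLL: "countable LL"
    by (rule countable_subset[OF _ countable_lists[OF R(1)]]) (auto simp: LL_def)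
  have neLL: "LL \<noteq> {}"
  proof -
    obtain p where "p \<in> R" using R(2) by blast
    then have "[p] \<in> LL" by (simp add: LL_def)
    then show ?thesis by blast
  qed
  define l where "l = from_nat_into LL"
  have l: "l k \<noteq> []" "set (l k) \<subseteq> R" for k using from_nat_into[OF neLL, of k] by (auto simp: l_def LL_def)
  have rl: "range l = LL" unfolding l_def by (rule range_from_nat_into[OF neLL cLL])
  define m where "m k w = list_mean (map (\<lambda>p. J p w) (l k))" for k w
  have m_sum: "m k w = (\<Sum>p\<in>set (l k). (real (count_list (l k) p) / real (length (l k))) *\<^sub>R J p w)" for k w
    unfolding m_def list_mean_def sum_list_map_scaleR_count by (simp add: scaleR_sum_right)
  have mF: "m k \<in> borel_measurable (F t)" for k
    unfolding m_sum[abs_def] using l(2)[of k] Rz JF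
    by (intro borel_measurable_sum borel_measurable_scaleR borel_measurable_const) auto
  have Xm: "X w = closure (range (\<lambda>k. m k w))" for w
  proof -
    have "list_means ((\<lambda>p. J p w) ` R) = range (\<lambda>k. m k w)"
    proof -
      have "list_means ((\<lambda>p. J p w) ` R) = (\<lambda>l. list_mean (map (\<lambda>p. J p w) l)) ` LL"
      proof (rule set_eqI, rule iffI)
        fix x assume "x \<in> list_means ((\<lambda>p. J p w) ` R)"
        then obtain k where k: "x = list_mean k" "k \<noteq> []" "set k \<subseteq> (\<lambda>p. J p w) ` R" unfolding list_means_def by blast
        then have "k \<in> map (\<lambda>p. J p w) ` lists R" by (simp add: lists_image[symmetric] in_lists_conv_set subset_iff)
        then obtain l' where "k = map (\<lambda>p. J p w) l'" "l' \<in> lists R" by blast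
        then show "x \<in> (\<lambda>l. list_mean (map (\<lambda>p. J p w) l)) ` LL"
          using k by (intro image_eqI[of _ _ l']) (auto simp: LL_def)
      next
        fix x assume "x \<in> (\<lambda>l. list_mean (map (\<lambda>p. J p w) l)) ` LL"
        then obtain l' where "x = list_mean (map (\<lambda>p. J p w) l')" "l' \<noteq> []" "set l' \<subseteq> R" by (auto simp: LL_def)
        then show "x \<in> list_means ((\<lambda>p. J p w) ` R)"
          unfolding list_means_def by (intro CollectI exI[of _ "map (\<lambda>p. J p w) l'"]) auto
      qed
      also have "\<dots> = range (\<lambda>k. m k w)" unfolding rl[symmetric] m_def by (simp add: image_image)
      finally show ?thesis .
    qed
    then show ?thesis unfolding X_def closure_convex_hull_eq by simp
  qed
  have svX: "set_valued_rv (F t) X"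
    unfolding Xm[abs_def] by (rule set_valued_rv_closure_range[OF mF])
  define c where "c k p = real (count_list (l k) p) / real (length (l k))" for k p
  define q where "q k = ((\<Sum>p\<in>set (l k). c k p *\<^sub>R fst p), (\<lambda>s w. \<Sum>p\<in>set (l k). c k p *\<^sub>R snd p s w))" for k
  have qR: "q k \<in> pair_conv R" for k
  proof -
    have "sum (c k) (set (l k)) = 1"
    proof -
      have "sum (c k) (set (l k)) = real (\<Sum>p\<in>set (l k). count_list (l k) p) / real (length (l k))"
        unfolding c_def by (simp add: sum_divide_distrib)
      also have "(\<Sum>p\<in>set (l k). count_list (l k) p) = length (l k)" by (rule sum_count_set) auto
      finally show ?thesis using l(1)[of k] by simp
    qed
    then show ?thesis
      unfolding pair_conv_def q_def using l(2)[of k]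
      by (intro CollectI exI[of _ "set (l k)"] exI[of _ "c k"]) (auto simp: c_def)
  qed
  have conv: "snd p \<in> L2_prog P T F \<and> (AE w in P. J p w \<in> X w)" if pR: "p \<in> pair_conv R" for p
  proof -
    obtain S a where p: "p = ((\<Sum>p\<in>S. a p *\<^sub>R fst p), (\<lambda>s w. \<Sum>p\<in>S. a p *\<^sub>R snd p s w))"
      and S: "finite S" "S \<subseteq> R" "\<forall>p\<in>S. 0 \<le> a p" "sum a S = 1"
      using pR unfolding pair_conv_def by blast
    have SL: "S \<subseteq> UNIV \<times> L2_prog P T F" using S(2) R(3) by blast
    have "AE w in P. J p w = (\<Sum>p\<in>S. a p *\<^sub>R J p w)" unfolding J_def p by (rule ito_J_sum_AE(2)[OF t S(1) SL])
    then have "AE w in P. J p w \<in> X w"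
    proof eventually_elim
      case (elim w)
      have "(\<Sum>p\<in>S. a p *\<^sub>R J p w) \<in> convex hull ((\<lambda>p. J p w) ` R)"
        by (rule convex_sum[OF S(1) convex_convex_hull S(4)]) (use S in \<open>auto intro!: hull_inc\<close>)
      then show ?case unfolding X_def elim using closure_subset by blast
    qed
    then show ?thesis using ito_J_sum_AE(1)[OF t S(1) SL, of a] unfolding p by blast
  qed
  have JqF: "J (q k) \<in> borel_measurable (F t)" and Jqs: "square_integrable P (J (q k))" for k
    using conv[OF qR[of k]] JF Js by auto
  have mq: "AE w in P. \<forall>k. J (q k) w = m k w"
    unfolding AE_all_countable
  proof
    fix k
    have "set (l k) \<subseteq> UNIV \<times> L2_prog P T F" using l(2)[of k] R(3) by blast
    from ito_J_sum_AE(2)[OF t _ this, of "c k"] show "AE w in P. J (q k) w = m k w"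
      unfolding J_def[symmetric] q_def m_sum c_def by simp
  qed
  have KS: "ito_J P T F B t ` pair_conv R \<subseteq> S2 P (F t) X"
  proof
    fix \<xi> assume "\<xi> \<in> ito_J P T F B t ` pair_conv R"
    then obtain p where p: "p \<in> pair_conv R" "\<xi> = J p" unfolding J_def[abs_def] by blast
    then show "\<xi> \<in> S2 P (F t) X"
      unfolding p(2) S2_iff[OF t] using conv[OF p(1)] JF[of p] Js[of p] by blast
  qed
  have S2eq: "S2 P (F t) X = L2_closure P (dec (F t) (ito_J P T F B t ` pair_conv R))"
  proof
    show "S2 P (F t) X \<subseteq> L2_closure P (dec (F t) (ito_J P T F B t ` pair_conv R))"
    proof (rule S2_subset_L2_closure_dec[OF t JqF Jqs])
      show "J (q k) \<in> ito_J P T F B t ` pair_conv R" for k unfolding J_def[abs_def] using qR[of k] by blast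
      show "AE w in P. X w \<subseteq> closure (range (\<lambda>k. J (q k) w))" using mq by eventually_elim (simp add: Xm)
    qed
    show "L2_closure P (dec (F t) (ito_J P T F B t ` pair_conv R)) \<subseteq> S2 P (F t) X"
      by (rule L2_closure_dec_subset_S2[OF t _ KS]) (simp add: X_def)
  qed
  have "J (q 0) \<in> S2 P P X"
    using KS qR[of 0] Jqs[of 0] S2_iff[OF t, of "J (q 0)" X] unfolding J_def[abs_def] S2_def square_integrable_def by blast
  then show ?thesis
    using svX S2eq unfolding is_sv_integral_def X_def[abs_def, symmetric] J_def[symmetric] by blast
qed

text \<open>The square-integrable selections determine a set-valued random variable almost surely,
  so the version picked by \<open>SOME\<close> coincides with the hull. The comparison starts from
  one existing selection, supplied by any \<open>p \<in> R\<close>.\<close>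

theorem sv_integral_AE_eq:
  fixes R :: "((real ^ 'd) \<times> (real \<Rightarrow> 'w \<Rightarrow> real ^ 'm ^ 'd)) set"
  assumes t: "t \<in> {0..T}" and R: "countable R" "R \<noteq> {}" "R \<subseteq> UNIV \<times> L2_prog P T F"
  shows "AE w in P. sv_integral P T F B (pair_conv R) t w = closure (convex hull ((\<lambda>p. ito_J P T F B t p w) ` R))"
proof -
  let ?X = "\<lambda>w. closure (convex hull ((\<lambda>p. ito_J P T F B t p w) ` R))"
  let ?Y = "sv_integral P T F B (pair_conv R) t"
  have X: "is_sv_integral P T F B (pair_conv R) t ?X" by (rule is_sv_integral_closure_convex_hull[OF assms])
  then have Y: "is_sv_integral P T F B (pair_conv R) t ?Y"
    unfolding sv_integral_def by (rule someI[of "is_sv_integral P T F B (pair_conv R) t"])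
  have G: "sets (F t) \<subseteq> sets P" "space (F t) = space P" using t sets_F_subset by auto
  have sX: "set_valued_rv (F t) ?X" and sY: "set_valued_rv (F t) ?Y" and eq: "S2 P (F t) ?X = S2 P (F t) ?Y"
    using X Y unfolding is_sv_integral_def by blast+
  obtain p where p: "p \<in> R" using R(2) by blast
  have "ito_J P T F B t p \<in> S2 P (F t) ?X"
    unfolding S2_iff[OF t]
  proof (intro conjI AE_I2)
    show "ito_J P T F B t p \<in> borel_measurable (F t)" "square_integrable P (ito_J P T F B t p)"
      using p R(3) by (auto intro!: ito_J_measurable_F[OF t] ito_J_square_integrable[OF t])
    fix w show "ito_J P T F B t p w \<in> ?X w"
      using p hull_inc[of "ito_J P T F B t p w" "(\<lambda>p. ito_J P T F B t p w) ` R" convex] closure_subset by blast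
  qed
  then have ne: "S2 P (F t) ?X \<noteq> {}" by blast
  have "AE w in P. ?X w \<subseteq> ?Y w"
    by (rule S2_subset_imp_AE_subset[OF finite_measure_axioms G sX sY]) (use eq ne in auto)
  moreover have "AE w in P. ?Y w \<subseteq> ?X w"
    by (rule S2_subset_imp_AE_subset[OF finite_measure_axioms G sY sX]) (use eq ne in auto)
  ultimately show ?thesis by eventually_elim auto
qed

end

section \<open>Hausdorff limits and support functions\<close>

text \<open>A real-valued stand-in for bounds on \<open>hausdorff_distance\<close>: witnesses attain
  both one-sided bounds, so triangle arguments need no extended arithmetic.\<close>

definition set_close :: "real \<Rightarrow> 'a::metric_space set \<Rightarrow> 'a set \<Rightarrow> bool" where
  "set_close e A B \<longleftrightarrow> (\<forall>x\<in>A. \<exists>y\<in>B. dist x y \<le> e) \<and> (\<forall>y\<in>B. \<exists>x\<in>A. dist x y \<le> e)"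

lemma set_close_sym: "set_close e A B \<Longrightarrow> set_close e B A"
  unfolding set_close_def by (simp add: dist_commute)

lemma set_close_trans:
  assumes "set_close e A B" "set_close f B C"
  shows "set_close (e + f) A C"
  unfolding set_close_def
proof (intro conjI ballI)
  fix x assume "x \<in> A"
  then obtain y where y: "y \<in> B" "dist x y \<le> e" using assms unfolding set_close_def by blast
  then obtain z where z: "z \<in> C" "dist y z \<le> f" using assms unfolding set_close_def by blast
  have "dist x z \<le> e + f" using dist_triangle[of x z y] y z by linarith
  then show "\<exists>z\<in>C. dist x z \<le> e + f" using z by blast
next
  fix z assume "z \<in> C"
  then obtain y where y: "y \<in> B" "dist y z \<le> f" using assms unfolding set_close_def by blast
  then obtain x where x: "x \<in> A" "dist x y \<le> e" using assms unfolding set_close_def by blast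
  have "dist x z \<le> e + f" using dist_triangle[of x z y] y x by linarith
  then show "\<exists>x\<in>A. dist x z \<le> e + f" using x by blast
qed

lemma set_close_mono: "set_close e A B \<Longrightarrow> e \<le> f \<Longrightarrow> set_close f A B"
  unfolding set_close_def by (meson order_trans)

lemma hausdorff_distance_le:
  assumes "set_close e A B"
  shows "hausdorff_distance A B \<le> ennreal e"
  unfolding hausdorff_distance_def
proof (rule max.boundedI; rule SUP_least)
  fix x assume "x \<in> A"
  then obtain y where "y \<in> B" "dist x y \<le> e" using assms unfolding set_close_def by blast
  then show "(INF y\<in>B. ennreal (dist x y)) \<le> ennreal e" by (intro INF_lower2[of y]) (auto intro: ennreal_leI)
next
  fix y assume "y \<in> B"
  then obtain x where "x \<in> A" "dist x y \<le> e" using assms unfolding set_close_def by blast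
  then show "(INF x\<in>A. ennreal (dist x y)) \<le> ennreal e" by (intro INF_lower2[of x]) (auto intro: ennreal_leI)
qed

lemma tendsto_hausdorff_0:
  assumes "\<And>e. 0 < e \<Longrightarrow> eventually (\<lambda>s. set_close e (M s) L) F"
  shows "((\<lambda>s. hausdorff_distance (M s) L) \<longlongrightarrow> 0) F"
proof (rule order_tendstoI)
  fix a :: ennreal assume a: "0 < a"
  obtain r where r: "0 < r" "ennreal r < a"
  proof (cases a)
    case (real b)
    then have "0 < b" using a by auto
    then show ?thesis using real that[of "b / 2"] by (simp add: ennreal_less_iff)
  next
    case top then show ?thesis using that[of 1] by simp
  qed
  show "eventually (\<lambda>s. hausdorff_distance (M s) L < a) F"
    using assms[OF r(1)] by eventually_elim (use hausdorff_distance_le r(2) order_le_less_trans in blast)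
qed auto

text \<open>Requiring a closed limit makes it unique along a proper filter; an arbitrary filter
  covers the one-sided limits along dyadic times.\<close>

definition hausdorff_lim :: "(real \<Rightarrow> 'a::metric_space set) \<Rightarrow> real filter \<Rightarrow> 'a set \<Rightarrow> bool" where
  "hausdorff_lim M F L \<longleftrightarrow> closed L \<and> L \<noteq> {} \<and> (\<forall>e>0. eventually (\<lambda>q. set_close e (M q) L) F)"

lemma hausdorff_lim_unique:
  assumes "hausdorff_lim M F L" "hausdorff_lim M F L'" "F \<noteq> bot"
  shows "L = L'"
proof -
  have "L \<subseteq> L'" if L: "hausdorff_lim M F L" and L': "hausdorff_lim M F L'" for L L'
  proof
    fix x assume x: "x \<in> L"
    have "x \<in> closure L'"
      unfolding closure_approachable
    proof (intro allI impI)
      fix e :: real assume e: "0 < e"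
      have "eventually (\<lambda>q. set_close (e/3) (M q) L \<and> set_close (e/3) (M q) L') F"
        using L L' e unfolding hausdorff_lim_def by (intro eventually_conj) auto
      then obtain q where q: "set_close (e/3) (M q) L" "set_close (e/3) (M q) L'"
        using eventually_happens'[OF assms(3)] by blast
      from set_close_trans[OF set_close_sym[OF q(1)] q(2)] x obtain y where "y \<in> L'" "dist x y \<le> e/3 + e/3"
        unfolding set_close_def by blast
      then show "\<exists>y\<in>L'. dist y x < e" using e by (intro bexI[of _ y]) (auto simp: dist_commute)
    qed
    then show "x \<in> L'" using L' unfolding hausdorff_lim_def by (simp add: closure_closed)
  qed
  then show ?thesis using assms by blast
qed

text \<open>Completeness of the space of nonempty closed sets: the limit consists of the points to
  which the sets \<open>M (q n)\<close> eventually stay arbitrarily close, along a sequence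
  \<open>q\<close> that runs into all Cauchy neighbourhoods. Compactness of bounded sequences
  supplies such points.\<close>

lemma hausdorff_lim_exists:
  fixes M :: "real \<Rightarrow> 'a::euclidean_space set"
  assumes F: "F \<noteq> bot" and ne: "\<And>q. M q \<noteq> {}"
    and C: "\<And>e. 0 < e \<Longrightarrow> \<exists>Q. eventually Q F \<and> (\<forall>q q'. Q q \<longrightarrow> Q q' \<longrightarrow> set_close e (M q) (M q'))"
  shows "\<exists>L. hausdorff_lim M F L"
proof -
  have "\<exists>Q. \<forall>n::nat. eventually (Q n) F \<and> (\<forall>q q'. Q n q \<longrightarrow> Q n q' \<longrightarrow> set_close (1 / real (Suc n)) (M q) (M q'))"
    by (rule choice, rule allI, rule C) simp
  then obtain Q where Q: "\<And>n::nat. eventually (Q n) F" "\<And>n q q'. Q n q \<Longrightarrow> Q n q' \<Longrightarrow> set_close (1 / real (Suc n)) (M q) (M q')"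
    by blast
  \<comment> \<open>The diagonal choice satisfies the first conditions up to \<open>n\<close> at
    once, so the sets \<open>M (q n)\<close> form a Cauchy sequence with an explicit rate.\<close>
  have "\<exists>q. \<forall>n::nat. \<forall>k\<le>n. Q k (q n)"
  proof (rule choice, rule allI)
    fix n :: nat
    have "eventually (\<lambda>q. \<forall>k\<in>{..n}. Q k q) F" by (rule eventually_ball_finite) (use Q(1) in auto)
    from eventually_happens'[OF F this] show "\<exists>q. \<forall>k\<le>n. Q k q" by auto
  qed
  then obtain q where q: "\<And>n k::nat. k \<le> n \<Longrightarrow> Q k (q n)" by blast
  define L where "L = {x. \<forall>e>0. \<exists>N. \<forall>n\<ge>N. \<exists>y\<in>M (q n). dist x y \<le> e}"
  \<comment> \<open>Points of \<open>M (q (n + k))\<close> close to \<open>x\<close> form a bounded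
    sequence; the limit of a convergent subsequence is approached by every later set, since these
    sets are close to each other.\<close>
  have far: "\<exists>l\<in>L. dist x l \<le> 1 / real (Suc k)" if p: "Q k p" and x: "x \<in> M p" for k p x
  proof -
    have "\<exists>y. \<forall>n. y n \<in> M (q (n + k)) \<and> dist x (y n) \<le> 1 / real (Suc k)"
    proof (rule choice, rule allI)
      fix n
      have "set_close (1 / real (Suc k)) (M p) (M (q (n + k)))" by (rule Q(2)[OF p q]) simp
      then show "\<exists>y. y \<in> M (q (n + k)) \<and> dist x y \<le> 1 / real (Suc k)" using x unfolding set_close_def by blast
    qed
    then obtain y where y: "\<And>n. y n \<in> M (q (n + k))" "\<And>n. dist x (y n) \<le> 1 / real (Suc k)" by blast
    have "bounded (range y)" using y(2) bounded_def by blast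
    then obtain l r where l: "strict_mono (r :: nat \<Rightarrow> nat)" "(y \<circ> r) \<longlonglongrightarrow> l" using bounded_imp_convergent_subsequence by blast
    have "l \<in> L"
      unfolding L_def
    proof (intro CollectI allI impI)
      fix e :: real assume e: "0 < e"
      obtain k' where k': "1 / real (Suc k') < e / 2" using nat_approx_posE[of "e/2"] e by auto
      have "\<forall>\<^sub>F m in sequentially. dist ((y \<circ> r) m) l < e / 2" by (rule tendstoD[OF l(2)]) (use e in simp)
      moreover have "\<forall>\<^sub>F m in sequentially. k' \<le> m" by (rule eventually_ge_at_top)
      ultimately have "\<forall>\<^sub>F m in sequentially. dist ((y \<circ> r) m) l < e / 2 \<and> k' \<le> m" by (rule eventually_conj)
      then obtain m where m: "dist (y (r m)) l < e / 2" "k' \<le> m" by (auto simp: eventually_sequentially)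
      have rm: "k' \<le> r m + k" using m(2) seq_suble[OF l(1), of m] by linarith
      show "\<exists>N. \<forall>n\<ge>N. \<exists>y\<in>M (q n). dist l y \<le> e"
      proof (intro exI[of _ k'] allI impI)
        fix n assume "k' \<le> n"
        then have "set_close (1 / real (Suc k')) (M (q (r m + k))) (M (q n))" by (intro Q(2)[OF q[OF rm] q])
        then obtain z where z: "z \<in> M (q n)" "dist (y (r m)) z \<le> 1 / real (Suc k')" using y(1)[of "r m"] unfolding set_close_def by blast
        have "dist l z \<le> dist (y (r m)) l + dist (y (r m)) z" by (rule dist_triangle3)
        then have "dist l z \<le> e" using m z k' by linarith
        then show "\<exists>y\<in>M (q n). dist l y \<le> e" using z by blast
      qed
    qed
    moreover have "dist x l \<le> 1 / real (Suc k)"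
    proof (rule LIMSEQ_le_const2)
      show "(\<lambda>m. dist x ((y \<circ> r) m)) \<longlonglongrightarrow> dist x l" by (intro tendsto_dist tendsto_const l(2))
    qed (use y(2) in auto)
    ultimately show ?thesis by blast
  qed
  have clo: "set_close (2 / real (Suc k)) (M p) L" if p: "Q k p" for k p
    unfolding set_close_def
  proof (intro conjI ballI)
    fix x assume "x \<in> M p"
    then obtain l where "l \<in> L" "dist x l \<le> 1 / real (Suc k)" using far[OF p] by blast
    moreover have "1 / real (Suc k) \<le> 2 / real (Suc k)" by (rule divide_right_mono) auto
    ultimately show "\<exists>y\<in>L. dist x y \<le> 2 / real (Suc k)" by (intro bexI[of _ l]) auto
  next
    fix y assume "y \<in> L"
    moreover have "0 < 1 / real (Suc k)" by simp
    ultimately obtain N where N: "\<And>n. n \<ge> N \<Longrightarrow> \<exists>z\<in>M (q n). dist y z \<le> 1 / real (Suc k)" unfolding L_def by blast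
    obtain z where z: "z \<in> M (q (max N k))" "dist y z \<le> 1 / real (Suc k)" using N[of "max N k"] by auto
    have "set_close (1 / real (Suc k)) (M p) (M (q (max N k)))" by (rule Q(2)[OF p q]) simp
    then obtain x where x: "x \<in> M p" "dist x z \<le> 1 / real (Suc k)" using z(1) unfolding set_close_def by blast
    have "dist x y \<le> dist x z + dist y z" by (rule dist_triangle2)
    then have "dist x y \<le> 2 / real (Suc k)" using x z by simp
    then show "\<exists>x\<in>M p. dist x y \<le> 2 / real (Suc k)" using x by blast
  qed
  have "closed L"
    unfolding closed_sequential_limits
  proof (intro allI impI)
    fix x l assume x: "(\<forall>n. x n \<in> L) \<and> x \<longlonglongrightarrow> l"
    show "l \<in> L" unfolding L_def
    proof (intro CollectI allI impI)
      fix e :: real assume e: "0 < e"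
      then obtain m where m: "dist (x m) l < e / 2" using tendstoD[of x l sequentially "e/2"] x by (auto simp: eventually_sequentially)
      have "x m \<in> L" using x by blast
      moreover have "0 < e / 2" using e by simp
      ultimately obtain N where N: "\<And>n. n \<ge> N \<Longrightarrow> \<exists>y\<in>M (q n). dist (x m) y \<le> e / 2" unfolding L_def by blast
      show "\<exists>N. \<forall>n\<ge>N. \<exists>y\<in>M (q n). dist l y \<le> e"
      proof (intro exI[of _ N] allI impI)
        fix n assume "N \<le> n"
        then obtain y where y: "y \<in> M (q n)" "dist (x m) y \<le> e / 2" using N by blast
        have "dist l y \<le> dist (x m) l + dist (x m) y" by (rule dist_triangle3)
        then have "dist l y \<le> e" using m y by linarith
        then show "\<exists>y\<in>M (q n). dist l y \<le> e" using y by blast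
      qed
    qed
  qed
  moreover have "L \<noteq> {}"
    using far[of 0 "q 0"] q[of 0 0] ne[of "q 0"] by blast
  moreover have "eventually (\<lambda>p. set_close e (M p) L) F" if e: "0 < e" for e
  proof -
    obtain k where k: "1 / real (Suc k) < e / 2" using nat_approx_posE[of "e/2"] e by auto
    show ?thesis
      using Q(1)[of k]
    proof eventually_elim
      case (elim p)
      show ?case by (rule set_close_mono[OF clo[OF elim]]) (use k in simp)
    qed
  qed
  ultimately show ?thesis unfolding hausdorff_lim_def by blast
qed

section \<open>Support functions\<close>

text \<open>The real supremum, meaningful for nonempty bounded sets; the lemmas using it supply a
  ball that contains the set.\<close>

definition support_fun :: "'a::euclidean_space set \<Rightarrow> 'a \<Rightarrow> real" where
  "support_fun A u = (SUP x\<in>A. u \<bullet> x)"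

lemma support_fun_bdd:
  assumes "A \<subseteq> cball 0 r"
  shows "bdd_above ((\<lambda>x. u \<bullet> x) ` A)"
proof (rule bdd_aboveI2)
  fix x assume "x \<in> A"
  then have "norm x \<le> r" using assms by auto
  then have "norm u * norm x \<le> norm u * r" by (rule mult_left_mono) simp
  then show "u \<bullet> x \<le> norm u * r" using norm_cauchy_schwarz[of u x] by linarith
qed

lemma support_fun_upper: "A \<subseteq> cball 0 r \<Longrightarrow> x \<in> A \<Longrightarrow> u \<bullet> x \<le> support_fun A u"
  unfolding support_fun_def by (rule cSUP_upper[OF _ support_fun_bdd])

lemma support_fun_upper_closure_hull:
  assumes "A \<subseteq> cball 0 r" "x \<in> closure (convex hull A)"
  shows "u \<bullet> x \<le> support_fun A u" and "norm x \<le> r"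
proof -
  have "convex hull A \<subseteq> {x. u \<bullet> x \<le> support_fun A u}"
    by (rule hull_minimal) (use support_fun_upper[OF assms(1)] in \<open>auto intro: convex_halfspace_le\<close>)
  then have "closure (convex hull A) \<subseteq> {x. u \<bullet> x \<le> support_fun A u}"
    by (rule closure_minimal) (rule closed_halfspace_le)
  then show "u \<bullet> x \<le> support_fun A u" using assms(2) by blast
  have "convex hull A \<subseteq> cball 0 r" using assms(1) convex_cball by (rule hull_minimal)
  then have "closure (convex hull A) \<subseteq> cball 0 r" by (rule closure_minimal) simp
  then show "norm x \<le> r" using assms(2) by auto
qed

text \<open>With \<open>y\<close> the point of the hull of \<open>B\<close> closest to
  \<open>x\<close> and \<open>u\<close> the unit vector from \<open>y\<close> to \<open>x\<close>,
  the distance is \<open>u \<bullet> x - u \<bullet> y\<close>, and \<open>y\<close> maximises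
  \<open>u\<close> over the hull. Replacing \<open>u\<close> by a net direction costs
  \<open>\<theta> * r\<close> once for \<open>x\<close> and once for \<open>B\<close>.\<close>

lemma support_one_sided:
  fixes A B E :: "'a::euclidean_space set"
  assumes A: "A \<subseteq> cball 0 r" and B: "B \<subseteq> cball 0 r" "B \<noteq> {}"
    and E: "\<And>u. norm u = 1 \<Longrightarrow> \<exists>v\<in>E. norm (u - v) \<le> \<theta>" and \<eta>: "\<And>u. u \<in> E \<Longrightarrow> support_fun A u \<le> support_fun B u + \<eta>"
    and x: "x \<in> closure (convex hull A)" and pos: "0 \<le> \<theta>" "0 \<le> \<eta>" "0 \<le> r"
  shows "\<exists>y\<in>closure (convex hull B). dist x y \<le> \<eta> + 2 * r * \<theta>"
proof -
  let ?Y = "closure (convex hull B)"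
  have Y: "closed ?Y" "convex ?Y" "?Y \<noteq> {}" using B(2) by auto
  define y where "y = closest_point ?Y x"
  have y: "y \<in> ?Y" unfolding y_def by (rule closest_point_in_set[OF Y(1,3)])
  show ?thesis
  proof (cases "x = y")
    case True
    then show ?thesis using y pos by (intro bexI[of _ y]) auto
  next
    case False
    define u where "u = (1 / norm (x - y)) *\<^sub>R (x - y)"
    have nu: "norm u = 1" using False by (simp add: u_def)
    obtain v where v: "v \<in> E" "norm (u - v) \<le> \<theta>" using E[OF nu] by blast
    have ip: "\<bar>(u - v) \<bullet> b\<bar> \<le> \<theta> * r" if "norm b \<le> r" for b
    proof -
      have "\<bar>(u - v) \<bullet> b\<bar> \<le> norm (u - v) * norm b" by (rule Cauchy_Schwarz_ineq2)
      also have "\<dots> \<le> \<theta> * r" using v that pos by (intro mult_mono) auto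
      finally show ?thesis .
    qed
    have "support_fun B v \<le> u \<bullet> y + \<theta> * r"
      unfolding support_fun_def
    proof (rule cSUP_least[OF B(2)])
      fix b assume b: "b \<in> B"
      have bY: "b \<in> ?Y" using b hull_inc[of b B convex] closure_subset by blast
      have "(x - y) \<bullet> (b - y) \<le> 0" unfolding y_def by (rule closest_point_dot[OF Y(2,1) bY])
      then have "u \<bullet> (b - y) \<le> 0" using False by (simp add: u_def divide_le_0_iff)
      then have "u \<bullet> b \<le> u \<bullet> y" by (simp add: inner_diff_right)
      moreover have "\<bar>(u - v) \<bullet> b\<bar> \<le> \<theta> * r" by (rule ip) (use b B in auto)
      ultimately show "v \<bullet> b \<le> u \<bullet> y + \<theta> * r" by (simp add: inner_diff_left)
    qed
    moreover have "v \<bullet> x \<le> support_fun A v" "norm x \<le> r" using support_fun_upper_closure_hull[OF A x] by auto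
    moreover have "\<bar>(u - v) \<bullet> x\<bar> \<le> \<theta> * r" by (rule ip) fact
    then have "u \<bullet> x \<le> v \<bullet> x + \<theta> * r" by (simp add: inner_diff_left)
    moreover have "support_fun A v \<le> support_fun B v + \<eta>" by (rule \<eta>[OF v(1)])
    ultimately have "u \<bullet> x - u \<bullet> y \<le> \<eta> + 2 * r * \<theta>" by (simp add: mult.commute)
    moreover have "u \<bullet> (x - y) = (1 / norm (x - y)) * (norm (x - y))\<^sup>2"
      by (simp add: u_def power2_norm_eq_inner)
    then have "u \<bullet> x - u \<bullet> y = norm (x - y)"
      using False by (simp add: inner_diff_right power2_eq_square)
    ultimately show ?thesis using y by (intro bexI[of _ y]) (auto simp: dist_norm)
  qed
qed

text \<open>Compactness of the unit sphere reduces closeness in all directions to finitely many of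
  them. The net depends only on \<open>r\<close> and \<open>e\<close>, not on the sets.\<close>

lemma support_close:
  fixes D :: "'a::euclidean_space set"
  assumes D: "\<And>x e. 0 < e \<Longrightarrow> \<exists>d\<in>D. dist d x < e" and r: "0 \<le> r" and e: "0 < e"
  shows "\<exists>E \<eta>. finite E \<and> E \<subseteq> D \<and> 0 < \<eta> \<and>
    (\<forall>A B. A \<noteq> {} \<longrightarrow> B \<noteq> {} \<longrightarrow> A \<subseteq> cball 0 r \<longrightarrow> B \<subseteq> cball 0 r \<longrightarrow>
      (\<forall>u\<in>E. \<bar>support_fun A u - support_fun B u\<bar> \<le> \<eta>) \<longrightarrow> set_close e (closure (convex hull A)) (closure (convex hull B)))"
proof -
  \<comment> \<open>Chosen so that the error \<open>2 * r * \<theta>\<close> takes at most half of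
    \<open>e\<close>; \<open>r + 1\<close> avoids division by zero.\<close>
  define \<theta> where "\<theta> = e / (4 * (r + 1))"
  have \<theta>: "0 < \<theta>" using e r by (simp add: \<theta>_def)
  have "2 * r * \<theta> \<le> 2 * (r + 1) * \<theta>" using \<theta> by (intro mult_right_mono) auto
  also have "2 * (r + 1) * \<theta> = e / 2" using r by (simp add: \<theta>_def field_simps)
  finally have r\<theta>: "2 * r * \<theta> \<le> e / 2" .
  have cp: "compact (sphere (0::'a) 1)" by simp
  have cov: "sphere (0::'a) 1 \<subseteq> (\<Union>d\<in>D. ball d \<theta>)"
  proof
    fix u :: 'a
    obtain d where "d \<in> D" "dist d u < \<theta>" using D[OF \<theta>] by blast
    then show "u \<in> (\<Union>d\<in>D. ball d \<theta>)" by auto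
  qed
  obtain E where E: "E \<subseteq> D" "finite E" "sphere (0::'a) 1 \<subseteq> (\<Union>d\<in>E. ball d \<theta>)"
    by (rule compactE_image[OF cp _ cov]) auto
  have net: "\<exists>v\<in>E. norm (u - v) \<le> \<theta>" if "norm u = 1" for u
  proof -
    have "u \<in> sphere 0 1" using that by simp
    then obtain v where "v \<in> E" "dist v u < \<theta>" using E(3) by auto
    then show ?thesis by (intro bexI[of _ v]) (auto simp: dist_norm norm_minus_commute)
  qed
  show ?thesis
  proof (intro exI[of _ E] exI[of _ "e/2"] conjI allI impI)
    fix A B :: "'a set"
    assume AB: "A \<noteq> {}" "B \<noteq> {}" "A \<subseteq> cball 0 r" "B \<subseteq> cball 0 r" and S: "\<forall>u\<in>E. \<bar>support_fun A u - support_fun B u\<bar> \<le> e/2"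
    have S1: "support_fun A u \<le> support_fun B u + e/2" and S2: "support_fun B u \<le> support_fun A u + e/2" if "u \<in> E" for u
      using bspec[OF S that] by linarith+
    have e2: "0 \<le> e / 2" using e by simp
    show "set_close e (closure (convex hull A)) (closure (convex hull B))"
      unfolding set_close_def
    proof (intro conjI ballI)
      fix x assume "x \<in> closure (convex hull A)"
      then have "\<exists>y\<in>closure (convex hull B). dist x y \<le> e / 2 + 2 * r * \<theta>"
        by (intro support_one_sided[of A r B E \<theta> "e/2" x] AB net S1 less_imp_le[OF \<theta>] e2 r)
      then obtain y where "y \<in> closure (convex hull B)" "dist x y \<le> e / 2 + 2 * r * \<theta>" by blast
      then show "\<exists>y\<in>closure (convex hull B). dist x y \<le> e" using r\<theta> by (intro bexI[of _ y]) auto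
    next
      fix y assume "y \<in> closure (convex hull B)"
      then have "\<exists>x\<in>closure (convex hull A). dist y x \<le> e / 2 + 2 * r * \<theta>"
        by (intro support_one_sided[of B r A E \<theta> "e/2" y] AB net S2 less_imp_le[OF \<theta>] e2 r)
      then obtain x where "x \<in> closure (convex hull A)" "dist y x \<le> e / 2 + 2 * r * \<theta>" by blast
      then show "\<exists>x\<in>closure (convex hull A). dist x y \<le> e" using r\<theta> by (intro bexI[of _ x]) (auto simp: dist_commute)
    qed
  qed (use E e in auto)
qed

text \<open>The hull of one family, enlarged by a ball of radius \<open>e\<close>, is convex and
  contains the other family. The factor \<open>2\<close> leaves room for passing to
  closures.\<close>

lemma set_close_closure_hull_family:
  fixes a b :: "'i \<Rightarrow> 'a::euclidean_space"
  assumes ab: "\<And>i. i \<in> I \<Longrightarrow> dist (a i) (b i) \<le> e" and e: "0 < e"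
  shows "set_close (2 * e) (closure (convex hull (a ` I))) (closure (convex hull (b ` I)))"
proof -
  have one: "\<exists>y\<in>closure (convex hull (b ` I)). dist x y \<le> 2 * e"
    if ab: "\<And>i. i \<in> I \<Longrightarrow> dist (a i) (b i) \<le> e" and x: "x \<in> closure (convex hull (a ` I))" for a b :: "'i \<Rightarrow> 'a" and x
  proof -
    let ?C = "{y + d | y d. y \<in> convex hull (b ` I) \<and> d \<in> cball 0 e}"
    have C: "?C = (\<Union>y\<in>convex hull (b ` I). \<Union>d\<in>cball 0 e. {y + d})" by blast
    have "convex hull (a ` I) \<subseteq> ?C"
    proof (rule hull_minimal)
      show "convex ?C" unfolding C by (rule convex_sums[OF convex_convex_hull convex_cball])
      show "a ` I \<subseteq> ?C"
      proof
        fix z assume "z \<in> a ` I"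
        then obtain i where i: "i \<in> I" "z = a i" by blast
        have "z = b i + (a i - b i)" "b i \<in> convex hull (b ` I)" "a i - b i \<in> cball 0 e"
          using i ab[OF i(1)] by (auto simp: dist_norm norm_minus_commute intro!: hull_inc)
        then show "z \<in> ?C" by blast
      qed
    qed
    moreover obtain x' where x': "x' \<in> convex hull (a ` I)" "dist x' x < e"
      using x e unfolding closure_approachable by blast
    ultimately obtain y d where y: "y \<in> convex hull (b ` I)" "norm d \<le> e" "x' = y + d" by auto
    have "dist x y \<le> dist x' x + dist x' y" by (rule dist_triangle3)
    also have "dist x' y = norm d" using y by (simp add: dist_norm)
    finally have "dist x y \<le> 2 * e" using x' y by simp
    then show ?thesis using y(1) closure_subset by blast
  qed
  show ?thesis
    unfolding set_close_def
  proof (intro conjI ballI)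
    fix x assume "x \<in> closure (convex hull (a ` I))"
    then show "\<exists>y\<in>closure (convex hull (b ` I)). dist x y \<le> 2 * e" by (intro one[of a b x] ab)
  next
    fix y assume y: "y \<in> closure (convex hull (b ` I))"
    have ba: "dist (b i) (a i) \<le> e" if "i \<in> I" for i using ab[OF that] by (simp add: dist_commute)
    have "\<exists>x\<in>closure (convex hull (a ` I)). dist y x \<le> 2 * e" by (intro one[of b a y] ba y)
    then show "\<exists>x\<in>closure (convex hull (a ` I)). dist x y \<le> 2 * e" by (simp add: dist_commute)
  qed
qed

section \<open>One-sided limits along dyadic times\<close>

lemma at_within_dyads_left:
  assumes "0 < T" "0 < t" "t \<le> T"
  shows "at t within (dyads T \<inter> {..<t}) \<noteq> bot"
  unfolding trivial_limit_within islimpt_approachable not_not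
proof (intro allI impI)
  fix e :: real assume "0 < e"
  then obtain q where "q \<in> dyads T" "max 0 (t - e) < q" "q < t" using dyads_dense[of "max 0 (t - e)" t T] assms by auto
  then show "\<exists>x'\<in>dyads T \<inter> {..<t}. x' \<noteq> t \<and> dist x' t < e" by (intro bexI[of _ q]) (auto simp: dist_real_def)
qed

lemma at_within_dyads_right:
  assumes "0 < T" "0 \<le> t" "t < T"
  shows "at t within (dyads T \<inter> {t<..}) \<noteq> bot"
  unfolding trivial_limit_within islimpt_approachable not_not
proof (intro allI impI)
  fix e :: real assume "0 < e"
  then obtain q where "q \<in> dyads T" "t < q" "q < min T (t + e)" using dyads_dense[of t "min T (t + e)" T] assms by auto
  then show "\<exists>x'\<in>dyads T \<inter> {t<..}. x' \<noteq> t \<and> dist x' t < e" by (intro bexI[of _ q]) (auto simp: dist_real_def)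
qed

text \<open>For \<open>s > 0\<close> every \<open>N s\<close> is approximated by some
  \<open>M q\<close> with a dyadic \<open>q\<close> slightly before \<open>s\<close>, so
  \<open>N\<close> inherits the limits of \<open>M\<close> from the left and from the right. On the
  left the limit is \<open>N t\<close> itself.\<close>

lemma hausdorff_caglad_left_limits:
  fixes M N :: "real \<Rightarrow> 'a::euclidean_space set"
  assumes T: "0 < T"
    and left: "\<And>t. 0 < t \<Longrightarrow> t \<le> T \<Longrightarrow> hausdorff_lim M (at t within (dyads T \<inter> {..<t})) (N t)"
    and right: "\<And>t. 0 \<le> t \<Longrightarrow> t < T \<Longrightarrow> \<exists>L. hausdorff_lim M (at t within (dyads T \<inter> {t<..})) L"
  shows "hausdorff_caglad T N"
proof -
  have near: "\<exists>q\<in>dyads T. a < q \<and> q < s \<and> set_close e (M q) (N s)" if s: "0 < s" "s \<le> T" "a < s" and e: "0 < e" for s a e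
  proof -
    have "eventually (\<lambda>q. set_close e (M q) (N s)) (at s within (dyads T \<inter> {..<s}))"
      using left[OF s(1,2)] e unfolding hausdorff_lim_def by blast
    then obtain d where d: "0 < d" "\<And>q. q \<in> dyads T \<Longrightarrow> q < s \<Longrightarrow> dist q s < d \<Longrightarrow> set_close e (M q) (N s)"
      unfolding eventually_at by auto
    obtain q where "q \<in> dyads T" "max 0 (max a (s - d)) < q" "q < s"
      using dyads_dense[of "max 0 (max a (s - d))" s T] s d by auto
    then show ?thesis using d(2)[of q] by (intro bexI[of _ q]) (auto simp: dist_real_def)
  qed
  have "((\<lambda>s. hausdorff_distance (N s) (N t)) \<longlongrightarrow> 0) (at t within {0..<t})" if t: "t \<in> {0<..T}" for t
  proof (rule tendsto_hausdorff_0)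
    fix e :: real assume e: "0 < e"
    have "eventually (\<lambda>q. set_close (e/2) (M q) (N t)) (at t within (dyads T \<inter> {..<t}))"
      using left[of t] t e unfolding hausdorff_lim_def by auto
    then obtain d where d: "0 < d" "\<And>q. q \<in> dyads T \<Longrightarrow> q < t \<Longrightarrow> dist q t < d \<Longrightarrow> set_close (e/2) (M q) (N t)"
      unfolding eventually_at by auto
    show "eventually (\<lambda>s. set_close e (N s) (N t)) (at t within {0..<t})"
      unfolding eventually_at
    proof (intro exI[of _ "min d t"] conjI ballI impI)
      \<comment> \<open>The radius is at most \<open>t\<close>, which keeps \<open>s\<close>
        positive, where \<open>N s\<close> is a left limit.\<close>
      fix s assume "s \<in> {0..<t}" and "s \<noteq> t \<and> dist s t < min d t"
      then have s: "0 < s" "s < t" "t - d < s" by (auto simp: dist_real_def)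
      then obtain q where q: "q \<in> dyads T" "t - d < q" "q < s" "set_close (e/2) (M q) (N s)"
        using near[of s "t - d" "e/2"] t e by auto
      have "set_close (e/2) (M q) (N t)" by (rule d(2)[OF q(1)]) (use q s in \<open>auto simp: dist_real_def\<close>)
      from set_close_trans[OF set_close_sym[OF q(4)] this] show "set_close e (N s) (N t)" by simp
    qed (use d t in auto)
  qed
  moreover have "\<exists>D. D \<noteq> {} \<and> closed D \<and> ((\<lambda>s. hausdorff_distance (N s) D) \<longlongrightarrow> 0) (at t within {t<..T})"
    if t: "t \<in> {0..<T}" for t
  proof -
    obtain L where L: "hausdorff_lim M (at t within (dyads T \<inter> {t<..})) L" using right[of t] t by auto
    have "((\<lambda>s. hausdorff_distance (N s) L) \<longlongrightarrow> 0) (at t within {t<..T})"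
    proof (rule tendsto_hausdorff_0)
      fix e :: real assume e: "0 < e"
      have "eventually (\<lambda>q. set_close (e/2) (M q) L) (at t within (dyads T \<inter> {t<..}))"
        using L e unfolding hausdorff_lim_def by auto
      then obtain d where d: "0 < d" "\<And>q. q \<in> dyads T \<Longrightarrow> t < q \<Longrightarrow> dist q t < d \<Longrightarrow> set_close (e/2) (M q) L"
        unfolding eventually_at by auto
      show "eventually (\<lambda>s. set_close e (N s) L) (at t within {t<..T})"
        unfolding eventually_at
      proof (intro exI[of _ d] conjI ballI impI)
        fix s assume "s \<in> {t<..T}" and "s \<noteq> t \<and> dist s t < d"
        then have s: "t < s" "s \<le> T" "s < t + d" by (auto simp: dist_real_def)
        then obtain q where q: "q \<in> dyads T" "t < q" "q < s" "set_close (e/2) (M q) (N s)"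
          using near[of s t "e/2"] t e by auto
        have "set_close (e/2) (M q) L" by (rule d(2)[OF q(1)]) (use q s in \<open>auto simp: dist_real_def\<close>)
        from set_close_trans[OF set_close_sym[OF q(4)] this] show "set_close e (N s) L" by simp
      qed (use d in auto)
    qed
    then show ?thesis using L unfolding hausdorff_lim_def by blast
  qed
  ultimately show ?thesis unfolding hausdorff_caglad_def by blast
qed

section \<open>Suprema of martingales\<close>

text \<open>An inequality tested on all sets of \<open>G\<close> passes to the maximum of two
  \<open>G\<close>-measurable functions, because the set where one dominates the other is itself a
  test set. Finite maxima then increase to the supremum.\<close>

lemma nn_set_integral_SUP_le:
  fixes f :: "nat \<Rightarrow> 'w \<Rightarrow> ennreal"
  assumes G: "sets G \<subseteq> sets P" "space G = space P" and f: "\<And>k. f k \<in> borel_measurable G" and h: "h \<in> borel_measurable P"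
    and le: "\<And>k A. A \<in> sets G \<Longrightarrow> (\<integral>\<^sup>+x\<in>A. f k x \<partial>P) \<le> (\<integral>\<^sup>+x\<in>A. h x \<partial>P)" and A: "A \<in> sets G"
  shows "(\<integral>\<^sup>+x\<in>A. (SUP k. f k x) \<partial>P) \<le> (\<integral>\<^sup>+x\<in>A. h x \<partial>P)"
proof -
  define m where "m = rec_nat (f 0) (\<lambda>n g x. max (g x) (f (Suc n) x))"
  have m0: "m 0 = f 0" unfolding m_def by simp
  have mS: "m (Suc n) = (\<lambda>x. max (m n x) (f (Suc n) x))" for n unfolding m_def by simp
  have mG: "m n \<in> borel_measurable G" for n
  proof (induction n)
    case (Suc n) then show ?case unfolding mS using f[of "Suc n"] by (intro borel_measurable_max)
  qed (simp add: m0 f)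
  have GP: "g \<in> borel_measurable P" if "g \<in> borel_measurable G" for g :: "'w \<Rightarrow> ennreal"
    using that G unfolding measurable_def by auto
  have mle: "(\<integral>\<^sup>+x\<in>A. m n x \<partial>P) \<le> (\<integral>\<^sup>+x\<in>A. h x \<partial>P)" if "A \<in> sets G" for n A
    using that
  proof (induction n arbitrary: A)
    case 0 then show ?case using le by (simp add: m0)
  next
    case (Suc n)
    define U where "U = {x \<in> space G. f (Suc n) x \<le> m n x}"
    have U: "U \<in> sets G" unfolding U_def using f[of "Suc n"] mG[of n] by measurable
    have AU: "A \<inter> U \<in> sets G" "A - U \<in> sets G" using U Suc(2) by auto
    have AUP: "A \<inter> U \<in> sets P" "A - U \<in> sets P" using AU G by auto
    have split: "(\<integral>\<^sup>+x\<in>A. g x \<partial>P) = (\<integral>\<^sup>+x\<in>A \<inter> U. g x \<partial>P) + (\<integral>\<^sup>+x\<in>A - U. g x \<partial>P)" if "g \<in> borel_measurable P" for g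
    proof -
      have "(\<integral>\<^sup>+x\<in>A. g x \<partial>P) = (\<integral>\<^sup>+x. g x * indicator (A \<inter> U) x + g x * indicator (A - U) x \<partial>P)"
        by (intro nn_integral_cong) (auto simp: indicator_def)
      then show ?thesis using that AUP by (simp add: nn_integral_add)
    qed
    have Asp: "A \<subseteq> space G" by (rule sets.sets_into_space[OF Suc(2)])
    have 1: "(\<integral>\<^sup>+x\<in>A \<inter> U. m (Suc n) x \<partial>P) = (\<integral>\<^sup>+x\<in>A \<inter> U. m n x \<partial>P)"
      by (intro nn_integral_cong) (auto simp: indicator_def mS U_def max_def)
    have 2: "(\<integral>\<^sup>+x\<in>A - U. m (Suc n) x \<partial>P) = (\<integral>\<^sup>+x\<in>A - U. f (Suc n) x \<partial>P)"
      by (intro nn_integral_cong) (use Asp in \<open>auto simp: indicator_def mS U_def max_def\<close>)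
    show ?case
      unfolding split[OF GP[OF mG]] split[OF h] 1 2 by (intro add_mono Suc(1) le AU)
  qed
  have inc: "incseq m" by (rule incseq_SucI) (simp add: mS le_fun_def)
  have sup: "(SUP k. f k x) = (SUP n. m n x)" for x
  proof (rule antisym)
    show "(SUP k. f k x) \<le> (SUP n. m n x)"
    proof (rule SUP_mono)
      fix k show "\<exists>n\<in>UNIV. f k x \<le> m n x" by (rule bexI[of _ k]) (cases k; simp add: m0 mS)+
    qed
    have "m n x \<le> (SUP k. f k x)" for n by (induction n) (auto simp: m0 mS intro: SUP_upper)
    then show "(SUP n. m n x) \<le> (SUP k. f k x)" by (intro SUP_least)
  qed
  have "(\<integral>\<^sup>+x\<in>A. (SUP k. f k x) \<partial>P) = (\<integral>\<^sup>+x. (SUP n. m n x * indicator A x) \<partial>P)"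
    unfolding sup by (intro nn_integral_cong) (simp add: SUP_mult_right_ennreal)
  also have "\<dots> = (SUP n. \<integral>\<^sup>+x\<in>A. m n x \<partial>P)"
  proof (rule nn_integral_monotone_convergence_SUP)
    show "incseq (\<lambda>n x. m n x * indicator A x)"
      using inc by (auto simp: incseq_def le_fun_def intro: mult_right_mono)
    show "(\<lambda>x. m n x * indicator A x) \<in> borel_measurable P" for n
      using GP[OF mG] A G by (intro borel_measurable_times_ennreal borel_measurable_indicator) auto
  qed
  also have "\<dots> \<le> (\<integral>\<^sup>+x\<in>A. h x \<partial>P)" by (rule SUP_least) (rule mle[OF A])
  finally show ?thesis .
qed

text \<open>From indicators to nonnegative measurable weights by the usual induction; this takes the
  place of conditioning on \<open>G\<close>.\<close>

lemma nn_integral_weight_mono: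
  fixes f g Z :: "'w \<Rightarrow> ennreal"
  assumes G: "sets G \<subseteq> sets P" "space G = space P" and fg: "f \<in> borel_measurable P" "g \<in> borel_measurable P"
    and le: "\<And>A. A \<in> sets G \<Longrightarrow> (\<integral>\<^sup>+x\<in>A. f x \<partial>P) \<le> (\<integral>\<^sup>+x\<in>A. g x \<partial>P)"
    and Z: "Z \<in> borel_measurable G"
  shows "(\<integral>\<^sup>+x. Z x * f x \<partial>P) \<le> (\<integral>\<^sup>+x. Z x * g x \<partial>P)"
proof -
  have GP: "u \<in> borel_measurable P" if "u \<in> borel_measurable G" for u :: "'w \<Rightarrow> ennreal"
    using that G unfolding measurable_def by auto
  show ?thesis
    using Z
  proof (induction Z rule: borel_measurable_induct)
    case (cong u v)
    have "(\<integral>\<^sup>+x. u x * f x \<partial>P) = (\<integral>\<^sup>+x. v x * f x \<partial>P)" "(\<integral>\<^sup>+x. u x * g x \<partial>P) = (\<integral>\<^sup>+x. v x * g x \<partial>P)"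
      using cong(3) G(2) by (auto intro!: nn_integral_cong)
    then show ?case using cong(4) by simp
  next
    case (set A)
    then show ?case using le[of A] by (simp add: mult.commute)
  next
    case (mult u c)
    have "(\<integral>\<^sup>+x. c * u x * f x \<partial>P) = c * (\<integral>\<^sup>+x. u x * f x \<partial>P)" "(\<integral>\<^sup>+x. c * u x * g x \<partial>P) = c * (\<integral>\<^sup>+x. u x * g x \<partial>P)"
      using GP[OF mult(2)] fg unfolding mult.assoc by (auto intro!: nn_integral_cmult)
    then show ?case using mult(4) by (simp add: mult_left_mono)
  next
    case (add u v)
    have "(\<integral>\<^sup>+x. (v x + u x) * f x \<partial>P) = (\<integral>\<^sup>+x. v x * f x \<partial>P) + (\<integral>\<^sup>+x. u x * f x \<partial>P)"
      "(\<integral>\<^sup>+x. (v x + u x) * g x \<partial>P) = (\<integral>\<^sup>+x. v x * g x \<partial>P) + (\<integral>\<^sup>+x. u x * g x \<partial>P)"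
      using GP[OF add(1)] GP[OF add(3)] fg unfolding distrib_right by (auto intro!: nn_integral_add)
    then show ?case using add(6,7) by (simp add: add_mono)
  next
    case (seq U)
    have *: "(\<integral>\<^sup>+x. (SUP i. U i) x * r x \<partial>P) = (SUP i. \<integral>\<^sup>+x. U i x * r x \<partial>P)" if r: "r \<in> borel_measurable P" for r
    proof -
      have "(\<integral>\<^sup>+x. (SUP i. U i) x * r x \<partial>P) = (\<integral>\<^sup>+x. (SUP i. U i x * r x) \<partial>P)"
        by (intro nn_integral_cong) (simp add: SUP_mult_right_ennreal image_comp)
      also have "\<dots> = (SUP i. \<integral>\<^sup>+x. U i x * r x \<partial>P)"
        by (rule nn_integral_monotone_convergence_SUP)
           (use seq(3) GP[OF seq(1)] r in \<open>auto simp: incseq_def le_fun_def intro: mult_right_mono\<close>)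
      finally show ?thesis .
    qed
    show ?case unfolding *[OF fg(1)] *[OF fg(2)] by (rule SUP_mono) (use seq(5) in blast)
  qed
qed

section \<open>Submartingales obtained from martingales\<close>

context brownian_setting
begin

text \<open>\<open>ennreal\<close> discards negative values, so positive parts are compared. The
  test vector is \<open>u\<close> on the part of \<open>A\<close> where
  \<open>u \<bullet> X s\<close> is positive: there the martingale equality holds, and at time
  \<open>t\<close> passing to the positive part and to all of \<open>A\<close> only increases the
  integral.\<close>

lemma martingale_pos_part_mono:
  fixes X :: "real \<Rightarrow> 'w \<Rightarrow> 'a::euclidean_space"
  assumes X: "cone_martingale UNIV X" and st: "0 \<le> s" "s \<le> t" "t \<le> T" and A: "A \<in> sets (F s)"
  shows "(\<integral>\<^sup>+w\<in>A. ennreal (u \<bullet> X s w) \<partial>P) \<le> (\<integral>\<^sup>+w\<in>A. ennreal (u \<bullet> X t w) \<partial>P)"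
proof -
  have sF: "X s \<in> borel_measurable (F s)" and ss: "square_integrable P (X s)" and ts: "square_integrable P (X t)"
    using cone_martingaleD[OF X, of s] cone_martingaleD[OF X, of t] st by auto
  have sT: "s \<le> T" using st by simp
  define A' where "A' = A \<inter> {w \<in> space (F s). 0 < u \<bullet> X s w}"
  have A': "A' \<in> sets (F s)" unfolding A'_def using A sF by measurable
  have A'P: "A' \<in> sets P" using A' sets_F_subset[OF sT] by blast
  have Asp: "A \<subseteq> space P" using sets.sets_into_space[OF A] by simp
  define Z where "Z w = indicator A' w *\<^sub>R u" for w
  have ZF: "Z \<in> borel_measurable (F s)"
    unfolding Z_def[abs_def] using A' by (intro borel_measurable_scaleR borel_measurable_indicator borel_measurable_const)
  have Zs: "square_integrable P Z"
    by (rule square_integrable_bound[OF measurable_F_P[OF sT ZF] square_integrable_const[of u]]) (auto simp: Z_def indicator_def)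
  have Zi: "integrable P (\<lambda>w. Z w \<bullet> X s w)" "integrable P (\<lambda>w. Z w \<bullet> X t w)"
    by (intro square_integrable_inner Zs ss ts)+
  have eq: "expectation (\<lambda>w. Z w \<bullet> X s w) = expectation (\<lambda>w. Z w \<bullet> X t w)"
    using cone_martingale_UNIV_eq_0[OF X st ZF Zs] Zi by (simp add: inner_diff_right)
  have "(\<integral>\<^sup>+w\<in>A. ennreal (u \<bullet> X s w) \<partial>P) = (\<integral>\<^sup>+w. ennreal (Z w \<bullet> X s w) \<partial>P)"
    by (intro nn_integral_cong) (auto simp: Z_def A'_def indicator_def ennreal_neg not_less)
  also have "\<dots> = ennreal (expectation (\<lambda>w. Z w \<bullet> X s w))"
  proof (rule nn_integral_eq_integral[OF Zi(1)])
    show "AE w in P. 0 \<le> Z w \<bullet> X s w" by (auto simp: Z_def A'_def indicator_def less_imp_le)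
  qed
  also have "\<dots> = ennreal (expectation (\<lambda>w. Z w \<bullet> X t w))" by (simp add: eq)
  also have "\<dots> \<le> (\<integral>\<^sup>+w. ennreal (Z w \<bullet> X t w) \<partial>P)"
  proof -
    have i: "integrable P (\<lambda>w. max 0 (Z w \<bullet> X t w))" using Zi(2) by simp
    have "expectation (\<lambda>w. Z w \<bullet> X t w) \<le> expectation (\<lambda>w. max 0 (Z w \<bullet> X t w))"
      by (rule integral_mono[OF Zi(2) i]) simp
    then have "ennreal (expectation (\<lambda>w. Z w \<bullet> X t w)) \<le> ennreal (expectation (\<lambda>w. max 0 (Z w \<bullet> X t w)))" by (rule ennreal_leI)
    also have "\<dots> = (\<integral>\<^sup>+w. ennreal (max 0 (Z w \<bullet> X t w)) \<partial>P)" by (rule nn_integral_eq_integral[symmetric, OF i]) simp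
    finally show ?thesis by (simp add: ennreal_max_0)
  qed
  also have "\<dots> \<le> (\<integral>\<^sup>+w\<in>A. ennreal (u \<bullet> X t w) \<partial>P)"
    by (rule nn_integral_mono) (auto simp: Z_def A'_def indicator_def)
  finally show ?thesis .
qed

text \<open>Testing with \<open>X s\<close> restricted to \<open>A\<close> removes the cross term.
  The localisation to sets of \<open>F s\<close> is what later admits the supremum over the
  family.\<close>

lemma martingale_norm2_mono:
  fixes X :: "real \<Rightarrow> 'w \<Rightarrow> 'a::euclidean_space"
  assumes X: "cone_martingale UNIV X" and st: "0 \<le> s" "s \<le> t" "t \<le> T" and A: "A \<in> sets (F s)"
  shows "(\<integral>\<^sup>+w\<in>A. ennreal ((norm (X s w))\<^sup>2) \<partial>P) \<le> (\<integral>\<^sup>+w\<in>A. ennreal ((norm (X t w))\<^sup>2) \<partial>P)"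
proof -
  have sF: "X s \<in> borel_measurable (F s)" and ss: "square_integrable P (X s)" and ts: "square_integrable P (X t)"
    using cone_martingaleD[OF X, of s] cone_martingaleD[OF X, of t] st by auto
  have sT: "s \<le> T" using st by simp
  have AP: "A \<in> sets P" using A sets_F_subset[OF sT] by blast
  define Z where "Z w = indicator A w *\<^sub>R X s w" for w
  have ZF: "Z \<in> borel_measurable (F s)"
    unfolding Z_def[abs_def] using A sF by (intro borel_measurable_scaleR borel_measurable_indicator)
  have Zs: "square_integrable P Z"
    by (rule square_integrable_bound[OF measurable_F_P[OF sT ZF] ss]) (auto simp: Z_def indicator_def)
  define Y where "Y w = indicator A w *\<^sub>R X t w" for w
  have Ys: "square_integrable P Y"
    by (rule square_integrable_bound[OF _ ts])
       (use AP square_integrable_measurable[OF ts] in \<open>auto simp: Y_def[abs_def] indicator_def\<close>)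
  have "0 = expectation (\<lambda>w. Z w \<bullet> (X t w - X s w))" using cone_martingale_UNIV_eq_0[OF X st ZF Zs] by simp
  also have "\<dots> = expectation (\<lambda>w. Z w \<bullet> (Y w - Z w))"
    by (intro Bochner_Integration.integral_cong refl) (auto simp: Z_def Y_def indicator_def)
  finally have z: "expectation (\<lambda>w. Z w \<bullet> (Y w - Z w)) = 0" by simp
  have "expectation (\<lambda>w. (norm (Z w))\<^sup>2 + 2 * (Z w \<bullet> (Y w - Z w))) \<le> expectation (\<lambda>w. (norm (Y w))\<^sup>2)"
  proof (rule integral_mono)
    fix w
    have "(norm (Y w))\<^sup>2 = (norm (Z w))\<^sup>2 + 2 * (Z w \<bullet> (Y w - Z w)) + (norm (Y w - Z w))\<^sup>2"
      by (simp add: power2_norm_eq_inner inner_diff_left inner_diff_right inner_commute)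
    then show "(norm (Z w))\<^sup>2 + 2 * (Z w \<bullet> (Y w - Z w)) \<le> (norm (Y w))\<^sup>2" by simp
  qed (use Zs Ys square_integrable_inner[OF Zs square_integrable_diff[OF Ys Zs]] in \<open>auto simp: square_integrable_def\<close>)
  moreover have "expectation (\<lambda>w. (norm (Z w))\<^sup>2 + 2 * (Z w \<bullet> (Y w - Z w))) = expectation (\<lambda>w. (norm (Z w))\<^sup>2)"
    using Zs square_integrable_inner[OF Zs square_integrable_diff[OF Ys Zs]] z
    by (subst Bochner_Integration.integral_add) (auto simp: square_integrable_def)
  ultimately have "(\<integral>\<^sup>+w. ennreal ((norm (Z w))\<^sup>2) \<partial>P) \<le> (\<integral>\<^sup>+w. ennreal ((norm (Y w))\<^sup>2) \<partial>P)"
    unfolding square_integrable_nn_integral[OF Zs] square_integrable_nn_integral[OF Ys] by (simp add: ennreal_leI)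
  moreover have "(\<integral>\<^sup>+w. ennreal ((norm (Z w))\<^sup>2) \<partial>P) = (\<integral>\<^sup>+w\<in>A. ennreal ((norm (X s w))\<^sup>2) \<partial>P)"
    "(\<integral>\<^sup>+w. ennreal ((norm (Y w))\<^sup>2) \<partial>P) = (\<integral>\<^sup>+w\<in>A. ennreal ((norm (X t w))\<^sup>2) \<partial>P)"
    by (auto intro!: nn_integral_cong simp: Z_def Y_def indicator_def)
  ultimately show ?thesis by simp
qed

section \<open>The supremum of a dominated family\<close>

text \<open>The supremum is taken in \<open>ennreal\<close>, where it always exists and is
  measurable, and negative members count as \<open>0\<close>. In the application the member with
  index \<open>0\<close> vanishes, so nothing is lost. An infinite supremum, which under domination
  occurs only on a null set at each time, is sent to \<open>0\<close>.\<close>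

definition sup_process :: "(nat \<Rightarrow> real \<Rightarrow> 'w \<Rightarrow> 'a::euclidean_space) \<Rightarrow> 'a \<Rightarrow> real \<Rightarrow> 'w \<Rightarrow> real" where
  "sup_process N u t w = enn2real (SUP k. ennreal (u \<bullet> N k t w))"

context
  fixes N :: "nat \<Rightarrow> real \<Rightarrow> 'w \<Rightarrow> 'a::euclidean_space" and \<zeta> :: "'w \<Rightarrow> real"
  assumes N: "\<And>k. cone_martingale UNIV (N k)"
    and \<zeta>: "\<zeta> \<in> borel_measurable P" "integrable P (\<lambda>w. (\<zeta> w)\<^sup>2)"
    and dom: "\<And>k. AE w in P. norm (N k T w) \<le> \<zeta> w"
begin

lemma N_measurable: "t \<in> {0..T} \<Longrightarrow> N k t \<in> borel_measurable (F t)"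
  and N_measurable_P: "t \<in> {0..T} \<Longrightarrow> N k t \<in> borel_measurable P"
  using cone_martingaleD[OF N[of k], of t] square_integrable_measurable[of P "N k t"] by auto

text \<open>Domination is assumed at time \<open>T\<close> only. On every set of \<open>F t\<close>
  the squared norm at \<open>t\<close> has no larger integral than the one at \<open>T\<close>,
  hence than the square of \<open>\<zeta>\<close>, and an inequality tested on sets passes to the
  supremum.\<close>

lemma sup_norm2_integral:
  assumes t: "t \<in> {0..T}"
  shows "(\<integral>\<^sup>+w. (SUP k. ennreal ((norm (N k t w))\<^sup>2)) \<partial>P) < \<infinity>"
proof -
  note [measurable] = N_measurable[OF t] \<zeta>(1)
  have "(\<integral>\<^sup>+w\<in>space P. (SUP k. ennreal ((norm (N k t w))\<^sup>2)) \<partial>P) \<le> (\<integral>\<^sup>+w\<in>space P. ennreal ((\<zeta> w)\<^sup>2) \<partial>P)"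
  proof (rule nn_set_integral_SUP_le[where G="F t"])
    show "sets (F t) \<subseteq> sets P" using t by (intro sets_F_subset) auto
    fix k A assume A: "A \<in> sets (F t)"
    have "(\<integral>\<^sup>+w\<in>A. ennreal ((norm (N k t w))\<^sup>2) \<partial>P) \<le> (\<integral>\<^sup>+w\<in>A. ennreal ((norm (N k T w))\<^sup>2) \<partial>P)"
      using t A by (intro martingale_norm2_mono[OF N]) auto
    also have "\<dots> \<le> (\<integral>\<^sup>+w\<in>A. ennreal ((\<zeta> w)\<^sup>2) \<partial>P)"
      using dom[of k]
    proof (intro nn_integral_mono_AE, eventually_elim)
      case (elim w)
      then have "(norm (N k T w))\<^sup>2 \<le> (\<zeta> w)\<^sup>2" by (intro power_mono) auto
      then show ?case by (intro mult_right_mono ennreal_leI) auto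
    qed
    finally show "(\<integral>\<^sup>+w\<in>A. ennreal ((norm (N k t w))\<^sup>2) \<partial>P) \<le> (\<integral>\<^sup>+w\<in>A. ennreal ((\<zeta> w)\<^sup>2) \<partial>P)" .
  qed (auto simp: space_F[of t, symmetric] simp del: space_F)
  also have "\<dots> = (\<integral>\<^sup>+w. ennreal ((\<zeta> w)\<^sup>2) \<partial>P)" by (intro nn_integral_cong) simp
  also have "\<dots> < \<infinity>" using \<zeta>(2) by (simp add: nn_integral_eq_integral)
  finally show ?thesis by (simp add: nn_integral_set_ennreal[symmetric] cong: nn_integral_cong)
qed

lemma AE_sup_norm2_finite:
  assumes t: "t \<in> {0..T}"
  shows "AE w in P. (SUP k. ennreal ((norm (N k t w))\<^sup>2)) < \<infinity>"
proof -
  note [measurable] = N_measurable_P[OF t]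
  have "AE w in P. (SUP k. ennreal ((norm (N k t w))\<^sup>2)) \<noteq> \<infinity>"
    using sup_norm2_integral[OF t] by (intro nn_integral_PInf_AE) auto
  then show ?thesis by eventually_elim (simp only: infinity_ennreal_def less_top)
qed

text \<open>A finite supremum of squares yields one bound for all members at the given time; the
  exceptional null set depends on that time.\<close>

lemma AE_bounded_family:
  assumes t: "t \<in> {0..T}"
  shows "AE w in P. \<exists>c\<ge>0. (\<forall>k. norm (N k t w) \<le> c) \<and> ennreal (c\<^sup>2) = (SUP k. ennreal ((norm (N k t w))\<^sup>2))"
  using AE_sup_norm2_finite[OF t]
proof eventually_elim
  case (elim w)
  then obtain b where b: "(SUP k. ennreal ((norm (N k t w))\<^sup>2)) = ennreal b" "0 \<le> b"
    by (cases "SUP k. ennreal ((norm (N k t w))\<^sup>2)") auto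
  have "norm (N k t w) \<le> sqrt b" for k
  proof -
    have "ennreal ((norm (N k t w))\<^sup>2) \<le> ennreal b" unfolding b(1)[symmetric] by (rule SUP_upper) simp
    then have "(norm (N k t w))\<^sup>2 \<le> b" using b(2) by (simp add: ennreal_le_iff)
    then show ?thesis by (rule real_le_rsqrt)
  qed
  then show ?case using b by (intro exI[of _ "sqrt b"]) auto
qed

lemma sup_process_bound:
  assumes "0 \<le> c" "\<forall>k. norm (N k t w) \<le> c"
  shows "(SUP k. ennreal (u \<bullet> N k t w)) = ennreal (sup_process N u t w)" and "sup_process N u t w \<le> norm u * c"
proof -
  have le: "(SUP k. ennreal (u \<bullet> N k t w)) \<le> ennreal (norm u * c)"
  proof (rule SUP_least, rule ennreal_leI)
    fix k
    have "u \<bullet> N k t w \<le> norm u * norm (N k t w)" by (rule norm_cauchy_schwarz)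
    also have "\<dots> \<le> norm u * c" using assms by (intro mult_left_mono) auto
    finally show "u \<bullet> N k t w \<le> norm u * c" .
  qed
  show "(SUP k. ennreal (u \<bullet> N k t w)) = ennreal (sup_process N u t w)"
    unfolding sup_process_def by (rule ennreal_enn2real[symmetric, OF le_less_trans[OF le ennreal_less_top]])
  show "sup_process N u t w \<le> norm u * c"
    unfolding sup_process_def using enn2real_mono[OF le] assms(1) by simp
qed

lemma AE_sup_process:
  assumes t: "t \<in> {0..T}"
  shows "AE w in P. (SUP k. ennreal (u \<bullet> N k t w)) = ennreal (sup_process N u t w)"
  using AE_bounded_family[OF t] by eventually_elim (use sup_process_bound(1) in blast)

lemma sup_process_measurable: "t \<in> {0..T} \<Longrightarrow> sup_process N u t \<in> borel_measurable (F t)"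
  unfolding sup_process_def[abs_def] using N_measurable[of t] by measurable

lemma sup_process_square_integrable:
  assumes t: "t \<in> {0..T}"
  shows "square_integrable P (sup_process N u t)"
  unfolding square_integrable_iff_nn_integral
proof
  have tT: "t \<le> T" using t by simp
  show "sup_process N u t \<in> borel_measurable P" by (rule measurable_F_P[OF tT sup_process_measurable[OF t]])
  note [measurable] = N_measurable_P[OF t]
  have "(\<integral>\<^sup>+w. ennreal ((norm (sup_process N u t w))\<^sup>2) \<partial>P) \<le> (\<integral>\<^sup>+w. ennreal ((norm u)\<^sup>2) * (SUP k. ennreal ((norm (N k t w))\<^sup>2)) \<partial>P)"
    using AE_bounded_family[OF t]
  proof (intro nn_integral_mono_AE, eventually_elim)
    case (elim w)
    then obtain c where c: "0 \<le> c" "\<forall>k. norm (N k t w) \<le> c" "ennreal (c\<^sup>2) = (SUP k. ennreal ((norm (N k t w))\<^sup>2))" by blast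
    have "norm (sup_process N u t w) \<le> norm u * c"
      using sup_process_bound(2)[OF c(1,2), of u] by (simp add: sup_process_def)
    then have "(norm (sup_process N u t w))\<^sup>2 \<le> (norm u * c)\<^sup>2" by (intro power_mono) auto
    then have "ennreal ((norm (sup_process N u t w))\<^sup>2) \<le> ennreal ((norm u)\<^sup>2 * c\<^sup>2)" by (simp add: power_mult_distrib ennreal_leI)
    then show ?case unfolding c(3)[symmetric] by (simp add: ennreal_mult)
  qed
  also have "\<dots> = ennreal ((norm u)\<^sup>2) * (\<integral>\<^sup>+w. (SUP k. ennreal ((norm (N k t w))\<^sup>2)) \<partial>P)"
    by (rule nn_integral_cmult) measurable
  also have "\<dots> < \<infinity>" using sup_norm2_integral[OF t] by (simp add: ennreal_mult_less_top)
  finally show "(\<integral>\<^sup>+w. ennreal ((norm (sup_process N u t w))\<^sup>2) \<partial>P) < \<infinity>" .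
qed

text \<open>Each positive part increases in the mean on sets of \<open>F s\<close>, and each member
  at time \<open>t\<close> is below the supremum at \<open>t\<close>; the supremum at
  \<open>s\<close> is then taken inside the integral.\<close>

lemma sup_set_mono:
  assumes st: "0 \<le> s" "s \<le> t" "t \<le> T" and A: "A \<in> sets (F s)"
  shows "(\<integral>\<^sup>+w\<in>A. (SUP k. ennreal (u \<bullet> N k s w)) \<partial>P) \<le> (\<integral>\<^sup>+w\<in>A. (SUP k. ennreal (u \<bullet> N k t w)) \<partial>P)"
proof (rule nn_set_integral_SUP_le[where G="F s", OF _ _ _ _ _ A])
  show "sets (F s) \<subseteq> sets P" using st by (intro sets_F_subset) auto
  have sT: "s \<in> {0..T}" using st by auto
  note [measurable] = N_measurable[OF sT]
  show "(\<lambda>w. ennreal (u \<bullet> N k s w)) \<in> borel_measurable (F s)" for k by measurable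
  show "(\<lambda>w. SUP k. ennreal (u \<bullet> N k t w)) \<in> borel_measurable P"
  proof -
    have t: "t \<in> {0..T}" using st by auto
    note [measurable] = N_measurable_P[OF t]
    show ?thesis by measurable
  qed
  fix k A assume A: "A \<in> sets (F s)"
  have "(\<integral>\<^sup>+w\<in>A. ennreal (u \<bullet> N k s w) \<partial>P) \<le> (\<integral>\<^sup>+w\<in>A. ennreal (u \<bullet> N k t w) \<partial>P)"
    by (rule martingale_pos_part_mono[OF N st A])
  also have "\<dots> \<le> (\<integral>\<^sup>+w\<in>A. (SUP k. ennreal (u \<bullet> N k t w)) \<partial>P)"
    by (intro nn_integral_mono mult_right_mono SUP_upper) auto
  finally show "(\<integral>\<^sup>+w\<in>A. ennreal (u \<bullet> N k s w) \<partial>P) \<le> (\<integral>\<^sup>+w\<in>A. (SUP k. ennreal (u \<bullet> N k t w)) \<partial>P)" .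
qed simp

text \<open>Monotonicity on sets extends to nonnegative weights \<open>Z\<close>, the test functions
  for the cone \<open>{0..}\<close>. Square integrability allows the return from extended to real
  integrals.\<close>

lemma sup_process_cone_martingale: "cone_martingale {0..} (sup_process N u)"
  unfolding cone_martingale_def
proof (intro conjI ballI allI impI)
  fix s t :: real and Z :: "'w \<Rightarrow> real"
  assume st: "0 \<le> s" "s \<le> t" "t \<le> T" and Z: "Z \<in> borel_measurable (F s)" "square_integrable P Z" "\<forall>w\<in>space P. Z w \<in> {0..}"
  have s: "s \<in> {0..T}" and t: "t \<in> {0..T}" using st by auto
  have nn: "ennreal (expectation (\<lambda>w. Z w * sup_process N u r w)) = (\<integral>\<^sup>+w. ennreal (Z w) * (SUP k. ennreal (u \<bullet> N k r w)) \<partial>P)"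
    if r: "r \<in> {0..T}" for r
  proof -
    have i: "integrable P (\<lambda>w. Z w * sup_process N u r w)"
      using square_integrable_inner[OF Z(2) sup_process_square_integrable[OF r]] by simp
    have "ennreal (expectation (\<lambda>w. Z w * sup_process N u r w)) = (\<integral>\<^sup>+w. ennreal (Z w * sup_process N u r w) \<partial>P)"
      by (rule nn_integral_eq_integral[symmetric, OF i]) (use Z(3) in \<open>auto simp: sup_process_def\<close>)
    also have "\<dots> = (\<integral>\<^sup>+w. ennreal (Z w) * (SUP k. ennreal (u \<bullet> N k r w)) \<partial>P)"
    proof (rule nn_integral_cong_AE)
      show "AE w in P. ennreal (Z w * sup_process N u r w) = ennreal (Z w) * (SUP k. ennreal (u \<bullet> N k r w))"
        using AE_sup_process[OF r, of u] AE_space[of P]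
      proof eventually_elim
        case (elim w)
        then show ?case using Z(3) unfolding elim(1) by (intro ennreal_mult) (auto simp: sup_process_def)
      qed
    qed
    finally show ?thesis .
  qed
  have m: "(\<lambda>w. SUP k. ennreal (u \<bullet> N k r w)) \<in> borel_measurable P" if "r \<in> {0..T}" for r
    using N_measurable_P[OF that] by measurable
  have "ennreal (expectation (\<lambda>w. Z w * sup_process N u s w)) \<le> ennreal (expectation (\<lambda>w. Z w * sup_process N u t w))"
    unfolding nn[OF s] nn[OF t]
  proof (rule nn_integral_weight_mono[where G="F s"])
    show "sets (F s) \<subseteq> sets P" using s by (intro sets_F_subset) auto
    show "(\<lambda>w. ennreal (Z w)) \<in> borel_measurable (F s)" using Z(1) by measurable
    fix A assume "A \<in> sets (F s)"
    then show "(\<integral>\<^sup>+w\<in>A. (SUP k. ennreal (u \<bullet> N k s w)) \<partial>P) \<le> (\<integral>\<^sup>+w\<in>A. (SUP k. ennreal (u \<bullet> N k t w)) \<partial>P)"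
      by (rule sup_set_mono[OF st])
  qed (auto intro: m s t)
  moreover have "0 \<le> expectation (\<lambda>w. Z w * sup_process N u t w)"
    by (rule integral_nonneg_AE) (use Z(3) in \<open>auto simp: sup_process_def\<close>)
  ultimately have "expectation (\<lambda>w. Z w * sup_process N u s w) \<le> expectation (\<lambda>w. Z w * sup_process N u t w)"
    by (simp add: ennreal_le_iff)
  then show "0 \<le> expectation (\<lambda>w. Z w \<bullet> (sup_process N u t w - sup_process N u s w))"
    using square_integrable_inner[OF Z(2) sup_process_square_integrable[OF s]] square_integrable_inner[OF Z(2) sup_process_square_integrable[OF t]]
    by (simp add: right_diff_distrib)
qed (auto intro: sup_process_measurable sup_process_square_integrable simp: sup_process_def)

text \<open>At a fixed time the submartingale is left continuous: lower semicontinuity of a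
  supremum of continuous paths gives one inequality, Fatou's lemma and the submartingale
  property give the other in the mean.\<close>

lemma sup_process_left_liminf:
  assumes t: "0 < t" "t \<le> T" and q: "\<And>n. q n \<in> {0..T}" "\<And>n. q n \<le> t" "q \<longlonglongrightarrow> t"
    and cont: "AE w in P. \<forall>k. continuous_on {0..T} (\<lambda>t. N k t w)"
  shows "AE w in P. liminf (\<lambda>n. ennreal (sup_process N u (q n) w)) = ennreal (sup_process N u t w)"
proof -
  have tT: "t \<in> {0..T}" using t by auto
  define a where "a n w = (SUP k. ennreal (u \<bullet> N k (q n) w))" for n w
  define b where "b w = (SUP k. ennreal (u \<bullet> N k t w))" for w
  have am[measurable]: "a n \<in> borel_measurable P" for n unfolding a_def[abs_def] using N_measurable_P[OF q(1)[of n]] by measurable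
  have bm[measurable]: "b \<in> borel_measurable P" unfolding b_def[abs_def] using N_measurable_P[OF tT] by measurable
  have le: "AE w in P. b w \<le> liminf (\<lambda>n. a n w)"
    using cont
  proof eventually_elim
    case (elim w)
    show ?case unfolding b_def
    proof (rule SUP_least)
      fix k
      have c: "continuous_on {0..T} (\<lambda>t. N k t w)" using elim by blast
      have "(\<lambda>n. N k (q n) w) \<longlonglongrightarrow> N k t w"
        by (rule continuous_on_tendsto_compose[OF c q(3) tT]) (use q(1) in auto)
      then have "(\<lambda>n. ennreal (u \<bullet> N k (q n) w)) \<longlonglongrightarrow> ennreal (u \<bullet> N k t w)"
        by (intro tendsto_ennrealI tendsto_inner tendsto_const)
      then have "ennreal (u \<bullet> N k t w) = liminf (\<lambda>n. ennreal (u \<bullet> N k (q n) w))"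
        by (intro lim_imp_Liminf[symmetric]) auto
      also have "\<dots> \<le> liminf (\<lambda>n. a n w)"
        unfolding a_def by (intro Liminf_mono always_eventually allI SUP_upper) auto
      finally show "ennreal (u \<bullet> N k t w) \<le> liminf (\<lambda>n. a n w)" .
    qed
  qed
  \<comment> \<open>The mean at \<open>t\<close> must be finite for the subtraction below, where a
    nonnegative difference with integral \<open>0\<close> is shown to vanish.\<close>
  have bfin: "(\<integral>\<^sup>+w. b w \<partial>P) \<noteq> \<infinity>"
  proof -
    have i: "integrable P (sup_process N u t)"
      using square_integrable_inner[OF sup_process_square_integrable[OF tT, of u] square_integrable_const[of 1]] by simp
    have "(\<integral>\<^sup>+w. b w \<partial>P) = (\<integral>\<^sup>+w. ennreal (sup_process N u t w) \<partial>P)"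
      unfolding b_def by (rule nn_integral_cong_AE[OF AE_sup_process[OF tT]])
    also have "\<dots> = ennreal (expectation (sup_process N u t))"
      by (rule nn_integral_eq_integral[OF i]) (simp add: sup_process_def)
    finally show ?thesis by simp
  qed
  have "(\<integral>\<^sup>+w. liminf (\<lambda>n. a n w) \<partial>P) \<le> liminf (\<lambda>n. \<integral>\<^sup>+w. a n w \<partial>P)"
    by (rule nn_integral_liminf) simp
  also have "\<dots> \<le> (\<integral>\<^sup>+w. b w \<partial>P)"
  proof (rule Liminf_le)
    show "\<forall>\<^sub>F n in sequentially. (\<integral>\<^sup>+w. a n w \<partial>P) \<le> (\<integral>\<^sup>+w. b w \<partial>P)"
    proof (intro always_eventually allI)
      fix n
      have sp: "(\<integral>\<^sup>+w\<in>space P. g w \<partial>P) = (\<integral>\<^sup>+w. g w \<partial>P)" for g :: "'w \<Rightarrow> ennreal" by (intro nn_integral_cong) simp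
      have "space P \<in> sets (F (q n))" using sets.top[of "F (q n)"] by simp
      from sup_set_mono[OF _ q(2) t(2) this] q(1)[of n]
      show "(\<integral>\<^sup>+w. a n w \<partial>P) \<le> (\<integral>\<^sup>+w. b w \<partial>P)" unfolding a_def b_def sp by simp
    qed
  qed simp
  finally have ge: "(\<integral>\<^sup>+w. liminf (\<lambda>n. a n w) \<partial>P) \<le> (\<integral>\<^sup>+w. b w \<partial>P)" .
  have "(\<integral>\<^sup>+w. liminf (\<lambda>n. a n w) - b w \<partial>P) = (\<integral>\<^sup>+w. liminf (\<lambda>n. a n w) \<partial>P) - (\<integral>\<^sup>+w. b w \<partial>P)"
    by (rule nn_integral_diff[OF _ bm bfin le]) measurable
  also have "\<dots> = 0" using ge bfin by (simp add: diff_eq_0_iff_ennreal less_top)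
  finally have "AE w in P. liminf (\<lambda>n. a n w) - b w = 0"
    by (subst (asm) nn_integral_0_iff_AE) auto
  moreover have "AE w in P. \<forall>n. a n w = ennreal (sup_process N u (q n) w)"
    unfolding AE_all_countable a_def using AE_sup_process[OF q(1)] by blast
  moreover have "AE w in P. b w = ennreal (sup_process N u t w)"
    unfolding b_def by (rule AE_sup_process[OF tT])
  ultimately show ?thesis
    using le
  proof eventually_elim
    case (elim w)
    have "b w < \<infinity>" unfolding elim(3) by simp
    then have "liminf (\<lambda>n. a n w) \<le> b w" using elim(1) by (simp add: diff_eq_0_iff_ennreal less_top)
    then have "liminf (\<lambda>n. a n w) = b w" using elim(4) by simp
    then show ?case using elim(2,3) by simp
  qed
qed

end

end

section \<open>Regular modifications\<close>

lemma tendsto_of_Cauchy: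
  fixes f :: "'b \<Rightarrow> 'a::complete_space"
  assumes F: "F \<noteq> bot" and C: "\<And>e. 0 < e \<Longrightarrow> \<exists>Q. eventually Q F \<and> (\<forall>x y. Q x \<and> Q y \<longrightarrow> dist (f x) (f y) < e)"
  shows "\<exists>l. (f \<longlongrightarrow> l) F"
proof -
  have "cauchy_filter (filtermap f F)" unfolding cauchy_filter_metric_filtermap using C by blast
  moreover have "filtermap f F \<noteq> bot" using F by (simp add: filtermap_bot_iff)
  ultimately have "\<exists>l\<in>UNIV. filtermap f F \<le> nhds l"
    using complete_UNIV[where 'a='a] unfolding complete_uniform by simp
  then show ?thesis by (auto simp: filterlim_def)
qed

lemma bounded_imp_cball_0:
  fixes S :: "'a::real_normed_vector set"
  shows "bounded S \<Longrightarrow> \<exists>r. S \<subseteq> cball 0 r"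
  unfolding bounded_iff by (auto simp: subset_iff)

text \<open>Bounds on the support functions along the coordinate axes, in both senses, confine the
  sets to a box. Boundedness of each set is required because the real supremum over an unbounded set
  carries no information.\<close>

lemma eventually_support_bounded:
  fixes A :: "'b \<Rightarrow> 'a::euclidean_space set"
  assumes bdd: "eventually (\<lambda>q. bounded (A q)) F"
    and lim: "\<And>u. u \<in> Basis \<union> uminus ` Basis \<Longrightarrow> \<exists>l. ((\<lambda>q. support_fun (A q) u) \<longlongrightarrow> l) F"
  shows "\<exists>r\<ge>0. eventually (\<lambda>q. A q \<subseteq> cball 0 r) F"
proof -
  let ?E = "Basis \<union> uminus ` Basis :: 'a set"
  have "\<forall>u\<in>?E. \<exists>l. ((\<lambda>q. support_fun (A q) u) \<longlongrightarrow> l) F" using lim by blast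
  then obtain l where l: "\<And>u. u \<in> ?E \<Longrightarrow> ((\<lambda>q. support_fun (A q) u) \<longlongrightarrow> l u) F" by (rule bchoice[THEN exE]) blast
  define c where "c = (\<Sum>u\<in>?E. \<bar>l u\<bar> + 1)"
  have fin: "finite ?E" by simp
  have c: "\<bar>l u\<bar> + 1 \<le> c" if "u \<in> ?E" for u
    unfolding c_def by (rule member_le_sum[OF that]) auto
  have ev: "eventually (\<lambda>q. \<forall>u\<in>?E. support_fun (A q) u < l u + 1) F"
    using l by (intro eventually_ball_finite fin ballI order_tendstoD(2)[OF l]) auto
  have "eventually (\<lambda>q. A q \<subseteq> cball 0 (DIM('a) * c)) F"
    using bdd ev
  proof eventually_elim
    case (elim q)
    obtain s where s: "A q \<subseteq> cball 0 s" using bounded_imp_cball_0[OF elim(1)] by blast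
    show ?case
    proof
      fix x assume x: "x \<in> A q"
      have u: "u \<bullet> x \<le> c" if "u \<in> ?E" for u
        using support_fun_upper[OF s x, of u] bspec[OF elim(2) that] c[OF that] by linarith
      have "norm x \<le> (\<Sum>b\<in>Basis. \<bar>x \<bullet> b\<bar>)" by (rule norm_le_l1)
      also have "\<dots> \<le> (\<Sum>b\<in>(Basis::'a set). c)"
      proof (rule sum_mono)
        fix b :: 'a assume b: "b \<in> Basis"
        then have "b \<bullet> x \<le> c" "- b \<bullet> x \<le> c" using u[of b] u[of "- b"] by auto
        then show "\<bar>x \<bullet> b\<bar> \<le> c" by (simp add: inner_commute)
      qed
      finally show "x \<in> cball 0 (DIM('a) * c)" by simp
    qed
  qed
  moreover have "0 \<le> c" unfolding c_def by (intro sum_nonneg) auto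
  ultimately show ?thesis by (intro exI[of _ "DIM('a) * c"]) auto
qed

text \<open>The axes give a common ball, inside which closeness in finitely many directions of
  \<open>D\<close> makes the hulls close; convergence of the support functions in these directions
  thus makes the hulls Cauchy.\<close>

lemma hausdorff_lim_of_support:
  fixes A :: "real \<Rightarrow> 'a::euclidean_space set"
  assumes F: "F \<noteq> bot" and ne: "\<And>q. A q \<noteq> {}" and bdd: "eventually (\<lambda>q. bounded (A q)) F"
    and D: "\<And>x e. 0 < e \<Longrightarrow> \<exists>d\<in>D. dist d x < e" "Basis \<union> uminus ` Basis \<subseteq> D"
    and lim: "\<And>u. u \<in> D \<Longrightarrow> \<exists>l. ((\<lambda>q. support_fun (A q) u) \<longlongrightarrow> l) F"
  shows "\<exists>L. hausdorff_lim (\<lambda>q. closure (convex hull (A q))) F L"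
proof (rule hausdorff_lim_exists[OF F])
  show "closure (convex hull (A q)) \<noteq> {}" for q using ne by simp
  fix e :: real assume e: "0 < e"
  obtain r where r: "0 \<le> r" "eventually (\<lambda>q. A q \<subseteq> cball 0 r) F"
    using eventually_support_bounded[OF bdd] lim D(2) by blast
  obtain E \<eta> where E: "finite E" "E \<subseteq> D" "0 < \<eta>"
    and cl: "\<And>A B. A \<noteq> {} \<Longrightarrow> B \<noteq> {} \<Longrightarrow> A \<subseteq> cball 0 r \<Longrightarrow> B \<subseteq> cball 0 r \<Longrightarrow>
      (\<forall>u\<in>E. \<bar>support_fun A u - support_fun B u\<bar> \<le> \<eta>) \<Longrightarrow> set_close e (closure (convex hull A)) (closure (convex hull B))"
    using support_close[OF D(1) r(1) e] by blast
  have "\<forall>u\<in>E. \<exists>l. ((\<lambda>q. support_fun (A q) u) \<longlongrightarrow> l) F" using lim E(2) by blast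
  then obtain l where l: "\<And>u. u \<in> E \<Longrightarrow> ((\<lambda>q. support_fun (A q) u) \<longlongrightarrow> l u) F" by (rule bchoice[THEN exE]) blast
  have ev: "eventually (\<lambda>q. \<forall>u\<in>E. dist (support_fun (A q) u) (l u) < \<eta> / 2) F"
    using E by (intro eventually_ball_finite ballI tendstoD[OF l]) auto
  show "\<exists>Q. eventually Q F \<and> (\<forall>q q'. Q q \<longrightarrow> Q q' \<longrightarrow> set_close e (closure (convex hull (A q))) (closure (convex hull (A q'))))"
  proof (rule exI, intro conjI allI impI)
    show "eventually (\<lambda>q. A q \<subseteq> cball 0 r \<and> (\<forall>u\<in>E. dist (support_fun (A q) u) (l u) < \<eta> / 2)) F"
      using r(2) ev by eventually_elim blast
    fix q q'
    assume q: "A q \<subseteq> cball 0 r \<and> (\<forall>u\<in>E. dist (support_fun (A q) u) (l u) < \<eta> / 2)"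
      and q': "A q' \<subseteq> cball 0 r \<and> (\<forall>u\<in>E. dist (support_fun (A q') u) (l u) < \<eta> / 2)"
    have "\<bar>support_fun (A q) u - support_fun (A q') u\<bar> \<le> \<eta>" if u: "u \<in> E" for u
    proof -
      have "dist (support_fun (A q) u) (l u) < \<eta> / 2" "dist (support_fun (A q') u) (l u) < \<eta> / 2" using q q' u by auto
      then show ?thesis unfolding dist_real_def by linarith
    qed
    then show "set_close e (closure (convex hull (A q))) (closure (convex hull (A q')))"
      using q q' by (intro cl ne) auto
  qed
qed

text \<open>When the limits of the support functions belong to a known set, the Cauchy argument
  becomes a direct comparison with \<open>C\<close>, inside a ball that contains \<open>C\<close> as
  well.\<close>

lemma hausdorff_lim_supportI:
  fixes A :: "real \<Rightarrow> 'a::euclidean_space set"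
  assumes ne: "\<And>q. A q \<noteq> {}" and bdd: "eventually (\<lambda>q. bounded (A q)) F"
    and D: "\<And>x e. 0 < e \<Longrightarrow> \<exists>d\<in>D. dist d x < e" "Basis \<union> uminus ` Basis \<subseteq> D"
    and C: "C \<noteq> {}" "bounded C"
    and lim: "\<And>u. u \<in> D \<Longrightarrow> ((\<lambda>q. support_fun (A q) u) \<longlongrightarrow> support_fun C u) F"
  shows "hausdorff_lim (\<lambda>q. closure (convex hull (A q))) F (closure (convex hull C))"
  unfolding hausdorff_lim_def
proof (intro conjI allI impI)
  fix e :: real assume e: "0 < e"
  obtain r1 where r1: "0 \<le> r1" "eventually (\<lambda>q. A q \<subseteq> cball 0 r1) F"
    using eventually_support_bounded[OF bdd] lim D(2) by blast
  obtain r2 where r2: "C \<subseteq> cball 0 r2" using bounded_imp_cball_0[OF C(2)] by blast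
  define r where "r = max r1 r2"
  have r: "0 \<le> r" and C': "C \<subseteq> cball 0 r" using r1(1) r2 by (auto simp: r_def)
  obtain E \<eta> where E: "finite E" "E \<subseteq> D" "0 < \<eta>"
    and cl: "\<And>A B. A \<noteq> {} \<Longrightarrow> B \<noteq> {} \<Longrightarrow> A \<subseteq> cball 0 r \<Longrightarrow> B \<subseteq> cball 0 r \<Longrightarrow>
      (\<forall>u\<in>E. \<bar>support_fun A u - support_fun B u\<bar> \<le> \<eta>) \<Longrightarrow> set_close e (closure (convex hull A)) (closure (convex hull B))"
    using support_close[OF D(1) r e] by blast
  have "eventually (\<lambda>q. \<forall>u\<in>E. dist (support_fun (A q) u) (support_fun C u) < \<eta>) F"
    using E by (intro eventually_ball_finite ballI tendstoD[OF lim]) auto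
  then show "eventually (\<lambda>q. set_close e (closure (convex hull (A q))) (closure (convex hull C))) F"
    using r1(2)
  proof eventually_elim
    case (elim q)
    have "A q \<subseteq> cball 0 r" using elim(2) by (force simp: r_def)
    moreover have "\<forall>u\<in>E. \<bar>support_fun (A q) u - support_fun C u\<bar> \<le> \<eta>"
      using elim(1) by (auto simp: dist_real_def intro: less_imp_le)
    ultimately show ?case by (intro cl ne C C')
  qed
qed (use C in auto)

text \<open>The index \<open>0\<close> contributes the value \<open>0\<close> to the differences, so
  their supremum is nonnegative and survives the passage through \<open>ennreal\<close>.\<close>

lemma support_fun_range:
  fixes f :: "nat \<Rightarrow> 'a::euclidean_space"
  assumes bdd: "bounded (range f)"
  shows "support_fun (range f) u = enn2real (SUP k. ennreal (u \<bullet> (f k - f 0))) + u \<bullet> f 0"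
proof -
  obtain r where r: "range f \<subseteq> cball 0 r" using bounded_imp_cball_0[OF bdd] by blast
  have up: "u \<bullet> f k \<le> support_fun (range f) u" for k by (rule support_fun_upper[OF r]) simp
  let ?s = "support_fun (range f) u - u \<bullet> f 0"
  have "(SUP k. ennreal (u \<bullet> (f k - f 0))) = ennreal ?s"
  proof (rule SUP_eqI)
    fix k show "ennreal (u \<bullet> (f k - f 0)) \<le> ennreal ?s"
      using up[of k] by (intro ennreal_leI) (simp add: inner_diff_right)
  next
    fix y assume y: "\<And>k. k \<in> UNIV \<Longrightarrow> ennreal (u \<bullet> (f k - f 0)) \<le> y"
    show "ennreal ?s \<le> y"
    proof (cases y)
      case (real b)
      have le: "u \<bullet> f k \<le> b + u \<bullet> f 0" for k
        using y[of k] real by (simp add: ennreal_le_iff inner_diff_right)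
      have "support_fun (range f) u \<le> b + u \<bullet> f 0"
        unfolding support_fun_def by (rule cSUP_least) (use le in auto)
      then show ?thesis unfolding real(2) by (intro ennreal_leI) simp
    qed simp
  qed
  then show ?thesis using up[of 0] by simp
qed

section \<open>Equicontinuous families and series over an index set\<close>

text \<open>Indices from \<open>K\<close> on stay within \<open>d\<close> of their starting value,
  at dyadic times by assumption and at all times by continuity; the finitely many others are
  continuous at \<open>t\<close>. Near \<open>t\<close> all members thus move by at most
  \<open>2 * d\<close>, and passing to closed hulls doubles this, whence
  \<open>4 * d \<le> e\<close>.\<close>

lemma hausdorff_continuous_family:
  fixes y :: "nat \<Rightarrow> real \<Rightarrow> 'a::euclidean_space"
  assumes T: "0 < T" and cont: "\<And>i. i \<in> I \<Longrightarrow> continuous_on {0..T} (y i)"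
    and ev: "\<And>n::nat. eventually (\<lambda>i. i \<in> I \<longrightarrow> (\<forall>q\<in>dyads T. norm (y i q - y i 0) < 1 / (n + 1))) sequentially"
  shows "hausdorff_continuous T (\<lambda>t. closure (convex hull ((\<lambda>i. c i + y i t) ` I)))"
  unfolding hausdorff_continuous_def
proof (intro ballI tendsto_hausdorff_0)
  fix t e :: real assume t: "t \<in> {0..T}" and e: "0 < e"
  obtain n :: nat where "inverse (real (Suc n)) < e / 4" using reals_Archimedean[of "e / 4"] e by auto
  moreover define d where "d = 1 / (real n + 1)"
  ultimately have d: "0 < d" "4 * d \<le> e" by (simp_all add: inverse_eq_divide add.commute)
  obtain K where K: "\<And>i q. K \<le> i \<Longrightarrow> i \<in> I \<Longrightarrow> q \<in> dyads T \<Longrightarrow> norm (y i q - y i 0) < d"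
    using ev[of n] unfolding eventually_sequentially d_def by blast
  have tail: "norm (y i s - y i 0) \<le> d" if "K \<le> i" "i \<in> I" "s \<in> {0..T}" for i s
    by (rule dyads_bound_extend[OF T, where f="\<lambda>s. y i s - y i 0"])
       (use cont that K in \<open>auto intro!: continuous_intros less_imp_le\<close>)
  have "eventually (\<lambda>s. \<forall>i\<in>{i\<in>I. i < K}. dist (y i s) (y i t) < 2 * d) (at t within {0..T})"
  proof (intro eventually_ball_finite ballI)
    fix i assume "i \<in> {i\<in>I. i < K}"
    then have "(y i \<longlongrightarrow> y i t) (at t within {0..T})" using cont t by (auto simp: continuous_on_def)
    then show "eventually (\<lambda>s. dist (y i s) (y i t) < 2 * d) (at t within {0..T})" by (rule tendstoD) (use d in simp)
  qed simp
  moreover have "eventually (\<lambda>s. s \<in> {0..T}) (at t within {0..T})" by (simp add: eventually_at_filter)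
  ultimately show "eventually (\<lambda>s. set_close e (closure (convex hull ((\<lambda>i. c i + y i s) ` I))) (closure (convex hull ((\<lambda>i. c i + y i t) ` I)))) (at t within {0..T})"
  proof eventually_elim
    case (elim s)
    have "set_close (2 * (2 * d)) (closure (convex hull ((\<lambda>i. c i + y i s) ` I))) (closure (convex hull ((\<lambda>i. c i + y i t) ` I)))"
    proof (rule set_close_closure_hull_family)
      fix i assume i: "i \<in> I"
      have "dist (y i s) (y i t) \<le> 2 * d"
      proof (cases "i < K")
        case True then show ?thesis using elim(1) i by (intro less_imp_le) auto
      next
        case False
        then have "dist (y i s) (y i 0) \<le> d" "dist (y i t) (y i 0) \<le> d"
          using tail[of i s] tail[of i t] i t elim(2) by (simp_all add: dist_norm)
        then show ?thesis using dist_triangle2[of "y i s" "y i t" "y i 0"] by linarith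
      qed
      then show "dist (c i + y i s) (c i + y i t) \<le> 2 * d" by simp
    qed (use d in simp)
    then show ?case by (rule set_close_mono) (use d in simp)
  qed
qed

text \<open>Unordered sums over \<open>I\<close> become series over all indices, padded with
  \<open>0\<close>, for which termwise integration and comparison are available.\<close>

lemma infsum_nat_ennreal:
  fixes f :: "nat \<Rightarrow> ennreal"
  shows "(\<Sum>\<^sub>\<infinity>i\<in>I. f i) = (\<Sum>i. if i \<in> I then f i else 0)"
proof -
  have "(\<Sum>\<^sub>\<infinity>i\<in>I. f i) = (\<Sum>\<^sub>\<infinity>i. if i \<in> I then f i else 0)"
    by (rule infsum_cong_neutral) auto
  also have "\<dots> = (\<Sum>i. if i \<in> I then f i else 0)"
    by (intro sums_unique has_sum_imp_sums has_sum_infsum nonneg_summable_on_complete) auto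
  finally show ?thesis .
qed

section \<open>Almost sure path regularity of the hulls\<close>

context brownian_setting
begin

lemma cone_martingale_add_const:
  fixes X :: "real \<Rightarrow> 'w \<Rightarrow> 'a::euclidean_space"
  assumes X: "cone_martingale UNIV X" shows "cone_martingale UNIV (\<lambda>t w. c + X t w)"
  unfolding cone_martingale_def
proof (intro conjI ballI allI impI)
  fix t assume t: "t \<in> {0..T}"
  show "(\<lambda>w. c + X t w) \<in> borel_measurable (F t)" using cone_martingaleD(1)[OF X t] by measurable
  show "square_integrable P (\<lambda>w. c + X t w)"
    by (rule square_integrable_add[OF square_integrable_const cone_martingaleD(2)[OF X t]])
next
  fix s t and Z :: "'w \<Rightarrow> 'a" assume "0 \<le> s" "s \<le> t" "t \<le> T" "Z \<in> borel_measurable (F s)" "square_integrable P Z"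
  then show "0 \<le> expectation (\<lambda>w. Z w \<bullet> ((c + X t w) - (c + X s w)))"
    using cone_martingale_UNIV_eq_0[OF X] by simp
qed simp

lemma cone_martingale_diff:
  fixes X Y :: "real \<Rightarrow> 'w \<Rightarrow> 'a::euclidean_space"
  assumes X: "cone_martingale UNIV X" and Y: "cone_martingale UNIV Y"
  shows "cone_martingale UNIV (\<lambda>t w. X t w - Y t w)"
  unfolding cone_martingale_def
proof (intro conjI ballI allI impI)
  fix t assume t: "t \<in> {0..T}"
  show "(\<lambda>w. X t w - Y t w) \<in> borel_measurable (F t)"
    using cone_martingaleD(1)[OF X t] cone_martingaleD(1)[OF Y t] by measurable
  show "square_integrable P (\<lambda>w. X t w - Y t w)"
    by (rule square_integrable_diff[OF cone_martingaleD(2)[OF X t] cone_martingaleD(2)[OF Y t]])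
next
  fix s t and Z :: "'w \<Rightarrow> 'a" assume st: "0 \<le> s" "s \<le> t" "t \<le> T" and Z: "Z \<in> borel_measurable (F s)" "square_integrable P Z"
  have tt: "s \<in> {0..T}" "t \<in> {0..T}" using st by auto
  have i: "integrable P (\<lambda>w. Z w \<bullet> (V t w - V s w))" if V: "cone_martingale UNIV V" for V :: "real \<Rightarrow> 'w \<Rightarrow> 'a"
    by (rule square_integrable_inner[OF Z(2) square_integrable_diff[OF cone_martingaleD(2)[OF V tt(2)] cone_martingaleD(2)[OF V tt(1)]]])
  have "expectation (\<lambda>w. Z w \<bullet> ((X t w - Y t w) - (X s w - Y s w)))
      = expectation (\<lambda>w. Z w \<bullet> (X t w - X s w) - Z w \<bullet> (Y t w - Y s w))"
    by (intro Bochner_Integration.integral_cong) (auto simp: inner_diff_right)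
  also have "\<dots> = expectation (\<lambda>w. Z w \<bullet> (X t w - X s w)) - expectation (\<lambda>w. Z w \<bullet> (Y t w - Y s w))"
    by (rule Bochner_Integration.integral_diff[OF i[OF X] i[OF Y]])
  also have "\<dots> = 0"
    unfolding cone_martingale_UNIV_eq_0[OF X st Z] cone_martingale_UNIV_eq_0[OF Y st Z] by simp
  finally show "0 \<le> expectation (\<lambda>w. Z w \<bullet> ((X t w - Y t w) - (X s w - Y s w)))" by simp
qed simp

text \<open>The translations \<open>c i\<close> cancel in the distance between the positions of one
  member at two times, so only the second moments of the martingale parts enter.\<close>

lemma AE_hausdorff_continuous:
  fixes Y :: "nat \<Rightarrow> real \<Rightarrow> 'w \<Rightarrow> 'a::euclidean_space"
  assumes Y: "\<And>i. i \<in> I \<Longrightarrow> cone_martingale UNIV (Y i)"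
    and cont: "AE w in P. \<forall>i\<in>I. continuous_on {0..T} (\<lambda>t. Y i t w)"
    and fin: "(\<Sum>i. if i \<in> I then \<integral>\<^sup>+w. ennreal ((norm (Y i T w))\<^sup>2) \<partial>P else 0) < \<infinity>"
  shows "AE w in P. hausdorff_continuous T (\<lambda>t. closure (convex hull ((\<lambda>i. c i + Y i t w) ` I)))"
proof -
  define v where "v i = (if i \<in> I then expectation (\<lambda>w. (norm (Y i T w))\<^sup>2) else 0)" for i
  have T: "T \<in> {0..T}" using T_pos by simp
  have v0: "0 \<le> v i" for i by (simp add: v_def)
  have "ennreal (v i) = (if i \<in> I then \<integral>\<^sup>+w. ennreal ((norm (Y i T w))\<^sup>2) \<partial>P else 0)" for i
    using square_integrable_nn_integral[OF cone_martingaleD(2)[OF Y T]] by (simp add: v_def)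
  then have "(\<Sum>i. ennreal (v i)) < \<infinity>" using fin by simp
  then have sv: "summable v" by (intro summable_suminf_not_top v0) auto
  have "AE w in P. eventually (\<lambda>i. i \<in> I \<longrightarrow> (\<forall>q\<in>dyads T. norm (Y i q w - Y i 0 w) < 1 / (real n + 1))) sequentially" for n
  proof -
    define d where "d = 1 / (real n + 1)"
    have d: "0 < d" by (simp add: d_def)
    \<comment> \<open>Indices outside \<open>I\<close> get the empty event, so that Borel-Cantelli
      applies to a full sequence.\<close>
    define A where "A i = (if i \<in> I then {w \<in> space P. \<exists>q\<in>dyads T. d \<le> norm (Y i q w - Y i 0 w)} else {})" for i
    have A: "A i \<in> sets P" "d\<^sup>2 * prob (A i) \<le> v i" for i
      using dyads_maximal_inequality[OF Y d, of i] by (simp_all add: A_def v_def)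
    have "summable (\<lambda>i. prob (A i))"
    proof (rule summable_comparison_test', rule summable_divide[OF sv])
      show "norm (prob (A i)) \<le> v i / d\<^sup>2" for i
        using A(2)[of i] d by (simp add: field_simps)
    qed
    then have "AE w in P. eventually (\<lambda>i. w \<in> space P - A i) sequentially"
      by (intro borel_cantelli_AE1 A) (auto simp: less_top[symmetric])
    then show ?thesis
    proof eventually_elim
      case (elim w)
      then show ?case by eventually_elim (auto simp: A_def d_def not_le)
    qed
  qed
  then have "AE w in P. \<forall>n. eventually (\<lambda>i. i \<in> I \<longrightarrow> (\<forall>q\<in>dyads T. norm (Y i q w - Y i 0 w) < 1 / (real n + 1))) sequentially"
    unfolding AE_all_countable by blast
  with cont show ?thesis
    by eventually_elim (rule hausdorff_continuous_family[OF T_pos], auto)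
qed

text \<open>Only the differences from the member with index \<open>0\<close> are assumed to be
  dominated martingales; the reference member enters through the continuity of its paths.\<close>

lemma AE_hausdorff_caglad:
  fixes a :: "nat \<Rightarrow> real \<Rightarrow> 'w \<Rightarrow> 'a::euclidean_space"
  assumes N: "\<And>k. cone_martingale UNIV (\<lambda>t w. a k t w - a 0 t w)"
    and \<zeta>: "\<zeta> \<in> borel_measurable P" "integrable P (\<lambda>w. (\<zeta> w)\<^sup>2)"
    and dom: "\<And>k. AE w in P. norm (a k T w - a 0 T w) \<le> \<zeta> w"
    and cont: "AE w in P. \<forall>k. continuous_on {0..T} (\<lambda>t. a k t w)"
  shows "\<exists>M. (\<forall>t w. closed (M t w) \<and> M t w \<noteq> {}) \<and>
    (\<forall>t\<in>{0..T}. AE w in P. M t w = closure (convex hull (range (\<lambda>k. a k t w)))) \<and>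
    (AE w in P. hausdorff_caglad T (\<lambda>t. M t w))"
proof -
  define A where "A t w = range (\<lambda>k. a k t w)" for t w
  define H where "H t w = closure (convex hull (A t w))" for t w
  let ?N = "\<lambda>k t w. a k t w - a 0 t w"
  note facts = N \<zeta> dom
  have A_ne: "A t w \<noteq> {}" for t w by (simp add: A_def)
  obtain D0 :: "'a set" where D0: "countable D0" "\<And>X. open X \<Longrightarrow> X \<noteq> {} \<Longrightarrow> \<exists>d\<in>D0. d \<in> X"
    using countable_dense_setE by blast
  \<comment> \<open>The axis directions, with both signs, are added because they provide the common
    ball for the hulls.\<close>
  define D where "D = D0 \<union> (Basis \<union> uminus ` Basis)"
  have D: "countable D" unfolding D_def using D0(1) by (auto intro: countable_finite)
  have D1: "\<exists>d\<in>D. dist d x < e" if "0 < e" for x e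
    using D0(2)[of "ball x e"] that by (auto simp: D_def dist_commute)
  have D2: "Basis \<union> uminus ` Basis \<subseteq> D" by (auto simp: D_def)
  have bdd: "AE w in P. bounded (A t w)" if t: "t \<in> {0..T}" for t
    using AE_bounded_family[of ?N, OF facts t]
  proof eventually_elim
    case (elim w)
    then obtain c where c: "\<And>k. norm (a k t w - a 0 t w) \<le> c" by blast
    have "norm (a k t w) \<le> c + norm (a 0 t w)" for k using c[of k] norm_triangle_sub[of "a k t w" "a 0 t w"] by linarith
    then show ?case unfolding bounded_iff A_def by auto
  qed
  have bdd_dyads: "AE w in P. \<forall>q\<in>dyads T. bounded (A q w)"
    using bdd dyads_subset[of T] T_pos by (subst AE_ball_countable[OF countable_dyads]) auto
  have "AE w in P. \<exists>m. \<forall>x y. \<not> jump_chain (1 / (real n + 1)) (dyads T) (\<lambda>t. sup_process ?N u t w) m x y" for u n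
    by (rule AE_no_long_chain[OF sup_process_cone_martingale[OF facts]]) simp
  then have chain: "AE w in P. \<forall>u\<in>D. \<forall>n::nat. \<exists>m. \<forall>x y. \<not> jump_chain (1 / (real n + 1)) (dyads T) (\<lambda>t. sup_process ?N u t w) m x y"
    by (subst AE_ball_countable[OF D]) (auto simp: AE_all_countable)
  \<comment> \<open>Only countably many conditions are collected, so a single null set serves all
    times and all directions in \<open>D\<close>.\<close>
  define good where "good w \<longleftrightarrow> (\<forall>k. continuous_on {0..T} (\<lambda>t. a k t w)) \<and> (\<forall>q\<in>dyads T. bounded (A q w)) \<and>
    (\<forall>u\<in>D. \<forall>n::nat. \<exists>m. \<forall>x y. \<not> jump_chain (1 / (real n + 1)) (dyads T) (\<lambda>t. sup_process ?N u t w) m x y)" for w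
  have good: "AE w in P. good w" using cont bdd_dyads chain by eventually_elim (simp add: good_def)
  have sf: "support_fun (A q w) u = sup_process ?N u q w + u \<bullet> a 0 q w" if "bounded (A q w)" for q w u
    using support_fun_range[OF that[unfolded A_def], of u] by (simp add: A_def sup_process_def)
  have lim0: "((\<lambda>q. u \<bullet> a 0 q w) \<longlongrightarrow> u \<bullet> a 0 t w) (at t within dyads T \<inter> S)" if w: "good w" and t: "t \<in> {0..T}" for w t S u
  proof -
    have "((\<lambda>q. a 0 q w) \<longlongrightarrow> a 0 t w) (at t within {0..T})" using w t by (auto simp: good_def continuous_on_def)
    then have "((\<lambda>q. a 0 q w) \<longlongrightarrow> a 0 t w) (at t within dyads T \<inter> S)"
      by (rule tendsto_within_subset) (use dyads_subset[of T] T_pos in auto)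
    then show ?thesis by (intro tendsto_intros)
  qed
  have ev_bdd: "eventually (\<lambda>q. bounded (A q w)) (at t within dyads T \<inter> S)" if "good w" for w t S
    using that by (auto simp: good_def eventually_at_filter)
  have sup_lim: "\<exists>l. ((\<lambda>q. sup_process ?N u q w) \<longlongrightarrow> l) (at t within dyads T \<inter> S)"
    if w: "good w" and u: "u \<in> D" and ne: "at t within dyads T \<inter> S \<noteq> bot" and S: "S = {..<t} \<or> S = {t<..}" for w u t S
  proof (rule tendsto_of_Cauchy[OF ne])
    fix e :: real assume e: "0 < e"
    obtain n :: nat where n: "inverse (real (Suc n)) < e / 2" using reals_Archimedean[of "e / 2"] e by auto
    have n': "2 * (1 / (real n + 1)) < e" using n by (simp add: inverse_eq_divide add.commute)
    obtain m where m: "\<And>x y. \<not> jump_chain (1 / (real n + 1)) (dyads T) (\<lambda>t. sup_process ?N u t w) m x y"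
      using w u unfolding good_def by blast
    obtain \<delta> where \<delta>: "0 < \<delta>" "\<And>q q'. q \<in> dyads T \<inter> S \<Longrightarrow> q' \<in> dyads T \<inter> S \<Longrightarrow> \<bar>q - t\<bar> < \<delta> \<Longrightarrow> \<bar>q' - t\<bar> < \<delta> \<Longrightarrow>
        norm (sup_process ?N u q w - sup_process ?N u q' w) < 2 * (1 / (real n + 1))"
    proof (rule disjE[OF S])
      assume S: "S = {..<t}"
      obtain \<delta> where "0 < \<delta>" "\<forall>q\<in>dyads T \<inter> {t-\<delta><..<t}. \<forall>q'\<in>dyads T \<inter> {t-\<delta><..<t}.
          norm (sup_process ?N u q w - sup_process ?N u q' w) < 2 * (1 / (real n + 1))"
        using no_chain_left_Cauchy[OF m, of t] by blast
      then show thesis by (intro that[of \<delta>]) (auto simp: S abs_less_iff)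
    next
      assume S: "S = {t<..}"
      obtain \<delta> where "0 < \<delta>" "\<forall>q\<in>dyads T \<inter> {t<..<t+\<delta>}. \<forall>q'\<in>dyads T \<inter> {t<..<t+\<delta>}.
          norm (sup_process ?N u q w - sup_process ?N u q' w) < 2 * (1 / (real n + 1))"
        using no_chain_right_Cauchy[OF m, of t] by blast
      then show thesis by (intro that[of \<delta>]) (auto simp: S abs_less_iff)
    qed
    show "\<exists>Q. eventually Q (at t within dyads T \<inter> S) \<and>
        (\<forall>x y. Q x \<and> Q y \<longrightarrow> dist (sup_process ?N u x w) (sup_process ?N u y w) < e)"
    proof (rule exI, intro conjI allI impI)
      show "eventually (\<lambda>q. q \<in> dyads T \<inter> S \<and> \<bar>q - t\<bar> < \<delta>) (at t within dyads T \<inter> S)"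
        unfolding eventually_at using \<delta>(1) by (auto simp: dist_real_def)
      fix x y assume "(x \<in> dyads T \<inter> S \<and> \<bar>x - t\<bar> < \<delta>) \<and> (y \<in> dyads T \<inter> S \<and> \<bar>y - t\<bar> < \<delta>)"
      then show "dist (sup_process ?N u x w) (sup_process ?N u y w) < e"
        unfolding dist_norm using less_trans[OF \<delta>(2) n'] by blast
    qed
  qed
  have H_lim: "\<exists>L. hausdorff_lim (\<lambda>q. H q w) (at t within dyads T \<inter> S) L"
    if w: "good w" and t: "t \<in> {0..T}" and ne: "at t within dyads T \<inter> S \<noteq> bot" and S: "S = {..<t} \<or> S = {t<..}" for w t S
    unfolding H_def
  proof (rule hausdorff_lim_of_support[OF ne A_ne ev_bdd[OF w] D1 D2])
    fix u assume u: "u \<in> D"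
    obtain l where "((\<lambda>q. sup_process ?N u q w) \<longlongrightarrow> l) (at t within dyads T \<inter> S)" using sup_lim[OF w u ne S] by blast
    then have "((\<lambda>q. sup_process ?N u q w + u \<bullet> a 0 q w) \<longlongrightarrow> l + u \<bullet> a 0 t w) (at t within dyads T \<inter> S)"
      by (rule tendsto_add[OF _ lim0[OF w t]])
    moreover have "eventually (\<lambda>q. sup_process ?N u q w + u \<bullet> a 0 q w = support_fun (A q w) u) (at t within dyads T \<inter> S)"
      using ev_bdd[OF w] by eventually_elim (rule sf[symmetric])
    ultimately have "((\<lambda>q. support_fun (A q w) u) \<longlongrightarrow> l + u \<bullet> a 0 t w) (at t within dyads T \<inter> S)"
      by (rule Lim_transform_eventually)
    then show "\<exists>l. ((\<lambda>q. support_fun (A q w) u) \<longlongrightarrow> l) (at t within dyads T \<inter> S)" by blast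
  qed assumption
  \<comment> \<open>At \<open>0\<close> there is no left limit and the hull itself is taken. The
    default \<open>{0}\<close> keeps the values nonempty and closed where the limit fails to exist,
    which on \<open>good\<close> paths does not happen at times in \<open>{0<..T}\<close>.\<close>
  define M where "M t w = (if t = 0 then H t w
    else if \<exists>L. hausdorff_lim (\<lambda>q. H q w) (at t within dyads T \<inter> {..<t}) L
    then SOME L. hausdorff_lim (\<lambda>q. H q w) (at t within dyads T \<inter> {..<t}) L else {0})" for t w
  have M_lim: "hausdorff_lim (\<lambda>q. H q w) (at t within dyads T \<inter> {..<t}) (M t w)"
    if "\<exists>L. hausdorff_lim (\<lambda>q. H q w) (at t within dyads T \<inter> {..<t}) L" "t \<noteq> 0" for t w
    using that someI_ex[OF that(1)] by (simp add: M_def)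
  have "closed (M t w) \<and> M t w \<noteq> {}" for t w
  proof (cases "t \<noteq> 0 \<and> (\<exists>L. hausdorff_lim (\<lambda>q. H q w) (at t within dyads T \<inter> {..<t}) L)")
    case True then show ?thesis using M_lim[of w t] by (simp add: hausdorff_lim_def)
  next
    case False then show ?thesis by (auto simp: M_def H_def A_ne)
  qed
  moreover have "AE w in P. M t w = closure (convex hull (range (\<lambda>k. a k t w)))" if t: "t \<in> {0..T}" for t
  proof (cases "t = 0")
    case True then show ?thesis by (simp add: M_def H_def A_def)
  next
    case False
    then have t0: "0 < t" and tT: "t \<le> T" using t by auto
    have ne: "at t within dyads T \<inter> {..<t} \<noteq> bot" by (rule at_within_dyads_left[OF T_pos t0 tT])
    \<comment> \<open>On \<open>good\<close> paths the limit along all dyadic times before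
      \<open>t\<close> exists already; the sequence only serves to identify it through the almost
      sure statement at the fixed time \<open>t\<close>.\<close>
    have "\<exists>q. \<forall>n. q n \<in> dyads T \<and> max 0 (t - 1 / (real n + 1)) < q n \<and> q n < t"
    proof (rule choice, rule allI)
      fix n show "\<exists>q. q \<in> dyads T \<and> max 0 (t - 1 / (real n + 1)) < q \<and> q < t"
        using dyads_dense[of "max 0 (t - 1 / (real n + 1))" t T] t0 tT by auto
    qed
    then obtain q where q: "\<And>n. q n \<in> dyads T" "\<And>n. max 0 (t - 1 / (real n + 1)) < q n" "\<And>n. q n < t" by blast
    have q_lim: "q \<longlonglongrightarrow> t"
    proof (rule tendsto_sandwich[of "\<lambda>n. t - 1 / (real n + 1)" _ _ "\<lambda>n. t"])
      show "(\<lambda>n. t - 1 / (real n + 1)) \<longlonglongrightarrow> t"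
        using tendsto_diff[OF tendsto_const LIMSEQ_inverse_real_of_nat, of t] by (simp add: inverse_eq_divide add.commute)
    qed (use q(2,3) in \<open>auto intro!: always_eventually less_imp_le\<close>)
    have q_filter: "filterlim q (at t within dyads T \<inter> {..<t}) sequentially"
      unfolding filterlim_at using q q_lim by (auto intro!: always_eventually simp: less_imp_neq)
    have qT: "q n \<in> {0..T}" for n using q(1)[of n] dyads_subset[of T] T_pos by auto
    have "AE w in P. liminf (\<lambda>n. ennreal (sup_process ?N u (q n) w)) = ennreal (sup_process ?N u t w)" for u
    proof (rule sup_process_left_liminf[OF facts t0 tT qT less_imp_le[OF q(3)] q_lim])
      show "AE w in P. \<forall>k. continuous_on {0..T} (\<lambda>t. a k t w - a 0 t w)"
        using cont by eventually_elim (auto intro: continuous_on_diff)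
    qed
    then have "AE w in P. \<forall>u\<in>D. liminf (\<lambda>n. ennreal (sup_process ?N u (q n) w)) = ennreal (sup_process ?N u t w)"
      by (subst AE_ball_countable[OF D]) auto
    then show ?thesis
      using good bdd[OF t]
    proof eventually_elim
      case (elim w)
      have sup_t: "((\<lambda>q. sup_process ?N u q w) \<longlongrightarrow> sup_process ?N u t w) (at t within dyads T \<inter> {..<t})" if u: "u \<in> D" for u
      proof -
        obtain l where l: "((\<lambda>q. sup_process ?N u q w) \<longlongrightarrow> l) (at t within dyads T \<inter> {..<t})"
          using sup_lim[OF elim(2) u ne] by blast
        have s: "(\<lambda>n. sup_process ?N u (q n) w) \<longlonglongrightarrow> l" by (rule filterlim_compose[OF l q_filter])
        then have l0: "0 \<le> l" by (rule LIMSEQ_le_const) (simp add: sup_process_def)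
        from s have "(\<lambda>n. ennreal (sup_process ?N u (q n) w)) \<longlonglongrightarrow> ennreal l" by (rule tendsto_ennrealI)
        then have "ennreal l = liminf (\<lambda>n. ennreal (sup_process ?N u (q n) w))"
          by (intro lim_imp_Liminf[symmetric]) auto
        also have "\<dots> = ennreal (sup_process ?N u t w)" using elim(1) u by blast
        finally have "l = sup_process ?N u t w" using l0 by (simp add: sup_process_def)
        then show ?thesis using l by simp
      qed
      have "hausdorff_lim (\<lambda>q. H q w) (at t within dyads T \<inter> {..<t}) (closure (convex hull (A t w)))"
        unfolding H_def
      proof (rule hausdorff_lim_supportI[OF A_ne ev_bdd[OF elim(2)] D1 D2 A_ne elim(3)])
        fix u assume u: "u \<in> D"
        have "((\<lambda>q. sup_process ?N u q w + u \<bullet> a 0 q w) \<longlongrightarrow> support_fun (A t w) u) (at t within dyads T \<inter> {..<t})"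
          unfolding sf[OF elim(3)] by (rule tendsto_add[OF sup_t[OF u] lim0[OF elim(2) t]])
        moreover have "eventually (\<lambda>q. sup_process ?N u q w + u \<bullet> a 0 q w = support_fun (A q w) u) (at t within dyads T \<inter> {..<t})"
          using ev_bdd[OF elim(2)] by eventually_elim (rule sf[symmetric])
        ultimately show "((\<lambda>q. support_fun (A q w) u) \<longlongrightarrow> support_fun (A t w) u) (at t within dyads T \<inter> {..<t})"
          by (rule Lim_transform_eventually)
      qed assumption
      then show ?case
        using hausdorff_lim_unique[OF M_lim _ ne] False unfolding A_def by blast
    qed
  qed
  moreover have "AE w in P. hausdorff_caglad T (\<lambda>t. M t w)"
    using good
  proof eventually_elim
    case (elim w)
    show ?case
    proof (rule hausdorff_caglad_left_limits[OF T_pos, where M="\<lambda>q. H q w"])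
      fix t assume t: "0 < t" "t \<le> T"
      show "hausdorff_lim (\<lambda>q. H q w) (at t within dyads T \<inter> {..<t}) (M t w)"
        using t by (intro M_lim H_lim[OF elim] at_within_dyads_left[OF T_pos]) auto
    next
      fix t assume t: "0 \<le> t" "t < T"
      show "\<exists>L. hausdorff_lim (\<lambda>q. H q w) (at t within dyads T \<inter> {t<..}) L"
        using t by (intro H_lim[OF elim] at_within_dyads_right[OF T_pos]) auto
    qed
  qed
  ultimately show ?thesis by (intro exI[of _ M]) auto
qed

section \<open>Transfer to the set-valued integral\<close>

text \<open>A process defined through limits has no evident measurability. By completeness its
  hitting events inherit measurability from those of \<open>X\<close>, from which they differ by
  null sets.\<close>

lemma set_valued_rv_AE_cong:
  fixes X M :: "'w \<Rightarrow> 'a::euclidean_space set"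
  assumes X: "set_valued_rv (F t) X" and t: "t \<in> {0..T}"
    and M: "\<And>w. closed (M w) \<and> M w \<noteq> {}" and ae: "AE w in P. M w = X w"
  shows "set_valued_rv P M"
  unfolding set_valued_rv_def
proof (intro conjI ballI allI impI)
  fix C :: "'a set" assume C: "closed C"
  show "{w \<in> space P. M w \<inter> C \<noteq> {}} \<in> sets P"
  proof (rule in_sets_AE)
    show "AE w in P. w \<in> {w \<in> space P. X w \<inter> C \<noteq> {}} \<longleftrightarrow> w \<in> {w \<in> space P. M w \<inter> C \<noteq> {}}"
      using ae by eventually_elim simp
    show "{w \<in> space P. X w \<inter> C \<noteq> {}} \<in> sets P"
      using X C sets_F_subset[of t] t by (auto simp: set_valued_rv_def)
  qed auto
qed (use M in auto)

text \<open>The cross term of \<open>x\<close> with the integral has mean \<open>0\<close>, since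
  the integral has a martingale version starting at \<open>0\<close>; the squared integral is
  evaluated by the isometry.\<close>

lemma ito_J_norm2:
  fixes z :: "real \<Rightarrow> 'w \<Rightarrow> real ^ 'm ^ 'd"
  assumes z: "z \<in> L2_prog P T F"
  shows "(\<integral>\<^sup>+w. ennreal ((norm (ito_J P T F B T (x, z) w))\<^sup>2) \<partial>P) = ennreal ((norm x)\<^sup>2) + proc_norm2 z"
proof -
  obtain Y where Y: "\<forall>t\<in>{0..T}. AE w in P. ito_integral P T F B t z w = Y t w" "cone_martingale UNIV Y"
    "(\<integral>\<^sup>+w. ennreal ((norm (Y T w))\<^sup>2) \<partial>P) = proc_norm2 z" "AE w in P. Y 0 w = 0"
    using ito_version[OF z] by blast
  have tt: "T \<in> {0..T}" "0 \<in> {0..T}" using T_pos by auto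
  note Ysq = cone_martingaleD(2)[OF Y(2) tt(1)] and Y0sq = cone_martingaleD(2)[OF Y(2) tt(2)]
  have ix: "integrable P (\<lambda>w. x \<bullet> Y T w)" by (rule square_integrable_inner[OF square_integrable_const Ysq])
  have iY: "integrable P (\<lambda>w. (norm (Y T w))\<^sup>2)" using Ysq by (simp add: square_integrable_def)
  have "expectation (\<lambda>w. x \<bullet> (Y T w - Y 0 w)) = 0"
    by (rule cone_martingale_UNIV_eq_0[OF Y(2)]) (use T_pos in \<open>auto intro: square_integrable_const\<close>)
  moreover have "expectation (\<lambda>w. x \<bullet> (Y T w - Y 0 w)) = expectation (\<lambda>w. x \<bullet> Y T w)"
  proof (rule integral_cong_AE)
    show "AE w in P. x \<bullet> (Y T w - Y 0 w) = x \<bullet> Y T w" using Y(4) by eventually_elim simp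
  qed (use Ysq Y0sq in \<open>auto simp: square_integrable_def\<close>)
  ultimately have 0: "expectation (\<lambda>w. x \<bullet> Y T w) = 0" by simp
  have "(\<integral>\<^sup>+w. ennreal ((norm (ito_J P T F B T (x, z) w))\<^sup>2) \<partial>P) = (\<integral>\<^sup>+w. ennreal ((norm (x + Y T w))\<^sup>2) \<partial>P)"
  proof (rule nn_integral_cong_AE)
    show "AE w in P. ennreal ((norm (ito_J P T F B T (x, z) w))\<^sup>2) = ennreal ((norm (x + Y T w))\<^sup>2)"
      using bspec[OF Y(1) tt(1)] by eventually_elim (simp add: ito_J_eq)
  qed
  also have "\<dots> = ennreal (expectation (\<lambda>w. (norm (x + Y T w))\<^sup>2))"
    by (rule square_integrable_nn_integral[OF square_integrable_add[OF square_integrable_const Ysq]])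
  also have "expectation (\<lambda>w. (norm (x + Y T w))\<^sup>2) = expectation (\<lambda>w. (norm x)\<^sup>2 + (2 * (x \<bullet> Y T w) + (norm (Y T w))\<^sup>2))"
    by (intro Bochner_Integration.integral_cong) (simp_all add: power2_norm_eq_inner inner_add_left inner_add_right inner_commute)
  also have "\<dots> = (norm x)\<^sup>2 + expectation (\<lambda>w. (norm (Y T w))\<^sup>2)"
    using ix iY 0 by (simp add: prob_space)
  also have "ennreal \<dots> = ennreal ((norm x)\<^sup>2) + proc_norm2 z"
    using square_integrable_nn_integral[OF Ysq] Y(3) by (simp add: ennreal_plus)
  finally show ?thesis .
qed

lemma nn_integral_infsum_ito_J_norm2:
  fixes z :: "nat \<Rightarrow> real \<Rightarrow> 'w \<Rightarrow> real ^ 'm ^ 'd"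
  assumes z: "\<And>i. i \<in> I \<Longrightarrow> z i \<in> L2_prog P T F"
  shows "(\<integral>\<^sup>+w. (\<Sum>\<^sub>\<infinity>i\<in>I. ennreal ((norm (ito_J P T F B T (x i, z i) w))\<^sup>2)) \<partial>P)
    = (\<Sum>\<^sub>\<infinity>i\<in>I. ennreal ((norm (x i))\<^sup>2) + proc_norm2 (z i))"
proof -
  have T: "T \<in> {0..T}" using T_pos by simp
  have m: "(\<lambda>w. ennreal ((norm (ito_J P T F B T (x i, z i) w))\<^sup>2)) \<in> borel_measurable P" if "i \<in> I" for i
  proof -
    have [measurable]: "ito_J P T F B T (x i, z i) \<in> borel_measurable P"
      using ito_J_square_integrable[OF T, of "(x i, z i)"] z[OF that] by (simp add: square_integrable_def)
    show ?thesis by measurable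
  qed
  have "(\<integral>\<^sup>+w. (\<Sum>\<^sub>\<infinity>i\<in>I. ennreal ((norm (ito_J P T F B T (x i, z i) w))\<^sup>2)) \<partial>P)
      = (\<Sum>i. \<integral>\<^sup>+w. (if i \<in> I then ennreal ((norm (ito_J P T F B T (x i, z i) w))\<^sup>2) else 0) \<partial>P)"
    unfolding infsum_nat_ennreal
  proof (rule nn_integral_suminf)
    show "(\<lambda>w. if i \<in> I then ennreal ((norm (ito_J P T F B T (x i, z i) w))\<^sup>2) else 0) \<in> borel_measurable P" for i
      using m by (cases "i \<in> I") simp_all
  qed
  also have "\<dots> = (\<Sum>i. if i \<in> I then ennreal ((norm (x i))\<^sup>2) + proc_norm2 (z i) else 0)"
    by (intro suminf_cong) (simp add: ito_J_norm2[OF z])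
  finally show ?thesis unfolding infsum_nat_ennreal .
qed

lemma ito_J_versions:
  fixes x :: "nat \<Rightarrow> real ^ 'd" and z :: "nat \<Rightarrow> real \<Rightarrow> 'w \<Rightarrow> real ^ 'm ^ 'd"
  assumes z: "\<And>i. i \<in> I \<Longrightarrow> z i \<in> L2_prog P T F"
  obtains Y where "\<And>i. i \<in> I \<Longrightarrow> cone_martingale UNIV (Y i)"
    "\<And>t. t \<in> {0..T} \<Longrightarrow> AE w in P. \<forall>i\<in>I. ito_J P T F B t (x i, z i) w = x i + Y i t w"
    "AE w in P. \<forall>i\<in>I. continuous_on {0..T} (\<lambda>t. Y i t w)"
    "\<And>i. i \<in> I \<Longrightarrow> (\<integral>\<^sup>+w. ennreal ((norm (Y i T w))\<^sup>2) \<partial>P) = proc_norm2 (z i)"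
proof -
  have "\<forall>i\<in>I. \<exists>Y. (\<forall>t\<in>{0..T}. AE w in P. ito_integral P T F B t (z i) w = Y t w) \<and>
    (AE w in P. continuous_on {0..T} (\<lambda>t. Y t w)) \<and> cone_martingale UNIV Y \<and>
    (\<integral>\<^sup>+w. ennreal ((norm (Y T w))\<^sup>2) \<partial>P) = proc_norm2 (z i) \<and> (AE w in P. Y 0 w = 0)"
    using ito_version z by blast
  then obtain Y where Y: "\<forall>i\<in>I. (\<forall>t\<in>{0..T}. AE w in P. ito_integral P T F B t (z i) w = Y i t w) \<and>
    (AE w in P. continuous_on {0..T} (\<lambda>t. Y i t w)) \<and> cone_martingale UNIV (Y i) \<and>
    (\<integral>\<^sup>+w. ennreal ((norm (Y i T w))\<^sup>2) \<partial>P) = proc_norm2 (z i) \<and> (AE w in P. Y i 0 w = 0)"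
    by (rule bchoice[THEN exE]) blast
  have I: "countable I" by (rule countableI_type)
  show thesis
  proof (rule that[of Y])
    fix t assume t: "t \<in> {0..T}"
    show "AE w in P. \<forall>i\<in>I. ito_J P T F B t (x i, z i) w = x i + Y i t w"
      using Y t by (subst AE_ball_countable[OF I]) (simp add: ito_J_eq)
  next
    show "AE w in P. \<forall>i\<in>I. continuous_on {0..T} (\<lambda>t. Y i t w)"
      using Y by (subst AE_ball_countable[OF I]) simp
  qed (use Y in auto)
qed

text \<open>The regular process and the set-valued integral are compared at each fixed time through
  the closed convex hull, to which both are almost surely equal.\<close>

lemma has_modification_withI:
  fixes x :: "nat \<Rightarrow> real ^ 'd" and z :: "nat \<Rightarrow> real \<Rightarrow> 'w \<Rightarrow> real ^ 'm ^ 'd"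
  assumes I: "I \<noteq> {}" and z: "\<And>i. i \<in> I \<Longrightarrow> z i \<in> L2_prog P T F"
    and J: "\<And>t. t \<in> {0..T} \<Longrightarrow> AE w in P. \<forall>i\<in>I. ito_J P T F B t (x i, z i) w = J i t w"
    and M: "\<And>t w. closed (M t w) \<and> M t w \<noteq> {}"
      "\<And>t. t \<in> {0..T} \<Longrightarrow> AE w in P. M t w = closure (convex hull ((\<lambda>i. J i t w) ` I))"
      "AE w in P. reg (\<lambda>t. M t w)"
  shows "has_modification_with P T reg (sv_integral P T F B (pair_conv ((\<lambda>i. (x i, z i)) ` I)))"
  unfolding has_modification_with_def
proof (intro exI[of _ M] conjI ballI)
  let ?R = "(\<lambda>i. (x i, z i)) ` I"
  have R: "countable ?R" "?R \<noteq> {}" "?R \<subseteq> UNIV \<times> L2_prog P T F" using I z by auto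
  fix t assume t: "t \<in> {0..T}"
  have ae: "AE w in P. M t w = closure (convex hull ((\<lambda>p. ito_J P T F B t p w) ` ?R))"
    using M(2)[OF t] J[OF t]
  proof eventually_elim
    case (elim w)
    have "(\<lambda>p. ito_J P T F B t p w) ` ?R = (\<lambda>i. J i t w) ` I" using elim(2) by (simp add: image_image)
    then show ?case using elim(1) by simp
  qed
  have sv: "set_valued_rv (F t) (\<lambda>w. closure (convex hull ((\<lambda>p. ito_J P T F B t p w) ` ?R)))"
    using is_sv_integral_closure_convex_hull[OF t R] by (simp add: is_sv_integral_def)
  show "set_valued_rv P (M t)" by (rule set_valued_rv_AE_cong[OF sv t M(1) ae])
  show "AE w in P. sv_integral P T F B (pair_conv ?R) t w = M t w"
    using ae sv_integral_AE_eq[OF t R] by eventually_elim simp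
qed (rule M(3))

lemma continuous_modification:
  fixes x :: "nat \<Rightarrow> real ^ 'd" and z :: "nat \<Rightarrow> real \<Rightarrow> 'w \<Rightarrow> real ^ 'm ^ 'd"
  assumes I: "I \<noteq> {}" and z: "\<And>i. i \<in> I \<Longrightarrow> z i \<in> L2_prog P T F"
    and fin: "(\<Sum>\<^sub>\<infinity>i\<in>I. ennreal ((norm (x i))\<^sup>2) + proc_norm2 (z i)) < \<infinity>"
  shows "has_modification_with P T (hausdorff_continuous T) (sv_integral P T F B (pair_conv ((\<lambda>i. (x i, z i)) ` I)))"
proof -
  obtain Y where Y: "\<And>i. i \<in> I \<Longrightarrow> cone_martingale UNIV (Y i)"
    "\<And>t. t \<in> {0..T} \<Longrightarrow> AE w in P. \<forall>i\<in>I. ito_J P T F B t (x i, z i) w = x i + Y i t w"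
    "AE w in P. \<forall>i\<in>I. continuous_on {0..T} (\<lambda>t. Y i t w)"
    "\<And>i. i \<in> I \<Longrightarrow> (\<integral>\<^sup>+w. ennreal ((norm (Y i T w))\<^sup>2) \<partial>P) = proc_norm2 (z i)"
    by (rule ito_J_versions[OF z, where x=x], assumption, rule that; assumption)
  \<comment> \<open>The starting points do not move in time, so only the second moments of the
    martingale parts are retained.\<close>
  have "(\<Sum>i. if i \<in> I then \<integral>\<^sup>+w. ennreal ((norm (Y i T w))\<^sup>2) \<partial>P else 0)
      \<le> (\<Sum>i. if i \<in> I then ennreal ((norm (x i))\<^sup>2) + proc_norm2 (z i) else 0)"
    by (intro suminf_le summableI) (simp add: Y(4))
  also have "\<dots> < \<infinity>" using fin unfolding infsum_nat_ennreal .
  finally have fin': "(\<Sum>i. if i \<in> I then \<integral>\<^sup>+w. ennreal ((norm (Y i T w))\<^sup>2) \<partial>P else 0) < \<infinity>" .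
  show ?thesis
  proof (rule has_modification_withI[OF I z Y(2), where M="\<lambda>t w. closure (convex hull ((\<lambda>i. x i + Y i t w) ` I))"])
    show "AE w in P. hausdorff_continuous T (\<lambda>t. closure (convex hull ((\<lambda>i. x i + Y i t w) ` I)))"
      by (rule AE_hausdorff_continuous[OF Y(1) Y(3) fin'])
  qed (use I in auto)
qed

lemma caglad_modification:
  fixes x :: "nat \<Rightarrow> real ^ 'd" and z :: "nat \<Rightarrow> real \<Rightarrow> 'w \<Rightarrow> real ^ 'm ^ 'd"
  assumes I: "I \<noteq> {}" and z: "\<And>i. i \<in> I \<Longrightarrow> z i \<in> L2_prog P T F"
    and dom: "dominated_L2 P (ito_J P T F B T ` ((\<lambda>i. (x i, z i)) ` I))"
  shows "has_modification_with P T (hausdorff_caglad T) (sv_integral P T F B (pair_conv ((\<lambda>i. (x i, z i)) ` I)))"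
proof -
  obtain Y where Y: "\<And>i. i \<in> I \<Longrightarrow> cone_martingale UNIV (Y i)"
    "\<And>t. t \<in> {0..T} \<Longrightarrow> AE w in P. \<forall>i\<in>I. ito_J P T F B t (x i, z i) w = x i + Y i t w"
    "AE w in P. \<forall>i\<in>I. continuous_on {0..T} (\<lambda>t. Y i t w)"
    by (rule ito_J_versions[OF z, where x=x], assumption, rule that; assumption)
  obtain \<xi> where \<xi>: "\<xi> \<in> borel_measurable P" "integrable P (\<lambda>w. (\<xi> w)\<^sup>2)"
    and le: "\<And>i. i \<in> I \<Longrightarrow> AE w in P. norm (ito_J P T F B T (x i, z i) w) \<le> \<xi> w"
    using dom unfolding dominated_L2_def by auto
  \<comment> \<open>An enumeration of \<open>I\<close>, with repetitions if \<open>I\<close> is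
    finite; \<open>e 0\<close> becomes the reference member.\<close>
  define e where "e = from_nat_into I"
  have re: "range e = I" unfolding e_def by (rule range_from_nat_into[OF I countableI_type])
  then have eI: "e k \<in> I" for k by auto
  define a where "a k t w = x (e k) + Y (e k) t w" for k t w
  have T: "T \<in> {0..T}" using T_pos by simp
  have N: "cone_martingale UNIV (\<lambda>t w. a k t w - a 0 t w)" for k
    unfolding a_def by (intro cone_martingale_diff cone_martingale_add_const Y(1) eI)
  \<comment> \<open>Both the member and the reference member are dominated by \<open>\<xi>\<close>,
    hence the bound \<open>2 * \<xi>\<close> for their difference.\<close>
  have d: "AE w in P. norm (a k T w - a 0 T w) \<le> 2 * \<xi> w" for k
    using le[OF eI[of k]] le[OF eI[of 0]] Y(2)[OF T]
  proof eventually_elim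
    case (elim w)
    have "norm (a k T w) \<le> \<xi> w" "norm (a 0 T w) \<le> \<xi> w"
      using elim(1,2) bspec[OF elim(3) eI] by (simp_all add: a_def)
    then show ?case using norm_triangle_ineq4[of "a k T w" "a 0 T w"] by linarith
  qed
  have cont: "AE w in P. \<forall>k. continuous_on {0..T} (\<lambda>t. a k t w)"
    using Y(3) by eventually_elim (auto simp: a_def intro!: continuous_intros eI)
  have m: "(\<lambda>w. 2 * \<xi> w) \<in> borel_measurable P" "integrable P (\<lambda>w. (2 * \<xi> w)\<^sup>2)"
    using \<xi> by (simp_all add: power_mult_distrib)
  obtain M where M: "\<And>t w. closed (M t w) \<and> M t w \<noteq> {}"
    "\<And>t. t \<in> {0..T} \<Longrightarrow> AE w in P. M t w = closure (convex hull (range (\<lambda>k. a k t w)))"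
    "AE w in P. hausdorff_caglad T (\<lambda>t. M t w)"
    using AE_hausdorff_caglad[OF N m d cont] by blast
  have "range (\<lambda>k. a k t w) = (\<lambda>i. x i + Y i t w) ` I" for t w
    unfolding a_def re[symmetric] by (simp add: image_image)
  then show ?thesis using M by (intro has_modification_withI[OF I z Y(2), where M=M]) auto
qed

end

theorem theorem5p14:
  fixes P :: "'w measure" and T :: real
    and B :: "real \<Rightarrow> 'w \<Rightarrow> real ^ 'm"
    and F :: "real \<Rightarrow> 'w measure"
    and I :: "nat set"
    and x :: "nat \<Rightarrow> real ^ 'd"
    and z :: "nat \<Rightarrow> real \<Rightarrow> 'w \<Rightarrow> real ^ 'm ^ 'd"
    and R :: "((real ^ 'd) \<times> (real \<Rightarrow> 'w \<Rightarrow> real ^ 'm ^ 'd)) set"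
  assumes "prob_space P" and "T > 0"
    and "brownian_motion P T B"
    and "F = brownian_filtration P B"
    and "usual_conditions P T F"
    and "I \<noteq> {}"
    and "R = (\<lambda>i. (x i, z i)) ` I"
    and "R \<subseteq> UNIV \<times> L2_prog P T F"
  shows "(dominated_L2 P (ito_J P T F B T ` R) \<longrightarrow>
           has_modification_with P T (hausdorff_caglad T) (sv_integral P T F B (pair_conv R)))
         \<and> (\<integral>\<^sup>+w. (\<Sum>\<^sub>\<infinity>i\<in>I. ennreal ((norm (ito_J P T F B T (x i, z i) w))\<^sup>2)) \<partial>P)
           = (\<Sum>\<^sub>\<infinity>i\<in>I. ennreal ((norm (x i))\<^sup>2)
                + (\<integral>\<^sup>+w. (\<integral>\<^sup>+s\<in>{0..T}. ennreal ((norm (z i s w))\<^sup>2) \<partial>lborel) \<partial>P))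
         \<and> ((\<integral>\<^sup>+w. (\<Sum>\<^sub>\<infinity>i\<in>I. ennreal ((norm (ito_J P T F B T (x i, z i) w))\<^sup>2)) \<partial>P) < \<infinity> \<longrightarrow>
              has_modification_with P T (hausdorff_continuous T) (sv_integral P T F B (pair_conv R)))"
proof -
  interpret prob_space P by fact
  interpret complete_measure P using assms(5) by (simp add: usual_conditions_def)
  interpret brownian_setting P T B F by unfold_locales fact+
  have z: "z i \<in> L2_prog P T F" if "i \<in> I" for i using assms(7,8) that by auto
  show ?thesis
    unfolding assms(7)
  proof (intro conjI impI)
    show eq: "(\<integral>\<^sup>+w. (\<Sum>\<^sub>\<infinity>i\<in>I. ennreal ((norm (ito_J P T F B T (x i, z i) w))\<^sup>2)) \<partial>P)
        = (\<Sum>\<^sub>\<infinity>i\<in>I. ennreal ((norm (x i))\<^sup>2)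
            + (\<integral>\<^sup>+w. (\<integral>\<^sup>+s\<in>{0..T}. ennreal ((norm (z i s w))\<^sup>2) \<partial>lborel) \<partial>P))"
      unfolding proc_norm2_def[symmetric] by (rule nn_integral_infsum_ito_J_norm2) (rule z)
    assume "(\<integral>\<^sup>+w. (\<Sum>\<^sub>\<infinity>i\<in>I. ennreal ((norm (ito_J P T F B T (x i, z i) w))\<^sup>2)) \<partial>P) < \<infinity>"
    \<comment> \<open>The identity turns the finite mean of the sum into the finite series of second
      moments on which \<open>continuous_modification\<close> relies.\<close>
    then show "has_modification_with P T (hausdorff_continuous T) (sv_integral P T F B (pair_conv ((\<lambda>i. (x i, z i)) ` I)))"
      unfolding eq proc_norm2_def[symmetric] by (intro continuous_modification assms(6) z)
  qed (intro caglad_modification assms(6) z)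
qed

end
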